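(* Let $p\ge3$ be a prime, let $a\in\mathbb{Z}_p$ satisfy conditions (1) and (2) of the context, and suppose $a^{(r)}=a$ for a positive integer $r$. Let $c\in1+pW$, $\sigma(t)=ct^p$ and $\widehat{\sigma}(t)=c^{-1}t^p$. Then $$\mathscr{F}^{(\sigma)}_{a,1-a;1}(t)\equiv-\widehat{\mathscr{F}}^{(\widehat{\sigma})}_{a,a;2a}(t^{-1})\pmod p$$ in the ring $W\langle t,t^{-1},h_a(t)^{-1}\rangle$, where $\widehat{\mathscr{F}}^{(\widehat{\sigma})}_{a,a;2a}(t^{-1}):=\omega(\widehat{\mathscr{F}}^{(\widehat{\sigma})}_{a,a;2a}(t))$.
   Context: $W=W(\overline{\mathbb{F}}_p)$, $F$ its Frobenius; $\sigma$ with $\sigma(t)=ct^p$ acts on $W[[t]]$ by $(\sum a_it^i)^\sigma=\sum a_i^Fc^it^{ip}$. $[f]_{<m}$ denotes truncation of a power series to degrees $<m$. For $h\in W[t]$, $W\langle t,h^{-1}\rangle=\varprojlim_n(W/p^nW)[t,h^{-1}]$ and $W\langle t,t^{-1},h^{-1}\rangle=\varprojlim_n(W/p^nW)[t,t^{-1},h^{-1}]$. Each $\alpha\in\mathbb{Z}_p$ is written $\alpha=-\sum_{i\ge0}[\alpha]_ip^i$ with $[\alpha]_i\in\{0,\dots,p-1\}$; the Dwork prime is $\alpha'=(\alpha+l_\alpha)/p$ with $l_\alpha\in\{0,\dots,p-1\}$, $\alpha+l_\alpha\equiv0\pmod p$; $\alpha^{(0)}=\alpha$, $\alpha^{(i)}=(\alpha^{(i-1)})'$.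 Conditions: (1) $a\in N^{-1}\mathbb{Z}$ for some integer $N\ge2$, $p\nmid N$; (2) $[a]_i<[2a]_i$, i.e. $0<[a]_i\le(p-1)/2$, for all $i\ge0$. Let $l=l_a$. $F_{\alpha,\beta;\gamma}(t)=\sum_n\frac{(\alpha)_n(\beta)_n}{(1)_n(\gamma)_n}t^n$ and $F^{(i)}_{\alpha,\beta;\gamma}=F_{\alpha^{(i)},\beta^{(i)};\gamma^{(i)}}$. Put $h_a(t)=\prod_{i=0}^{r-1}[F^{(i)}_{a,1-a;1}(t)]_{<p}$, $\widehat{h}_a(t)=\prod_{i=0}^{r-1}[F^{(i)}_{a,a;2a}(t)]_{<p}$. There is an isomorphism $\omega\colon W\langle t,t^{-1},\widehat{h}_a(t)^{-1}\rangle\to W\langle t,t^{-1},h_a(t)^{-1}\rangle$, $f(t)\mapsto f(t^{-1})$. Logarithmic type function: $\widetilde{\psi}_p(z)=\lim_{n\in\mathbb{Z}_{>0},n\to z}\sum_{1\le k<n,\,p\nmid k}\frac1k$, $\gamma_p=-\lim_{s\to\infty}\frac1{p^s}\sum_{0\le j<p^s,\,p\nmid j}\log(j)$ ($\log$ = Iwasawa logarithm), $\psi_p(z)=-\gamma_p+\widetilde{\psi}_p(z)$. Put $$G_{a,1-a;1}(t)=\psi_p(a)+\psi_p(1-a)+2\gamma_p-p^{-1}\log(c)+\int_0^t\big(F_{a,1-a;1}(t)-F^{(1)}_{a,1-a;1}(t^\sigma)\big)\frac{dt}t,$$ where $t^\sigma=ct^p$ and $\int_0^t(\cdot)\frac{dt}t$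 sends $\sum_{n\ge1}a_nt^n$ to $\sum_{n\ge1}\frac{a_n}nt^n$; then $\mathscr{F}^{(\sigma)}_{a,1-a;1}(t)=G_{a,1-a;1}(t)/F_{a,1-a;1}(t)\in W\langle t,h_a(t)^{-1}\rangle$. The other function, for $\tau(t)=ut^p$ with $u\in1+pW$: $\widehat{G}^{(\tau)}_{a,a;2a}(t)=t^{-a}\int_0^t\big(t^aF_{a,a;2a}(t)-(-1)^lB_p(a,a)^{-1}[t^{a'}F_{a',a';(2a)'}(t)]^\tau\big)\frac{dt}t$, where $\int_0^tt^\beta\frac{dt}t=t^\beta/\beta$ ($\beta\neq0$), $[t^{a'}f(t)]^\tau=u^{a'}t^{pa'}f(ut^p)$ for $f\in\mathbb{Z}_p[[t]]$, $B_p(x,y)=\Gamma_p(x)\Gamma_p(y)/\Gamma_p(x+y)$, $\Gamma_p$ Morita's $p$-adic Gamma function; $\widehat{\mathscr{F}}^{(\tau)}_{a,a;2a}(t)=\widehat{G}^{(\tau)}_{a,a;2a}(t)/F_{a,a;2a}(t)\in W\langle t,\widehat{h}_a(t)^{-1}\rangle$. *)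

theory Defs
  imports
    "HOL-Library.Poly_Mapping"
    "HOL-Computational_Algebra.Computational_Algebra"
    "HOL-Algebra.QuotRing"
    "HOL-Algebra.Algebraic_Closure_Type"
    "Berlekamp_Zassenhaus.Finite_Field"
begin

section \<open>Integer polynomials in arbitrary variables\<close>

type_synonym 'v ipoly = "('v \<Rightarrow>\<^sub>0 nat) \<Rightarrow>\<^sub>0 int"

definition ipvar :: "'v \<Rightarrow> 'v ipoly" where
  "ipvar v = Poly_Mapping.single (Poly_Mapping.single v 1) 1"

definition ipmon :: "('v \<Rightarrow> 'a::comm_ring_1) \<Rightarrow> ('v \<Rightarrow>\<^sub>0 nat) \<Rightarrow> 'a" where
  "ipmon \<rho> m = (\<Prod>v\<in>Poly_Mapping.keys m. \<rho> v ^ Poly_Mapping.lookup m v)"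

definition ipeval :: "('v \<Rightarrow> 'a::comm_ring_1) \<Rightarrow> 'v ipoly \<Rightarrow> 'a" where
  "ipeval \<rho> f = (\<Sum>m\<in>Poly_Mapping.keys f. of_int (Poly_Mapping.lookup f m) * ipmon \<rho> m)"

lemma ipoly_induct [case_names single add]:
  assumes "\<And>m c. P (Poly_Mapping.single m c)"
    and "\<And>f g. P f \<Longrightarrow> P g \<Longrightarrow> P (f + g)"
  shows "P (f :: 'v ipoly)"
proof (induction f rule: Poly_Mapping.update_induct)
  case const
  show ?case using assms(1)[of 0 0] by simp
next
  case (update f a b)
  have "Poly_Mapping.update a b f = f + Poly_Mapping.single a b"
    using update(1)
    by (intro poly_mapping_eqI)
       (auto simp: lookup_update lookup_add lookup_single when_def in_keys_iff)
  then show ?case using assms update by metis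
qed

lemma ipmon_superset:
  assumes "finite A" "Poly_Mapping.keys m \<subseteq> A"
  shows "ipmon \<rho> m = (\<Prod>v\<in>A. \<rho> v ^ Poly_Mapping.lookup m v)"
  unfolding ipmon_def using assms
  by (intro prod.mono_neutral_left) (auto simp: in_keys_iff)

lemma ipmon_0 [simp]: "ipmon \<rho> 0 = 1"
  by (simp add: ipmon_def)

lemma ipmon_add: "ipmon \<rho> (m + n) = ipmon \<rho> m * ipmon \<rho> n"
proof -
  let ?A = "Poly_Mapping.keys m \<union> Poly_Mapping.keys n"
  have "Poly_Mapping.keys (m + n) \<subseteq> ?A" by (rule keys_add)
  then show ?thesis
    by (simp add: ipmon_superset[of ?A] lookup_add power_add prod.distrib)
qed

lemma ipeval_superset:
  assumes "finite A" "Poly_Mapping.keys f \<subseteq> A"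
  shows "ipeval \<rho> f = (\<Sum>m\<in>A. of_int (Poly_Mapping.lookup f m) * ipmon \<rho> m)"
  unfolding ipeval_def using assms
  by (intro sum.mono_neutral_left) (auto simp: in_keys_iff)

lemma ipeval_single [simp]: "ipeval \<rho> (Poly_Mapping.single m c) = of_int c * ipmon \<rho> m"
  by (subst ipeval_superset[of "{m}"]) (auto simp: lookup_single)

lemma ipeval_add: "ipeval \<rho> (f + g) = ipeval \<rho> f + ipeval \<rho> g"
proof -
  let ?A = "Poly_Mapping.keys f \<union> Poly_Mapping.keys g"
  have "Poly_Mapping.keys (f + g) \<subseteq> ?A" by (rule keys_add)
  then show ?thesis
    by (simp add: ipeval_superset[of ?A] lookup_add algebra_simps sum.distrib)
qed

lemma ipeval_mult: "ipeval \<rho> (f * g) = ipeval \<rho> f * ipeval \<rho> g"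
proof (induction f rule: ipoly_induct)
  case (single m c)
  show ?case
    by (induction g rule: ipoly_induct)
       (simp_all add: mult_single ipmon_add ipeval_add algebra_simps)
qed (simp add: ipeval_add algebra_simps)

lemma ipeval_0 [simp]: "ipeval \<rho> 0 = 0"
  by (simp add: ipeval_def)

lemma ipeval_1 [simp]: "ipeval \<rho> 1 = 1"
  by (metis ipeval_single ipmon_0 mult_1 of_int_1 single_one)

lemma ipeval_uminus: "ipeval \<rho> (- f) = - ipeval \<rho> f"
  by (metis add.inverse_unique ipeval_0 ipeval_add add.right_inverse)

lemma ipeval_var [simp]: "ipeval \<rho> (ipvar v) = \<rho> v"
  by (simp add: ipvar_def ipmon_def)

lemma ipoly_torsion_free:
  assumes "of_nat n * f = (0 :: 'v ipoly)" "n \<noteq> 0"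
  shows "f = 0"
proof (rule poly_mapping_eqI)
  fix k
  have "Poly_Mapping.lookup (of_nat n * f) k = int n * Poly_Mapping.lookup f k"
    by (simp add: Poly_Mapping.map.rep_eq when_def in_keys_iff flip: mult_map_scale_conv_mult single_of_nat)
  then show "Poly_Mapping.lookup f k = Poly_Mapping.lookup 0 k"
    using assms by simp
qed

text \<open>Homomorphisms of commutative rings, unbundled.\<close>

definition is_hom :: "('a::comm_ring_1 \<Rightarrow> 'b::comm_ring_1) \<Rightarrow> bool" where
  "is_hom h \<longleftrightarrow> h 0 = 0 \<and> h 1 = 1 \<and> (\<forall>x y. h (x + y) = h x + h y) \<and> (\<forall>x y. h (x * y) = h x * h y)"

lemma is_hom_ipeval: "is_hom (ipeval \<rho>)"
  by (simp add: is_hom_def ipeval_add ipeval_mult)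

lemma is_homD:
  assumes "is_hom h"
  shows "h 0 = 0" "h 1 = 1" "h (x + y) = h x + h y" "h (x * y) = h x * h y"
    "h (- x) = - h x" "h (x ^ n) = h x ^ n" "h (of_nat n) = of_nat n" "h (sum f A) = (\<Sum>i\<in>A. h (f i))"
    "h (of_int k) = of_int k" "h (prod f A) = (\<Prod>i\<in>A. h (f i))" 
proof -
  have *: "h 0 = 0" "h 1 = 1" "\<And>x y. h (x + y) = h x + h y" "\<And>x y. h (x * y) = h x * h y"
    using assms by (auto simp: is_hom_def)
  show "h 0 = 0" "h 1 = 1" "h (x + y) = h x + h y" "h (x * y) = h x * h y" by fact+
  show neg: "h (- x) = - h x" for x
    by (metis *(1,3) add.inverse_unique add.right_inverse)
  show "h (x ^ n) = h x ^ n" by (induction n) (auto simp: *)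
  show nat: "h (of_nat n) = of_nat n" for n by (induction n) (auto simp: *)
  show "h (sum f A) = (\<Sum>i\<in>A. h (f i))" by (induction A rule: infinite_finite_induct) (auto simp: *)
  show "h (prod f A) = (\<Prod>i\<in>A. h (f i))" by (induction A rule: infinite_finite_induct) (auto simp: *)
  show "h (of_int k) = of_int k" by (cases k) (auto simp: nat neg simp del: of_nat_Suc)
qed

lemma is_hom_ipeval_comp:
  assumes "is_hom h"
  shows "h (ipeval \<rho> f) = ipeval (h \<circ> \<rho>) f"
  by (simp add: ipeval_def ipmon_def is_homD[OF assms])


section \<open>Witt vectors\<close>

text \<open>
  \<open>p\<close>-typical Witt vectors: addition, multiplication and negation are given by the integer
  polynomials that the ghost components \<open>w\<^sub>n(x) = \<Sum>i\<le>n. p\<^sup>i x\<^sub>i^(p^(n - i))\<close> turn into the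
  ring operations. The variable \<open>(False, i)\<close> stands for the component \<open>i\<close> of the first operand,
  \<open>(True, i)\<close> for that of the second.
\<close>

definition ghost :: "nat \<Rightarrow> nat \<Rightarrow> (nat \<Rightarrow> 'a::comm_ring_1) \<Rightarrow> 'a" where
  "ghost p n x = (\<Sum>i\<le>n. of_nat p ^ i * x i ^ (p ^ (n - i)))"

abbreviation gvar :: "'b \<Rightarrow> nat \<Rightarrow> ('b \<times> nat) ipoly" where
  "gvar b \<equiv> \<lambda>i. ipvar (b, i)"

definition witt_add_poly :: "nat \<Rightarrow> nat \<Rightarrow> (bool \<times> nat) ipoly" where
  "witt_add_poly p = (THE S. \<forall>n. ghost p n S = ghost p n (gvar False) + ghost p n (gvar True))"

definition witt_mult_poly :: "nat \<Rightarrow> nat \<Rightarrow> (bool \<times> nat) ipoly" where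
  "witt_mult_poly p = (THE S. \<forall>n. ghost p n S = ghost p n (gvar False) * ghost p n (gvar True))"

definition witt_neg_poly :: "nat \<Rightarrow> nat \<Rightarrow> (bool \<times> nat) ipoly" where
  "witt_neg_poly p = (THE S. \<forall>n. ghost p n S = - ghost p n (gvar False))"

abbreviation pick2 :: "(nat \<Rightarrow> 'a) \<Rightarrow> (nat \<Rightarrow> 'a) \<Rightarrow> bool \<times> nat \<Rightarrow> 'a" where
  "pick2 x y \<equiv> \<lambda>(b, i). if b then y i else x i"

definition wadd :: "nat \<Rightarrow> (nat \<Rightarrow> 'a::comm_ring_1) \<Rightarrow> (nat \<Rightarrow> 'a) \<Rightarrow> nat \<Rightarrow> 'a" where
  "wadd p x y n = ipeval (pick2 x y) (witt_add_poly p n)"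

definition wmult :: "nat \<Rightarrow> (nat \<Rightarrow> 'a::comm_ring_1) \<Rightarrow> (nat \<Rightarrow> 'a) \<Rightarrow> nat \<Rightarrow> 'a" where
  "wmult p x y n = ipeval (pick2 x y) (witt_mult_poly p n)"

definition wneg :: "nat \<Rightarrow> (nat \<Rightarrow> 'a::comm_ring_1) \<Rightarrow> nat \<Rightarrow> 'a" where
  "wneg p x n = ipeval (pick2 x x) (witt_neg_poly p n)"

definition wone :: "nat \<Rightarrow> 'a::comm_ring_1" where
  "wone n = (if n = 0 then 1 else 0)"

lemma ghost_hom:
  assumes "is_hom h"
  shows "ghost p n (h \<circ> x) = h (ghost p n x)"
  by (simp add: ghost_def is_homD[OF assms])

lemma ghost_split: "ghost p n x = (\<Sum>i<n. of_nat p ^ i * x i ^ (p ^ (n - i))) + of_nat p ^ n * x n"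
  by (simp add: ghost_def lessThan_Suc_atMost[symmetric])

lemma ghost_inj:
  assumes tf: "\<And>f :: 'a::comm_ring_1. of_nat p * f = 0 \<Longrightarrow> f = 0"
    and eq: "\<And>m. m \<le> n \<Longrightarrow> ghost p m x = ghost p m y"
  shows "x n = (y n :: 'a)"
  using eq
proof (induction n rule: less_induct)
  case (less n)
  have tf': "f = 0" if "of_nat p ^ k * f = 0" for f :: 'a and k
    using that by (induction k) (auto simp: mult.assoc dest: tf)
  have "\<And>i. i < n \<Longrightarrow> x i = y i" using less by simp
  then have "of_nat p ^ n * x n = of_nat p ^ n * y n"
    using less(2)[of n] by (simp add: ghost_split)
  then have "of_nat p ^ n * (x n - y n) = 0" by (simp add: algebra_simps)
  then show ?case using tf' by fastforce
qed

lemma cong_pow_p: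
  fixes x y :: "'a::comm_ring_1"
  assumes "of_nat p ^ Suc k dvd x - y"
  shows "of_nat p ^ Suc (Suc k) dvd x ^ p - y ^ p"
proof -
  have pd: "of_nat p dvd x - y" using assms by (metis dvd_mult_left power_Suc)
  have pw: "of_nat p dvd x ^ i - y ^ i" for i
    using pd by (metis dvd_mult2 power_diff_sumr2)
  let ?s = "\<Sum>i<p. y ^ (p - Suc i) * x ^ i"
  have "?s - of_nat p * y ^ (p - 1) = (\<Sum>i<p. y ^ (p - Suc i) * x ^ i - y ^ (p - 1))"
    by (simp add: sum_subtractf)
  also have "\<dots> = (\<Sum>i<p. y ^ (p - Suc i) * (x ^ i - y ^ i))"
    by (intro sum.cong refl) (simp add: algebra_simps flip: power_add)
  also have "of_nat p dvd \<dots>" by (intro dvd_sum dvd_mult pw)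
  finally have "of_nat p dvd ?s" by (metis dvd_diff_right_iff dvd_triv_left dvd_diff_left_iff)
  then have "of_nat p ^ Suc k * of_nat p dvd (x - y) * ?s" by (rule mult_dvd_mono[OF assms])
  then show ?thesis by (simp add: power_diff_sumr2 mult.commute)
qed

lemma cong_pow_pp:
  fixes x y :: "'a::comm_ring_1"
  assumes "of_nat p dvd x - y"
  shows "of_nat p ^ Suc k dvd x ^ (p ^ k) - y ^ (p ^ k)"
proof (induction k)
  case 0
  show ?case using assms by simp
next
  case (Suc k)
  show ?case using cong_pow_p[OF Suc] by (simp add: mult.commute flip: power_mult)
qed

lemma power_split:
  fixes c :: "'a::comm_ring_1"
  assumes "i \<le> n"
  shows "c ^ i * c ^ Suc (n - i) = c ^ Suc n"
  using assms by (metis power_add add_Suc_right le_add_diff_inverse)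

lemma ghost_cong:
  fixes x y :: "nat \<Rightarrow> 'a::comm_ring_1"
  assumes "\<And>i. i < n \<Longrightarrow> of_nat p dvd x i - y i"
  shows "of_nat p ^ Suc n dvd (\<Sum>i<n. of_nat p ^ i * x i ^ (p ^ (n - i))) - (\<Sum>i<n. of_nat p ^ i * y i ^ (p ^ (n - i)))"
  unfolding sum_subtractf[symmetric]
proof (intro dvd_sum)
  fix i assume i: "i \<in> {..<n}"
  have "of_nat p ^ i * of_nat p ^ Suc (n - i) dvd of_nat p ^ i * (x i ^ (p ^ (n - i)) - y i ^ (p ^ (n - i)))"
    using i by (intro mult_dvd_mono cong_pow_pp assms) auto
  then show "of_nat p ^ Suc n dvd of_nat p ^ i * x i ^ p ^ (n - i) - of_nat p ^ i * y i ^ p ^ (n - i)"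
    using i by (simp only: power_split right_diff_distrib lessThan_iff less_imp_le)
qed

lemma ghost_cong_imp:
  fixes x y :: "nat \<Rightarrow> 'a::comm_ring_1"
  assumes tf: "\<And>f :: 'a. of_nat p * f = 0 \<Longrightarrow> f = 0"
    and eq: "\<And>n. of_nat p ^ Suc n dvd ghost p n x - ghost p n y"
  shows "of_nat p dvd x n - y n"
proof (induction n rule: less_induct)
  case (less n)
  have tf': "f = 0" if "of_nat p ^ k * f = 0" for f :: 'a and k
    using that by (induction k) (auto simp: mult.assoc dest: tf)
  have d: "ghost p n x - ghost p n y = ((\<Sum>i<n. of_nat p ^ i * x i ^ (p ^ (n - i))) - (\<Sum>i<n. of_nat p ^ i * y i ^ (p ^ (n - i))))
     + of_nat p ^ n * (x n - y n)"
    by (simp add: ghost_split algebra_simps)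
  have "of_nat p ^ Suc n dvd of_nat p ^ n * (x n - y n)"
    by (rule iffD1[OF dvd_add_right_iff[OF ghost_cong[of n p x y, OF less]] eq[of n, unfolded d]])
  then obtain z where "of_nat p ^ n * (x n - y n) = of_nat p ^ Suc n * z" by (auto simp: dvd_def)
  then have "of_nat p ^ n * (x n - y n - of_nat p * z) = 0" by (simp add: algebra_simps)
  then have "x n - y n = of_nat p * z" using tf' by fastforce
  then show ?case by simp
qed

text \<open>Dwork's criterion for being a sequence of ghost components.\<close>

lemma dwork_exists:
  fixes \<phi> :: "'a::comm_ring_1 \<Rightarrow> 'a"
  assumes \<phi>: "is_hom \<phi>" "\<And>x. of_nat p dvd \<phi> x - x ^ p"
    and tf: "\<And>f :: 'a. of_nat p * f = 0 \<Longrightarrow> f = 0"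
    and g: "\<And>n. of_nat p ^ Suc n dvd g (Suc n) - \<phi> (g n)"
  shows "\<exists>!x. \<forall>n. ghost p n x = g n"
proof -
  have fr: "of_nat p ^ Suc n dvd (\<Sum>i<Suc n. of_nat p ^ i * x i ^ (p ^ (Suc n - i))) - \<phi> (ghost p n x)" for n and x :: "nat \<Rightarrow> 'a"
  proof -
    have "(\<Sum>i<Suc n. of_nat p ^ i * x i ^ (p ^ (Suc n - i))) - \<phi> (ghost p n x)
       = (\<Sum>i<Suc n. of_nat p ^ i * ((x i ^ p) ^ (p ^ (n - i)) - \<phi> (x i) ^ (p ^ (n - i))))"
      unfolding ghost_def lessThan_Suc_atMost[symmetric] is_homD[OF \<phi>(1)] sum_subtractf[symmetric]
      by (intro sum.cong refl) (auto simp: Suc_diff_le algebra_simps simp flip: power_mult)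
    also have "of_nat p ^ Suc n dvd \<dots>"
    proof (intro dvd_sum)
      fix i assume i: "i \<in> {..<Suc n}"
      have "of_nat p dvd x i ^ p - \<phi> (x i)" using dvd_minus_iff[THEN iffD2, OF \<phi>(2)[of "x i"]] by simp
      then have "of_nat p ^ i * of_nat p ^ Suc (n - i) dvd of_nat p ^ i * ((x i ^ p) ^ (p ^ (n - i)) - \<phi> (x i) ^ (p ^ (n - i)))"
        by (intro mult_dvd_mono cong_pow_pp) auto
      then show "of_nat p ^ Suc n dvd of_nat p ^ i * ((x i ^ p) ^ (p ^ (n - i)) - \<phi> (x i) ^ (p ^ (n - i)))"
        using i by (simp only: power_split lessThan_iff less_Suc_eq_le)
    qed
    finally show ?thesis .
  qed
  have ex: "\<exists>x. \<forall>m\<le>n. ghost p m x = g m" for n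
  proof (induction n)
    case 0
    show ?case by (intro exI[of _ "\<lambda>_. g 0"]) (simp add: ghost_def)
  next
    case (Suc n)
    then obtain x where x: "\<And>m. m \<le> n \<Longrightarrow> ghost p m x = g m" by blast
    have "of_nat p ^ Suc n dvd g (Suc n) - (\<Sum>i<Suc n. of_nat p ^ i * x i ^ (p ^ (Suc n - i)))"
      using dvd_diff[OF g[of n] fr[of n x, unfolded x[OF order_refl]]] by (simp add: algebra_simps)
    then obtain y where y: "g (Suc n) - (\<Sum>i<Suc n. of_nat p ^ i * x i ^ (p ^ (Suc n - i))) = of_nat p ^ Suc n * y"
      by (auto simp only: dvd_def)
    have "ghost p m (x(Suc n := y)) = g m" if "m \<le> Suc n" for m
    proof (cases "m = Suc n")
      case True
      show ?thesis using y unfolding True ghost_split by (simp add: algebra_simps)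
    next
      case False
      then have "ghost p m (x(Suc n := y)) = ghost p m x"
        using that by (simp add: ghost_def)
      then show ?thesis using x that False by simp
    qed
    then show ?case by blast
  qed
  have "\<exists>S. \<forall>n. \<forall>m\<le>n. ghost p m (S n) = g m" by (rule choice) (use ex in blast)
  then obtain S where S: "m \<le> n \<Longrightarrow> ghost p m (S n) = g m" for n m by blast
  have diag: "S n i = S i i" if "i \<le> n" for n i
    using that by (intro ghost_inj[OF tf, where n = i and x = "S n" and y = "S i"]) (auto simp: S)
  have "ghost p n (\<lambda>i. S i i) = ghost p n (S n)" for n
    unfolding ghost_def by (intro sum.cong refl) (simp only: diag[of _ n] atMost_iff)
  then have "\<forall>n. ghost p n (\<lambda>i. S i i) = g n" by (simp add: S)
  moreover have "x = y" if "\<forall>n. ghost p n x = g n" "\<forall>n. ghost p n y = g n" for x y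
    using that by (intro ext ghost_inj[OF tf, where x = x and y = y]) auto
  ultimately show ?thesis by blast
qed

lemma ghost_frob:
  fixes \<phi> :: "'a::comm_ring_1 \<Rightarrow> 'a"
  assumes \<phi>: "is_hom \<phi>" and x: "\<And>i. \<phi> (x i) = x i ^ p"
  shows "of_nat p ^ Suc n dvd ghost p (Suc n) x - \<phi> (ghost p n x)"
proof -
  have "\<phi> (ghost p n x) = (\<Sum>i<Suc n. of_nat p ^ i * x i ^ (p ^ (Suc n - i)))"
    unfolding ghost_def lessThan_Suc_atMost[symmetric] is_homD[OF \<phi>] x
    by (intro sum.cong refl) (auto simp: Suc_diff_le simp flip: power_mult)
  then show ?thesis by (simp add: ghost_split)
qed

definition ipfrob :: "nat \<Rightarrow> 'v ipoly \<Rightarrow> 'v ipoly" where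
  "ipfrob p = ipeval (\<lambda>v. ipvar v ^ p)"

lemma ipoly_single_eq: "Poly_Mapping.single m c = of_int c * ipmon ipvar m"
proof -
  have v: "ipvar v ^ k = Poly_Mapping.single (Poly_Mapping.single v k) 1" for v :: 'a and k
    by (induction k) (simp_all add: ipvar_def mult_single single_one flip: single_add)
  have fin: "(\<Prod>v\<in>A. Poly_Mapping.single (f v) (1::int)) = Poly_Mapping.single (\<Sum>v\<in>A. f v) 1"
    if "finite A" for f :: "'a \<Rightarrow> 'a \<Rightarrow>\<^sub>0 nat" and A
    using that by (induction A) (auto simp: mult_single single_one)
  have "(\<Sum>v\<in>Poly_Mapping.keys m. Poly_Mapping.single v (Poly_Mapping.lookup m v)) = m"
    by (rule poly_mapping_eqI) (auto simp: lookup_sum lookup_single when_def in_keys_iff)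
  then have "ipmon ipvar m = Poly_Mapping.single m 1"
    by (simp add: ipmon_def v fin)
  then show ?thesis by (simp add: mult_single flip: single_of_int)
qed

lemma freshman:
  fixes x y :: "'a::comm_ring_1"
  assumes "prime p"
  shows "of_nat p dvd (x + y) ^ p - (x ^ p + y ^ p)"
proof -
  have p: "p \<ge> 1" "p > 0" using prime_gt_0_nat[OF assms] by auto
  have "(x + y) ^ p = (\<Sum>k\<le>p. of_nat (p choose k) * x ^ k * y ^ (p - k))"
    by (rule binomial_ring)
  also have "{..p} = insert 0 (insert p {1..<p})" using p by auto
  also have "(\<Sum>k\<in>\<dots>. of_nat (p choose k) * x ^ k * y ^ (p - k)) =
      y ^ p + x ^ p + (\<Sum>k\<in>{1..<p}. of_nat (p choose k) * x ^ k * y ^ (p - k))"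
    using p by (simp add: algebra_simps)
  finally have "(x + y) ^ p - (x ^ p + y ^ p) = (\<Sum>k\<in>{1..<p}. of_nat (p choose k) * x ^ k * y ^ (p - k))"
    by (simp add: algebra_simps)
  also have "of_nat p dvd \<dots>"
  proof (intro dvd_sum dvd_mult2)
    fix k assume "k \<in> {1..<p}"
    then have "p dvd (p choose k)" using assms by (intro dvd_choose_prime) auto
    then show "(of_nat p :: 'a) dvd of_nat (p choose k)" by (metis dvd_def of_nat_mult)
  qed
  finally show ?thesis .
qed

lemma int_fermat:
  assumes "prime p"
  shows "int p dvd c - c ^ p"
proof -
  have nat: "int p dvd int n - int n ^ p" for n
  proof (induction n)
    case 0
    show ?case using prime_gt_0_nat[OF assms] by (simp add: power_0_left)
  next
    case (Suc n)
    have "int p dvd (int n + 1) ^ p - (int n ^ p + 1 ^ p)" using freshman[OF assms, of "int n" 1] by simp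
    with Suc have "int p dvd (int n - int n ^ p) - ((int n + 1) ^ p - (int n ^ p + 1 ^ p))"
      by (rule dvd_diff)
    then show ?case by (simp add: algebra_simps)
  qed
  have "[c = int (nat (c mod int p))] (mod int p)"
    using prime_gt_0_nat[OF assms] by (simp add: cong_def)
  moreover from this have "[c ^ p = int (nat (c mod int p)) ^ p] (mod int p)"
    by (rule cong_pow)
  ultimately have "[c - c ^ p = int (nat (c mod int p)) - int (nat (c mod int p)) ^ p] (mod int p)"
    by (rule cong_diff)
  then show ?thesis using nat[of "nat (c mod int p)"] by (simp only: cong_dvd_iff)
qed

lemma ipfrob_lift:
  assumes "prime p"
  shows "of_nat p dvd ipfrob p f - f ^ p"
proof (induction f rule: ipoly_induct)
  case (single m c)
  have 1: "ipfrob p (Poly_Mapping.single m c) = of_int c * ipmon ipvar m ^ p"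
    by (simp add: ipfrob_def ipmon_def prod_power_distrib mult.commute flip: power_mult)
  have "(of_int (int p) :: 'a ipoly) dvd of_int (c - c ^ p)"
    using int_fermat[OF assms, of c] by (metis dvd_def of_int_mult)
  then have "(of_nat p :: 'a ipoly) dvd of_int (c - c ^ p) * ipmon ipvar m ^ p" by simp
  then show ?case unfolding 1 unfolding ipoly_single_eq by (simp add: power_mult_distrib algebra_simps)
next
  case (add f g)
  have "of_nat p dvd (ipfrob p f - f ^ p) + (ipfrob p g - g ^ p) - ((f + g) ^ p - (f ^ p + g ^ p))"
    by (intro dvd_diff dvd_add add freshman assms)
  then show ?case by (simp add: ipfrob_def ipeval_add algebra_simps)
qed

lemma ip_tf: "prime p \<Longrightarrow> of_nat p * f = (0::'v ipoly) \<Longrightarrow> f = 0"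
  using ipoly_torsion_free prime_gt_0_nat by blast

lemma dvd_mult_diff:
  fixes a b c d k :: "'a::comm_ring_1"
  assumes "k dvd a - b" "k dvd c - d"
  shows "k dvd a * c - b * d"
proof -
  have "a * c - b * d = (a - b) * c + b * (c - d)" by (simp add: algebra_simps)
  then show ?thesis using assms by simp
qed

context
  fixes p :: nat
  assumes p: "prime p"
begin

lemma ipfrob_ghost:
  "of_nat p ^ Suc n dvd ghost p (Suc n) (gvar b) - ipfrob p (ghost p n (gvar b))"
  by (rule ghost_frob) (auto simp: ipfrob_def is_hom_ipeval)

lemmas ip_dwork = dwork_exists[OF is_hom_ipeval[of "\<lambda>v. ipvar v ^ p", folded ipfrob_def] ipfrob_lift[OF p] ip_tf[OF p]]

lemmas ipfrob_hom = is_homD[OF is_hom_ipeval[of "\<lambda>v. ipvar v ^ p", folded ipfrob_def]]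

lemma ghost_add_poly: "ghost p n (witt_add_poly p) = ghost p n (gvar False) + ghost p n (gvar True)"
proof -
  let ?g = "\<lambda>n. ghost p n (gvar False) + ghost p n (gvar True)"
  have "\<exists>!S. \<forall>n. ghost p n S = ?g n"
  proof (rule ip_dwork)
    fix n
    show "of_nat p ^ Suc n dvd ?g (Suc n) - ipfrob p (?g n)"
      unfolding ipfrob_hom add_diff_add by (intro dvd_add ipfrob_ghost)
  qed
  from theI'[OF this] show ?thesis by (simp add: witt_add_poly_def)
qed

lemma ghost_mult_poly: "ghost p n (witt_mult_poly p) = ghost p n (gvar False) * ghost p n (gvar True)"
proof -
  let ?g = "\<lambda>n. ghost p n (gvar False) * ghost p n (gvar True)"
  have "\<exists>!S. \<forall>n. ghost p n S = ?g n"
  proof (rule ip_dwork)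
    fix n
    show "of_nat p ^ Suc n dvd ?g (Suc n) - ipfrob p (?g n)"
      unfolding ipfrob_hom by (intro dvd_mult_diff ipfrob_ghost)
  qed
  from theI'[OF this] show ?thesis by (simp add: witt_mult_poly_def)
qed

lemma ghost_neg_poly: "ghost p n (witt_neg_poly p) = - ghost p n (gvar False)"
proof -
  let ?g = "\<lambda>n. - ghost p n (gvar False)"
  have "\<exists>!S. \<forall>n. ghost p n S = ?g n"
  proof (rule ip_dwork)
    fix n
    have "of_nat p ^ Suc n dvd - (ghost p (Suc n) (gvar False) - ipfrob p (ghost p n (gvar False)))"
      unfolding dvd_minus_iff by (rule ipfrob_ghost)
    then show "of_nat p ^ Suc n dvd ?g (Suc n) - ipfrob p (?g n)"
      unfolding ipfrob_hom by simp
  qed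
  from theI'[OF this] show ?thesis by (simp add: witt_neg_poly_def)
qed

lemma ghost_pick2:
  "ipeval (pick2 x y) (ghost p n (gvar b)) = ghost p n (if b then y else x)"
  by (subst ghost_hom[OF is_hom_ipeval, symmetric]) (auto simp: o_def intro!: arg_cong[of _ _ "ghost p n"])

lemma ghost_wadd: "ghost p n (wadd p x y) = ghost p n x + ghost p n y"
proof -
  have "ghost p n (wadd p x y) = ghost p n (ipeval (pick2 x y) \<circ> witt_add_poly p)"
    by (simp add: wadd_def[abs_def] o_def)
  then show ?thesis
    unfolding ghost_hom[OF is_hom_ipeval] ghost_add_poly ipeval_add ghost_pick2 by simp
qed

lemma ghost_wmult: "ghost p n (wmult p x y) = ghost p n x * ghost p n y"
proof -
  have "ghost p n (wmult p x y) = ghost p n (ipeval (pick2 x y) \<circ> witt_mult_poly p)"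
    by (simp add: wmult_def[abs_def] o_def)
  then show ?thesis
    unfolding ghost_hom[OF is_hom_ipeval] ghost_mult_poly ipeval_mult ghost_pick2 by simp
qed

lemma ghost_wneg: "ghost p n (wneg p x) = - ghost p n x"
proof -
  have "ghost p n (wneg p x) = ghost p n (ipeval (pick2 x x) \<circ> witt_neg_poly p)"
    by (simp add: wneg_def[abs_def] o_def case_prod_unfold)
  then show ?thesis
    unfolding ghost_hom[OF is_hom_ipeval] ghost_neg_poly ipeval_uminus ghost_pick2 by simp
qed

lemma ghost_wzero: "ghost p n (\<lambda>_. 0) = 0"
  using prime_gt_0_nat[OF p] by (simp add: ghost_def power_0_left)

lemma ghost_wone: "ghost p n wone = 1"
proof -
  have "ghost p n wone = (\<Sum>i\<le>n. if i = 0 then 1 else (0::'a))"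
    unfolding ghost_def using prime_gt_0_nat[OF p]
    by (intro sum.cong refl) (auto simp: wone_def power_0_left)
  then show ?thesis by simp
qed

end

lemma pick2_comp: "h \<circ> pick2 x y = pick2 (h \<circ> x) (h \<circ> y)"
  by (rule ext) (simp split: prod.split)

lemma wadd_hom: assumes "is_hom h" shows "h \<circ> wadd p x y = wadd p (h \<circ> x) (h \<circ> y)"
  by (rule ext) (simp only: wadd_def o_apply[of h] is_hom_ipeval_comp[OF assms] pick2_comp)

lemma wmult_hom: assumes "is_hom h" shows "h \<circ> wmult p x y = wmult p (h \<circ> x) (h \<circ> y)"
  by (rule ext) (simp only: wmult_def o_apply[of h] is_hom_ipeval_comp[OF assms] pick2_comp)

lemma wneg_hom: assumes "is_hom h" shows "h \<circ> wneg p x = wneg p (h \<circ> x)"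
  by (rule ext) (simp only: wneg_def o_apply[of h] is_hom_ipeval_comp[OF assms] pick2_comp)

lemma wzero_hom: assumes "is_hom h" shows "h \<circ> (\<lambda>_. 0) = (\<lambda>_. 0)"
  by (auto simp: is_homD[OF assms])

lemma wone_hom: assumes "is_hom h" shows "h \<circ> wone = wone"
  by (auto simp: wone_def is_homD[OF assms])

lemmas w_hom = wadd_hom wmult_hom wneg_hom wzero_hom wone_hom

definition pick3 :: "(nat \<Rightarrow> 'a) \<Rightarrow> (nat \<Rightarrow> 'a) \<Rightarrow> (nat \<Rightarrow> 'a) \<Rightarrow> nat \<times> nat \<Rightarrow> 'a" where
  "pick3 x y z = (\<lambda>(j, i). if j = 0 then x i else if j = 1 then y i else z i)"

lemma pick3_var:
  "ipeval (pick3 x y z) \<circ> gvar 0 = x" "ipeval (pick3 x y z) \<circ> gvar 1 = y" "ipeval (pick3 x y z) \<circ> gvar 2 = z"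
  by (auto simp: pick3_def o_def)

text \<open>An identity between Witt vectors over the generic ring yields it over every ring.\<close>

lemma generic3:
  fixes L R :: "(nat \<Rightarrow> (nat \<times> nat) ipoly) \<Rightarrow> (nat \<Rightarrow> (nat \<times> nat) ipoly) \<Rightarrow> (nat \<Rightarrow> (nat \<times> nat) ipoly) \<Rightarrow> nat \<Rightarrow> (nat \<times> nat) ipoly"
    and L' R' :: "(nat \<Rightarrow> 'a::comm_ring_1) \<Rightarrow> (nat \<Rightarrow> 'a) \<Rightarrow> (nat \<Rightarrow> 'a) \<Rightarrow> nat \<Rightarrow> 'a"
  assumes "prime p"
    and g: "\<And>n. ghost p n (L (gvar 0) (gvar 1) (gvar 2)) = ghost p n (R (gvar 0) (gvar 1) (gvar 2))"
    and "\<And>h. is_hom h \<Longrightarrow> h \<circ> L (gvar 0) (gvar 1) (gvar 2) = L' (h \<circ> gvar 0) (h \<circ> gvar 1) (h \<circ> gvar 2)"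
    and "\<And>h. is_hom h \<Longrightarrow> h \<circ> R (gvar 0) (gvar 1) (gvar 2) = R' (h \<circ> gvar 0) (h \<circ> gvar 1) (h \<circ> gvar 2)"
  shows "L' x y z = R' x y z"
proof -
  have "L (gvar 0) (gvar 1) (gvar 2) = R (gvar 0) (gvar 1) (gvar 2)"
    using g by (intro ext ghost_inj[OF ip_tf[OF assms(1)],
      where x = "L (gvar 0) (gvar 1) (gvar 2)" and y = "R (gvar 0) (gvar 1) (gvar 2)"]) auto
  then show ?thesis
    using assms(3,4)[OF is_hom_ipeval[of "pick3 x y z"]] unfolding pick3_var by simp
qed

lemmas w_ghost = ghost_wadd ghost_wmult ghost_wneg ghost_wzero ghost_wone

context
  fixes p :: nat
  assumes p: "prime p"
begin

lemma wadd_assoc: "wadd p (wadd p x y) z = wadd p x (wadd p y z)"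
  by (rule generic3[OF p, of "\<lambda>x y z. wadd p (wadd p x y) z" "\<lambda>x y z. wadd p x (wadd p y z)"
      "\<lambda>x y z. wadd p (wadd p x y) z" "\<lambda>x y z. wadd p x (wadd p y z)" x y z])
     (simp_all add: w_ghost[OF p] w_hom algebra_simps)

lemma wadd_comm: "wadd p x y = wadd p y x"
  by (rule generic3[OF p, of "\<lambda>x y z. wadd p x y" "\<lambda>x y z. wadd p y x" "\<lambda>x y z. wadd p x y" "\<lambda>x y z. wadd p y x" x y y])
     (simp_all add: w_ghost[OF p] w_hom algebra_simps)

lemma wadd_0: "wadd p (\<lambda>_. 0) x = x"
  by (rule generic3[OF p, of "\<lambda>x y z. wadd p (\<lambda>_. 0) x" "\<lambda>x y z. x" "\<lambda>x y z. wadd p (\<lambda>_. 0) x" "\<lambda>x y z. x" x x x])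
     (simp_all add: w_ghost[OF p] w_hom algebra_simps)

lemma wadd_neg: "wadd p (wneg p x) x = (\<lambda>_. 0)"
  by (rule generic3[OF p, of "\<lambda>x y z. wadd p (wneg p x) x" "\<lambda>x y z _. 0" "\<lambda>x y z. wadd p (wneg p x) x" "\<lambda>x y z _. 0" x x x])
     (simp_all add: w_ghost[OF p] w_hom algebra_simps)

lemma wmult_assoc: "wmult p (wmult p x y) z = wmult p x (wmult p y z)"
  by (rule generic3[OF p, of "\<lambda>x y z. wmult p (wmult p x y) z" "\<lambda>x y z. wmult p x (wmult p y z)"
      "\<lambda>x y z. wmult p (wmult p x y) z" "\<lambda>x y z. wmult p x (wmult p y z)" x y z])
     (simp_all add: w_ghost[OF p] w_hom algebra_simps)

lemma wmult_comm: "wmult p x y = wmult p y x"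
  by (rule generic3[OF p, of "\<lambda>x y z. wmult p x y" "\<lambda>x y z. wmult p y x" "\<lambda>x y z. wmult p x y" "\<lambda>x y z. wmult p y x" x y y])
     (simp_all add: w_ghost[OF p] w_hom algebra_simps)

lemma wmult_1: "wmult p wone x = x"
  by (rule generic3[OF p, of "\<lambda>x y z. wmult p wone x" "\<lambda>x y z. x" "\<lambda>x y z. wmult p wone x" "\<lambda>x y z. x" x x x])
     (simp_all add: w_ghost[OF p] w_hom algebra_simps)

lemma wdistrib: "wmult p (wadd p x y) z = wadd p (wmult p x z) (wmult p y z)"
  by (rule generic3[OF p, of "\<lambda>x y z. wmult p (wadd p x y) z" "\<lambda>x y z. wadd p (wmult p x z) (wmult p y z)"
      "\<lambda>x y z. wmult p (wadd p x y) z" "\<lambda>x y z. wadd p (wmult p x z) (wmult p y z)" x y z])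
     (simp_all add: w_ghost[OF p] w_hom algebra_simps)

text \<open>In characteristic \<open>p\<close>, multiplication by \<open>p\<close> is \<open>V \<circ> F\<close>.\<close>

lemma wadd_p:
  fixes x :: "nat \<Rightarrow> 'a::comm_ring_1"
  assumes char: "of_nat p = (0::'a)"
  shows "((wadd p x ^^ p) (\<lambda>_. 0)) n = (if n = 0 then 0 else x (n - 1) ^ p)"
proof -
  let ?X = "gvar (0::nat)"
  let ?V = "\<lambda>n. if n = 0 then 0 else ?X (n - 1) ^ p"
  have g: "ghost p n ((wadd p y ^^ k) (\<lambda>_. 0)) = of_nat k * ghost p n y" for k n and y :: "nat \<Rightarrow> (nat \<times> nat) ipoly"
    by (induction k) (simp_all add: w_ghost[OF p] algebra_simps)
  have hom: "h \<circ> (wadd p y ^^ k) (\<lambda>_. 0) = (wadd p (h \<circ> y) ^^ k) (\<lambda>_. 0)" if "is_hom h"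
    for k y and h :: "(nat \<times> nat) ipoly \<Rightarrow> 'a"
    by (induction k) (simp_all only: funpow.simps id_apply o_apply[of "wadd p _"] w_hom[OF that])
  have V: "ghost p n ?V = of_nat p * (ghost p n ?X - of_nat p ^ n * ?X n)" for n
  proof (cases n)
    case 0
    then show ?thesis by (simp add: ghost_def)
  next
    case (Suc m)
    have "ghost p n ?V = (\<Sum>i\<le>m. of_nat p ^ Suc i * (?X i ^ p) ^ (p ^ (m - i)))"
      unfolding Suc ghost_def sum.atMost_Suc_shift using prime_gt_0_nat[OF p]
      by (simp add: power_0_left)
    also have "\<dots> = (\<Sum>i\<le>m. of_nat p * (of_nat p ^ i * ?X i ^ (p ^ (n - i))))"
      by (intro sum.cong refl) (auto simp: Suc Suc_diff_le mult.assoc simp flip: power_mult)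
    also have "\<dots> = of_nat p * (ghost p n ?X - of_nat p ^ n * ?X n)"
      by (simp add: ghost_split Suc lessThan_Suc_atMost sum_distrib_left)
    finally show ?thesis .
  qed
  have "of_nat p dvd ((wadd p ?X ^^ p) (\<lambda>_. 0)) n - ?V n"
  proof (rule ghost_cong_imp[OF ip_tf[OF p], where x = "(wadd p ?X ^^ p) (\<lambda>_. 0)" and y = ?V])
    fix n
    have "ghost p n ((wadd p ?X ^^ p) (\<lambda>_. 0)) - ghost p n ?V = of_nat p ^ Suc n * ?X n"
      unfolding V g by (simp add: algebra_simps)
    then show "of_nat p ^ Suc n dvd ghost p n ((wadd p ?X ^^ p) (\<lambda>_. 0)) - ghost p n ?V" by simp
  qed
  then obtain q where q: "((wadd p ?X ^^ p) (\<lambda>_. 0)) n = ?V n + of_nat p * q"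
    by (metis dvd_def diff_add_cancel add.commute)
  let ?h = "ipeval (pick3 x x x)"
  note h = is_hom_ipeval[of "pick3 x x x"]
  have "((wadd p x ^^ p) (\<lambda>_. 0)) n = (?h \<circ> (wadd p ?X ^^ p) (\<lambda>_. 0)) n"
    unfolding hom[OF h] pick3_var ..
  also have "\<dots> = ?h (?V n + of_nat p * q)" using q by simp
  also have "\<dots> = (if n = 0 then 0 else x (n - 1) ^ p)"
    by (simp add: is_homD[OF h] char) (simp add: pick3_def)
  finally show ?thesis .
qed

end

datatype 'a witt = Witt (witt_nth: "nat \<Rightarrow> 'a")

lemma CHAR_prime: "prime CHAR('a::{comm_ring_1, semiring_prime_char})"
  by simp

instantiation witt :: ("{comm_ring_1, semiring_prime_char}") comm_ring_1
begin

definition zero_witt :: "'a witt" where "zero_witt = Witt (\<lambda>_. 0)"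
definition one_witt :: "'a witt" where "one_witt = Witt wone"
definition plus_witt :: "'a witt \<Rightarrow> 'a witt \<Rightarrow> 'a witt" where
  "plus_witt x y = Witt (wadd CHAR('a) (witt_nth x) (witt_nth y))"
definition uminus_witt :: "'a witt \<Rightarrow> 'a witt" where
  "uminus_witt x = Witt (wneg CHAR('a) (witt_nth x))"
definition minus_witt :: "'a witt \<Rightarrow> 'a witt \<Rightarrow> 'a witt" where
  "minus_witt x y = x + - y"
definition times_witt :: "'a witt \<Rightarrow> 'a witt \<Rightarrow> 'a witt" where
  "times_witt x y = Witt (wmult CHAR('a) (witt_nth x) (witt_nth y))"

instance
proof
  have "witt_nth 0 0 \<noteq> witt_nth (1 :: 'a witt) 0"
    by (simp add: zero_witt_def one_witt_def wone_def)
  then show "(0 :: 'a witt) \<noteq> 1" by metis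
next
  fix a b c :: "'a witt"
  show "a * b * c = a * (b * c)" by (simp add: times_witt_def wmult_assoc[OF CHAR_prime])
  show "a + b + c = a + (b + c)" by (simp add: plus_witt_def wadd_assoc[OF CHAR_prime])
  show "- a + a = 0" by (simp add: plus_witt_def uminus_witt_def zero_witt_def wadd_neg[OF CHAR_prime])
  show "(a + b) * c = a * c + b * c" by (simp add: times_witt_def plus_witt_def wdistrib[OF CHAR_prime])
qed (simp_all add: zero_witt_def one_witt_def plus_witt_def minus_witt_def uminus_witt_def times_witt_def
    wadd_0[OF CHAR_prime] wmult_1[OF CHAR_prime] wadd_comm[OF CHAR_prime] wmult_comm[OF CHAR_prime])

end

lemma witt_nth_0 [simp]: "witt_nth 0 n = 0"
  by (simp add: zero_witt_def)

lemma witt_nth_1_0 [simp]: "witt_nth 1 0 = 1"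
  by (simp add: one_witt_def wone_def)

lemma witt_nth_mult_0: "witt_nth (x * y) 0 = witt_nth x 0 * witt_nth y 0"
  using ghost_wmult[OF CHAR_prime, of 0 "witt_nth x" "witt_nth y"] by (simp add: ghost_def times_witt_def)

lemma witt_nth_add_0: "witt_nth (x + y) 0 = witt_nth x 0 + witt_nth y 0"
  using ghost_wadd[OF CHAR_prime, of 0 "witt_nth x" "witt_nth y"] by (simp add: ghost_def plus_witt_def)

lemma witt_nth_p:
  "witt_nth (of_nat CHAR('a) * x) n = (if n = 0 then 0 else witt_nth (x :: 'a::{comm_ring_1, semiring_prime_char} witt) (n - 1) ^ CHAR('a))"
proof -
  have "of_nat k * x = Witt ((wadd CHAR('a) (witt_nth x) ^^ k) (\<lambda>_. 0))" for k
  proof (induction k)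
    case 0
    show ?case by (simp flip: zero_witt_def)
  next
    case (Suc k)
    have "of_nat (Suc k) * x = x + of_nat k * x" by (simp add: distrib_right)
    then show ?case unfolding Suc by (simp add: plus_witt_def)
  qed
  then show ?thesis by (simp add: wadd_p[OF CHAR_prime])
qed

lemma witt_p_torsion_free:
  assumes "of_nat CHAR('a) ^ k * x = (0 :: 'a::{idom, semiring_prime_char} witt)"
  shows "x = 0"
  using assms
proof (induction k)
  case (Suc k)
  let ?y = "of_nat CHAR('a) ^ k * x"
  have "witt_nth ?y n = 0" for n
    using witt_nth_p[of ?y "Suc n"] Suc(2) by (simp add: mult.assoc)
  then have "?y = 0" by (metis ext witt.collapse zero_witt_def)
  then show ?case by (rule Suc.IH)
qed simp

lemma witt_unit_part:
  assumes "witt_nth x k \<noteq> 0"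
  shows "\<exists>m y. x = of_nat CHAR('a) ^ m * y \<and> witt_nth y 0 \<noteq> (0 :: 'a::{alg_closed_field, semiring_prime_char})"
  using assms
proof (induction k arbitrary: x)
  case 0
  then show ?case by (intro exI[of _ 0] exI[of _ x]) simp
next
  case (Suc k)
  show ?case
  proof (cases "witt_nth x 0 = 0")
    case False
    then show ?thesis by (intro exI[of _ 0] exI[of _ x]) simp
  next
    case True
    have "\<exists>w. w ^ CHAR('a) = u" for u :: 'a
      using nth_root_exists[of "CHAR('a)" u] prime_gt_0_nat[OF CHAR_prime] by blast
    then obtain f where f: "\<And>u :: 'a. f u ^ CHAR('a) = u" by metis
    define z where "z = Witt (\<lambda>n. f (witt_nth x (Suc n)))"
    have "witt_nth x = witt_nth (of_nat CHAR('a) * z)"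
      by (rule ext) (simp add: witt_nth_p z_def f True)
    then have x: "x = of_nat CHAR('a) * z" by (metis witt.collapse)
    have "witt_nth z k \<noteq> 0"
      using Suc.prems f[of "witt_nth x (Suc k)"] prime_gt_0_nat[OF CHAR_prime[where 'a='a]]
      by (auto simp: z_def power_0_left)
    from Suc.IH[OF this] obtain m y where "z = of_nat CHAR('a) ^ m * y" "witt_nth y 0 \<noteq> 0" by blast
    then show ?thesis using x by (intro exI[of _ "Suc m"] exI[of _ y]) (simp add: mult.assoc)
  qed
qed

instance witt :: ("{alg_closed_field, semiring_prime_char}") idom
proof
  fix x y :: "'a witt"
  assume "x \<noteq> 0" "y \<noteq> 0"
  then obtain i j where "witt_nth x i \<noteq> 0" "witt_nth y j \<noteq> 0"
    by (metis ext witt.collapse zero_witt_def)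
  then obtain m n u v where x: "x = of_nat CHAR('a) ^ m * u" "witt_nth u 0 \<noteq> 0"
    and y: "y = of_nat CHAR('a) ^ n * v" "witt_nth v 0 \<noteq> 0"
    using witt_unit_part[of x i] witt_unit_part[of y j] by blast
  have "witt_nth (u * v) 0 \<noteq> 0" using x y by (simp add: witt_nth_mult_0)
  then have "u * v \<noteq> 0" by auto
  moreover have "x * y = of_nat CHAR('a) ^ (m + n) * (u * v)"
    by (simp add: x y power_add algebra_simps)
  ultimately show "x * y \<noteq> 0" using witt_p_torsion_free by metis
qed


section \<open>The ring W and its fraction field\<close>

instance alg_closure :: (field_prime_char) field_prime_char
  by (rule field_prime_charI') (simp add: prime_gt_0_nat)

lemma CHAR_Fpbar: "CHAR('p::prime_card mod_ring alg_closure) = CARD('p)"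
  by simp

text \<open>
  The prime is \<open>CARD('p)\<close>. \<open>'p K\<close> is the fraction field of \<open>W(k)\<close>, where \<open>k\<close> is the algebraic
  closure of the field with \<open>p\<close> elements; \<open>W\<close> and \<open>Z\<^sub>p\<close> are regarded as subsets of it.
\<close>

type_synonym 'p K = "'p mod_ring alg_closure witt fract"

abbreviation pK :: "'p::prime_card K" where
  "pK \<equiv> of_nat CARD('p)"

definition W :: "'p::prime_card K set" where
  "W = range (\<lambda>w. Fract w 1)"

definition pW :: "nat \<Rightarrow> 'p::prime_card K set" where
  "pW n = (\<lambda>x. pK ^ n * x) ` W"

text \<open>\<open>Z\<^sub>p = W(F\<^sub>p)\<close> is the closure of the integers in \<open>W\<close>.\<close>

definition Zp :: "'p::prime_card K set" where
  "Zp = {x \<in> W. \<forall>n. \<exists>m. x - of_int m \<in> pW n}"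

definition padic_lim :: "('i \<Rightarrow> 'p::prime_card K) \<Rightarrow> 'i filter \<Rightarrow> 'p K" where
  "padic_lim f F = (THE L. \<forall>n. \<forall>\<^sub>F i in F. f i - L \<in> pW n)"

text \<open>The filter of positive integers tending \<open>p\<close>-adically to \<open>z\<close>.\<close>

definition nat_near :: "'p::prime_card K \<Rightarrow> nat filter" where
  "nat_near z = (INF N. principal {n. 0 < n \<and> of_nat n - z \<in> pW N})"


section \<open>Digits and Dwork primes\<close>

definition dwork_l :: "'p::prime_card K \<Rightarrow> nat" where
  "dwork_l \<alpha> = (THE l. l < CARD('p) \<and> \<alpha> + of_nat l \<in> pW 1)"

definition dwork :: "'p::prime_card K \<Rightarrow> 'p K" where
  "dwork \<alpha> = (\<alpha> + of_nat (dwork_l \<alpha>)) / pK"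

text \<open>The digits are those of \<open>-\<alpha>\<close>, as \<open>\<alpha> = - (\<Sum>i. [\<alpha>]\<^sub>i p\<^sup>i)\<close>.\<close>

definition dwork_digit :: "'p::prime_card K \<Rightarrow> nat \<Rightarrow> nat" where
  "dwork_digit \<alpha> = (THE d. (\<forall>i. d i < CARD('p)) \<and> (\<forall>n. \<alpha> + (\<Sum>i<n. of_nat (d i) * pK ^ i) \<in> pW n))"


section \<open>Hypergeometric series\<close>

definition hyp :: "'p::prime_card K \<Rightarrow> 'p K \<Rightarrow> 'p K \<Rightarrow> 'p K fps" where
  "hyp \<alpha> \<beta> \<gamma> = Abs_fps (\<lambda>n. pochhammer \<alpha> n * pochhammer \<beta> n / (pochhammer 1 n * pochhammer \<gamma> n))"

definition hyp_dwork :: "nat \<Rightarrow> 'p::prime_card K \<Rightarrow> 'p K \<Rightarrow> 'p K \<Rightarrow> 'p K fps" where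
  "hyp_dwork i \<alpha> \<beta> \<gamma> = hyp ((dwork ^^ i) \<alpha>) ((dwork ^^ i) \<beta>) ((dwork ^^ i) \<gamma>)"

definition h_poly :: "'p::prime_card K \<Rightarrow> nat \<Rightarrow> 'p K poly" where
  "h_poly a r = (\<Prod>i<r. truncate_fps CARD('p) (hyp_dwork i a (1 - a) 1))"

definition hhat_poly :: "'p::prime_card K \<Rightarrow> nat \<Rightarrow> 'p K poly" where
  "hhat_poly a r = (\<Prod>i<r. truncate_fps CARD('p) (hyp_dwork i a a (2 * a)))"


section \<open>p-adic special functions\<close>

definition log_series :: "'p::prime_card K \<Rightarrow> 'p K" where
  "log_series x = padic_lim (\<lambda>n. \<Sum>k=1..n. (- 1) ^ (k + 1) * x ^ k / of_nat k) sequentially"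

text \<open>
  The Iwasawa logarithm, restricted to the nonzero elements of \<open>K\<close> (which determines it, every
  unit of \<open>W\<close> having a power in \<open>1 + pW\<close>); the value at \<open>0\<close> is a dummy.
\<close>

definition iwasawa_log :: "'p::prime_card K \<Rightarrow> 'p K" where
  "iwasawa_log = (THE L. L 0 = 0 \<and> L pK = 0 \<and>
     (\<forall>x y. x \<noteq> 0 \<longrightarrow> y \<noteq> 0 \<longrightarrow> L (x * y) = L x + L y) \<and>
     (\<forall>x\<in>pW 1. L (1 + x) = log_series x))"

definition psi_tilde :: "'p::prime_card K \<Rightarrow> 'p K" where
  "psi_tilde z = padic_lim (\<lambda>n. \<Sum>k | 1 \<le> k \<and> k < n \<and> \<not> CARD('p) dvd k. 1 / of_nat k) (nat_near z)"

definition gamma_p :: "'p::prime_card K" where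
  "gamma_p = - padic_lim (\<lambda>s. (1 / pK ^ s) * (\<Sum>j | j < CARD('p) ^ s \<and> \<not> CARD('p) dvd j. iwasawa_log (of_nat j))) sequentially"

definition psi_p :: "'p::prime_card K \<Rightarrow> 'p K" where
  "psi_p z = - gamma_p + psi_tilde z"

text \<open>Morita's Gamma function; this is the definition for odd \<open>p\<close>.\<close>

definition Gamma_p :: "'p::prime_card K \<Rightarrow> 'p K" where
  "Gamma_p z = padic_lim (\<lambda>n. (- 1) ^ n * (\<Prod>k | 1 \<le> k \<and> k < n \<and> \<not> CARD('p) dvd k. of_nat k)) (nat_near z)"

definition Beta_p :: "'p::prime_card K \<Rightarrow> 'p K \<Rightarrow> 'p K" where
  "Beta_p x y = Gamma_p x * Gamma_p y / Gamma_p (x + y)"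

definition padic_powr :: "'p::prime_card K \<Rightarrow> 'p K \<Rightarrow> 'p K" where
  "padic_powr u z = padic_lim (\<lambda>n. u ^ n) (nat_near z)"


section \<open>The p-adic hypergeometric function of logarithmic type\<close>

text \<open>\<open>f(t\<^sup>\<sigma>)\<close> for \<open>t\<^sup>\<sigma> = c t\<^sup>p\<close>\<close>

definition subst_sigma :: "'p::prime_card K \<Rightarrow> 'p K fps \<Rightarrow> 'p K fps" where
  "subst_sigma c f = fps_compose f (fps_const c * fps_X ^ CARD('p))"

definition int_dtt :: "'p::prime_card K fps \<Rightarrow> 'p K fps" where
  "int_dtt f = Abs_fps (\<lambda>n. if n = 0 then 0 else fps_nth f n / of_nat n)"

definition G_log :: "'p::prime_card K \<Rightarrow> 'p K \<Rightarrow> 'p K fps" where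
  "G_log c a = fps_const (psi_p a + psi_p (1 - a) + 2 * gamma_p - (1 / pK) * iwasawa_log c)
     + int_dtt (hyp a (1 - a) 1 - subst_sigma c (hyp_dwork 1 a (1 - a) 1))"

definition F_log :: "'p::prime_card K \<Rightarrow> 'p K \<Rightarrow> 'p K fps" where
  "F_log c a = G_log c a / hyp a (1 - a) 1"


section \<open>The function on the other side\<close>

text \<open>
  Formal expressions \<open>t\<^sup>\<beta> f(t)\<close> with \<open>\<beta> \<in> Z\<^sub>p\<close> are represented by the function that maps an exponent
  to its coefficient.
\<close>

type_synonym 'p gser = "'p K \<Rightarrow> 'p K"

definition tpow_mult :: "'p::prime_card K \<Rightarrow> 'p K fps \<Rightarrow> 'p gser" where
  "tpow_mult \<beta> f = (\<lambda>e. \<Sum>n | e = \<beta> + of_nat n. fps_nth f n)"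

definition tpow_unmult :: "'p::prime_card K \<Rightarrow> 'p gser \<Rightarrow> 'p K fps" where
  "tpow_unmult \<beta> \<phi> = Abs_fps (\<lambda>n. \<phi> (\<beta> + of_nat n))"

definition gser_int_dtt :: "'p::prime_card gser \<Rightarrow> 'p gser" where
  "gser_int_dtt \<phi> = (\<lambda>\<beta>. \<phi> \<beta> / \<beta>)"

text \<open>\<open>[t\<^sup>\<beta> f(t)]\<^sup>\<tau>\<close> for \<open>\<tau>(t) = u t\<^sup>p\<close>\<close>

definition gser_tau :: "'p::prime_card K \<Rightarrow> 'p K \<Rightarrow> 'p K fps \<Rightarrow> 'p gser" where
  "gser_tau u \<beta> f = tpow_mult (pK * \<beta>) (fps_const (padic_powr u \<beta>) * subst_sigma u f)"

definition G_hat :: "'p::prime_card K \<Rightarrow> 'p K \<Rightarrow> 'p K fps" where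
  "G_hat u a = tpow_unmult a (gser_int_dtt (\<lambda>e.
     tpow_mult a (hyp a a (2 * a)) e
     - (- 1) ^ dwork_l a * inverse (Beta_p a a) * gser_tau u (dwork a) (hyp_dwork 1 a a (2 * a)) e))"

definition F_hat :: "'p::prime_card K \<Rightarrow> 'p K \<Rightarrow> 'p K fps" where
  "F_hat u a = G_hat u a / hyp a a (2 * a)"


section \<open>The rings of convergent functions\<close>

definition subring_of :: "'a::comm_ring_1 set \<Rightarrow> 'a ring" where
  "subring_of A = \<lparr>carrier = A, monoid.mult = (*), one = 1, zero = 0, ring.add = (+)\<rparr>"

definition p_ideal :: "nat \<Rightarrow> 'a::comm_ring_1 set \<Rightarrow> nat \<Rightarrow> 'a set" where
  "p_ideal p A n = PIdl\<^bsub>subring_of A\<^esub> (of_nat p ^ n)"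

definition p_quot :: "nat \<Rightarrow> 'a::comm_ring_1 set \<Rightarrow> nat \<Rightarrow> 'a set ring" where
  "p_quot p A n = subring_of A Quot p_ideal p A n"

text \<open>
  \<open>lim\<^sub>n A / p\<^sup>n A\<close>. The transition map sends a coset of \<open>p\<^sup>n\<^sup>+\<^sup>1A\<close> to the coset of \<open>p\<^sup>nA\<close> that
  contains it.
\<close>

definition p_completion :: "nat \<Rightarrow> 'a::comm_ring_1 set \<Rightarrow> (nat \<Rightarrow> 'a set) ring" where
  "p_completion p A = \<lparr>
     carrier = {x. (\<forall>n. x n \<in> carrier (p_quot p A n)) \<and> (\<forall>n. x (Suc n) \<subseteq> x n)},
     monoid.mult = (\<lambda>x y n. x n \<otimes>\<^bsub>p_quot p A n\<^esub> y n),
     one = (\<lambda>n. \<one>\<^bsub>p_quot p A n\<^esub>),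
     zero = (\<lambda>n. \<zero>\<^bsub>p_quot p A n\<^esub>),
     ring.add = (\<lambda>x y n. x n \<oplus>\<^bsub>p_quot p A n\<^esub> y n)\<rparr>"

definition p_const :: "nat \<Rightarrow> 'a::comm_ring_1 set \<Rightarrow> 'a \<Rightarrow> nat \<Rightarrow> 'a set" where
  "p_const p A x = (\<lambda>n. p_ideal p A n +>\<^bsub>subring_of A\<^esub> x)"

text \<open>The map of completions induced by an inclusion into \<open>B\<close>.\<close>

definition p_incl :: "nat \<Rightarrow> 'a::comm_ring_1 set \<Rightarrow> (nat \<Rightarrow> 'a set) \<Rightarrow> nat \<Rightarrow> 'a set" where
  "p_incl p B x = (\<lambda>n. p_ideal p B n <+>\<^bsub>subring_of B\<^esub> x n)"

text \<open>
  \<open>W[t, h\<^sup>-\<^sup>1]\<close> and \<open>W[t, t\<^sup>-\<^sup>1, h\<^sup>-\<^sup>1]\<close>, as subrings of the field \<open>K(t)\<close>; their quotients by \<open>p\<^sup>n\<close> are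
  \<open>(W/p\<^sup>n)[t, h\<^sup>-\<^sup>1]\<close> and \<open>(W/p\<^sup>n)[t, t\<^sup>-\<^sup>1, h\<^sup>-\<^sup>1]\<close>.
\<close>

type_synonym 'p Kt = "'p K poly fract"

definition W_poly :: "'p::prime_card K poly set" where
  "W_poly = {g. \<forall>i. coeff g i \<in> W}"

definition W_loc :: "'p::prime_card K poly \<Rightarrow> 'p Kt set" where
  "W_loc h = {Fract g (h ^ k) | g k. g \<in> W_poly}"

definition W_lloc :: "'p::prime_card K poly \<Rightarrow> 'p Kt set" where
  "W_lloc h = {Fract g ([:0, 1:] ^ j * h ^ k) | g j k. g \<in> W_poly}"

definition Kt_t :: "'p::prime_card Kt" where
  "Kt_t = Fract [:0, 1:] 1"

definition Kt_const :: "'p::prime_card K \<Rightarrow> 'p Kt" where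
  "Kt_const w = Fract [:w:] 1"

definition W_conv :: "'p::prime_card K poly \<Rightarrow> (nat \<Rightarrow> 'p Kt set) ring" where
  "W_conv h = p_completion CARD('p) (W_loc h)"

definition W_lconv :: "'p::prime_card K poly \<Rightarrow> (nat \<Rightarrow> 'p Kt set) ring" where
  "W_lconv h = p_completion CARD('p) (W_lloc h)"

text \<open>Expansion at \<open>t = 0\<close>, through which \<open>W\<langle>t, h\<^sup>-\<^sup>1\<rangle>\<close> is a subring of \<open>W[[t]]\<close> when \<open>h(0) = 1\<close>.\<close>

definition expands :: "'p::prime_card Kt \<Rightarrow> 'p K fps \<Rightarrow> bool" where
  "expands w e \<longleftrightarrow> (\<exists>g q. q \<noteq> 0 \<and> w = Fract g q \<and> e * fps_of_poly q = fps_of_poly g)"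

definition has_expansion :: "(nat \<Rightarrow> 'p::prime_card Kt set) \<Rightarrow> 'p K fps \<Rightarrow> bool" where
  "has_expansion x f \<longleftrightarrow> (\<forall>n. \<forall>w\<in>x n. \<exists>e. expands w e \<and> (\<forall>i. fps_nth (e - f) i \<in> pW n))"

definition conv_of_fps :: "'p::prime_card K poly \<Rightarrow> 'p K fps \<Rightarrow> nat \<Rightarrow> 'p Kt set" where
  "conv_of_fps h f = (THE x. x \<in> carrier (W_conv h) \<and> has_expansion x f)"

text \<open>The element of \<open>W\<langle>t, t\<^sup>-\<^sup>1, h\<^sup>-\<^sup>1\<rangle>\<close> given by an element of \<open>W[[t]]\<close> that lies in \<open>W\<langle>t, h\<^sup>-\<^sup>1\<rangle>\<close>.\<close>

definition lconv_of_fps :: "'p::prime_card K poly \<Rightarrow> 'p K fps \<Rightarrow> nat \<Rightarrow> 'p Kt set" where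
  "lconv_of_fps h f = p_incl CARD('p) (W_lloc h) (conv_of_fps h f)"

text \<open>
  The isomorphism \<open>f(t) \<mapsto> f(t\<^sup>-\<^sup>1)\<close>: the ring isomorphism that fixes \<open>W\<close> and maps \<open>t\<close> to \<open>t\<^sup>-\<^sup>1\<close>. It is
  unique, as it is determined on \<open>W[t, t\<^sup>-\<^sup>1, hhat\<^sup>-\<^sup>1]\<close> and ring homomorphisms are \<open>p\<close>-adically
  continuous.
\<close>

definition omega :: "'p::prime_card K poly \<Rightarrow> 'p K poly \<Rightarrow> (nat \<Rightarrow> 'p Kt set) \<Rightarrow> nat \<Rightarrow> 'p Kt set" where
  "omega hhat h = (THE f. f \<in> ring_iso (W_lconv hhat) (W_lconv h) \<and>
     f \<in> extensional (carrier (W_lconv hhat)) \<and>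
     (\<forall>w\<in>W. f (p_const CARD('p) (W_lloc hhat) (Kt_const w)) = p_const CARD('p) (W_lloc h) (Kt_const w)) \<and>
     f (p_const CARD('p) (W_lloc hhat) Kt_t) = p_const CARD('p) (W_lloc h) (inverse Kt_t))"

definition ring_cong :: "('a, 'b) ring_scheme \<Rightarrow> nat \<Rightarrow> 'a \<Rightarrow> 'a \<Rightarrow> bool" where
  "ring_cong R m x y \<longleftrightarrow> x \<ominus>\<^bsub>R\<^esub> y \<in> PIdl\<^bsub>R\<^esub> ([m] \<cdot>\<^bsub>R\<^esub> \<one>\<^bsub>R\<^esub>)"

end

theory Submission
  imports Defs
begin

text \<open>
  Write \<open>A(n)\<close> for the coefficients of \<open>F(t) = F\<^bsub>a,1-a;1\<^esub>(t)\<close> and \<open>B(n)\<close> for those of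
  \<open>F\<^bsub>a,a;2a\<^esub>(t)\<close>. Both functions of the theorem have the form \<open>G / F\<close>, where the \<open>n\<close>-th coefficient
  of \<open>G\<close> is \<open>f(n)\<close> times that of \<open>F\<close>, for a function \<open>f\<close> that is Lipschitz for the \<open>p\<close>-adic metric.

  On the logarithmic side (\<open>G_log_coeffs\<close>), \<open>f(n) = 1/n\<close> when \<open>p\<close> does not divide \<open>n\<close>. For \<open>p | n\<close>
  it is, up to a factor that tends to \<open>1\<close>, the difference of two quotients \<open>(E(n) - 1)/n\<close>, one for
  the ratio \<open>E\<close> of \<open>A(n)\<close> and the coefficient \<open>n/p\<close> of the Dwork prime, the other for \<open>E(n) =
  c\<^bsup>n/p\<^esup>\<close>. Their limits at \<open>n = 0\<close> are \<open>2 \<psi>(a)\<close>, for the digamma function \<open>\<psi>\<close> without its constant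
  \<open>-\<gamma>\<^sub>p\<close>, and \<open>p\<^sup>-\<^sup>1 log c\<close>; by the reflection formula \<open>\<psi>(1 - a) = \<psi>(a)\<close> the value \<open>f(0) = 2 \<psi>(a) -
  p\<^sup>-\<^sup>1 log c\<close> is the constant term of \<open>G\<close>. On the other side (\<open>G_hat_coeffs\<close>) the role of \<open>n\<close> is
  played by \<open>a + n\<close>: \<open>f(n) = 1/(a + n)\<close> unless \<open>a + n\<close> is divisible by \<open>p\<close>, and \<open>f\<close> tends to \<open>-(2
  \<psi>(a) - p\<^sup>-\<^sup>1 log c)\<close> as \<open>a + n\<close> tends to \<open>0\<close>. The Gamma factors are just those that turn the ratio
  of \<open>B\<close>-coefficients into the same function of \<open>a + n\<close>, a product of the \<open>(1 + y/k)/(1 - y/k)\<close>,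
  that the ratio of \<open>A\<close>-coefficients is of \<open>y = n\<close> (\<open>rho_Rprod\<close>, \<open>ufact_Rprod\<close>).

  The coefficients of a hypergeometric series factor, in blocks of length \<open>p\<close>, through those of the
  series of the Dwork primes. Induction on the power of \<open>p\<close> then shows that \<open>G / F\<close> is a convergent
  function and that modulo \<open>p\<close> it is the quotient of the truncations to degrees less than \<open>p\<close>: the
  Dwork congruences, in the form of the locale \<open>dwork_tower\<close> and its theorem \<open>quotient_conv\<close>.

  So the theorem concerns polynomials modulo \<open>p\<close>. With \<open>l = l\<^sub>a\<close>, the coefficients at degrees
  between \<open>l\<close> and \<open>p\<close> vanish modulo \<open>p\<close>, and \<open>n \<mapsto> l - n\<close> turns \<open>A\<close> into \<open>B\<close> up to the unit \<open>B(l)\<close>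
  (\<open>hyp_coeff_reversal\<close>); it also turns \<open>f\<close> into \<open>-f\<close>, as \<open>1/(a + l - k) \<equiv> - 1/k\<close> and the limits
  above are opposite. Hence \<open>t \<mapsto> t\<^sup>-\<^sup>1\<close> takes the truncation of \<open>F\<^bsub>a,a;2a\<^esub>\<close> to \<open>B(l) t\<^bsup>-l\<^esup>\<close> times
  that of \<open>F\<close>, takes the numerators into each other with the same factor and the opposite sign, and
  the factors cancel. The product of the first congruence over \<open>i < r\<close> shows that the substitution
  exchanges the two localizations modulo \<open>p\<close>, hence their completions. To compare elements of these
  completions (\<open>ring_cong_lconv_omega\<close>), all localizations are regarded as subrings of the Gauss
  valuation ring of \<open>K(t)\<close>, on which \<open>t \<mapsto> t\<^sup>-\<^sup>1\<close> acts; congruences modulo \<open>p\<^sup>n\<close> in a localization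
  are the ones that hold there.
\<close>

section \<open>Completeness of the Witt vectors\<close>

text \<open>Setting the variables of index greater than \<open>n\<close> to zero. It fixes the first \<open>n + 1\<close> ghost
  components, hence the polynomials that these determine; so the \<open>n\<close>-th component of a sum of Witt
  vectors depends only on the components up to \<open>n\<close> of the summands.\<close>

definition ip_trunc :: "nat \<Rightarrow> (bool \<times> nat) ipoly \<Rightarrow> (bool \<times> nat) ipoly" where
  "ip_trunc n = ipeval (\<lambda>(b, i). if i \<le> n then ipvar (b, i) else 0)"

lemma is_hom_ip_trunc: "is_hom (ip_trunc n)"
  unfolding ip_trunc_def by (rule is_hom_ipeval)

lemma ip_trunc_ghost_var:
  assumes "m \<le> n"
  shows "ip_trunc n (ghost p m (gvar b)) = ghost p m (gvar b)"
  unfolding ghost_hom[OF is_hom_ip_trunc, symmetric] using assms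
  by (auto simp: ghost_def ip_trunc_def intro!: sum.cong)

lemma ip_trunc_fixed:
  assumes "prime p" "\<And>m. m \<le> n \<Longrightarrow> ip_trunc n (ghost p m S) = ghost p m S"
  shows "ip_trunc n (S n) = S n"
  using ghost_inj[OF ip_tf[OF assms(1)], where x = "ip_trunc n \<circ> S" and y = S and n = n] assms
  by (auto simp: ghost_hom[OF is_hom_ip_trunc])

lemma ipeval_ip_trunc_cong:
  assumes "\<And>b i. i \<le> n \<Longrightarrow> \<rho> (b, i) = \<rho>' (b, i)"
  shows "ipeval \<rho> (ip_trunc n f) = ipeval \<rho>' (ip_trunc n f)"
proof -
  have "ipeval \<rho> \<circ> (\<lambda>(b, i). if i \<le> n then ipvar (b, i) else 0)
      = ipeval \<rho>' \<circ> (\<lambda>(b, i). if i \<le> n then ipvar (b, i) else 0)"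
    using assms by (intro ext) (auto split: prod.split)
  then show ?thesis
    unfolding ip_trunc_def is_hom_ipeval_comp[OF is_hom_ipeval] by simp
qed

lemma wadd_cong:
  assumes "prime p" "\<And>i. i \<le> n \<Longrightarrow> x i = x' i" "\<And>i. i \<le> n \<Longrightarrow> y i = y' i"
  shows "wadd p x y n = wadd p x' y' n"
proof -
  have "ip_trunc n (witt_add_poly p n) = witt_add_poly p n"
    by (rule ip_trunc_fixed[OF assms(1)])
       (simp add: ghost_add_poly[OF assms(1)] is_homD(3)[OF is_hom_ip_trunc] ip_trunc_ghost_var)
  then show ?thesis
    using ipeval_ip_trunc_cong[of n "pick2 x y" "pick2 x' y'" "witt_add_poly p n"] assms(2,3)
    by (simp add: wadd_def)
qed

lemma witt_eqI: "(\<And>n. witt_nth x n = witt_nth y n) \<Longrightarrow> x = y"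
  by (metis ext witt.expand)

lemma witt_nth_p_power:
  assumes "i < n"
  shows "witt_nth (of_nat CHAR('a) ^ n * x) i = (0 :: 'a::{comm_ring_1, semiring_prime_char})"
  using assms
proof (induction n arbitrary: i)
  case (Suc n)
  show ?case
    unfolding power_Suc mult.assoc witt_nth_p
    using Suc prime_gt_0_nat[OF CHAR_prime[where 'a='a]] by (auto simp: power_0_left)
qed simp

lemma witt_dvd_p_power:
  fixes x :: "'a::{alg_closed_field, semiring_prime_char} witt"
  assumes "\<And>i. i < n \<Longrightarrow> witt_nth x i = 0"
  shows "of_nat CHAR('a) ^ n dvd x"
  using assms
proof (induction n arbitrary: x)
  case (Suc n)
  have "\<exists>w. w ^ CHAR('a) = u" for u :: 'a
    using nth_root_exists[of "CHAR('a)" u] prime_gt_0_nat[OF CHAR_prime] by blast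
  then obtain f where f: "\<And>u :: 'a. f u ^ CHAR('a) = u" by metis
  define z where "z = Witt (\<lambda>n. f (witt_nth x (Suc n)))"
  have x: "x = of_nat CHAR('a) * z"
    by (rule witt_eqI) (simp add: witt_nth_p z_def f Suc.prems)
  have "witt_nth z i = 0" if "i < n" for i
    using f[of "witt_nth z i"] f[of 0] that Suc.prems[of "Suc i"]
    by (metis (no_types, lifting) Suc_less_eq power_eq_0_iff witt.sel z_def)
  from Suc.IH[OF this] show ?case unfolding x by simp
qed simp

text \<open>Over a perfect field of characteristic \<open>p\<close>, multiplication by \<open>p\<close> shifts the components after
  raising them to the \<open>p\<close>-th power, so the multiples of \<open>p\<^sup>n\<close> are the vectors whose first \<open>n\<close>
  components vanish. Subtraction respects this because addition is compatible with truncation.\<close>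

lemma witt_cong_iff:
  fixes x y :: "'a::{alg_closed_field, semiring_prime_char} witt"
  shows "of_nat CHAR('a) ^ n dvd x - y \<longleftrightarrow> (\<forall>i<n. witt_nth x i = witt_nth y i)"
proof
  assume "of_nat CHAR('a) ^ n dvd x - y"
  then obtain z where z: "x = y + of_nat CHAR('a) ^ n * z" by (auto simp: dvd_def algebra_simps)
  show "\<forall>i<n. witt_nth x i = witt_nth y i"
  proof (intro allI impI)
    fix i assume i: "i < n"
    have "witt_nth x i = wadd CHAR('a) (witt_nth y) (witt_nth (of_nat CHAR('a) ^ n * z)) i"
      by (simp add: z plus_witt_def)
    also have "\<dots> = wadd CHAR('a) (witt_nth y) (witt_nth 0) i"
      using i by (intro wadd_cong CHAR_prime) (auto simp: witt_nth_p_power)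
    also have "\<dots> = witt_nth (y + 0) i" unfolding plus_witt_def by simp
    finally show "witt_nth x i = witt_nth y i" by simp
  qed
next
  assume eq: "\<forall>i<n. witt_nth x i = witt_nth y i"
  show "of_nat CHAR('a) ^ n dvd x - y"
  proof (rule witt_dvd_p_power)
    fix i assume i: "i < n"
    have "witt_nth (x - y) i = wadd CHAR('a) (witt_nth x) (wneg CHAR('a) (witt_nth y)) i"
      by (simp add: minus_witt_def plus_witt_def uminus_witt_def)
    also have "\<dots> = wadd CHAR('a) (witt_nth y) (wneg CHAR('a) (witt_nth y)) i"
      using i eq by (intro wadd_cong CHAR_prime) auto
    also have "\<dots> = witt_nth (y + - y) i"
      by (simp only: plus_witt_def uminus_witt_def witt.sel)
    finally show "witt_nth (x - y) i = 0" by simp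
  qed
qed

text \<open>The limit has the components at which the sequence becomes stationary.\<close>

lemma witt_complete:
  fixes Y :: "nat \<Rightarrow> 'a::{alg_closed_field, semiring_prime_char} witt"
  assumes "\<And>n. of_nat CHAR('a) ^ n dvd Y (Suc n) - Y n"
  shows "\<exists>L. \<forall>n. of_nat CHAR('a) ^ n dvd L - Y n"
proof -
  have stab: "witt_nth (Y (n + k)) i = witt_nth (Y n) i" if "i < n" for n k i
  proof (induction k)
    case (Suc k)
    then show ?case using assms[of "n + k"] that unfolding witt_cong_iff by simp
  qed simp
  have "of_nat CHAR('a) ^ n dvd Witt (\<lambda>i. witt_nth (Y (Suc i)) i) - Y n" for n
    unfolding witt_cong_iff
  proof (intro allI impI)
    fix i assume "i < n"
    then show "witt_nth (Witt (\<lambda>i. witt_nth (Y (Suc i)) i)) i = witt_nth (Y n) i"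
      using stab[of i "Suc i" "n - Suc i"] by simp
  qed
  then show ?thesis by blast
qed

text \<open>By completeness: the first component has an inverse in the field, which gives an inverse modulo
  \<open>p\<close>, and a geometric series corrects it.\<close>

lemma witt_unit:
  fixes x :: "'a::{alg_closed_field, semiring_prime_char} witt"
  assumes "witt_nth x 0 \<noteq> 0"
  shows "x dvd 1"
proof -
  define y where "y = Witt (\<lambda>_. inverse (witt_nth x 0))"
  have "of_nat CHAR('a) ^ 1 dvd 1 - x * y"
    unfolding witt_cong_iff using assms by (simp add: y_def witt_nth_mult_0)
  then obtain z where z: "1 - x * y = of_nat CHAR('a) * z" by auto
  define S where "S n = (\<Sum>i<n. (of_nat CHAR('a) * z) ^ i)" for n
  have "\<exists>L. \<forall>n. of_nat CHAR('a) ^ n dvd L - S n"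
    by (rule witt_complete) (simp add: S_def power_mult_distrib)
  then obtain L where L: "\<And>n. of_nat CHAR('a) ^ n dvd L - S n" by blast
  have "witt_nth (x * y * L) i = witt_nth 1 i" for i
  proof -
    have "x * y = 1 - of_nat CHAR('a) * z" unfolding z[symmetric] by simp
    then have "x * y * S (Suc i) = (1 - of_nat CHAR('a) * z) * S (Suc i)" by simp
    also have "\<dots> = 1 - (of_nat CHAR('a) * z) ^ Suc i" 
      unfolding S_def by (simp only: one_diff_power_eq)
    finally have "x * y * L - 1 = x * y * (L - S (Suc i)) - of_nat CHAR('a) ^ Suc i * z ^ Suc i"
      unfolding power_mult_distrib[symmetric] by (simp add: algebra_simps)
    then have "of_nat CHAR('a) ^ Suc i dvd x * y * L - 1"
      using L[of "Suc i"] by (metis dvd_diff dvd_mult dvd_triv_left)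
    then show ?thesis unfolding witt_cong_iff by blast
  qed
  then have "x * (y * L) = 1" using witt_eqI[of "x * y * L" 1] by (simp add: mult.assoc)
  then show ?thesis by (metis dvdI)
qed

section \<open>The valuation ring W of K\<close>

abbreviation (input) emb :: "'a::idom \<Rightarrow> 'a fract" where
  "emb w \<equiv> Fract w 1"

lemma emb_simps:
  fixes x y :: "'a::idom"
  shows "emb (x + y) = emb x + emb y" "emb (x * y) = emb x * emb y" "emb (- x) = - emb x"
    "emb (x - y) = emb x - emb y" "emb (0 :: 'a) = 0" "emb (1 :: 'a) = 1"
    "emb (x ^ n) = emb x ^ n" "emb (of_nat n :: 'a) = of_nat n"
proof -
  show "emb (x + y) = emb x + emb y" "emb (x * y) = emb x * emb y" "emb (- x) = - emb x"
    "emb (x - y) = emb x - emb y" "emb (0 :: 'a) = 0" by (simp_all add: Zero_fract_def)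
  show one: "emb (1 :: 'a) = 1" by (simp add: One_fract_def)
  have mul: "emb (u * v) = emb u * emb v" for u v :: 'a by simp
  show "emb (x ^ n) = emb x ^ n"
    by (induction n) (simp_all only: power_0 power_Suc one mul)
  show "emb (of_nat n :: 'a) = of_nat n" by (simp add: of_nat_fract)
qed

lemma emb_inj: "emb x = emb y \<longleftrightarrow> x = y"
  by (simp add: eq_fract)

lemma W_0 [simp]: "0 \<in> W" and W_1 [simp]: "1 \<in> W"
  unfolding W_def by (metis emb_simps(5) rangeI) (metis emb_simps(6) rangeI)

lemma W_add [intro, simp]: "x \<in> W \<Longrightarrow> y \<in> W \<Longrightarrow> x + y \<in> W"
  and W_mult [intro, simp]: "x \<in> W \<Longrightarrow> y \<in> W \<Longrightarrow> x * y \<in> W"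
  and W_diff [intro, simp]: "x \<in> W \<Longrightarrow> y \<in> W \<Longrightarrow> x - y \<in> W"
  and W_neg [intro, simp]: "x \<in> W \<Longrightarrow> - x \<in> W"
  unfolding W_def by (auto simp flip: emb_simps)

lemma W_power [intro, simp]: "x \<in> W \<Longrightarrow> x ^ n \<in> W"
  by (induction n) auto

lemma W_of_nat [simp]: "of_nat n \<in> W" by (induction n) auto
lemma W_of_int [simp]: "of_int n \<in> W" by (cases n) (auto simp del: of_nat_Suc)
lemma W_numeral [simp]: "numeral n \<in> W" using W_of_nat[of "numeral n"] by simp

lemma W_sum [intro]: "(\<And>i. i \<in> A \<Longrightarrow> f i \<in> W) \<Longrightarrow> sum f A \<in> W"
  by (induction A rule: infinite_finite_induct) auto

lemma W_prod [intro]: "(\<And>i. i \<in> A \<Longrightarrow> f i \<in> W) \<Longrightarrow> prod f A \<in> W"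
  by (induction A rule: infinite_finite_induct) auto

lemma pK_nz [simp]: "(pK :: 'p::prime_card K) \<noteq> 0"
proof
  assume "(pK :: 'p K) = 0"
  then have "of_nat CARD('p) = (0 :: 'p mod_ring alg_closure witt)"
    by (metis emb_simps(5,8) emb_inj)
  then have "of_nat CHAR('p mod_ring alg_closure) ^ 1 * 1 = (0 :: 'p mod_ring alg_closure witt)"
    unfolding CHAR_Fpbar by simp
  from witt_p_torsion_free[OF this] show False by simp
qed

lemma pW_iff: "x \<in> pW n \<longleftrightarrow> (\<exists>y\<in>W. x = pK ^ n * y)"
  unfolding pW_def by auto

lemma pW_emb: "emb w \<in> pW n \<longleftrightarrow> of_nat CHAR('p::prime_card mod_ring alg_closure) ^ n dvd (w :: 'p mod_ring alg_closure witt)"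
proof -
  have "emb w = pK ^ n * emb v \<longleftrightarrow> w = of_nat CHAR('p mod_ring alg_closure) ^ n * v" for v
    unfolding CHAR_Fpbar by (metis emb_inj emb_simps(2,7,8))
  then show ?thesis unfolding pW_iff W_def by (auto simp: dvd_def)
qed

lemma pW_0 [simp]: "pW 0 = W" by (auto simp: pW_iff)

lemma pW_zero [simp]: "0 \<in> pW n" unfolding pW_iff by (rule bexI[of _ 0]) auto

lemma pW_I: "y \<in> W \<Longrightarrow> x = pK ^ n * y \<Longrightarrow> x \<in> pW n"
  unfolding pW_iff by blast

lemma pW_E:
  assumes "x \<in> pW n" obtains y where "y \<in> W" "x = pK ^ n * y"
  using assms unfolding pW_iff by blast

lemma pW_mult: 
  assumes "x \<in> pW m" "y \<in> pW n" shows "x * y \<in> pW (m + n)"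
proof -
  obtain u v where "u \<in> W" "x = pK ^ m * u" "v \<in> W" "y = pK ^ n * v"
    using assms by (auto elim!: pW_E)
  then show ?thesis by (intro pW_I[of "u * v"]) (auto simp: power_add algebra_simps)
qed

lemma pW_add [intro]: 
  assumes "x \<in> pW n" "y \<in> pW n" shows "x + y \<in> pW n"
proof -
  obtain u v where "u \<in> W" "x = pK ^ n * u" "v \<in> W" "y = pK ^ n * v"
    using assms by (auto elim!: pW_E)
  then show ?thesis by (intro pW_I[of "u + v"]) (auto simp: algebra_simps)
qed

lemma pW_mult_W [intro]: "x \<in> pW m \<Longrightarrow> y \<in> W \<Longrightarrow> x * y \<in> pW m"
  using pW_mult[of x m y 0] by simp

lemma W_mult_pW [intro]: "x \<in> W \<Longrightarrow> y \<in> pW m \<Longrightarrow> x * y \<in> pW m"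
  using pW_mult[of x 0 y m] by simp

lemma pW_neg [intro]: "x \<in> pW n \<Longrightarrow> - x \<in> pW n"
  using W_mult_pW[of "- 1" x n] by simp

lemma pW_diff [intro]: "x \<in> pW n \<Longrightarrow> y \<in> pW n \<Longrightarrow> x - y \<in> pW n"
  using pW_add[of x n "- y"] pW_neg[of y n] by simp

lemma pW_mono: 
  assumes "x \<in> pW m" "n \<le> m" shows "x \<in> pW n"
proof -
  obtain u where u: "u \<in> W" "x = pK ^ m * u" using assms by (auto elim!: pW_E)
  have "m = n + (m - n)" using assms by simp
  then have "pK ^ m = pK ^ n * (pK ^ (m - n) :: 'a K)" by (metis power_add)
  then show ?thesis using u by (intro pW_I[of "pK ^ (m - n) * u"]) auto
qed

lemma pW_imp_W: "x \<in> pW m \<Longrightarrow> x \<in> W"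
  using pW_mono[of x m 0] by simp

lemma pW_sum [intro]: "(\<And>i. i \<in> A \<Longrightarrow> f i \<in> pW n) \<Longrightarrow> sum f A \<in> pW n"
  by (induction A rule: infinite_finite_induct) auto

lemma pK_power_pW [simp]: "pK ^ n \<in> pW n" unfolding pW_iff by (rule bexI[of _ 1]) auto
lemma pK_pW [simp]: "pK \<in> pW (Suc 0)" using pK_power_pW[of 1] by simp

lemma pW_scale: "pK ^ k * x \<in> pW (k + n) \<longleftrightarrow> x \<in> pW n"
  unfolding pW_iff by (simp add: power_add mult.assoc)

lemma pW_scale1: "pK * x \<in> pW (Suc n) \<longleftrightarrow> x \<in> pW n"
  using pW_scale[of 1 x n] by simp

lemma pW_Inter: 
  assumes "\<And>n. x \<in> pW n" shows "x = 0"
proof -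
  obtain w where w: "x = emb w" using assms[of 0] by (auto simp: W_def)
  have "of_nat CHAR('a mod_ring alg_closure) ^ n dvd w - 0" for n
    using assms[of n] unfolding w pW_emb by simp
  then have "w = 0" unfolding witt_cong_iff by (intro witt_eqI) auto
  then show ?thesis by (simp add: w emb_simps)
qed

lemma W_unit: 
  assumes "x \<in> W" "x \<notin> pW 1" shows "inverse x \<in> W" 
proof -
  obtain w where w: "x = emb w" using assms(1) by (auto simp: W_def)
  have "\<not> of_nat CHAR('a mod_ring alg_closure) ^ 1 dvd w - 0"
    using assms(2) unfolding w pW_emb by simp
  then have "witt_nth w 0 \<noteq> 0" unfolding witt_cong_iff by simp
  then obtain v where v: "1 = w * v" using witt_unit unfolding dvd_def by blast
  then have "x * emb v = 1" unfolding w by (metis emb_simps(2,6))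
  then have "inverse x = emb v" by (rule inverse_unique)
  then show ?thesis by (auto simp: W_def)
qed

lemma one_notin_pW [simp]: "(1 :: 'p::prime_card K) \<notin> pW (Suc n)"
proof
  assume "1 \<in> (pW (Suc n) :: 'p K set)"
  then have "emb (1 - 0) \<in> (pW (Suc n) :: 'p K set)" by (simp add: emb_simps)
  then have "of_nat CHAR('p mod_ring alg_closure) ^ Suc n dvd (1 :: 'p mod_ring alg_closure witt) - 0"
    unfolding pW_emb .
  then show False unfolding witt_cong_iff by auto
qed

lemma pW_prime:
  assumes "x \<in> W" "y \<in> W" "x * y \<in> pW 1" shows "x \<in> pW 1 \<or> y \<in> pW 1"
proof (rule ccontr)
  assume "\<not> ?thesis"
  then have n: "x \<notin> pW 1" "inverse x \<in> W" "y \<notin> pW 1" using W_unit assms by auto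
  then have "x \<noteq> 0" by auto
  then have "y = inverse x * (x * y)" by simp
  then show False using n assms(3) W_mult_pW by metis
qed

lemma K_denom: "\<exists>n. pK ^ n * x \<in> (W :: 'p::prime_card K set)"
proof -
  obtain v w where x: "x = Fract v w" "w \<noteq> 0" by (cases x) auto
  then obtain k where "witt_nth w k \<noteq> 0" by (metis witt_eqI witt_nth_0)
  from witt_unit_part[OF this] obtain m y where 
    y: "w = of_nat CHAR('p mod_ring alg_closure) ^ m * y" "witt_nth y 0 \<noteq> 0" by blast
  obtain z where z: "1 = y * z" using witt_unit[OF y(2)] unfolding dvd_def by blast
  have "pK ^ m * x = emb (of_nat CHAR('p mod_ring alg_closure) ^ m) * Fract v w"
    unfolding CHAR_Fpbar x by (metis emb_simps(7,8))
  also have "\<dots> = emb (v * z)" unfolding mult_fract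
  proof (subst eq_fract)
    have "of_nat CHAR('p mod_ring alg_closure) ^ m * v * 1
        = of_nat CHAR('p mod_ring alg_closure) ^ m * v * (y * z)" using z by simp
    also have "\<dots> = v * z * (1 * w)" by (simp only: y(1) mult_1 mult_ac)
    finally show "of_nat CHAR('p mod_ring alg_closure) ^ m * v * 1 = v * z * (1 * w)" .
  qed (use x in auto)
  finally show ?thesis by (auto simp: W_def intro!: exI[of _ m])
qed

lemma W_complete:
  fixes Y :: "nat \<Rightarrow> 'p::prime_card K"
  assumes "\<And>n. Y n \<in> W" "\<And>n. Y (Suc n) - Y n \<in> pW n"
  shows "\<exists>L\<in>W. \<forall>n. L - Y n \<in> pW n"
proof -
  have "\<forall>n. \<exists>w. Y n = emb w" using assms(1) by (auto simp: W_def)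
  then obtain Z where Z: "\<And>n. Y n = emb (Z n)" by metis
  have "\<exists>L. \<forall>n. of_nat CHAR('p mod_ring alg_closure) ^ n dvd L - Z n"
    by (rule witt_complete) (use assms(2) in \<open>simp only: Z pW_emb emb_simps(4)[symmetric]\<close>)
  then obtain L where L: "\<And>n. of_nat CHAR('p mod_ring alg_closure) ^ n dvd L - Z n" by blast
  have "emb L - Y n \<in> pW n" for n
    unfolding Z emb_simps(4)[symmetric] pW_emb by (rule L)
  then show ?thesis by (auto simp: W_def)
qed

lemma of_nat_pW1: "(of_nat n :: 'p::prime_card K) \<in> pW 1 \<longleftrightarrow> CARD('p) dvd n"
proof
  assume "CARD('p) dvd n"
  then show "(of_nat n :: 'p K) \<in> pW 1" by (auto simp: dvd_def intro!: pW_mult_W)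
next
  assume *: "(of_nat n :: 'p K) \<in> pW 1"
  show "CARD('p) dvd n"
  proof (rule ccontr)
    assume "\<not> CARD('p) dvd n"
    then have "coprime (int n) (int CARD('p))"
      using prime_imp_coprime[OF prime_card, of n] by (simp add: coprime_commute)
    then obtain u v where "u * int n + v * int CARD('p) = 1"
      by (metis bezout_int coprime_iff_gcd_eq_1)
    then have "of_int (u * int n + v * int CARD('p)) = (1 :: 'p K)" by simp
    then have "of_int u * of_nat n + of_int v * pK = (1 :: 'p K)" by simp
    moreover have "of_int u * of_nat n + of_int v * pK \<in> (pW 1 :: 'p K set)"
      using * by (intro pW_add W_mult_pW) auto
    ultimately show False using one_notin_pW[of 0] by simp
  qed
qed

lemma of_nat_K_eq_0: "(of_nat n :: 'p::prime_card K) = 0 \<longleftrightarrow> n = 0"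
proof (induction n rule: less_induct)
  case (less n)
  show ?case
  proof (cases "CARD('p) dvd n \<and> n > 0")
    case True
    then obtain m where m: "n = CARD('p) * m" "m > 0" by auto
    then have "m < n" using prime_gt_1_nat[OF prime_card[where 'a='p]] by simp
    then show ?thesis using less[of m] m by simp
  next
    case False
    then show ?thesis using of_nat_pW1[of n, where 'p='p] by auto
  qed
qed

section \<open>Congruences and limits in W\<close>

definition wcong :: "nat \<Rightarrow> 'p::prime_card K \<Rightarrow> 'p K \<Rightarrow> bool" where
  "wcong n x y \<longleftrightarrow> x - y \<in> pW n"

lemma wcong_refl [simp]: "wcong n x x" by (simp add: wcong_def)
lemma wcong_sym: "wcong n x y \<Longrightarrow> wcong n y x"
  unfolding wcong_def using pW_neg[of "x - y" n] by simp
lemma wcong_trans [trans]: "wcong n x y \<Longrightarrow> wcong n y z \<Longrightarrow> wcong n x z"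
  unfolding wcong_def using pW_add[of "x - y" n "y - z"] by simp
lemma wcong_add: "wcong n x y \<Longrightarrow> wcong n x' y' \<Longrightarrow> wcong n (x + x') (y + y')"
  unfolding wcong_def using pW_add[of "x - y" n "x' - y'"] by (simp add: algebra_simps)
lemma wcong_uminus: "wcong n x y \<Longrightarrow> wcong n (- x) (- y)"
  unfolding wcong_def using pW_neg[of "x - y" n] by simp
lemma wcong_diff: "wcong n x y \<Longrightarrow> wcong n x' y' \<Longrightarrow> wcong n (x - x') (y - y')"
  using wcong_add[of n x y "- x'" "- y'"] wcong_uminus[of n x' y'] by simp
lemma wcong_mono: "wcong m x y \<Longrightarrow> n \<le> m \<Longrightarrow> wcong n x y"
  unfolding wcong_def by (rule pW_mono)
lemma wcong_W: "wcong n x y \<Longrightarrow> y \<in> W \<Longrightarrow> x \<in> W"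
  unfolding wcong_def using W_add[OF pW_imp_W[of "x - y" n], of y] by simp
lemma wcong_W': "wcong n x y \<Longrightarrow> x \<in> W \<Longrightarrow> y \<in> W"
  using wcong_W wcong_sym by blast
lemma wcong_0 [simp]: "wcong n x 0 \<longleftrightarrow> x \<in> pW n" by (simp add: wcong_def)

lemma wcong_mult:
  assumes "wcong n x y" "wcong n x' y'" "x \<in> W" "x' \<in> W"
  shows "wcong n (x * x') (y * y')"
proof -
  have "x * x' - y * y' = (x - y) * x' + y * (x' - y')" by (simp add: algebra_simps)
  then show ?thesis using assms wcong_W'[of n x y] unfolding wcong_def by auto
qed

lemma wcong_power:
  assumes "wcong n x y" "x \<in> W" shows "wcong n (x ^ k) (y ^ k)"
  by (induction k) (auto intro!: wcong_mult assms)

lemma wcong_sum: "(\<And>i. i \<in> A \<Longrightarrow> wcong n (f i) (g i)) \<Longrightarrow> wcong n (sum f A) (sum g A)"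
  by (induction A rule: infinite_finite_induct) (auto intro!: wcong_add)

lemma wcong_prod:
  assumes "\<And>i. i \<in> A \<Longrightarrow> wcong n (f i) (g i)" "\<And>i. i \<in> A \<Longrightarrow> f i \<in> W"
  shows "wcong n (prod f A) (prod g A)"
  using assms by (induction A rule: infinite_finite_induct) (auto intro!: wcong_mult)

definition Wunit :: "'p::prime_card K \<Rightarrow> bool" where "Wunit x \<longleftrightarrow> x \<in> W \<and> x \<notin> pW 1"

lemma Wunit_nz: "Wunit x \<Longrightarrow> x \<noteq> 0" unfolding Wunit_def by auto
lemma Wunit_W: "Wunit x \<Longrightarrow> x \<in> W" unfolding Wunit_def by auto
lemma Wunit_inverse_W: "Wunit x \<Longrightarrow> inverse x \<in> W" unfolding Wunit_def using W_unit by blast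

lemma WunitI: 
  assumes "x \<in> W" "inverse x \<in> W" "x \<noteq> 0" shows "Wunit x"
  unfolding Wunit_def
proof (intro conjI notI)
  assume "x \<in> pW 1"
  then have "x * inverse x \<in> pW 1" using assms by (intro pW_mult_W)
  then show False using assms one_notin_pW[of 0] by simp
qed (use assms in auto)

lemma Wunit_iff: "Wunit x \<longleftrightarrow> x \<in> W \<and> inverse x \<in> W \<and> x \<noteq> 0"
  using WunitI Wunit_nz Wunit_W Wunit_inverse_W by blast

lemma Wunit_inverse [intro]: "Wunit x \<Longrightarrow> Wunit (inverse x)" by (auto simp: Wunit_iff)
lemma Wunit_mult [intro]: "Wunit x \<Longrightarrow> Wunit y \<Longrightarrow> Wunit (x * y)" by (auto simp: Wunit_iff)
lemma Wunit_divide [intro]: "Wunit x \<Longrightarrow> Wunit y \<Longrightarrow> Wunit (x / y)" 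
  by (auto simp: divide_inverse)
lemma W_divide [intro]: "x \<in> W \<Longrightarrow> Wunit y \<Longrightarrow> x / y \<in> W" 
  by (auto simp: divide_inverse Wunit_iff)
lemma Wunit_1 [simp]: "Wunit 1" by (simp add: Wunit_iff)
lemma Wunit_uminus [simp]: "Wunit (- x) \<longleftrightarrow> Wunit x"
  unfolding Wunit_def using W_neg[of x] W_neg[of "-x"] pW_neg[of x 1] pW_neg[of "-x" 1] by auto
lemma Wunit_prod [intro]: "(\<And>i. i \<in> A \<Longrightarrow> Wunit (f i)) \<Longrightarrow> Wunit (prod f A)"
  by (induction A rule: infinite_finite_induct) auto
lemma Wunit_power [intro]: "Wunit x \<Longrightarrow> Wunit (x ^ n)"
  by (induction n) auto

lemma Wunit_of_nat: "Wunit (of_nat n :: 'p::prime_card K) \<longleftrightarrow> \<not> CARD('p) dvd n"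
  unfolding Wunit_def by (simp only: of_nat_pW1 W_of_nat simp_thms)

lemma Wunit_cong: 
  assumes "wcong n x y" "n > 0" "Wunit x" shows "Wunit y"
proof -
  have "x - y \<in> pW 1" using assms pW_mono[of "x - y" n 1] by (simp add: wcong_def)
  then have "x \<in> pW 1" if "y \<in> pW 1" using pW_add[of "x - y" 1 y] that by simp
  then show ?thesis using assms wcong_W'[of n x y] unfolding Wunit_def by auto
qed

lemma Wunit_pW1_add: "Wunit x \<Longrightarrow> y \<in> pW 1 \<Longrightarrow> Wunit (x + y)"
  by (rule Wunit_cong[of 1 x]) (auto simp: wcong_def)

lemma wcong_inverse:
  assumes "wcong n x y" "Wunit x" "Wunit y"
  shows "wcong n (inverse x) (inverse y)"
proof -
  have "inverse x - inverse y = - (inverse x * inverse y) * (x - y)"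
    using Wunit_nz[OF assms(2)] Wunit_nz[OF assms(3)] by (simp add: field_simps)
  then show ?thesis using assms unfolding wcong_def
    by (metis W_mult W_mult_pW W_neg Wunit_inverse_W)
qed

lemma wcong_divide:
  assumes "wcong n x y" "wcong n x' y'" "x \<in> W" "Wunit x'" "Wunit y'"
  shows "wcong n (x / x') (y / y')"
  unfolding divide_inverse using assms by (intro wcong_mult wcong_inverse) (auto intro: Wunit_inverse_W)

lemma pW_divide_unit: "x \<in> pW n \<Longrightarrow> Wunit y \<Longrightarrow> x / y \<in> pW n"
  unfolding divide_inverse using Wunit_inverse_W by auto

lemma unit_mult_pW: "Wunit u \<Longrightarrow> u * x \<in> pW n \<longleftrightarrow> x \<in> pW n"
proof
  assume u: "Wunit u" and "u * x \<in> pW n"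
  then have "inverse u * (u * x) \<in> pW n" using Wunit_inverse_W by blast
  then show "x \<in> pW n" using Wunit_nz[OF u] by (simp add: mult.assoc[symmetric])
qed (auto dest: Wunit_W)

text \<open>As \<open>\<Inter>\<^sub>n p\<^sup>n W = 0\<close>, there is a largest power of \<open>p\<close> that divides \<open>x\<close>.\<close>

lemma W_unit_part:
  assumes "x \<in> W" "x \<noteq> 0"
  obtains v u where "x = pK ^ v * u" "Wunit u"
proof -
  obtain n where "x \<notin> pW n" using assms pW_Inter by blast
  then have "\<exists>v u. x = pK ^ v * u \<and> Wunit u" using assms(1)
  proof (induction n arbitrary: x)
    case (Suc n)
    show ?case
    proof (cases "x \<in> pW 1")
      case True
      then obtain y where y: "y \<in> W" "x = pK ^ 1 * y" by (auto elim: pW_E)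
      then have "y \<notin> pW n" using Suc.prems(1) pW_scale1[of y n] by auto
      then obtain v u where "y = pK ^ v * u" "Wunit u" using Suc.IH y(1) by blast
      then show ?thesis using y by (intro exI[of _ "Suc v"] exI[of _ u]) simp
    next
      case False
      then show ?thesis using Suc.prems by (intro exI[of _ 0] exI[of _ x]) (simp add: Wunit_def)
    qed
  qed simp
  then show ?thesis using that by blast
qed

lemma of_nat_unit_part:
  assumes "n > 0"
  obtains v u where "(of_nat n :: 'p::prime_card K) = pK ^ v * of_nat u" "n = CARD('p) ^ v * u" "\<not> CARD('p) dvd u"
proof -
  have "n \<noteq> 0 \<and> \<not> is_unit CARD('p)" using assms prime_gt_1_nat[OF prime_card[where 'a='p]] by simp
  then obtain u where "n = CARD('p) ^ multiplicity CARD('p) n * u" "\<not> CARD('p) dvd u"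
    using multiplicity_decompose'[of n "CARD('p)"] by blast
  then show ?thesis using that[of "multiplicity CARD('p) n" u] by (metis of_nat_mult of_nat_power)
qed

lemma of_int_pW: "(of_int k :: 'p::prime_card K) \<in> pW n \<longleftrightarrow> int CARD('p) ^ n dvd k"
proof
  assume "int CARD('p) ^ n dvd k"
  then show "(of_int k :: 'p K) \<in> pW n" by (auto simp: dvd_def intro!: pW_mult_W)
next
  assume *: "(of_int k :: 'p K) \<in> pW n"
  show "int CARD('p) ^ n dvd k"
  proof (cases "k = 0")
    case False
    obtain v u where vu: "(of_nat (nat \<bar>k\<bar>) :: 'p K) = pK ^ v * of_nat u" "nat \<bar>k\<bar> = CARD('p) ^ v * u" "\<not> CARD('p) dvd u"
      by (rule of_nat_unit_part[of "nat \<bar>k\<bar>"]) (use False in auto)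
    have "(of_nat (nat \<bar>k\<bar>) :: 'p K) = of_int k \<or> of_nat (nat \<bar>k\<bar>) = (- of_int k :: 'p K)"
      by (cases "k \<ge> 0") (auto simp flip: of_int_minus)
    then have in_n: "pK ^ v * of_nat u \<in> (pW n :: 'p K set)" using * pW_neg unfolding vu(1) by metis
    have "n \<le> v"
    proof (rule ccontr)
      assume "\<not> n \<le> v"
      then have "pK ^ v * of_nat u \<in> (pW (v + 1) :: 'p K set)" by (intro pW_mono[OF in_n]) auto
      then have "(of_nat u :: 'p K) \<in> pW 1" unfolding pW_scale .
      then show False using vu(3) unfolding of_nat_pW1 by simp
    qed
    then have "CARD('p) ^ n dvd nat \<bar>k\<bar>" unfolding vu(2) by (simp add: le_imp_power_dvd)
    then have "int CARD('p) ^ n dvd int (nat \<bar>k\<bar>)" unfolding int_dvd_int_iff of_nat_power[symmetric] .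
    then show ?thesis by simp
  qed simp
qed

lemma wcong_of_nat: "wcong n (of_nat a :: 'p::prime_card K) (of_nat b) \<longleftrightarrow> [a = b] (mod CARD('p) ^ n)"
proof -
  have "(of_nat a - of_nat b :: 'p K) = of_int (int a - int b)" by simp
  then have "wcong n (of_nat a :: 'p K) (of_nat b) \<longleftrightarrow> int CARD('p) ^ n dvd int a - int b"
    unfolding wcong_def by (simp only: of_int_pW)
  also have "\<dots> \<longleftrightarrow> [int a = int b] (mod int (CARD('p) ^ n))"
    by (simp add: cong_iff_dvd_diff)
  finally show ?thesis unfolding cong_int_iff .
qed

lemma pW1_cong: "wcong n x y \<Longrightarrow> n > 0 \<Longrightarrow> x \<in> pW 1 \<longleftrightarrow> y \<in> pW 1"
  using wcong_mono[of n x y 1] wcong_sym[of 1 x y] wcong_trans[of 1 _ _ 0] by (auto simp flip: wcong_0)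

lemma Zp_W: "x \<in> Zp \<Longrightarrow> x \<in> W" by (simp add: Zp_def)

lemma Zp_approx_int: "x \<in> Zp \<Longrightarrow> \<exists>m. wcong n x (of_int m)" by (simp add: Zp_def wcong_def)

text \<open>Adding a multiple of \<open>p\<^sup>n\<close> makes the approximating integer as large as desired.\<close>

lemma Zp_approx:
  assumes "(x :: 'p::prime_card K) \<in> Zp" obtains m where "m > b" "wcong n x (of_nat m)"
proof -
  obtain k where k: "wcong n x (of_int k)" using Zp_approx_int assms by blast
  define q where "q = int CARD('p) ^ n"
  have q: "q > 0" unfolding q_def by simp
  define m where "m = nat (k + q * (\<bar>k\<bar> + int b + 1))"
  have "\<bar>k\<bar> + int b + 1 \<le> q * (\<bar>k\<bar> + int b + 1)"
    using mult_right_mono[of 1 q "\<bar>k\<bar> + int b + 1", unfolded mult_1] q by linarith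
  then have "k + q * (\<bar>k\<bar> + int b + 1) > int b" by linarith
  then have m: "int m = k + q * (\<bar>k\<bar> + int b + 1)" "m > b" unfolding m_def by linarith+
  have "(of_nat m :: 'p K) = of_int k + pK ^ n * of_int (\<bar>k\<bar> + int b + 1)"
    using arg_cong[OF m(1), of "of_int :: int \<Rightarrow> 'p K"] by (simp add: q_def)
  then have "wcong n (of_nat m :: 'p K) (of_int k)"
    unfolding wcong_def by (auto intro!: pW_mult_W simp del: of_int_add)
  then have "wcong n x (of_nat m)" using k wcong_sym wcong_trans by blast
  then show ?thesis using m that by blast
qed

lemma ZpI: "x \<in> W \<Longrightarrow> (\<And>n. \<exists>m. wcong n x (of_int m)) \<Longrightarrow> x \<in> Zp"
  by (simp add: Zp_def wcong_def)

lemma Zp_of_int [simp]: "of_int k \<in> Zp" by (rule ZpI) (auto intro: exI[of _ k])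
lemma Zp_of_nat [simp]: "of_nat k \<in> Zp" using Zp_of_int[of "int k"] by simp
lemma Zp_1 [simp]: "1 \<in> Zp" using Zp_of_nat[of 1] by simp
lemma Zp_0 [simp]: "0 \<in> Zp" using Zp_of_nat[of 0] by simp
lemma Zp_add [intro]: assumes "x \<in> Zp" "y \<in> Zp" shows "x + y \<in> Zp"
proof (rule ZpI)
  fix n
  obtain k l where "wcong n x (of_int k)" "wcong n y (of_int l)" using assms Zp_approx_int by blast
  then have "wcong n (x + y) (of_int (k + l))" by (simp add: wcong_add)
  then show "\<exists>m. wcong n (x + y) (of_int m)" by blast
qed (use assms Zp_W in auto)
lemma Zp_uminus [intro]: assumes "x \<in> Zp" shows "- x \<in> Zp"
proof (rule ZpI)
  fix n
  obtain k where "wcong n x (of_int k)" using assms Zp_approx_int by blast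
  then have "wcong n (- x) (of_int (- k))" by (simp add: wcong_uminus)
  then show "\<exists>m. wcong n (- x) (of_int m)" by blast
qed (use assms Zp_W in auto)
lemma Zp_diff [intro]: "x \<in> Zp \<Longrightarrow> y \<in> Zp \<Longrightarrow> x - y \<in> Zp"
  using Zp_add[of x "- y"] Zp_uminus by auto

lemma wcong_pK_cancel: "wcong (Suc n) (pK * x) (pK * y) \<longleftrightarrow> wcong n x y"
  unfolding wcong_def right_diff_distrib[symmetric] pW_scale1 ..

lemma wcong_pK_mult: "wcong n x y \<Longrightarrow> wcong (Suc n) (pK * x) (pK * y)"
  by (simp only: wcong_pK_cancel)

lemma Zp_div_p: assumes "pK * x \<in> Zp" "x \<in> W" shows "x \<in> (Zp :: 'p::prime_card K set)"
proof (rule ZpI)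
  fix n
  obtain k where k: "wcong (Suc n) (pK * x) (of_int k)" using assms Zp_approx_int by blast
  then have "wcong 1 (pK * x) (of_int k :: 'p K)" by (rule wcong_mono) simp
  moreover have "wcong 1 (pK * x) 0" using assms(2) by (simp add: pW_mult_W)
  ultimately have "wcong 1 (of_int k) (0 :: 'p K)" using wcong_sym wcong_trans by blast
  then have "int CARD('p) ^ 1 dvd k" by (simp only: wcong_0 of_int_pW)
  then obtain j where "k = int CARD('p) * j" by auto
  then have "wcong (Suc n) (pK * x) (pK * of_int j)" using k by simp
  then show "\<exists>m. wcong n x (of_int m)" by (auto simp: wcong_pK_cancel)
qed (use assms in auto)

lemma padic_limI:
  assumes "F \<noteq> bot" "\<And>N. \<forall>\<^sub>F i in F. wcong N (f i) L"
  shows "padic_lim f F = L"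
  unfolding padic_lim_def
proof (rule the_equality)
  show "\<forall>n. \<forall>\<^sub>F i in F. f i - L \<in> pW n" using assms(2) by (simp add: wcong_def)
next
  fix M assume M: "\<forall>n. \<forall>\<^sub>F i in F. f i - M \<in> pW n"
  have "M - L \<in> pW n" for n
  proof -
    have "\<forall>\<^sub>F i in F. f i - M \<in> pW n \<and> wcong n (f i) L" using M assms(2) eventually_conj by blast
    then obtain i where "f i - M \<in> pW n" "wcong n (f i) L"
      using eventually_happens'[OF assms(1)] by blast
    then show ?thesis using wcong_trans[of n M "f i" L] wcong_sym[of n "f i" M] by (simp add: wcong_def)
  qed
  then show "M = L" using pW_Inter[of "M - L"] by simp
qed

lemma eventually_nat_near:
  "eventually P (nat_near z) \<longleftrightarrow> (\<exists>N. \<forall>n. 0 < n \<and> wcong N (of_nat n) z \<longrightarrow> P n)"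
  unfolding nat_near_def
proof (subst eventually_INF_base)
  fix a b :: nat
  have "x \<in> pW a" "x \<in> pW b" if "x \<in> pW (max a b)" for x :: "'a K"
    by (rule pW_mono[OF that], simp)+
  then have "{n. 0 < n \<and> of_nat n - z \<in> pW (max a b)}
      \<subseteq> {n. 0 < n \<and> of_nat n - z \<in> pW a} \<inter> {n. 0 < n \<and> of_nat n - z \<in> pW b}" by blast
  then show "\<exists>x\<in>UNIV. principal {n. 0 < n \<and> of_nat n - z \<in> pW x}
     \<le> inf (principal {n. 0 < n \<and> of_nat n - z \<in> pW a}) (principal {n. 0 < n \<and> of_nat n - z \<in> pW b})"
    unfolding inf_principal principal_le_iff by blast
qed (auto simp: eventually_principal wcong_def)

lemma nat_near_neq_bot: 
  assumes "z \<in> Zp" shows "nat_near z \<noteq> bot"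
proof
  assume "nat_near z = bot"
  then have "eventually (\<lambda>_. False) (nat_near z)" by simp
  then obtain N where N: "\<And>n. \<not> (0 < n \<and> wcong N (of_nat n) z)" unfolding eventually_nat_near by blast
  obtain m where "m > 0" "wcong N z (of_nat m)" using assms by (rule Zp_approx)
  then show False using N wcong_sym by blast
qed

text \<open>A function on the positive integers that respects congruences modulo all powers of \<open>p\<close> extends
  continuously to \<open>\<int>\<^sub>p\<close>, and the extension still respects them. This evaluates all limits over
  integers that tend to a \<open>p\<close>-adic number.\<close>

lemma padic_limD:
  fixes g :: "nat \<Rightarrow> 'p::prime_card K" and z :: "'p K"
  assumes z: "z \<in> Zp" and W: "\<And>n. n > 0 \<Longrightarrow> g n \<in> W"
    and c: "\<And>N m n. 0 < N \<Longrightarrow> 0 < m \<Longrightarrow> 0 < n \<Longrightarrow> [m = n] (mod CARD('p) ^ N) \<Longrightarrow> wcong N (g m) (g n)"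
  shows "padic_lim g (nat_near z) \<in> W"
    and "\<And>N m. 0 < m \<Longrightarrow> wcong N z (of_nat m) \<Longrightarrow> wcong N (padic_lim g (nat_near z)) (g m)"
proof -
  have c': "wcong N (g m) (g n)" if "0 < m" "0 < n" "wcong N z (of_nat m)" "wcong N z (of_nat n)" for N m n
  proof (cases "N = 0")
    case True
    then show ?thesis using W that by (simp add: wcong_def)
  next
    case False
    have "wcong N (of_nat m :: 'p K) (of_nat n)"
      by (rule wcong_trans[OF wcong_sym[OF that(3)] that(4)])
    then show ?thesis using that(1,2) False c unfolding wcong_of_nat by blast
  qed
  have "\<exists>m. m > 0 \<and> wcong N z (of_nat m)" for N
    by (rule Zp_approx[OF z, of 0 N]) auto
  then obtain m where m: "\<And>N. m N > 0" "\<And>N. wcong N z (of_nat (m N))" by metis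
  have "\<exists>L\<in>W. \<forall>n. L - g (m n) \<in> pW n"
  proof (rule W_complete)
    fix n show "g (m (Suc n)) - g (m n) \<in> pW n"
      unfolding wcong_def[symmetric] using wcong_mono[OF m(2)[of "Suc n"], of n] by (intro c' m) auto
  qed (use m W in auto)
  then obtain L where L: "L \<in> W" "\<And>n. wcong n L (g (m n))" by (auto simp: wcong_def)
  have L': "wcong N L (g k)" if "0 < k" "wcong N z (of_nat k)" for N k
    by (rule wcong_trans[OF L(2) c'[OF m(1) that(1) m(2) that(2)]])
  have "padic_lim g (nat_near z) = L"
  proof (rule padic_limI[OF nat_near_neq_bot[OF z]], unfold eventually_nat_near, intro exI allI impI)
    fix N k assume "0 < k \<and> wcong N (of_nat k) z"
    then show "wcong N (g k) L" by (intro wcong_sym[OF L'] wcong_sym[of N _ z]) auto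
  qed
  then show "padic_lim g (nat_near z) \<in> W"
    and "\<And>N m. 0 < m \<Longrightarrow> wcong N z (of_nat m) \<Longrightarrow> wcong N (padic_lim g (nat_near z)) (g m)"
    using L(1) L' by blast+
qed

section \<open>Closures of subrings in the p-adic topology\<close>

definition subring_set :: "'a::comm_ring_1 set \<Rightarrow> bool" where
  "subring_set A \<longleftrightarrow> 0 \<in> A \<and> 1 \<in> A \<and> (\<forall>x\<in>A. \<forall>y\<in>A. x + y \<in> A \<and> x * y \<in> A) \<and> (\<forall>x\<in>A. - x \<in> A)"

lemma subring_setD:
  assumes "subring_set A"
  shows "0 \<in> A" "1 \<in> A" "\<And>x y. x \<in> A \<Longrightarrow> y \<in> A \<Longrightarrow> x + y \<in> A"
    "\<And>x y. x \<in> A \<Longrightarrow> y \<in> A \<Longrightarrow> x * y \<in> A" "\<And>x. x \<in> A \<Longrightarrow> - x \<in> A"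
    "\<And>x y. x \<in> A \<Longrightarrow> y \<in> A \<Longrightarrow> x - y \<in> A" "\<And>x n. x \<in> A \<Longrightarrow> x ^ n \<in> A" "\<And>n. of_nat n \<in> A"
    "\<And>f S. (\<And>i. i \<in> S \<Longrightarrow> f i \<in> A) \<Longrightarrow> sum f S \<in> A"
proof -
  show *: "0 \<in> A" "1 \<in> A" "\<And>x y. x \<in> A \<Longrightarrow> y \<in> A \<Longrightarrow> x + y \<in> A"
    "\<And>x y. x \<in> A \<Longrightarrow> y \<in> A \<Longrightarrow> x * y \<in> A" "\<And>x. x \<in> A \<Longrightarrow> - x \<in> A"
    using assms by (auto simp: subring_set_def)
  show "\<And>x y. x \<in> A \<Longrightarrow> y \<in> A \<Longrightarrow> x - y \<in> A"
    using *(3,5) by (metis add_uminus_conv_diff)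
  show "x ^ n \<in> A" if "x \<in> A" for x n by (induction n) (auto intro: * that)
  show "of_nat n \<in> A" for n by (induction n) (auto intro: *)
  show "\<And>f S. (\<And>i. i \<in> S \<Longrightarrow> f i \<in> A) \<Longrightarrow> sum f S \<in> A"
    subgoal for f S by (induction S rule: infinite_finite_induct) (auto intro: *)
    done
qed

definition pcong :: "nat \<Rightarrow> 'a::comm_ring_1 set \<Rightarrow> nat \<Rightarrow> 'a \<Rightarrow> 'a \<Rightarrow> bool" where
  "pcong p R n x y \<longleftrightarrow> (\<exists>z\<in>R. x - y = of_nat p ^ n * z)"

text \<open>The \<open>p\<close>-adic closure of \<open>B\<close> in \<open>R\<close>. Convergent functions will be the closure of \<open>W[t, h\<^sup>-\<^sup>1]\<close> in
  \<open>W[[t]]\<close>.\<close>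

definition pclosure :: "nat \<Rightarrow> 'a::comm_ring_1 set \<Rightarrow> 'a set \<Rightarrow> 'a set" where
  "pclosure p R B = {x. x \<in> R \<and> (\<forall>n. \<exists>b\<in>B. pcong p R n x b)}"

context
  fixes p :: nat and R :: "'a::comm_ring_1 set"
  assumes R: "subring_set R"
begin

lemma pcong_refl [simp]: "pcong p R n x x"
  unfolding pcong_def by (rule bexI[of _ 0]) (auto simp: subring_setD[OF R])

lemma pcong_sym: assumes "pcong p R n x y" shows "pcong p R n y x"
proof -
  obtain z where z: "z \<in> R" "x - y = of_nat p ^ n * z" using assms unfolding pcong_def by blast
  have "y - x = of_nat p ^ n * (- z)" using z(2) by (metis minus_diff_eq mult_minus_right)
  then show ?thesis unfolding pcong_def using z(1) subring_setD(5)[OF R] by blast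
qed

lemma pcong_add: assumes "pcong p R n x y" "pcong p R n x' y'" shows "pcong p R n (x + x') (y + y')"
proof -
  obtain z z' where z: "z \<in> R" "x - y = of_nat p ^ n * z" "z' \<in> R" "x' - y' = of_nat p ^ n * z'"
    using assms unfolding pcong_def by blast
  have "(x + x') - (y + y') = (x - y) + (x' - y')" by simp
  also have "\<dots> = of_nat p ^ n * (z + z')" unfolding z by (simp add: distrib_left)
  finally show ?thesis unfolding pcong_def using z subring_setD(3)[OF R] by blast
qed

lemma pcong_trans: assumes "pcong p R n x y" "pcong p R n y z" shows "pcong p R n x z"
proof -
  obtain u v where z: "u \<in> R" "x - y = of_nat p ^ n * u" "v \<in> R" "y - z = of_nat p ^ n * v"
    using assms unfolding pcong_def by blast
  have "x - z = (x - y) + (y - z)" by simp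
  also have "\<dots> = of_nat p ^ n * (u + v)" unfolding z by (simp add: distrib_left)
  finally show ?thesis unfolding pcong_def using z subring_setD(3)[OF R] by blast
qed

lemma pcong_minus: assumes "pcong p R n x y" shows "pcong p R n (- x) (- y)"
proof -
  obtain z where z: "z \<in> R" "x - y = of_nat p ^ n * z" using assms unfolding pcong_def by blast
  have "- x - - y = - (x - y)" by simp
  also have "\<dots> = of_nat p ^ n * (- z)" unfolding z by simp
  finally show ?thesis unfolding pcong_def using z(1) subring_setD(5)[OF R] by blast
qed

lemma pcong_diff: "pcong p R n x y \<Longrightarrow> pcong p R n x' y' \<Longrightarrow> pcong p R n (x - x') (y - y')"
  using pcong_add[of n x y "- x'" "- y'"] pcong_minus by simp

lemma pcong_mult:
  assumes "pcong p R n x y" "pcong p R n x' y'" "x' \<in> R" "y \<in> R"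
  shows "pcong p R n (x * x') (y * y')"
proof -
  obtain z z' where z: "z \<in> R" "x - y = of_nat p ^ n * z" "z' \<in> R" "x' - y' = of_nat p ^ n * z'"
    using assms unfolding pcong_def by blast
  have "x * x' - y * y' = (x - y) * x' + y * (x' - y')" by (simp add: algebra_simps)
  also have "\<dots> = of_nat p ^ n * (z * x' + y * z')" unfolding z by (simp add: algebra_simps)
  finally show ?thesis unfolding pcong_def using z assms(3,4) subring_setD(3,4)[OF R] by blast
qed

lemma pcong_mono: assumes "pcong p R n x y" "m \<le> n" shows "pcong p R m x y"
proof -
  obtain z where z: "z \<in> R" "x - y = of_nat p ^ n * z" using assms unfolding pcong_def by blast
  have "(of_nat p :: 'a) ^ n = of_nat p ^ m * of_nat p ^ (n - m)"
    using assms(2) by (simp flip: power_add)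
  then have "x - y = of_nat p ^ m * (of_nat p ^ (n - m) * z)" using z(2) by (simp add: mult.assoc)
  then show ?thesis unfolding pcong_def using z(1) subring_setD(4,7,8)[OF R] by blast
qed

lemma pcong_0: "pcong p R 0 x y \<longleftrightarrow> x - y \<in> R" by (simp add: pcong_def)

lemma pcong_in: "pcong p R n x y \<Longrightarrow> y \<in> R \<Longrightarrow> x \<in> R"
  using pcong_mono[of n x y 0] subring_setD(3)[OF R, of "x - y" y] by (simp add: pcong_0)

context
  fixes B assumes B: "subring_set B" and BR: "B \<subseteq> R"
begin

lemma subset_pclosure: "B \<subseteq> pclosure p R B"
  using BR pcong_refl unfolding pclosure_def by blast

lemma subring_set_pclosure: "subring_set (pclosure p R B)"
proof -
  have add: "x + y \<in> pclosure p R B" and mul: "x * y \<in> pclosure p R B"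
    if xy: "x \<in> pclosure p R B" "y \<in> pclosure p R B" for x y
  proof -
    have R': "x \<in> R" "y \<in> R" using xy by (auto simp: pclosure_def)
    have "\<exists>b\<in>B. pcong p R n (x + y) b" "\<exists>b\<in>B. pcong p R n (x * y) b" for n
    proof -
      obtain b c where bc: "b \<in> B" "pcong p R n x b" "c \<in> B" "pcong p R n y c"
        using xy unfolding pclosure_def by blast
      show "\<exists>b\<in>B. pcong p R n (x + y) b" using bc subring_setD(3)[OF B] pcong_add by blast
      show "\<exists>b\<in>B. pcong p R n (x * y) b"
        using bc subring_setD(4)[OF B] pcong_mult[OF bc(2,4) R'(2)] BR by blast
    qed
    then show "x + y \<in> pclosure p R B" "x * y \<in> pclosure p R B"
      using R' subring_setD(3,4)[OF R] unfolding pclosure_def by blast+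
  qed
  have neg: "- x \<in> pclosure p R B" if x: "x \<in> pclosure p R B" for x
  proof -
    have "\<exists>b\<in>B. pcong p R n (- x) b" for n
    proof -
      obtain b where "b \<in> B" "pcong p R n x b" using x unfolding pclosure_def by blast
      then show ?thesis using subring_setD(5)[OF B] pcong_minus by blast
    qed
    then show ?thesis using x subring_setD(5)[OF R] unfolding pclosure_def by blast
  qed
  show ?thesis unfolding subring_set_def
    using add mul neg subset_pclosure subring_setD(1,2)[OF B] by blast
qed

lemma pclosure_closed:
  assumes "x \<in> R" "\<And>n. \<exists>b\<in>pclosure p R B. pcong p R n x b"
  shows "x \<in> pclosure p R B"
proof -
  have "\<exists>b\<in>B. pcong p R n x b" for n
  proof -
    obtain c where c: "c \<in> pclosure p R B" "pcong p R n x c" using assms(2) by blast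
    then obtain b where "b \<in> B" "pcong p R n c b" unfolding pclosure_def by blast
    then show ?thesis using c pcong_trans by blast
  qed
  then show ?thesis using assms(1) by (simp add: pclosure_def)
qed

text \<open>If \<open>q v = 1 - p e\<close>, then \<open>q\<^sup>-\<^sup>1 = v (1 + p e + p\<^sup>2 e\<^sup>2 + \<dots>)\<close>, whose partial sums lie in the
  closure.\<close>

lemma pclosure_inverse:
  assumes q: "q \<in> pclosure p R B" and v: "v \<in> pclosure p R B" and qv: "pcong p R 1 (q * v) 1"
    and y: "q * y = 1" "y \<in> R"
  shows "y \<in> pclosure p R B"
proof (rule pclosure_closed[OF y(2)])
  fix n
  define e where "e = 1 - q * v"
  obtain z where z: "z \<in> R" "e = of_nat p ^ 1 * z"
    using pcong_sym[OF qv] unfolding e_def pcong_def by blast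
  note cl = subring_setD[OF subring_set_pclosure]
  have e: "e \<in> pclosure p R B"
    unfolding e_def by (rule cl(6)[OF cl(2) cl(4)[OF q v]])
  let ?b = "v * (\<Sum>i<n. e ^ i)"
  have b: "?b \<in> pclosure p R B"
    by (rule cl(4)[OF v cl(9)[OF cl(7)[OF e]]])
  have "y * (1 - e) = (q * y) * v" by (simp add: e_def algebra_simps)
  then have "y * (1 - e) = v" using y(1) by simp
  then have "?b = y * ((1 - e) * (\<Sum>i<n. e ^ i))" by (simp only: mult.assoc[symmetric])
  also have "\<dots> = y - y * e ^ n" unfolding one_diff_power_eq[symmetric] by (simp add: algebra_simps)
  finally have "y - ?b = of_nat p ^ n * (y * z ^ n)" unfolding z by (simp add: power_mult_distrib)
  then have "pcong p R n y ?b" unfolding pcong_def using y(2) z(1) subring_setD(4,7)[OF R] by blast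
  then show "\<exists>b\<in>pclosure p R B. pcong p R n y b" using b by blast
qed

end
end

section \<open>Power series over W\<close>

definition Wf :: "'p::prime_card K fps set" where
  "Wf = {f. \<forall>i. fps_nth f i \<in> W}"

definition fcong :: "nat \<Rightarrow> 'p::prime_card K fps \<Rightarrow> 'p K fps \<Rightarrow> bool" where
  "fcong n f g \<longleftrightarrow> (\<forall>i. wcong n (fps_nth f i) (fps_nth g i))"

lemma Wf_nth: "f \<in> Wf \<Longrightarrow> fps_nth f i \<in> W" by (simp add: Wf_def)

lemma subring_Wf: "subring_set (Wf :: 'p::prime_card K fps set)"
  unfolding subring_set_def Wf_def by (auto simp: fps_mult_nth)

lemma pK_power_mult_nth:
  "fps_nth (of_nat CARD('p) ^ n * z) i = (pK ^ n * fps_nth z i :: 'p::prime_card K)"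
proof -
  have "of_nat CARD('p) ^ n = fps_const (pK ^ n :: 'p K)"
    by (simp only: fps_of_nat[symmetric] fps_const_power)
  then show ?thesis by simp
qed

lemma pcong_Wf: "pcong CARD('p) Wf n f g \<longleftrightarrow> fcong n f (g :: 'p::prime_card K fps)"
proof
  assume "pcong CARD('p) Wf n f g"
  then obtain z where z: "z \<in> Wf" "f - g = of_nat CARD('p) ^ n * z" unfolding pcong_def by blast
  have "fps_nth f i - fps_nth g i = pK ^ n * fps_nth z i" for i
    by (simp only: z(2) pK_power_mult_nth fps_sub_nth[symmetric])
  then show "fcong n f g" using Wf_nth[OF z(1)] by (auto simp: fcong_def wcong_def intro: pW_I)
next
  assume *: "fcong n f g"
  define z where "z = Abs_fps (\<lambda>i. (fps_nth f i - fps_nth g i) / pK ^ n)"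
  have "f - g = of_nat CARD('p) ^ n * z"
    by (rule fps_ext) (simp add: pK_power_mult_nth, simp add: z_def)
  moreover have "z \<in> Wf"
    unfolding Wf_def
  proof (intro CollectI allI)
    fix i
    have "fps_nth f i - fps_nth g i \<in> pW n" using * by (simp add: fcong_def wcong_def)
    then obtain y where "y \<in> W" "fps_nth f i - fps_nth g i = pK ^ n * y" by (rule pW_E)
    then show "fps_nth z i \<in> W" by (simp add: z_def)
  qed
  ultimately show "pcong CARD('p) Wf n f g" unfolding pcong_def by blast
qed

lemmas Wf_ring = subring_setD[OF subring_Wf]

lemma fcong_refl [simp]: "fcong n f f" by (simp add: fcong_def)
lemma fcong_sym: "fcong n f g \<Longrightarrow> fcong n g f" by (auto simp: fcong_def intro: wcong_sym)
lemma fcong_trans [trans]: "fcong n f g \<Longrightarrow> fcong n g h \<Longrightarrow> fcong n f h"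
  unfolding fcong_def using wcong_trans by blast
lemma fcong_add: "fcong n f g \<Longrightarrow> fcong n f' g' \<Longrightarrow> fcong n (f + f') (g + g')"
  by (auto simp: fcong_def intro: wcong_add)
lemma fcong_diff: "fcong n f g \<Longrightarrow> fcong n f' g' \<Longrightarrow> fcong n (f - f') (g - g')"
  by (auto simp: fcong_def intro: wcong_diff)
lemma fcong_sum: "(\<And>i. i \<in> A \<Longrightarrow> fcong n (f i) (g i)) \<Longrightarrow> fcong n (sum f A) (sum g A)"
  by (induction A rule: infinite_finite_induct) (auto intro!: fcong_add)
lemma fcong_mono: "fcong m f g \<Longrightarrow> n \<le> m \<Longrightarrow> fcong n f g"
  unfolding fcong_def using wcong_mono by blast
lemma fcong_mult_left: 
  assumes "fcong n f g" "h \<in> Wf" shows "fcong n (h * f) (h * g)"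
  unfolding fcong_def fps_mult_nth
proof (intro allI wcong_sum)
  fix i j
  have "wcong n (fps_nth f (i - j)) (fps_nth g (i - j))" using assms(1) by (simp add: fcong_def)
  then show "wcong n (fps_nth h j * fps_nth f (i - j)) (fps_nth h j * fps_nth g (i - j))"
    unfolding wcong_def right_diff_distrib[symmetric] using Wf_nth[OF assms(2)] by blast
qed

lemma fcong_mult_right: "fcong n f g \<Longrightarrow> h \<in> Wf \<Longrightarrow> fcong n (f * h) (g * h)"
  using fcong_mult_left[of n f g h] by (simp add: mult.commute)

lemma fcong_p_mult: "fcong n f g \<Longrightarrow> fcong (Suc n) (fps_const pK * f) (fps_const pK * g)"
  unfolding fcong_def by (simp add: wcong_pK_cancel)

lemma Wf_const: "c \<in> W \<Longrightarrow> fps_const c \<in> Wf" by (auto simp: Wf_def)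
lemma Wf_X [simp]: "fps_X \<in> Wf" by (auto simp: Wf_def fps_X_def)

text \<open>The recursion for the coefficients of the inverse divides by the constant term only.\<close>

lemma Wf_inverse:
  assumes "f \<in> Wf" "Wunit (fps_nth f 0)"
  shows "inverse f \<in> Wf"
proof -
  have nz: "fps_nth f 0 \<noteq> 0" using assms Wunit_nz by blast
  have "fps_nth (inverse f) n \<in> W" for n
  proof (induction n rule: less_induct)
    case (less n)
    show ?case
    proof (cases "n = 0")
      case True
      then show ?thesis using assms Wunit_inverse_W by simp
    next
      case False
      have "(\<Sum>i=0..n. fps_nth (inverse f) i * fps_nth f (n - i)) = 0"
        using False by (simp only: fps_mult_nth[symmetric] inverse_mult_eq_1[OF nz]) simp
      moreover have "{0..n} = insert n {0..<n}" by auto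
      ultimately have "fps_nth (inverse f) n * fps_nth f 0 = - (\<Sum>i\<in>{0..<n}. fps_nth (inverse f) i * fps_nth f (n - i))"
        by (simp add: eq_neg_iff_add_eq_0 add.commute)
      then have "fps_nth (inverse f) n = - (\<Sum>i\<in>{0..<n}. fps_nth (inverse f) i * fps_nth f (n - i)) / fps_nth f 0"
        using nz by (simp add: field_simps)
      also have "\<dots> \<in> W"
        using less assms Wf_nth by (intro W_divide W_neg W_sum W_mult) auto
      finally show ?thesis .
    qed
  qed
  then show ?thesis by (simp add: Wf_def)
qed

lemma W_polyD: "g \<in> W_poly \<Longrightarrow> fps_of_poly g \<in> Wf"
  by (simp add: W_poly_def Wf_def)

lemma subring_W_poly: "subring_set (W_poly :: 'p::prime_card K poly set)"
  unfolding subring_set_def W_poly_def by (auto simp: coeff_mult)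

lemmas W_poly_ring = subring_setD[OF subring_W_poly]

lemma W_poly_pCons: "pCons a g \<in> W_poly \<longleftrightarrow> a \<in> W \<and> g \<in> W_poly"
  by (auto simp: W_poly_def coeff_pCons split: nat.splits)

subsection \<open>Substitution of the p-th power of the variable\<close>

definition psub :: "'p::prime_card K fps \<Rightarrow> 'p K fps" where
  "psub f = f oo (fps_X ^ CARD('p))"

lemma CARD_pos [simp]: "CARD('p::prime_card) > 0" "CARD('p) \<noteq> 0" by auto

lemma psub_X0: "fps_nth (fps_X ^ CARD('p::prime_card) :: 'p K fps) 0 = 0"
  by (simp add: fps_X_power_nth)

lemma psub_nth: "fps_nth (psub f) n = (if CARD('p) dvd n then fps_nth f (n div CARD('p)) else (0 :: 'p::prime_card K))"
proof -
  have "fps_nth (psub f) n = (\<Sum>i = 0..n. fps_nth f i * fps_nth (fps_X ^ (CARD('p) * i)) n)"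
    unfolding psub_def fps_compose_def by (simp add: power_mult)
  also have "\<dots> = (\<Sum>i\<in>(if CARD('p) dvd n then {n div CARD('p)} else {}). fps_nth f i * fps_nth (fps_X ^ (CARD('p) * i)) n)"
    by (intro sum.mono_neutral_right) (auto simp: fps_X_power_nth)
  finally show ?thesis by auto
qed

lemma psub_add: "psub (f + g) = psub f + psub g" by (simp add: psub_def fps_compose_add_distrib)
lemma psub_mult: "psub (f * g) = psub f * psub g"
  unfolding psub_def by (rule fps_compose_mult_distrib[OF psub_X0])
lemma psub_const [simp]: "psub (fps_const c) = fps_const c" by (simp add: psub_def)
lemma psub_1 [simp]: "psub 1 = 1" using psub_const[of 1] by simp
lemma psub_power: "psub (f ^ n) = psub f ^ n" by (induction n) (auto simp: psub_mult)
lemma psub_Wf: "f \<in> Wf \<Longrightarrow> psub f \<in> Wf" by (auto simp: Wf_def psub_nth)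
lemma psub_fcong: "fcong n f g \<Longrightarrow> fcong n (psub f) (psub g)" by (auto simp: fcong_def psub_nth)

lemma psub_inverse: 
  assumes "fps_nth f 0 \<noteq> 0" shows "psub (inverse f) = inverse (psub f)"
proof -
  have "psub (inverse f) * psub f = 1" using inverse_mult_eq_1[OF assms] by (simp flip: psub_mult)
  then show ?thesis by (metis fps_inverse_unique mult.commute)
qed

lemma psub_poly: 
  "g \<in> W_poly \<Longrightarrow> \<exists>g'\<in>W_poly. psub (fps_of_poly g) = fps_of_poly (g' :: 'p::prime_card K poly)"
proof (induction g)
  case 0
  then show ?case by (intro bexI[of _ 0]) (auto simp: psub_def)
next
  case (pCons a g)
  then obtain g' where g': "g' \<in> W_poly" "psub (fps_of_poly g) = fps_of_poly g'" by (auto simp: W_poly_pCons)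
  have "psub (fps_of_poly (pCons a g)) = fps_const a + psub fps_X * fps_of_poly g'"
    using g' by (simp add: fps_of_poly_pCons psub_add psub_mult)
  also have "psub fps_X = (fps_X ^ CARD('p) :: 'p K fps)" by (simp add: psub_def)
  also have "fps_const a + fps_X ^ CARD('p) * fps_of_poly g' = fps_of_poly ([:a:] + monom 1 CARD('p) * g')"
    by (simp add: fps_of_poly_add fps_of_poly_mult fps_of_poly_monom' fps_of_poly_const)
  finally have eq: "psub (fps_of_poly (pCons a g)) = fps_of_poly ([:a:] + monom 1 CARD('p) * g')" .
  have "[:a:] + monom 1 CARD('p) * g' \<in> W_poly"
  proof (intro W_poly_ring(3,4) g'(1))
    show "[:a:] \<in> W_poly" using pCons.prems by (simp add: W_poly_pCons W_poly_ring(1))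
    show "monom 1 CARD('p) \<in> W_poly" by (simp add: W_poly_def)
  qed
  then show ?case using eq by blast
qed

lemma ipeval_in_subring:
  assumes "subring_set R" "\<And>v. \<rho> v \<in> R" shows "ipeval \<rho> f \<in> R"
proof (induction f rule: ipoly_induct)
  case (single m c)
  note R = subring_setD[OF assms(1)]
  have "(\<Prod>v\<in>S. \<rho> v ^ Poly_Mapping.lookup m v) \<in> R" for S
    by (induction S rule: infinite_finite_induct) (simp_all add: R(2,4,7) assms(2))
  then have "ipmon \<rho> m \<in> R" unfolding ipmon_def .
  moreover have "of_int c \<in> R" by (cases c) (simp_all add: R(5,8) del: of_nat_Suc)
  ultimately show ?case by (simp add: R(4))
qed (simp add: ipeval_add subring_setD(3)[OF assms(1)])

text \<open>The quotient of the difference by \<open>p\<close> is a value of an integer polynomial, hence lies in the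
  subring. This is read off from the generic polynomial ring, since in a subring of a field of
  characteristic \<open>0\<close>, divisibility in the ambient ring would say nothing.\<close>

lemma freshman_subring:
  assumes "prime p" "subring_set R" "x \<in> R" "y \<in> R"
  shows "pcong p R 1 ((x + y) ^ p) (x ^ p + y ^ p)"
proof -
  let ?x = "ipvar True :: bool ipoly" and ?y = "ipvar False :: bool ipoly"
  let ?h = "ipeval (\<lambda>b. if b then x else y)"
  obtain D where D: "(?x + ?y) ^ p - (?x ^ p + ?y ^ p) = of_nat p * D"
    using freshman[OF assms(1)] by (auto simp: dvd_def)
  have "?h ((?x + ?y) ^ p) - ?h (?x ^ p + ?y ^ p) = ?h (of_nat p * D)"
    unfolding D[symmetric] using is_homD(3)[OF is_hom_ipeval, of "\<lambda>b. if b then x else y" "(?x + ?y) ^ p - (?x ^ p + ?y ^ p)" "?x ^ p + ?y ^ p"]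
    by (simp del: ipeval_var)
  then have "(x + y) ^ p - (x ^ p + y ^ p) = of_nat p ^ 1 * ?h D"
    by (simp add: is_homD[OF is_hom_ipeval])
  moreover have "?h D \<in> R" using assms by (intro ipeval_in_subring) auto
  ultimately show ?thesis unfolding pcong_def by blast
qed

text \<open>Modulo \<open>p\<close> the \<open>p\<close>-th power is additive, and it fixes the coefficients by assumption.\<close>

lemma Frobenius_poly:
  assumes "g \<in> W_poly" "\<And>i. wcong 1 (coeff g i ^ CARD('p)) (coeff g i :: 'p::prime_card K)"
  shows "fcong 1 (fps_of_poly g ^ CARD('p)) (psub (fps_of_poly g))"
  using assms
proof (induction g)
  case 0
  then show ?case by (simp add: psub_def power_0_left)
next
  case (pCons a g)
  have g: "g \<in> W_poly" "a \<in> W" using pCons.prems(1) by (auto simp: W_poly_pCons)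
  have IH: "fcong 1 (fps_of_poly g ^ CARD('p)) (psub (fps_of_poly g))"
    using pCons.prems(2)[of "Suc _"] g by (intro pCons.IH) auto
  have "fps_of_poly (pCons a g) ^ CARD('p) = (fps_const a + fps_X * fps_of_poly g) ^ CARD('p)"
    by (simp add: fps_of_poly_pCons)
  also have "fcong 1 \<dots> (fps_const a ^ CARD('p) + (fps_X * fps_of_poly g) ^ CARD('p))"
    unfolding pcong_Wf[symmetric]
    by (rule freshman_subring[OF prime_card subring_Wf Wf_const[OF g(2)] Wf_ring(4)[OF Wf_X W_polyD[OF g(1)]]])
  also have "fcong 1 \<dots> (fps_const a + fps_X ^ CARD('p) * psub (fps_of_poly g))"
    unfolding power_mult_distrib
  proof (rule fcong_add)
    show "fcong 1 (fps_const a ^ CARD('p)) (fps_const a)"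
      using pCons.prems(2)[of 0] by (auto simp: fcong_def)
    show "fcong 1 (fps_X ^ CARD('p) * fps_of_poly g ^ CARD('p)) (fps_X ^ CARD('p) * psub (fps_of_poly g))"
      by (rule fcong_mult_left[OF IH Wf_ring(7)[OF Wf_X]])
  qed
  also have "fps_const a + fps_X ^ CARD('p) * psub (fps_of_poly g) = psub (fps_of_poly (pCons a g))"
    by (simp add: fps_of_poly_pCons psub_add psub_mult) (simp add: psub_def)
  finally show ?case .
qed

section \<open>The ring of convergent functions as a ring of power series\<close>

definition Wrat :: "'p::prime_card K poly \<Rightarrow> 'p K fps set" where
  "Wrat h = {fps_of_poly g * inverse (fps_of_poly h) ^ k | g k. g \<in> W_poly}"

text \<open>The ring \<open>W\<langle>t, h\<^sup>-\<^sup>1\<rangle>\<close>, through the expansion at \<open>t = 0\<close>. Membership in it can be tested on power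
  series, where the quotient \<open>G / F\<close> is available; the inverse limit that defines the completion is
  only needed at the end.\<close>

abbreviation conv :: "'p::prime_card K poly \<Rightarrow> 'p K fps set" where
  "conv h \<equiv> pclosure CARD('p) Wf (Wrat h)"

context
  fixes h :: "'p::prime_card K poly"
  assumes h: "h \<in> W_poly" "coeff h 0 = 1"
begin

lemma h_inv_Wf: "inverse (fps_of_poly h) \<in> Wf"
  by (rule Wf_inverse[OF W_polyD[OF h(1)]]) (simp add: h(2))

lemma h_inv: "fps_of_poly h * inverse (fps_of_poly h) = 1"
  using inverse_mult_eq_1[of "fps_of_poly h"] h(2) by (simp add: mult.commute)

lemma Wrat_I: "g \<in> W_poly \<Longrightarrow> fps_of_poly g * inverse (fps_of_poly h) ^ k \<in> Wrat h"
  unfolding Wrat_def by blast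

lemma Wrat_poly: "g \<in> W_poly \<Longrightarrow> fps_of_poly g \<in> Wrat h"
  using Wrat_I[of g 0] by simp

lemma Wrat_inv: "inverse (fps_of_poly h) ^ k \<in> Wrat h"
  using Wrat_I[of 1 k] W_poly_ring(2) by simp

lemma Wrat_Wf: "Wrat h \<subseteq> Wf"
proof
  fix x assume "x \<in> Wrat h"
  then obtain g k where x: "x = fps_of_poly g * inverse (fps_of_poly h) ^ k" "g \<in> W_poly" 
    unfolding Wrat_def by blast
  show "x \<in> Wf" unfolding x(1) by (rule Wf_ring(4)[OF W_polyD[OF x(2)] Wf_ring(7)[OF h_inv_Wf]])
qed

lemma Wrat_split: "fps_of_poly g * inverse (fps_of_poly h) ^ k = fps_of_poly (g * h ^ j) * inverse (fps_of_poly h) ^ (k + j)"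
proof -
  have "fps_of_poly (g * h ^ j) * inverse (fps_of_poly h) ^ (k + j)
      = fps_of_poly g * inverse (fps_of_poly h) ^ k * (fps_of_poly h * inverse (fps_of_poly h)) ^ j"
    by (simp only: fps_of_poly_mult fps_of_poly_power power_add power_mult_distrib mult_ac)
  then show ?thesis by (simp only: h_inv power_one mult_1_right)
qed

lemma subring_Wrat: "subring_set (Wrat h)"
  unfolding subring_set_def
proof (intro conjI ballI)
  show "0 \<in> Wrat h" using Wrat_poly[OF W_poly_ring(1)] by simp
  show "1 \<in> Wrat h" using Wrat_poly[OF W_poly_ring(2)] by simp
next
  fix x y assume "x \<in> Wrat h" "y \<in> Wrat h"
  then obtain g k g' k' where x: "x = fps_of_poly g * inverse (fps_of_poly h) ^ k" "g \<in> W_poly" 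
    and y: "y = fps_of_poly g' * inverse (fps_of_poly h) ^ k'" "g' \<in> W_poly"
    unfolding Wrat_def by blast
  have "x + y = fps_of_poly (g * h ^ k') * inverse (fps_of_poly h) ^ (k + k') + fps_of_poly (g' * h ^ k) * inverse (fps_of_poly h) ^ (k' + k)"
    unfolding x(1) y(1) using Wrat_split[of g k k'] Wrat_split[of g' k' k] by simp
  also have "\<dots> = fps_of_poly (g * h ^ k' + g' * h ^ k) * inverse (fps_of_poly h) ^ (k + k')"
    by (simp add: fps_of_poly_add distrib_right add.commute)
  finally show "x + y \<in> Wrat h"
    using Wrat_I[OF W_poly_ring(3)[OF W_poly_ring(4)[OF x(2) W_poly_ring(7)[OF h(1)]] W_poly_ring(4)[OF y(2) W_poly_ring(7)[OF h(1)]]]]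
    by simp
  have "x * y = fps_of_poly (g * g') * inverse (fps_of_poly h) ^ (k + k')"
    unfolding x(1) y(1) by (simp add: fps_of_poly_mult power_add mult_ac)
  then show "x * y \<in> Wrat h" using Wrat_I[OF W_poly_ring(4)[OF x(2) y(2)]] by simp
next
  fix x assume "x \<in> Wrat h"
  then obtain g k where x: "x = fps_of_poly g * inverse (fps_of_poly h) ^ k" "g \<in> W_poly" 
    unfolding Wrat_def by blast
  have "- x = fps_of_poly (- g) * inverse (fps_of_poly h) ^ k" unfolding x(1) by (simp add: fps_of_poly_uminus)
  then show "- x \<in> Wrat h" using Wrat_I[OF W_poly_ring(5)[OF x(2)]] by simp
qed

lemmas conv_ring = subring_setD[OF subring_set_pclosure[OF subring_Wf subring_Wrat Wrat_Wf, where p = "CARD('p)"]]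

lemma conv_Wf: "f \<in> conv h \<Longrightarrow> f \<in> Wf" by (simp add: pclosure_def)

lemma Wrat_conv: "f \<in> Wrat h \<Longrightarrow> f \<in> conv h"
  using subset_pclosure[OF subring_Wf subring_Wrat Wrat_Wf] by blast

lemma poly_conv: "g \<in> W_poly \<Longrightarrow> fps_of_poly g \<in> conv h" by (rule Wrat_conv[OF Wrat_poly])

lemma const_conv: "c \<in> W \<Longrightarrow> fps_const c \<in> conv h"
  using poly_conv[of "[:c:]"] by (simp add: W_poly_pCons W_poly_ring(1) fps_of_poly_const)

lemma X_conv: "fps_X \<in> conv h"
  using poly_conv[of "[:0, 1:]"] by (simp add: W_poly_pCons W_poly_ring(1) fps_of_poly_pCons)

lemma conv_approx: 
  assumes "f \<in> conv h" obtains g k where "g \<in> W_poly" "fcong n f (fps_of_poly g * inverse (fps_of_poly h) ^ k)"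
proof -
  obtain b where b: "b \<in> Wrat h" "pcong CARD('p) Wf n f b" using assms unfolding pclosure_def by blast
  then obtain g k where "b = fps_of_poly g * inverse (fps_of_poly h) ^ k" "g \<in> W_poly" unfolding Wrat_def by blast
  then show ?thesis using that b(2) unfolding pcong_Wf by blast
qed

lemma conv_closed:
  assumes "f \<in> Wf" "\<And>n. \<exists>b\<in>conv h. fcong n f b" shows "f \<in> conv h"
  using pclosure_closed[OF subring_Wf subring_Wrat Wrat_Wf, of f "CARD('p)"] assms unfolding pcong_Wf by blast

lemma conv_inverse:
  assumes "q \<in> conv h" "v \<in> conv h" "fcong 1 (q * v) 1" "Wunit (fps_nth q 0)"
  shows "inverse q \<in> conv h"
proof (rule pclosure_inverse[OF subring_Wf subring_Wrat Wrat_Wf assms(1,2)])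
  show "pcong CARD('p) Wf 1 (q * v) 1" using assms(3) unfolding pcong_Wf .
  show "q * inverse q = 1" using inverse_mult_eq_1[of q] Wunit_nz[OF assms(4)] by (simp add: mult.commute)
  show "inverse q \<in> Wf" by (rule Wf_inverse[OF conv_Wf[OF assms(1)] assms(4)])
qed

text \<open>A convergent function that vanishes at \<open>0\<close> is divisible by \<open>t\<close>: modulo \<open>p\<^sup>n\<close> the numerator of an
  approximation has no constant term.\<close>

lemma conv_shift:
  assumes f: "f \<in> conv h" "fps_nth f 0 = 0"
  shows "fps_shift 1 f \<in> conv h"
proof (rule conv_closed)
  show "fps_shift 1 f \<in> Wf" using conv_Wf[OF f(1)] by (simp add: Wf_def)
  fix n
  obtain g k where g: "g \<in> W_poly" "fcong n f (fps_of_poly g * inverse (fps_of_poly h) ^ k)"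
    by (rule conv_approx[OF f(1)])
  obtain a g2 where ag: "g = pCons a g2" by (rule pCons_cases)
  have g2: "g2 \<in> W_poly" "a \<in> W" using g(1) unfolding ag W_poly_pCons by auto
  let ?i = "inverse (fps_of_poly h) ^ k"
  have "wcong n (fps_nth f 0) (fps_nth (fps_of_poly g * ?i) 0)" using g(2) unfolding fcong_def by blast
  then have "wcong n 0 a" unfolding f(2) by (simp add: fps_power_zeroth h(2) ag)
  then have a: "fcong n (fps_const a) 0" using wcong_sym[of n 0 a] by (auto simp: fcong_def)
  have "fcong n f (fps_of_poly g * ?i)" by (rule g(2))
  also have "fps_of_poly g * ?i = fps_const a * ?i + fps_X * (fps_of_poly g2 * ?i)"
    by (simp add: ag fps_of_poly_pCons algebra_simps)
  also have "fcong n \<dots> (0 * ?i + fps_X * (fps_of_poly g2 * ?i))"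
    by (intro fcong_add fcong_refl fcong_mult_right a Wf_ring(7) h_inv_Wf)
  finally have *: "fcong n f (fps_X * (fps_of_poly g2 * ?i))" by simp
  have "fcong n (fps_shift 1 f) (fps_of_poly g2 * ?i)"
    unfolding fcong_def
  proof
    fix i show "wcong n (fps_nth (fps_shift 1 f) i) (fps_nth (fps_of_poly g2 * ?i) i)"
      using *[unfolded fcong_def, rule_format, of "Suc i"] by simp
  qed
  then show "\<exists>b\<in>conv h. fcong n (fps_shift 1 f) b" using Wrat_conv[OF Wrat_I[OF g2(1)]] by blast
qed

text \<open>The substitution \<open>t \<mapsto> t\<^sup>p\<close> maps \<open>h\<close> to a polynomial that is congruent to \<open>h\<^sup>p\<close>, hence still
  invertible; this is why the coefficients of \<open>h\<close> have to be fixed by the \<open>p\<close>-th power map modulo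
  \<open>p\<close>.\<close>

lemma psub_conv:
  assumes F: "\<And>i. wcong 1 (coeff h i ^ CARD('p)) (coeff h i)" and f: "f \<in> conv h"
  shows "psub f \<in> conv h"
proof (rule conv_closed)
  show "psub f \<in> Wf" by (rule psub_Wf[OF conv_Wf[OF f]])
  fix n
  let ?h = "fps_of_poly h"
  obtain g k where g: "g \<in> W_poly" "fcong n f (fps_of_poly g * inverse ?h ^ k)"
    by (rule conv_approx[OF f])
  have inv: "inverse (psub ?h) \<in> conv h"
  proof (rule conv_inverse)
    show "psub ?h \<in> conv h" using psub_poly[OF h(1)] poly_conv by auto
    show "inverse ?h ^ CARD('p) \<in> conv h" by (rule Wrat_conv[OF Wrat_inv])
    have "fcong 1 (psub ?h * inverse ?h ^ CARD('p)) (?h ^ CARD('p) * inverse ?h ^ CARD('p))"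
      by (intro fcong_mult_right fcong_sym[OF Frobenius_poly[OF h(1) F]] Wf_ring(7) h_inv_Wf)
    also have "?h ^ CARD('p) * inverse ?h ^ CARD('p) = 1"
      by (simp only: power_mult_distrib[symmetric] h_inv power_one)
    finally show "fcong 1 (psub ?h * inverse ?h ^ CARD('p)) 1" .
    show "Wunit (fps_nth (psub ?h) 0)" by (simp add: psub_nth h(2))
  qed
  have "psub (fps_of_poly g * inverse ?h ^ k) = psub (fps_of_poly g) * inverse (psub ?h) ^ k"
    by (simp add: psub_mult psub_power psub_inverse h(2))
  moreover have "psub (fps_of_poly g) * inverse (psub ?h) ^ k \<in> conv h"
    using psub_poly[OF g(1)] poly_conv by (intro conv_ring(4) conv_ring(7) inv) auto
  ultimately show "\<exists>b\<in>conv h. fcong n (psub f) b" using psub_fcong[OF g(2)] by auto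
qed

end

section \<open>Dwork congruences\<close>

definition wlip :: "(nat \<Rightarrow> 'p::prime_card K) \<Rightarrow> bool" where
  "wlip f \<longleftrightarrow> (\<forall>n. f n \<in> W) \<and> (\<forall>s m n. [m = n] (mod CARD('p) ^ s) \<longrightarrow> wcong s (f m) (f n))"

text \<open>The restriction of a Lipschitz function to a residue class modulo \<open>p\<close>, as a function of \<open>(n -
  k)/p\<close>, gains one power of \<open>p\<close>. This gain drives the induction in the Dwork congruences.\<close>

definition wlip_gain :: "(nat \<Rightarrow> 'p::prime_card K) \<Rightarrow> bool" where
  "wlip_gain f \<longleftrightarrow> (\<forall>n. f n \<in> W) \<and> (\<forall>s m n. [m = n] (mod CARD('p) ^ s) \<longrightarrow> wcong (Suc s) (f m) (f n))"

lemma wlipI: "(\<And>n. f n \<in> W) \<Longrightarrow> (\<And>s m n. [m = n] (mod CARD('p::prime_card) ^ s) \<Longrightarrow> wcong s (f m) (f n :: 'p K)) \<Longrightarrow> wlip f"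
  unfolding wlip_def by blast
lemma wlipD: "wlip f \<Longrightarrow> f n \<in> W" "wlip f \<Longrightarrow> [m = n] (mod CARD('p::prime_card) ^ s) \<Longrightarrow> wcong s (f m) (f n :: 'p K)"
  unfolding wlip_def by blast+
lemma wlip_gainD: "wlip_gain f \<Longrightarrow> f n \<in> W" "wlip_gain f \<Longrightarrow> [m = n] (mod CARD('p::prime_card) ^ s) \<Longrightarrow> wcong (Suc s) (f m) (f n :: 'p K)"
  unfolding wlip_gain_def by blast+

lemma cong_block:
  fixes q :: nat
  assumes "[m = n] (mod q ^ s)" shows "[k + q * m = k + q * n] (mod q ^ Suc s)"
proof -
  have "[q * m = q * n] (mod (q * q ^ s))" using assms by (simp add: cong_def mod_mult_mult1)
  then show ?thesis by (intro cong_add cong_refl) simp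
qed

lemma wlip_block_gain:
  assumes "wlip (f :: nat \<Rightarrow> 'p::prime_card K)" shows "wlip_gain (\<lambda>m. f (k + CARD('p) * m))"
  unfolding wlip_gain_def
proof (intro conjI allI impI)
  fix s m n assume "[m = n] (mod CARD('p) ^ s)"
  then show "wcong (Suc s) (f (k + CARD('p) * m)) (f (k + CARD('p) * n))"
    by (intro wlipD(2)[OF assms] cong_block)
qed (rule wlipD(1)[OF assms])

lemma wlip_gain_mult:
  assumes "wlip_gain f" "wlip_gain g" shows "wlip_gain (\<lambda>m. f m * g m)"
  unfolding wlip_gain_def
  by (auto intro!: wcong_mult wlip_gainD(1)[OF assms(1)] wlip_gainD(1)[OF assms(2)]
      wlip_gainD(2)[OF assms(1)] wlip_gainD(2)[OF assms(2)])

lemma wlip_const: "c \<in> W \<Longrightarrow> wlip (\<lambda>_. c)" by (simp add: wlip_def)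

lemma fps_blocks:
  fixes f :: "'p::prime_card K fps"
  shows "f = (\<Sum>k<CARD('p). fps_X ^ k * psub (Abs_fps (\<lambda>m. fps_nth f (k + CARD('p) * m))))"
proof (rule fps_ext)
  fix n
  let ?p = "CARD('p)"
  have p: "?p > 0" by simp
  have "fps_nth (\<Sum>k<?p. fps_X ^ k * psub (Abs_fps (\<lambda>m. fps_nth f (k + ?p * m)))) n
     = (\<Sum>k<?p. if k = n mod ?p then fps_nth f n else 0)"
    unfolding fps_sum_nth
  proof (intro sum.cong refl)
    fix k assume k: "k \<in> {..<?p}"
    show "fps_nth (fps_X ^ k * psub (Abs_fps (\<lambda>m. fps_nth f (k + ?p * m)))) n = (if k = n mod ?p then fps_nth f n else 0)"
    proof (cases "k \<le> n \<and> ?p dvd n - k")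
      case True
      then have "n mod ?p = k mod ?p" by (metis mod_eq_dvd_iff_nat)
      moreover have "k + ?p * ((n - k) div ?p) = n" using True by simp
      ultimately show ?thesis using k True by (simp add: fps_X_power_mult_nth psub_nth)
    next
      case False
      have "k \<noteq> n mod ?p"
      proof
        assume "k = n mod ?p"
        then show False using False by (auto simp: minus_mod_eq_mult_div)
      qed
      then show ?thesis using False by (auto simp: fps_X_power_mult_nth psub_nth)
    qed
  qed
  also have "\<dots> = fps_nth f n" using p by simp
  finally show "fps_nth f n = fps_nth (\<Sum>k<?p. fps_X ^ k * psub (Abs_fps (\<lambda>m. fps_nth f (k + ?p * m)))) n" ..
qed

text \<open>A sequence of power series \<open>F\<^sub>i\<close> with coefficients \<open>A i n\<close>, each governed by its successor: on the
  residue class of \<open>k\<close> the coefficients of \<open>F\<^sub>i\<close> are either those of \<open>F\<^bsub>i+1\<^esub>\<close> times a function that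
  gains a power of \<open>p\<close>, or, after a carry, coefficients with shifted index \<open>m + 1\<close>. In that case the
  factor \<open>p (m + 1)\<close> makes up for the shift: the coefficients \<open>m A(m)\<close> are those of a series without
  constant term, which \<open>t\<close> divides. The series and the polynomial \<open>h\<close> are abstract here, as the
  argument applies to both sides of the theorem.\<close>

locale dwork_tower =
  fixes A :: "nat \<Rightarrow> nat \<Rightarrow> 'p::prime_card K" and h :: "'p K poly"
  assumes h: "h \<in> W_poly" "coeff h 0 = 1" and hF: "\<And>i. wcong 1 (coeff h i ^ CARD('p)) (coeff h i)"
    and A0: "\<And>i. A i 0 = 1" and A_W: "\<And>i n. A i n \<in> W"
    and step: "\<And>i k. k < CARD('p) \<Longrightarrow>
       (\<exists>u. wlip_gain u \<and> (\<forall>m. A i (k + CARD('p) * m) = u m * A (Suc i) m)) \<or>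
       (\<exists>w. wlip w \<and> (\<forall>m. A i (k + CARD('p) * m) = pK * of_nat (Suc m) * w m * A (Suc i) (Suc m)))"
    and unit: "\<And>i. inverse (fps_cutoff CARD('p) (Abs_fps (A i))) \<in> conv h"
begin

lemma F_Wf: "Abs_fps (A i) \<in> Wf" by (simp add: Wf_def A_W)

lemma G_Wf: "wlip f \<Longrightarrow> Abs_fps (\<lambda>n. f n * A i n) \<in> Wf"
  by (simp add: Wf_def A_W wlipD(1))

text \<open>One residue class of the coefficients of \<open>G\<close>. In the first case, the factor is its value at \<open>m =
  0\<close> plus \<open>p\<close> times a Lipschitz function, and the induction hypothesis for the latter is only needed
  to one power of \<open>p\<close> less. In the second case the block is divisible by \<open>p\<close>, with the same effect,
  and the shift of the index is undone by dividing by \<open>t\<close>.\<close>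

lemma block_congruence:
  assumes IH: "\<And>w. wlip w \<Longrightarrow> \<exists>R\<in>conv h. fcong s (Abs_fps (\<lambda>m. w m * A (Suc i) m)) (Abs_fps (A (Suc i)) * R)"
    and f: "wlip f" and k: "k < CARD('p)"
  shows "\<exists>S\<in>conv h. fcong (Suc s) (fps_X ^ k * psub (Abs_fps (\<lambda>m. f (k + CARD('p) * m) * A i (k + CARD('p) * m))))
            (psub (Abs_fps (A (Suc i))) * S)
          \<and> fcong 1 S (fps_const (f k * A i k) * fps_X ^ k)"
  using step[OF k, of i]
proof (elim disjE exE conjE)
  let ?p = "CARD('p)" and ?F' = "Abs_fps (A (Suc i))"
  let ?H = "Abs_fps (\<lambda>m. f (k + ?p * m) * A i (k + ?p * m))"
  note C = conv_ring[OF h]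
  {
    fix u assume u: "wlip_gain u" "\<forall>m. A i (k + ?p * m) = u m * A (Suc i) m"
    define v where "v m = f (k + ?p * m) * u m" for m
    have v: "wlip_gain v" unfolding v_def by (rule wlip_gain_mult[OF wlip_block_gain[OF f] u(1)])
    have "\<exists>y\<in>W. v m - v 0 = pK ^ 1 * y" for m
    proof -
      have "wcong (Suc 0) (v m) (v 0)" by (rule wlip_gainD(2)[OF v]) (simp add: cong_def)
      then show ?thesis unfolding wcong_def pW_iff by simp
    qed
    then obtain w where w: "\<And>m. w m \<in> W" "\<And>m. v m - v 0 = pK * w m" by (metis power_one_right)
    have v_eq: "v m = v 0 + pK * w m" for m using w(2)[of m] by (simp add: algebra_simps)
    have lw: "wlip w"
    proof (rule wlipI[OF w(1)])
      fix t m n assume "[m = n] (mod ?p ^ t)"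
      then have "wcong (Suc t) (v m - v 0) (v n - v 0)" by (intro wcong_diff wlip_gainD(2)[OF v]) auto
      then show "wcong t (w m) (w n)" unfolding w(2) wcong_pK_cancel .
    qed
    obtain R where R: "R \<in> conv h" "fcong s (Abs_fps (\<lambda>m. w m * A (Suc i) m)) (?F' * R)" using IH[OF lw] by blast
    \<comment> \<open>modulo \<open>p\<close> only the constant \<open>v 0 = f k * A i k\<close> remains\<close>
    define S where "S = fps_X ^ k * (fps_const (v 0) + fps_const pK * psub R)"
    have H: "?H = fps_const (v 0) * ?F' + fps_const pK * Abs_fps (\<lambda>m. w m * A (Suc i) m)"
    proof (rule fps_ext)
      fix n 
      have "fps_nth ?H n = v n * A (Suc i) n" using u(2) by (simp add: v_def)
      then show "fps_nth ?H n = fps_nth (fps_const (v 0) * ?F' + fps_const pK * Abs_fps (\<lambda>m. w m * A (Suc i) m)) n"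
        unfolding v_eq[of n] by (simp add: algebra_simps)
    qed
    have "fcong (Suc s) (psub ?H) (psub (fps_const (v 0) * ?F' + fps_const pK * (?F' * R)))"
      unfolding H by (intro psub_fcong fcong_add fcong_refl fcong_p_mult R(2))
    also have "\<dots> = psub ?F' * (fps_const (v 0) + fps_const pK * psub R)"
      by (simp add: psub_add psub_mult algebra_simps)
    finally have "fcong (Suc s) (fps_X ^ k * psub ?H) (fps_X ^ k * (psub ?F' * (fps_const (v 0) + fps_const pK * psub R)))"
      by (intro fcong_mult_left Wf_ring(7) Wf_X)
    also have "\<dots> = psub ?F' * S" by (simp add: S_def algebra_simps)
    finally have 1: "fcong (Suc s) (fps_X ^ k * psub ?H) (psub ?F' * S)" .
    have pR: "psub R \<in> conv h" by (rule psub_conv[OF h hF R(1)])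
    have S_C: "S \<in> conv h" unfolding S_def
      by (intro C(3) C(4) C(7) X_conv[OF h] const_conv[OF h] wlip_gainD(1)[OF v] pR) simp
    have v0: "v 0 = f k * A i k" using u(2)[rule_format, of 0] by (simp add: v_def A0)
    have "fcong (Suc 0) (fps_const pK * psub R) (fps_const pK * 0)"
      by (intro fcong_p_mult) (use Wf_nth[OF conv_Wf[OF h pR]] in \<open>simp add: fcong_def\<close>)
    then have "fcong 1 S (fps_X ^ k * (fps_const (v 0) + 0))" unfolding S_def
      by (intro fcong_mult_left fcong_add fcong_refl Wf_ring(7) Wf_X) simp
    then have "fcong 1 S (fps_const (f k * A i k) * fps_X ^ k)" by (simp add: v0 mult.commute)
    then show ?thesis using 1 S_C by blast
  }
  {
    fix w assume w: "wlip w" "\<forall>m. A i (k + ?p * m) = pK * of_nat (Suc m) * w m * A (Suc i) (Suc m)"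
    define v where "v m = f (k + ?p * m) * w m" for m
    have v: "wlip v"
    proof (rule wlipI)
      fix t m n assume c: "[m = n] (mod ?p ^ t)"
      have "wcong (Suc t) (f (k + ?p * m)) (f (k + ?p * n))" by (rule wlipD(2)[OF f cong_block[OF c]])
      then show "wcong t (v m) (v n)" unfolding v_def
        by (intro wcong_mult wlipD(1)[OF f] wlipD(1)[OF w(1)] wlipD(2)[OF w(1) c]) (rule wcong_mono, auto)
    qed (auto simp: v_def wlipD(1)[OF f] wlipD(1)[OF w(1)])
    \<comment> \<open>the index \<open>m + 1\<close> becomes \<open>m\<close>; the value \<open>0\<close> at \<open>m = 0\<close> continues \<open>m v(m - 1)\<close>\<close>
    define g where "g m = (if m = 0 then 0 else of_nat m * v (m - 1))" for m
    have gz: "wcong t (g m) (g 0)" if c: "[m = 0] (mod ?p ^ t)" for t m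
    proof (cases "m = 0")
      case False
      have "wcong t (of_nat m :: 'p K) (of_nat 0)" unfolding wcong_of_nat by (rule c)
      then have "of_nat m * v (m - 1) \<in> pW t" using wlipD(1)[OF v] by (intro pW_mult_W) auto
      then show ?thesis using False by (simp add: g_def)
    qed simp
    have g: "wlip g"
    proof (rule wlipI)
      fix t m n assume c: "[m = n] (mod ?p ^ t)"
      show "wcong t (g m) (g n)"
      proof (cases "m = 0 \<or> n = 0")
        case True
        then show ?thesis using gz[of m t] gz[of n t] c by (auto intro: wcong_sym simp: cong_sym_eq)
      next
        case False
        then obtain m' n' where mn: "m = Suc m'" "n = Suc n'" by (metis not0_implies_Suc)
        have "[m' + 1 = n' + 1] (mod ?p ^ t)" using c mn by simp
        then have c': "[m' = n'] (mod ?p ^ t)" by (simp only: cong_add_rcancel_nat)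
        have "wcong t (of_nat m * v m') (of_nat n * v n')"
          using c by (intro wcong_mult wlipD[OF v] c') (auto simp: wcong_of_nat)
        then show ?thesis by (simp add: g_def mn)
      qed
    qed (auto simp: g_def wlipD(1)[OF v])
    obtain R where R: "R \<in> conv h" "fcong s (Abs_fps (\<lambda>m. g m * A (Suc i) m)) (?F' * R)" using IH[OF g] by blast
    define R1 where "R1 = R - fps_const (fps_nth R 0)"
    have RW: "fps_nth R 0 \<in> W" using Wf_nth[OF conv_Wf[OF h R(1)]] .
    have R1: "R1 \<in> conv h" "fps_nth R1 0 = 0"
      unfolding R1_def by (intro C(6) R(1) const_conv[OF h] RW) simp
    have R2: "fps_shift 1 R1 \<in> conv h" by (rule conv_shift[OF h R1])
    have XR2: "fps_X * fps_shift 1 R1 = R1" using R1(2)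
      by (intro fps_ext) (auto simp: fps_X_mult_nth)
    have "wcong s (g 0 * A (Suc i) 0) (fps_nth (?F' * R) 0)" using R(2)[unfolded fcong_def, rule_format, of 0] by simp
    then have "wcong s 0 (fps_nth R 0)" by (simp add: g_def A0)
    then have "fcong s (fps_const (fps_nth R 0)) 0" using wcong_sym[of s 0 "fps_nth R 0"] by (auto simp: fcong_def)
    then have "fcong s (R - fps_const (fps_nth R 0)) (R - 0)" by (intro fcong_diff fcong_refl)
    then have "fcong s R1 R" unfolding R1_def by simp
    then have RR1: "fcong s R R1" by (rule fcong_sym)
    have "fcong s (Abs_fps (\<lambda>m. g m * A (Suc i) m)) (?F' * R1)"
      by (rule fcong_trans[OF R(2) fcong_mult_left[OF RR1 F_Wf]])
    then have gR: "fcong s (Abs_fps (\<lambda>m. g m * A (Suc i) m)) (fps_X * (?F' * fps_shift 1 R1))"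
      by (simp only: mult.left_commute[of fps_X] XR2)
    have "fcong (Suc s) ?H (fps_const pK * (?F' * fps_shift 1 R1))"
      unfolding fcong_def
    proof
      fix m
      have "wcong s (g (Suc m) * A (Suc i) (Suc m)) (fps_nth (?F' * fps_shift 1 R1) m)"
        using gR[unfolded fcong_def, rule_format, of "Suc m"] by simp
      then have "wcong (Suc s) (pK * (g (Suc m) * A (Suc i) (Suc m))) (pK * fps_nth (?F' * fps_shift 1 R1) m)"
        by (rule wcong_pK_mult)
      moreover have "fps_nth ?H m = pK * (g (Suc m) * A (Suc i) (Suc m))"
        using w(2) by (simp add: g_def v_def algebra_simps)
      ultimately show "wcong (Suc s) (fps_nth ?H m) (fps_nth (fps_const pK * (?F' * fps_shift 1 R1)) m)" by simp
    qed
    then have "fcong (Suc s) (fps_X ^ k * psub ?H) (fps_X ^ k * psub (fps_const pK * (?F' * fps_shift 1 R1)))"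
      by (intro fcong_mult_left psub_fcong Wf_ring(7) Wf_X)
    also have "\<dots> = psub ?F' * (fps_X ^ k * (fps_const pK * psub (fps_shift 1 R1)))"
      by (simp only: psub_mult psub_const mult_ac)
    finally have 1: "fcong (Suc s) (fps_X ^ k * psub ?H) (psub ?F' * (fps_X ^ k * (fps_const pK * psub (fps_shift 1 R1))))" .
    have pR: "psub (fps_shift 1 R1) \<in> conv h" by (rule psub_conv[OF h hF R2])
    have S_C: "fps_X ^ k * (fps_const pK * psub (fps_shift 1 R1)) \<in> conv h"
      by (intro C(4) C(7) X_conv[OF h] const_conv[OF h] pR) simp
    have "fcong (Suc 0) (fps_const pK * psub (fps_shift 1 R1)) (fps_const pK * 0)"
      by (intro fcong_p_mult) (use Wf_nth[OF conv_Wf[OF h pR]] in \<open>simp add: fcong_def\<close>)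
    then have "fcong 1 (fps_X ^ k * (fps_const pK * psub (fps_shift 1 R1))) (fps_X ^ k * 0)"
      by (intro fcong_mult_left Wf_ring(7) Wf_X) simp
    then have 2: "fcong 1 (fps_X ^ k * (fps_const pK * psub (fps_shift 1 R1))) 0" by simp
    have "fcong 1 (fps_const (f k * A i k) * fps_X ^ k) (0 * fps_X ^ k)"
    proof (intro fcong_mult_right Wf_ring(7) Wf_X)
      have "A i k = pK * (w 0 * A (Suc i) 1)" using w(2)[rule_format, of 0] by (simp add: mult.assoc)
      then have "f k * A i k = pK ^ 1 * (f k * (w 0 * A (Suc i) 1))" by (simp add: mult_ac)
      then have "f k * A i k \<in> pW 1" by (intro pW_I[OF _ \<open>f k * A i k = _\<close>]) (auto simp: wlipD(1)[OF f] wlipD(1)[OF w(1)] A_W)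
      then show "fcong 1 (fps_const (f k * A i k)) 0" by (auto simp: fcong_def)
    qed
    then have "fcong 1 0 (fps_const (f k * A i k) * fps_X ^ k)" unfolding mult_zero_left by (rule fcong_sym)
    with 2 have "fcong 1 (fps_X ^ k * (fps_const pK * psub (fps_shift 1 R1))) (fps_const (f k * A i k) * fps_X ^ k)"
      by (rule fcong_trans)
    then show ?thesis using 1 S_C by blast
  }
qed

text \<open>Induction on \<open>s\<close>, for all Lipschitz \<open>f\<close> and all \<open>i\<close> at once. Summing the blocks gives \<open>G \<equiv> F'(t\<^sup>p)
  S\<close> for a convergent \<open>S\<close>, and for \<open>f = 1\<close> also \<open>F \<equiv> F'(t\<^sup>p) Q\<close>; so \<open>G \<equiv> F S/Q\<close>. Modulo \<open>p\<close>, \<open>S\<close> and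
  \<open>Q\<close> are the truncations, and \<open>Q\<close> is invertible because the truncation of \<open>F\<close> is.\<close>

lemma dwork_congruence:
  assumes "wlip f"
  shows "\<exists>R\<in>conv h. fcong s (Abs_fps (\<lambda>n. f n * A i n)) (Abs_fps (A i) * R) \<and>
    (s > 0 \<longrightarrow> fcong 1 (R * fps_cutoff CARD('p) (Abs_fps (A i))) (fps_cutoff CARD('p) (Abs_fps (\<lambda>n. f n * A i n))))"
  using assms
proof (induction s arbitrary: f i)
  case 0
  have "fcong 0 (Abs_fps (\<lambda>n. f n * A i n)) (Abs_fps (A i) * 0)"
    using Wf_nth[OF G_Wf[OF 0]] by (simp add: fcong_def)
  then show ?case using conv_ring(1)[OF h] by blast
next
  case (Suc s)
  let ?p = "CARD('p)" and ?F = "Abs_fps (A i)" and ?F' = "Abs_fps (A (Suc i))"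
  note C = conv_ring[OF h]
  have main: "\<exists>S\<in>conv h. fcong (Suc s) (Abs_fps (\<lambda>n. f n * A i n)) (psub ?F' * S) \<and>
       fcong 1 S (fps_cutoff ?p (Abs_fps (\<lambda>n. f n * A i n)))" if f: "wlip f" for f
  proof -
    let ?G = "Abs_fps (\<lambda>n. f n * A i n)"
    have "\<forall>k\<in>{..<?p}. \<exists>S. S \<in> conv h \<and> fcong (Suc s) (fps_X ^ k * psub (Abs_fps (\<lambda>m. fps_nth ?G (k + ?p * m)))) (psub ?F' * S)
          \<and> fcong 1 S (fps_const (f k * A i k) * fps_X ^ k)"
    proof
      fix k assume "k \<in> {..<?p}"
      then have k: "k < ?p" by simp
      have "\<exists>R\<in>conv h. fcong s (Abs_fps (\<lambda>m. w m * A (Suc i) m)) (Abs_fps (A (Suc i)) * R)" if "wlip w" for w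
        using Suc.IH[OF that, of "Suc i"] by blast
      from block_congruence[OF this f k]
      show "\<exists>S. S \<in> conv h \<and> fcong (Suc s) (fps_X ^ k * psub (Abs_fps (\<lambda>m. fps_nth ?G (k + ?p * m)))) (psub ?F' * S)
          \<and> fcong 1 S (fps_const (f k * A i k) * fps_X ^ k)" by auto
    qed
    from bchoice[OF this] obtain S where S: "\<And>k. k < ?p \<Longrightarrow> S k \<in> conv h"
      "\<And>k. k < ?p \<Longrightarrow> fcong (Suc s) (fps_X ^ k * psub (Abs_fps (\<lambda>m. fps_nth ?G (k + ?p * m)))) (psub ?F' * S k)"
      "\<And>k. k < ?p \<Longrightarrow> fcong 1 (S k) (fps_const (f k * A i k) * fps_X ^ k)" by auto
    have "?G = (\<Sum>k<?p. fps_X ^ k * psub (Abs_fps (\<lambda>m. fps_nth ?G (k + ?p * m))))" by (rule fps_blocks)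
    also have "fcong (Suc s) \<dots> (\<Sum>k<?p. psub ?F' * S k)" by (intro fcong_sum S(2)) simp
    also have "\<dots> = psub ?F' * (\<Sum>k<?p. S k)" by (simp add: sum_distrib_left)
    finally have 1: "fcong (Suc s) ?G (psub ?F' * (\<Sum>k<?p. S k))" .
    have "fcong 1 (\<Sum>k<?p. S k) (\<Sum>k<?p. fps_const (f k * A i k) * fps_X ^ k)" by (intro fcong_sum S(3)) simp
    also have "(\<Sum>k<?p. fps_const (f k * A i k) * fps_X ^ k) = fps_cutoff ?p ?G"
      by (rule fps_ext) (simp add: fps_sum_nth fps_X_power_nth if_distrib[of "\<lambda>x. _ * x"] cong: if_cong)
    finally have 2: "fcong 1 (\<Sum>k<?p. S k) (fps_cutoff ?p ?G)" .
    have "(\<Sum>k<?p. S k) \<in> conv h" by (rule C(9)) (simp add: S(1))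
    then show ?thesis using 1 2 by blast
  qed
  obtain Q where Q: "Q \<in> conv h" "fcong (Suc s) ?F (psub ?F' * Q)" "fcong 1 Q (fps_cutoff ?p ?F)"
    using main[OF wlip_const[OF W_1]] by auto
  obtain S where S: "S \<in> conv h" "fcong (Suc s) (Abs_fps (\<lambda>n. f n * A i n)) (psub ?F' * S)"
    "fcong 1 S (fps_cutoff ?p (Abs_fps (\<lambda>n. f n * A i n)))"
    using main[OF Suc.prems] by auto
  have cut0: "fps_nth (fps_cutoff ?p ?F) 0 = 1" by (simp add: A0)
  have cutinv: "fps_cutoff ?p ?F * inverse (fps_cutoff ?p ?F) = 1"
    using inverse_mult_eq_1[of "fps_cutoff ?p ?F"] cut0 by (simp add: mult.commute)
  have uQ: "Wunit (fps_nth Q 0)"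
    using Q(3)[unfolded fcong_def, rule_format, of 0] cut0 Wunit_cong[of 1 1 "fps_nth Q 0"] wcong_sym by auto
  have Qinv: "inverse Q \<in> conv h"
  proof (rule conv_inverse[OF h Q(1) unit[of i] _ uQ])
    have "fcong 1 (Q * inverse (fps_cutoff ?p ?F)) (fps_cutoff ?p ?F * inverse (fps_cutoff ?p ?F))"
      by (intro fcong_mult_right Q(3) conv_Wf[OF h] unit)
    then show "fcong 1 (Q * inverse (fps_cutoff ?p ?F)) 1" unfolding cutinv .
  qed
  have QQ: "Q * inverse Q = 1" using inverse_mult_eq_1[of Q] Wunit_nz[OF uQ] by (simp add: mult.commute)
  have QW: "inverse Q \<in> Wf" "S \<in> Wf" "Q \<in> Wf" using conv_Wf[OF h] Qinv S(1) Q(1) by auto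
  have R: "S * inverse Q \<in> conv h" by (rule C(4)[OF S(1) Qinv])
  have "fcong (Suc s) (?F * (S * inverse Q)) (psub ?F' * Q * (S * inverse Q))"
    by (intro fcong_mult_right Q(2) Wf_ring(4) QW)
  also have "psub ?F' * Q * (S * inverse Q) = psub ?F' * S * (Q * inverse Q)" by (simp only: mult_ac)
  also have "\<dots> = psub ?F' * S" unfolding QQ by simp
  also have "fcong (Suc s) \<dots> (Abs_fps (\<lambda>n. f n * A i n))" by (rule fcong_sym[OF S(2)])
  finally have 1: "fcong (Suc s) (Abs_fps (\<lambda>n. f n * A i n)) (?F * (S * inverse Q))" by (rule fcong_sym)
  have "fcong 1 (S * inverse Q * fps_cutoff ?p ?F) (S * inverse Q * Q)"
    by (intro fcong_mult_left fcong_sym[OF Q(3)] Wf_ring(4) QW)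
  also have "S * inverse Q * Q = S * (Q * inverse Q)" by (simp only: mult_ac)
  also have "\<dots> = S" unfolding QQ by simp
  also have "fcong 1 S (fps_cutoff ?p (Abs_fps (\<lambda>n. f n * A i n)))" by (rule S(3))
  finally show ?case using 1 R by blast
qed

theorem quotient_conv:
  fixes f :: "nat \<Rightarrow> 'p K" and i :: nat
  assumes f: "wlip f"
  defines "G \<equiv> Abs_fps (\<lambda>n. f n * A i n)"
  shows "G / Abs_fps (A i) \<in> conv h"
    and "fcong 1 (G / Abs_fps (A i) * fps_cutoff CARD('p) (Abs_fps (A i))) (fps_cutoff CARD('p) G)"
proof -
  let ?F = "Abs_fps (A i)"
  have F0: "fps_nth ?F 0 = 1" by (simp add: A0)
  have div: "G / ?F = G * inverse ?F" using F0 by (simp add: fps_divide_unit)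
  have iF: "inverse ?F \<in> Wf" by (rule Wf_inverse[OF F_Wf]) (simp add: A0)
  have FF: "?F * inverse ?F = 1" using inverse_mult_eq_1[of ?F] F0 by (simp add: mult.commute)
  have GW: "G / ?F \<in> Wf" unfolding div by (rule Wf_ring(4)[OF _ iF]) (simp add: G_def G_Wf[OF f])
  have appr: "fcong s (G / ?F) R" if "fcong s G (?F * R)" for s R
  proof -
    have "fcong s (G * inverse ?F) (?F * R * inverse ?F)" by (rule fcong_mult_right[OF that iF])
    also have "?F * R * inverse ?F = R * (?F * inverse ?F)" by (simp only: mult_ac)
    also have "\<dots> = R" unfolding FF by simp
    finally show ?thesis unfolding div .
  qed
  have "\<exists>b\<in>conv h. fcong n (G / ?F) b" for n
    using dwork_congruence[OF f, of n i] appr[of n, unfolded G_def] unfolding G_def by blast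
  then show "G / ?F \<in> conv h" by (rule conv_closed[OF h GW])
  obtain R where R: "R \<in> conv h" "fcong 1 G (?F * R)" "fcong 1 (R * fps_cutoff CARD('p) ?F) (fps_cutoff CARD('p) G)"
    using dwork_congruence[OF f, of 1 i] unfolding G_def by auto
  have "fps_cutoff CARD('p) ?F \<in> Wf" by (auto simp: Wf_def A_W)
  then have "fcong 1 (G / ?F * fps_cutoff CARD('p) ?F) (R * fps_cutoff CARD('p) ?F)"
    by (intro fcong_mult_right appr R(2))
  then show "fcong 1 (G / ?F * fps_cutoff CARD('p) ?F) (fps_cutoff CARD('p) G)"
    by (rule fcong_trans[OF _ R(3)])
qed

end

section \<open>p-adic completions as inverse limits\<close>

definition pcos :: "nat \<Rightarrow> 'a::comm_ring_1 set \<Rightarrow> nat \<Rightarrow> 'a \<Rightarrow> 'a set" where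
  "pcos p A n x = {y. pcong p A n y x}"

definition pseq :: "nat \<Rightarrow> 'a::comm_ring_1 set \<Rightarrow> (nat \<Rightarrow> 'a) \<Rightarrow> bool" where
  "pseq p A w \<longleftrightarrow> (\<forall>n. w n \<in> A \<and> pcong p A n (w (Suc n)) (w n))"

text \<open>The element of the inverse limit that is represented by a compatible sequence in \<open>A\<close>.\<close>

definition pmk :: "nat \<Rightarrow> 'a::comm_ring_1 set \<Rightarrow> (nat \<Rightarrow> 'a) \<Rightarrow> nat \<Rightarrow> 'a set" where
  "pmk p A w = (\<lambda>n. pcos p A n (w n))"

lemma subring_of_simps [simp]:
  "carrier (subring_of A) = A" "monoid.mult (subring_of A) = (*)" "one (subring_of A) = 1"
  "zero (subring_of A) = 0" "ring.add (subring_of A) = (+)"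
  by (simp_all add: subring_of_def)

lemma cring_subring_of:
  assumes A: "subring_set A" shows "cring (subring_of A)"
proof (rule cringI)
  note A' = subring_setD[OF A]
  show "abelian_group (subring_of A)"
  proof (rule abelian_groupI)
    fix x assume "x \<in> carrier (subring_of A)"
    then show "\<exists>y\<in>carrier (subring_of A). y \<oplus>\<^bsub>subring_of A\<^esub> x = \<zero>\<^bsub>subring_of A\<^esub>"
      using A'(5)[of x] by (intro bexI[of _ "- x"]) auto
  qed (auto simp: A' algebra_simps)
  show "comm_monoid (subring_of A)"
    by (rule comm_monoidI) (auto simp: A' algebra_simps)
qed (auto simp: algebra_simps)

context
  fixes p :: nat and A :: "'a::comm_ring_1 set"
  assumes A: "subring_set A"
begin

lemmas A_ring = subring_setD[OF A]

lemma p_ideal_eq: "p_ideal p A n = {x. pcong p A n x 0}"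
  unfolding p_ideal_def cgenideal_def pcong_def by (auto simp: mult.commute)

lemma ideal_p_ideal: "ideal (p_ideal p A n) (subring_of A)"
  unfolding p_ideal_def
  by (rule cring.cgenideal_ideal[OF cring_subring_of[OF A]]) (simp add: A_ring(7,8))

lemma coset_pcos: "p_ideal p A n +>\<^bsub>subring_of A\<^esub> x = pcos p A n x"
proof -
  have "p_ideal p A n +>\<^bsub>subring_of A\<^esub> x = (\<Union>h\<in>p_ideal p A n. {h + x})"
    by (simp add: a_r_coset_def')
  also have "\<dots> = pcos p A n x"
  proof (intro Set.set_eqI iffI)
    fix y assume "y \<in> pcos p A n x"
    then have "y - x \<in> p_ideal p A n" by (simp add: pcos_def p_ideal_eq pcong_def)
    then show "y \<in> (\<Union>h\<in>p_ideal p A n. {h + x})" by (intro UN_I[of "y - x"]) auto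
  qed (auto simp: pcos_def p_ideal_eq pcong_def)
  finally show ?thesis .
qed

lemma pcos_eq_iff: "pcos p A n x = pcos p A n y \<longleftrightarrow> pcong p A n x y"
proof
  assume "pcos p A n x = pcos p A n y"
  then show "pcong p A n x y" using pcong_refl[OF A, of p n x] by (auto simp: pcos_def)
next
  assume xy: "pcong p A n x y"
  show "pcos p A n x = pcos p A n y"
    unfolding pcos_def using pcong_trans[OF A _ xy] pcong_trans[OF A _ pcong_sym[OF A xy]] by blast
qed

lemma p_quot_carrier: "carrier (p_quot p A n) = pcos p A n ` A"
  by (auto simp: p_quot_def FactRing_def A_RCOSETS_def' coset_pcos)

lemma p_quot_simps:
  "\<one>\<^bsub>p_quot p A n\<^esub> = pcos p A n 1" "\<zero>\<^bsub>p_quot p A n\<^esub> = pcos p A n 0"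
  by (simp_all add: p_quot_def FactRing_def coset_pcos) (simp add: pcos_def p_ideal_eq)

lemma p_quot_ops:
  assumes "x \<in> A" "y \<in> A"
  shows "pcos p A n x \<otimes>\<^bsub>p_quot p A n\<^esub> pcos p A n y = pcos p A n (x * y)"
    and "pcos p A n x \<oplus>\<^bsub>p_quot p A n\<^esub> pcos p A n y = pcos p A n (x + y)"
proof -
  interpret I: ideal "p_ideal p A n" "subring_of A" by (rule ideal_p_ideal)
  show "pcos p A n x \<otimes>\<^bsub>p_quot p A n\<^esub> pcos p A n y = pcos p A n (x * y)"
    using I.rcoset_mult_add[of x y] assms by (simp add: p_quot_def FactRing_def coset_pcos)
  show "pcos p A n x \<oplus>\<^bsub>p_quot p A n\<^esub> pcos p A n y = pcos p A n (x + y)"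
    using I.a_rcos_sum[of x y] assms by (simp add: p_quot_def FactRing_def coset_pcos)
qed

lemma pseqD: "pseq p A w \<Longrightarrow> w n \<in> A" "pseq p A w \<Longrightarrow> pcong p A n (w (Suc n)) (w n)"
  by (simp_all add: pseq_def)

lemma pseqI: "(\<And>n. w n \<in> A) \<Longrightarrow> (\<And>n. pcong p A n (w (Suc n)) (w n)) \<Longrightarrow> pseq p A w"
  by (simp add: pseq_def)

lemma pmk_eq_iff: "pmk p A w = pmk p A v \<longleftrightarrow> (\<forall>n. pcong p A n (w n) (v n))"
  unfolding pmk_def fun_eq_iff pcos_eq_iff ..

text \<open>Cosets are nonempty, so representatives can be chosen; the inclusions between the cosets are the
  compatibility of the representatives.\<close>

lemma p_completion_carrier: "carrier (p_completion p A) = pmk p A ` {w. pseq p A w}"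
proof (intro Set.set_eqI iffI)
  fix x assume "x \<in> carrier (p_completion p A)"
  then have x: "\<And>n. x n \<in> pcos p A n ` A" "\<And>n. x (Suc n) \<subseteq> x n"
    by (auto simp: p_completion_def p_quot_carrier)
  then have "\<forall>n. \<exists>w. w \<in> A \<and> x n = pcos p A n w" by blast
  then obtain w where w: "\<And>n. w n \<in> A" "\<And>n. x n = pcos p A n (w n)" by metis
  have "pcong p A n (w (Suc n)) (w n)" for n
  proof -
    have "w (Suc n) \<in> x (Suc n)" unfolding w(2) pcos_def by (simp add: pcong_refl[OF A])
    then have "w (Suc n) \<in> x n" using x(2) by blast
    then show ?thesis unfolding w(2) pcos_def by simp
  qed
  then have "pseq p A w" using w(1) by (simp add: pseq_def)
  moreover have "x = pmk p A w" unfolding pmk_def using w(2) by blast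
  ultimately show "x \<in> pmk p A ` {w. pseq p A w}" by blast
next
  fix x assume "x \<in> pmk p A ` {w. pseq p A w}"
  then obtain w where w: "pseq p A w" "x = pmk p A w" by blast
  have "x (Suc n) \<subseteq> x n" for n
  proof
    fix y assume "y \<in> x (Suc n)"
    then have "pcong p A (Suc n) y (w (Suc n))" by (simp add: w(2) pmk_def pcos_def)
    then have "pcong p A n y (w (Suc n))" by (rule pcong_mono[OF A]) simp
    then have "pcong p A n y (w n)" by (rule pcong_trans[OF A _ pseqD(2)[OF w(1)]])
    then show "y \<in> x n" by (simp add: w(2) pmk_def pcos_def)
  qed
  then show "x \<in> carrier (p_completion p A)"
    using pseqD(1)[OF w(1)] by (auto simp: p_completion_def p_quot_carrier w(2) pmk_def)
qed

lemma pmk_carrier: "pseq p A w \<Longrightarrow> pmk p A w \<in> carrier (p_completion p A)"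
  by (simp add: p_completion_carrier)

lemma p_completion_cases:
  assumes "x \<in> carrier (p_completion p A)" obtains w where "pseq p A w" "x = pmk p A w"
  using assms unfolding p_completion_carrier by blast

lemma pmk_mult: "pseq p A w \<Longrightarrow> pseq p A v \<Longrightarrow> pmk p A w \<otimes>\<^bsub>p_completion p A\<^esub> pmk p A v = pmk p A (\<lambda>n. w n * v n)"
  by (simp add: p_completion_def pmk_def p_quot_ops pseqD)

lemma pmk_add: "pseq p A w \<Longrightarrow> pseq p A v \<Longrightarrow> pmk p A w \<oplus>\<^bsub>p_completion p A\<^esub> pmk p A v = pmk p A (\<lambda>n. w n + v n)"
  by (simp add: p_completion_def pmk_def p_quot_ops pseqD)

lemma pmk_one: "\<one>\<^bsub>p_completion p A\<^esub> = pmk p A (\<lambda>_. 1)"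
  and pmk_zero: "\<zero>\<^bsub>p_completion p A\<^esub> = pmk p A (\<lambda>_. 0)"
  by (simp_all add: p_completion_def pmk_def p_quot_simps)

lemma pseq_const: "x \<in> A \<Longrightarrow> pseq p A (\<lambda>_. x)"
  by (simp add: pseq_def pcong_refl[OF A])

lemma pseq_mult: "pseq p A w \<Longrightarrow> pseq p A v \<Longrightarrow> pseq p A (\<lambda>n. w n * v n)"
  unfolding pseq_def using A_ring(4) pcong_mult[OF A] by blast
lemma pseq_add: "pseq p A w \<Longrightarrow> pseq p A v \<Longrightarrow> pseq p A (\<lambda>n. w n + v n)"
  unfolding pseq_def using A_ring(3) pcong_add[OF A] by blast
lemma pseq_minus: "pseq p A w \<Longrightarrow> pseq p A (\<lambda>n. - w n)"
  unfolding pseq_def using A_ring(5) pcong_minus[OF A] by blast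

lemma p_const_pmk: "p_const p A x = pmk p A (\<lambda>_. x)"
  by (simp add: p_const_def pmk_def coset_pcos)

lemma cring_p_completion: "cring (p_completion p A)"
proof (rule cringI)
  let ?C = "p_completion p A"
  show "abelian_group ?C"
  proof (rule abelian_groupI)
    fix x y assume "x \<in> carrier ?C" "y \<in> carrier ?C"
    then obtain w v where w: "pseq p A w" "x = pmk p A w" and v: "pseq p A v" "y = pmk p A v"
      by (elim p_completion_cases)
    show "x \<oplus>\<^bsub>?C\<^esub> y \<in> carrier ?C" by (simp add: w v pmk_add pseq_add pmk_carrier)
    show "x \<oplus>\<^bsub>?C\<^esub> y = y \<oplus>\<^bsub>?C\<^esub> x" by (simp add: w v pmk_add add.commute)
    fix z assume "z \<in> carrier ?C"
    then obtain u where u: "pseq p A u" "z = pmk p A u" by (elim p_completion_cases)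
    show "x \<oplus>\<^bsub>?C\<^esub> y \<oplus>\<^bsub>?C\<^esub> z = x \<oplus>\<^bsub>?C\<^esub> (y \<oplus>\<^bsub>?C\<^esub> z)" by (simp add: w v u pmk_add pseq_add add.assoc)
  next
    show "\<zero>\<^bsub>?C\<^esub> \<in> carrier ?C" by (simp add: pmk_zero pmk_carrier pseq_const A_ring(1))
    fix x assume "x \<in> carrier ?C"
    then obtain w where w: "pseq p A w" "x = pmk p A w" by (elim p_completion_cases)
    show "\<zero>\<^bsub>?C\<^esub> \<oplus>\<^bsub>?C\<^esub> x = x" by (simp add: w pmk_zero pmk_add pseq_const A_ring(1))
    show "\<exists>y\<in>carrier ?C. y \<oplus>\<^bsub>?C\<^esub> x = \<zero>\<^bsub>?C\<^esub>"
      using w by (intro bexI[of _ "pmk p A (\<lambda>n. - w n)"]) (simp_all add: pmk_zero pmk_add pmk_carrier pseq_minus)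
  qed
  show "comm_monoid ?C"
  proof (rule comm_monoidI)
    fix x y assume "x \<in> carrier ?C" "y \<in> carrier ?C"
    then obtain w v where w: "pseq p A w" "x = pmk p A w" and v: "pseq p A v" "y = pmk p A v"
      by (elim p_completion_cases)
    show "x \<otimes>\<^bsub>?C\<^esub> y \<in> carrier ?C" by (simp add: w v pmk_mult pseq_mult pmk_carrier)
    show "x \<otimes>\<^bsub>?C\<^esub> y = y \<otimes>\<^bsub>?C\<^esub> x" by (simp add: w v pmk_mult mult.commute)
    fix z assume "z \<in> carrier ?C"
    then obtain u where u: "pseq p A u" "z = pmk p A u" by (elim p_completion_cases)
    show "x \<otimes>\<^bsub>?C\<^esub> y \<otimes>\<^bsub>?C\<^esub> z = x \<otimes>\<^bsub>?C\<^esub> (y \<otimes>\<^bsub>?C\<^esub> z)" by (simp add: w v u pmk_mult pseq_mult mult.assoc)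
  next
    show "\<one>\<^bsub>?C\<^esub> \<in> carrier ?C" by (simp add: pmk_one pmk_carrier pseq_const A_ring(2))
    fix x assume "x \<in> carrier ?C"
    then obtain w where w: "pseq p A w" "x = pmk p A w" by (elim p_completion_cases)
    show "\<one>\<^bsub>?C\<^esub> \<otimes>\<^bsub>?C\<^esub> x = x" by (simp add: w pmk_one pmk_mult pseq_const A_ring(2))
  qed
  fix x y z assume "x \<in> carrier ?C" "y \<in> carrier ?C" "z \<in> carrier ?C"
  then obtain w v u where "pseq p A w" "x = pmk p A w" "pseq p A v" "y = pmk p A v" "pseq p A u" "z = pmk p A u"
    by (elim p_completion_cases)
  then show "(x \<oplus>\<^bsub>?C\<^esub> y) \<otimes>\<^bsub>?C\<^esub> z = x \<otimes>\<^bsub>?C\<^esub> z \<oplus>\<^bsub>?C\<^esub> y \<otimes>\<^bsub>?C\<^esub> z"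
    by (simp add: pmk_mult pmk_add pseq_add pseq_mult distrib_right)
qed

lemma pmk_minus:
  assumes w: "pseq p A w" shows "\<ominus>\<^bsub>p_completion p A\<^esub> pmk p A w = pmk p A (\<lambda>n. - w n)"
proof -
  interpret C: cring "p_completion p A" by (rule cring_p_completion)
  show ?thesis
    using w by (intro C.minus_equality) (simp_all add: pmk_zero pmk_add pmk_carrier pseq_minus)
qed

lemma pmk_add_pow: "[k] \<cdot>\<^bsub>p_completion p A\<^esub> \<one>\<^bsub>p_completion p A\<^esub> = pmk p A (\<lambda>_. of_nat k)" for k :: nat
proof (induction k)
  case 0
  show ?case by (simp add: add_pow_def pmk_zero nat_pow_def)
next
  case (Suc k)
  have "[Suc k] \<cdot>\<^bsub>p_completion p A\<^esub> \<one>\<^bsub>p_completion p A\<^esub>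
      = [k] \<cdot>\<^bsub>p_completion p A\<^esub> \<one>\<^bsub>p_completion p A\<^esub> \<oplus>\<^bsub>p_completion p A\<^esub> \<one>\<^bsub>p_completion p A\<^esub>"
    by (simp add: add_pow_def nat_pow_def)
  then show ?case using Suc
    by (simp add: pmk_one pmk_add pseq_const A_ring(2,8) add.commute)
qed

lemma p_incl_pmk:
  assumes B: "A \<subseteq> B" "subring_set B"
  shows "p_incl p B (pmk p A w) = pmk p B w"
proof
  fix n
  have "p_ideal p B n <+>\<^bsub>subring_of B\<^esub> pcos p A n (w n) = pcos p B n (w n)"
  proof (intro Set.set_eqI iffI)
    fix y assume "y \<in> p_ideal p B n <+>\<^bsub>subring_of B\<^esub> pcos p A n (w n)"
    then obtain i x where "i \<in> p_ideal p B n" "pcong p A n x (w n)" "y = i + x"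
      by (auto simp: set_add_def' pcos_def)
    then have "pcong p B n i 0" "pcong p B n x (w n)" "y = i + x"
      using B(1) unfolding p_ideal_def cgenideal_def pcong_def by (auto simp: mult.commute)
    then have "pcong p B n (i + x) (0 + w n)" by (intro pcong_add[OF B(2)])
    then show "y \<in> pcos p B n (w n)" using \<open>y = i + x\<close> by (simp add: pcos_def)
  next
    fix y assume "y \<in> pcos p B n (w n)"
    then have "y - w n \<in> p_ideal p B n"
      unfolding p_ideal_def cgenideal_def pcos_def pcong_def by (auto simp: mult.commute)
    moreover have "w n \<in> pcos p A n (w n)" by (simp add: pcos_def pcong_refl[OF A])
    ultimately show "y \<in> p_ideal p B n <+>\<^bsub>subring_of B\<^esub> pcos p A n (w n)"
      unfolding set_add_def' by (intro UN_I[of "y - w n"] UN_I[of "w n"]) auto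
  qed
  then show "p_incl p B (pmk p A w) n = pmk p B w n" by (simp add: p_incl_def pmk_def)
qed

text \<open>The quotients of the later components by \<open>p\<^sup>n\<close> form a compatible sequence, as \<open>p\<close> is not a zero
  divisor.\<close>

lemma pmk_divide:
  assumes tf: "\<And>x :: 'a. of_nat p * x = 0 \<Longrightarrow> x = 0"
    and d: "pseq p A d" and n: "pcong p A n (d n) 0"
  shows "\<exists>z. pseq p A z \<and> pmk p A d = pmk p A (\<lambda>k. z k * of_nat p ^ n)"
proof -
  have tf': "of_nat p ^ k * x = 0 \<Longrightarrow> x = 0" for k and x :: 'a
    by (induction k) (auto simp: mult.assoc dest: tf)
  have shift: "pcong p A k (d (k + j)) (d k)" for k j
  proof (induction j)
    case (Suc j)
    have "pcong p A k (d (k + Suc j)) (d (k + j))"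
      using pcong_mono[OF A pseqD(2)[OF d, of "k + j"], of k] by simp
    then show ?case by (rule pcong_trans[OF A _ Suc])
  qed (simp add: pcong_refl[OF A])
  have "\<exists>z. z \<in> A \<and> d (n + k) = of_nat p ^ n * z" for k
    using pcong_trans[OF A shift n, of k] unfolding pcong_def by auto
  then obtain z where z: "\<And>k. z k \<in> A" "\<And>k. d (n + k) = of_nat p ^ n * z k" by metis
  have zs: "pseq p A z"
  proof (rule pseqI[OF z(1)])
    fix k
    obtain y where y: "y \<in> A" "d (Suc (n + k)) - d (n + k) = of_nat p ^ (n + k) * y"
      using pseqD(2)[OF d, of "n + k"] unfolding pcong_def by blast
    have "of_nat p ^ n * (z (Suc k) - z k - of_nat p ^ k * y) = 0"
      using y(2) z(2)[of k] z(2)[of "Suc k"] by (simp add: algebra_simps power_add)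
    then have "z (Suc k) - z k = of_nat p ^ k * y" using tf' by fastforce
    then show "pcong p A k (z (Suc k)) (z k)" unfolding pcong_def using y(1) by blast
  qed
  have "pmk p A d = pmk p A (\<lambda>k. z k * of_nat p ^ n)"
    unfolding pmk_eq_iff
  proof
    fix k
    have "pcong p A k (d (n + k)) (d k)" using shift[of k n] by (simp add: add.commute)
    then have "pcong p A k (d k) (d (n + k))" by (rule pcong_sym[OF A])
    then show "pcong p A k (d k) (z k * of_nat p ^ n)" unfolding z(2) by (simp add: mult.commute)
  qed
  then show ?thesis using zs by blast
qed

text \<open>A congruence modulo \<open>p\<close> in the completion is one of the first components.\<close>

lemma ring_cong_pmk:
  assumes tf: "\<And>x :: 'a. of_nat p * x = 0 \<Longrightarrow> x = 0"
    and w: "pseq p A w" and v: "pseq p A v" and 1: "pcong p A 1 (w 1) (v 1)"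
  shows "ring_cong (p_completion p A) p (pmk p A w) (pmk p A v)"
proof -
  let ?C = "p_completion p A"
  define d where "d = (\<lambda>n. w n - v n)"
  have d: "pseq p A d" using pseq_add[OF w pseq_minus[OF v]] by (simp add: d_def)
  have "pcong p A 1 (d 1) 0"
    using pcong_diff[OF A 1 pcong_refl[OF A, of p 1 "v 1"]] by (simp add: d_def)
  from pmk_divide[OF tf d this] obtain z where z: "pseq p A z" "pmk p A d = pmk p A (\<lambda>k. z k * of_nat p)"
    by auto
  have "pmk p A w \<ominus>\<^bsub>?C\<^esub> pmk p A v = pmk p A d"
    by (simp add: a_minus_def pmk_minus[OF v] pmk_add[OF w pseq_minus[OF v]] d_def)
  also have "\<dots> = pmk p A z \<otimes>\<^bsub>?C\<^esub> ([p] \<cdot>\<^bsub>?C\<^esub> \<one>\<^bsub>?C\<^esub>)"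
    unfolding pmk_add_pow z(2) by (simp add: pmk_mult z(1) pseq_const A_ring(8))
  finally show ?thesis unfolding ring_cong_def cgenideal_def using pmk_carrier[OF z(1)] by blast
qed

end

section \<open>The Gauss valuation ring of K(t)\<close>

lemma Fract_emb: "q \<noteq> 0 \<Longrightarrow> Fract g q = emb g / emb q"
  by simp

lemma is_hom_emb: "is_hom (emb :: 'a::idom \<Rightarrow> 'a fract)"
  unfolding is_hom_def by (intro conjI allI emb_simps)

lemma emb_0_iff [simp]: "emb g = 0 \<longleftrightarrow> g = (0 :: 'a::idom)"
  using emb_inj[of g 0] by (simp add: emb_simps)

lemma is_hom_Kt_const: "is_hom (Kt_const :: 'p::prime_card K \<Rightarrow> 'p Kt)"
  unfolding is_hom_def Kt_const_def
proof (intro conjI allI)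
  show "emb [:0 :: 'p K:] = 0" by simp
  show "emb [:1 :: 'p K:] = 1" by (simp only: emb_simps(6)[symmetric] one_pCons)
  fix x y :: "'p K"
  have "[:x + y:] = [:x:] + [:y:]" "[:x * y:] = [:x:] * [:y:]" by simp_all
  then show "emb [:x + y:] = emb [:x:] + emb [:y:]" "emb [:x * y:] = emb [:x:] * emb [:y:]"
    by (simp_all only: emb_simps)
qed

lemma Kt_t_nz [simp]: "(Kt_t :: 'p::prime_card Kt) \<noteq> 0"
  by (simp add: Kt_t_def)

lemma emb_pCons: "emb (pCons a g) = Kt_const a + Kt_t * emb (g :: 'p::prime_card K poly)"
proof -
  have "pCons a g = [:a:] + [:0, 1:] * g" by simp
  then show ?thesis unfolding Kt_const_def Kt_t_def by (metis emb_simps(1,2))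
qed

abbreviation pKt :: "'p::prime_card Kt" where "pKt \<equiv> of_nat CARD('p)"

lemma pKt_emb: "(pKt :: 'p::prime_card Kt) ^ n * emb g = emb (smult (pK ^ n) g)"
proof -
  have "(pKt :: 'p Kt) = emb [:pK:]" by (simp only: emb_simps(8)[symmetric] of_nat_poly)
  then have "pKt ^ n = emb ([:pK:] ^ n :: 'p K poly)" by (simp only: emb_simps(7))
  then have "pKt ^ n * emb g = emb ([:pK:] ^ n * g)" by (simp only: emb_simps(2))
  then show ?thesis by (simp add: poly_const_pow)
qed

lemma pKt_nz: "(pKt :: 'p::prime_card Kt) \<noteq> 0"
proof -
  have "(pKt :: 'p Kt) = emb [:pK:]" by (simp only: emb_simps(8)[symmetric] of_nat_poly)
  then show ?thesis unfolding emb_0_iff by simp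
qed

lemma pKt_tf: "pKt * x = 0 \<Longrightarrow> x = (0 :: 'p::prime_card Kt)"
  using pKt_nz[where 'p='p] by simp

definition pWp :: "nat \<Rightarrow> 'p::prime_card K poly set" where
  "pWp n = {g. \<forall>i. coeff g i \<in> pW n}"

lemma pWp_0 [simp]: "pWp 0 = W_poly" by (simp add: pWp_def W_poly_def)

lemma pWp_iff: "g \<in> pWp n \<longleftrightarrow> (\<exists>g'\<in>W_poly. g = smult (pK ^ n) (g' :: 'p::prime_card K poly))"
proof
  assume g: "g \<in> pWp n"
  have "smult (inverse (pK ^ n)) g \<in> W_poly"
    unfolding W_poly_def
  proof (intro CollectI allI)
    fix i
    have "coeff g i \<in> pW n" using g by (simp add: pWp_def)
    then obtain y where "y \<in> W" "coeff g i = pK ^ n * y" by (rule pW_E)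
    moreover have "inverse (pK ^ n) * (pK ^ n * y) = y" by (simp add: mult.assoc[symmetric])
    ultimately show "coeff (smult (inverse (pK ^ n)) g) i \<in> W" by (simp only: coeff_smult)
  qed
  moreover have "g = smult (pK ^ n) (smult (inverse (pK ^ n)) g)" by simp
  ultimately show "\<exists>g'\<in>W_poly. g = smult (pK ^ n) g'" by blast
next
  assume "\<exists>g'\<in>W_poly. g = smult (pK ^ n) g'"
  then show "g \<in> pWp n" unfolding pWp_def W_poly_def by (auto intro!: pW_mult_W)
qed

text \<open>Compare the coefficient at the sum of the lowest degrees at which the factors do not vanish modulo
  \<open>p\<close>.\<close>

lemma Gauss_lemma:
  assumes "g \<in> W_poly" "q \<in> W_poly" "g \<notin> pWp 1" "q \<notin> pWp 1" shows "g * q \<notin> pWp 1"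
proof
  assume gq: "g * q \<in> pWp 1"
  define i where "i = (LEAST i. coeff g i \<notin> pW 1)"
  define j where "j = (LEAST j. coeff q j \<notin> pW 1)"
  have ex: "\<exists>i. coeff g i \<notin> pW 1" "\<exists>j. coeff q j \<notin> pW 1" using assms(3,4) by (auto simp: pWp_def)
  have i: "coeff g i \<notin> pW 1" "\<And>k. k < i \<Longrightarrow> coeff g k \<in> pW 1"
    unfolding i_def using LeastI_ex[OF ex(1)] not_less_Least[of _ "\<lambda>i. coeff g i \<notin> pW 1"] by blast+
  have j: "coeff q j \<notin> pW 1" "\<And>k. k < j \<Longrightarrow> coeff q k \<in> pW 1"
    unfolding j_def using LeastI_ex[OF ex(2)] not_less_Least[of _ "\<lambda>i. coeff q i \<notin> pW 1"] by blast+
  have W: "coeff g k \<in> W" "coeff q k \<in> W" for k using assms(1,2) by (auto simp: W_poly_def)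
  have "coeff (g * q) (i + j) = (\<Sum>k\<le>i + j. coeff g k * coeff q (i + j - k))" by (rule coeff_mult)
  also have "\<dots> = coeff g i * coeff q j + (\<Sum>k\<in>{..i + j} - {i}. coeff g k * coeff q (i + j - k))"
    by (subst sum.remove[of _ i]) auto
  finally have "coeff g i * coeff q j = coeff (g * q) (i + j) - (\<Sum>k\<in>{..i + j} - {i}. coeff g k * coeff q (i + j - k))"
    by simp
  also have "\<dots> \<in> pW 1"
  proof (intro pW_diff pW_sum)
    show "coeff (g * q) (i + j) \<in> pW 1" using gq unfolding pWp_def by blast
    fix k assume k: "k \<in> {..i + j} - {i}"
    show "coeff g k * coeff q (i + j - k) \<in> pW 1"
    proof (cases "k < i")
      case True
      then show ?thesis using i(2) W by (intro pW_mult_W)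
    next
      case False
      then have "i + j - k < j" using k by auto
      then show ?thesis using j(2) W by (intro W_mult_pW)
    qed
  qed
  finally show False using pW_prime W i(1) j(1) by blast
qed

lemma Gauss_power:
  assumes "q \<in> W_poly" "q \<notin> pWp 1" shows "q ^ k \<notin> pWp 1"
proof (induction k)
  case 0
  show ?case using one_notin_pW[of 0] by (auto simp: pWp_def dest: spec[of _ 0])
next
  case (Suc k)
  then show ?case using Gauss_lemma[OF assms(1) W_poly_ring(7)[OF assms(1)] assms(2)] by simp
qed

lemma Gauss_cancel:
  assumes "g \<in> W_poly" "q \<in> W_poly" "q \<notin> pWp 1" "g * q \<in> pWp n" shows "g \<in> pWp n"
  using assms(1,4)
proof (induction n arbitrary: g)
  case (Suc n)
  have "coeff (g * q) i \<in> pW 1" for i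
    by (rule pW_mono[of _ "Suc n"]) (use Suc.prems(2) in \<open>auto simp: pWp_def\<close>)
  then have "g * q \<in> pWp 1" by (simp add: pWp_def)
  then have "g \<in> pWp 1" using Gauss_lemma[OF Suc.prems(1) assms(2) _ assms(3)] by blast
  then obtain g' where g': "g' \<in> W_poly" "g = smult (pK ^ 1) g'" unfolding pWp_iff by blast
  have "g' * q \<in> pWp n" using Suc.prems(2) unfolding g'(2) pWp_def by (simp add: pW_scale1)
  then have "g' \<in> pWp n" using Suc.IH g'(1) by blast
  then show ?case unfolding g'(2) pWp_def by (simp add: pW_scale1)
qed simp

text \<open>The valuation ring of the Gauss valuation on \<open>K(t)\<close>: quotients whose denominator is nonzero modulo
  \<open>p\<close>. It contains all localizations that occur here and is stable under \<open>t \<mapsto> t\<^sup>-\<^sup>1\<close>, which these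
  are not.\<close>

definition OG :: "'p::prime_card Kt set" where
  "OG = {emb g / emb q | g q. g \<in> W_poly \<and> q \<in> W_poly \<and> q \<notin> pWp 1}"

lemma zero_pWp [simp]: "0 \<in> pWp n" by (simp add: pWp_def)

lemma OG_I: "g \<in> W_poly \<Longrightarrow> q \<in> W_poly \<Longrightarrow> q \<notin> pWp 1 \<Longrightarrow> emb g / emb q \<in> OG"
  unfolding OG_def by blast

lemma one_W_poly: "1 \<in> W_poly" "1 \<notin> pWp 1"
  using W_poly_ring(2) one_notin_pW[of 0] by (auto simp: pWp_def dest: spec[of _ 0])

lemma OG_poly: "g \<in> W_poly \<Longrightarrow> emb g \<in> OG"
  using OG_I[OF _ one_W_poly, of g] by (simp add: emb_simps del: divide_fract)

lemma subring_OG: "subring_set (OG :: 'p::prime_card Kt set)"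
  unfolding subring_set_def
proof (intro conjI ballI)
  show "0 \<in> (OG :: 'p Kt set)" using OG_poly[OF W_poly_ring(1)] by (simp only: emb_simps)
  show "1 \<in> (OG :: 'p Kt set)" using OG_poly[OF W_poly_ring(2)] by (simp only: emb_simps)
next
  fix x y :: "'p Kt" assume "x \<in> OG" "y \<in> OG"
  then obtain g q g' q' where x: "x = emb g / emb q" "g \<in> W_poly" "q \<in> W_poly" "q \<notin> pWp 1"
    and y: "y = emb g' / emb q'" "g' \<in> W_poly" "q' \<in> W_poly" "q' \<notin> pWp 1" unfolding OG_def by blast
  have nz: "q \<noteq> 0" "q' \<noteq> 0" using x(4) y(4) by auto
  have q: "q * q' \<in> W_poly" "q * q' \<notin> pWp 1" using W_poly_ring(4) Gauss_lemma x y by blast+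
  have "x + y = emb (g * q' + g' * q) / emb (q * q')" using nz unfolding x(1) y(1) by simp
  moreover have "g * q' + g' * q \<in> W_poly" using W_poly_ring(3,4) x y by blast
  ultimately show "x + y \<in> OG" using OG_I q by metis
  have "x * y = emb (g * g') / emb (q * q')" using nz unfolding x(1) y(1) by simp
  moreover have "g * g' \<in> W_poly" using W_poly_ring(4) x y by blast
  ultimately show "x * y \<in> OG" using OG_I q by metis
next
  fix x :: "'p Kt" assume "x \<in> OG"
  then obtain g q where x: "x = emb g / emb q" "g \<in> W_poly" "q \<in> W_poly" "q \<notin> pWp 1" unfolding OG_def by blast
  have "- x = emb (- g) / emb q" unfolding x(1) by simp
  then show "- x \<in> OG" using OG_I W_poly_ring(5) x by metis
qed

lemmas OG_ring = subring_setD[OF subring_OG]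

section \<open>Localizations of W[t]\<close>

lemma inv_emb: "inverse (emb r) ^ k = 1 / emb (r ^ k :: 'a::idom)"
  by (simp only: emb_simps(7) power_inverse[symmetric] inverse_eq_divide[symmetric] power_one)

context
  fixes r :: "'p::prime_card K poly"
  assumes r: "r \<in> W_poly" "r \<notin> pWp 1"
begin

lemma r_nz: "r \<noteq> 0" using r(2) by auto

lemma W_loc_eq: "W_loc r = {emb g * inverse (emb r) ^ k | g k. g \<in> W_poly}"
proof -
  have "Fract g (r ^ k) = emb g * inverse (emb r) ^ k" for g k
    by (subst inv_emb) (simp add: r_nz)
  then show ?thesis unfolding W_loc_def by simp
qed

lemma W_loc_I: "g \<in> W_poly \<Longrightarrow> emb g * inverse (emb r) ^ k \<in> W_loc r"
  unfolding W_loc_eq by blast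

lemma W_loc_E:
  assumes "x \<in> W_loc r" obtains g k where "g \<in> W_poly" "x = emb g * inverse (emb r) ^ k"
  using assms unfolding W_loc_eq by blast

lemma emb_r_inv: "emb r * inverse (emb r) = 1"
  using r_nz by (simp del: inverse_fract)

lemma W_loc_split: "emb g * inverse (emb r) ^ k = emb (g * r ^ j) * inverse (emb r) ^ (k + j)"
proof -
  have "emb (g * r ^ j) * inverse (emb r) ^ (k + j)
      = emb g * inverse (emb r) ^ k * (emb r * inverse (emb r)) ^ j"
    by (simp only: emb_simps power_add power_mult_distrib mult_ac)
  then show ?thesis by (simp only: emb_r_inv power_one mult_1_right)
qed

lemma subring_W_loc: "subring_set (W_loc r)"
  unfolding subring_set_def
proof (intro conjI ballI)
  show "0 \<in> W_loc r" using W_loc_I[OF W_poly_ring(1), of 0] by (simp only: emb_simps power_0 mult_1_right)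
  show "1 \<in> W_loc r" using W_loc_I[OF W_poly_ring(2), of 0] by (simp only: emb_simps power_0 mult_1_right)
next
  fix x y assume "x \<in> W_loc r" "y \<in> W_loc r"
  then obtain g k g' k' where x: "g \<in> W_poly" "x = emb g * inverse (emb r) ^ k" 
    and y: "g' \<in> W_poly" "y = emb g' * inverse (emb r) ^ k'" by (metis W_loc_E)
  have "x + y = emb (g * r ^ k') * inverse (emb r) ^ (k + k') + emb (g' * r ^ k) * inverse (emb r) ^ (k' + k)"
    unfolding x(2) y(2) W_loc_split[of g k k', symmetric] W_loc_split[of g' k' k, symmetric] ..
  also have "\<dots> = emb (g * r ^ k' + g' * r ^ k) * inverse (emb r) ^ (k + k')"
    by (simp only: emb_simps distrib_right add.commute[of k' k])
  finally show "x + y \<in> W_loc r"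
    using W_loc_I[OF W_poly_ring(3)[OF W_poly_ring(4)[OF x(1) W_poly_ring(7)[OF r(1)]] W_poly_ring(4)[OF y(1) W_poly_ring(7)[OF r(1)]]]]
    by (simp only:)
  have "x * y = emb (g * g') * inverse (emb r) ^ (k + k')"
    unfolding x(2) y(2) by (simp only: emb_simps power_add mult_ac)
  then show "x * y \<in> W_loc r" using W_loc_I[OF W_poly_ring(4)[OF x(1) y(1)]] by (simp only:)
next
  fix x assume "x \<in> W_loc r"
  then obtain g k where x: "g \<in> W_poly" "x = emb g * inverse (emb r) ^ k" by (rule W_loc_E)
  have "- x = emb (- g) * inverse (emb r) ^ k" unfolding x(2) by (simp only: emb_simps mult_minus_left)
  then show "- x \<in> W_loc r" using W_loc_I[OF W_poly_ring(5)[OF x(1)]] by (simp only:)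
qed

lemma W_loc_OG: "W_loc r \<subseteq> OG"
proof
  fix x assume "x \<in> W_loc r"
  then obtain g k where x: "g \<in> W_poly" "x = emb g * inverse (emb r) ^ k" by (rule W_loc_E)
  have "x = emb g / emb (r ^ k)" unfolding x(2) inv_emb by (simp only: times_divide_eq_right mult_1_right)
  then show "x \<in> OG" using OG_I[OF x(1) W_poly_ring(7)[OF r(1)] Gauss_power[OF r]] by (simp only:)
qed

text \<open>If \<open>g / r\<^sup>k\<close> is \<open>p\<^sup>n\<close> times an element of the Gauss valuation ring, then by Gauss's lemma \<open>p\<^sup>n\<close>
  divides the numerator \<open>g\<close>. So congruences may be checked in the larger ring.\<close>

lemma pcong_W_loc_OG:
  assumes "x \<in> W_loc r" "y \<in> W_loc r"
  shows "pcong CARD('p) (W_loc r) n x y \<longleftrightarrow> pcong CARD('p) OG n x y"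
proof
  assume "pcong CARD('p) (W_loc r) n x y"
  then show "pcong CARD('p) OG n x y" using W_loc_OG unfolding pcong_def by blast
next
  assume "pcong CARD('p) OG n x y"
  then obtain z where z: "z \<in> OG" "x - y = pKt ^ n * z" unfolding pcong_def by blast
  obtain g k where g: "g \<in> W_poly" "x - y = emb g * inverse (emb r) ^ k"
    by (rule W_loc_E[OF subring_setD(6)[OF subring_W_loc assms]])
  obtain g' q where q: "z = emb g' / emb q" "g' \<in> W_poly" "q \<in> W_poly" "q \<notin> pWp 1"
    using z(1) unfolding OG_def by blast
  have nz: "emb q \<noteq> 0" "emb (r ^ k) \<noteq> 0" using q(4) r_nz unfolding emb_0_iff by auto
  have "emb g / emb (r ^ k) = emb (smult (pK ^ n) g') / emb q"
    using z(2) unfolding g(2) q(1) inv_emb by (simp only: pKt_emb[symmetric] times_divide_eq_right mult_1_right)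
  then have "emb g * emb q = emb (smult (pK ^ n) g') * emb (r ^ k)"
    by (rule frac_eq_eq[OF nz(2,1), THEN iffD1])
  then have "g * q = smult (pK ^ n) (g' * r ^ k)" 
    unfolding emb_simps(2)[symmetric] emb_inj by simp
  then have "g * q \<in> pWp n" unfolding pWp_iff using W_poly_ring(4)[OF q(2) W_poly_ring(7)[OF r(1)]] by blast
  then have "g \<in> pWp n" by (rule Gauss_cancel[OF g(1) q(3,4)])
  then obtain g2 where g2: "g2 \<in> W_poly" "g = smult (pK ^ n) g2" unfolding pWp_iff by blast
  have "x - y = pKt ^ n * (emb g2 * inverse (emb r) ^ k)"
    unfolding g(2) g2(2) pKt_emb[symmetric] by (simp only: mult.assoc)
  then show "pcong CARD('p) (W_loc r) n x y" unfolding pcong_def using W_loc_I[OF g2(1)] by blast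
qed

lemma W_loc_poly: "g \<in> W_poly \<Longrightarrow> emb g \<in> W_loc r"
  using W_loc_I[of g 0] by (simp only: power_0 mult_1_right)

end

text \<open>Inverting \<open>t\<close> and \<open>h\<close> is the same as inverting \<open>t h\<close>, so the statements for one denominator apply.\<close>

lemma W_lloc_eq:
  assumes "h \<noteq> 0" "h \<in> W_poly" shows "W_lloc h = W_loc ([:0, 1:] * (h :: 'p::prime_card K poly))"
proof (intro Set.set_eqI iffI)
  let ?t = "[:0, 1:] :: 'p K poly"
  fix x
  { assume "x \<in> W_lloc h"
    then obtain g j k where x: "x = Fract g (?t ^ j * h ^ k)" "g \<in> W_poly" unfolding W_lloc_def by blast
    have "x = Fract (g * (?t ^ k * h ^ j)) ((?t * h) ^ (j + k))"
      unfolding x(1)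
    proof (subst eq_fract)
      show "g * (?t * h) ^ (j + k) = g * (?t ^ k * h ^ j) * (?t ^ j * h ^ k)"
        by (simp only: power_add power_mult_distrib mult_ac)
    qed (use assms(1) in auto)
    moreover have "g * (?t ^ k * h ^ j) \<in> W_poly"
      by (intro W_poly_ring(4) W_poly_ring(7) x(2) assms(2)) (simp add: W_poly_pCons W_poly_ring(1))
    ultimately show "x \<in> W_loc (?t * h)" unfolding W_loc_def by blast }
  { assume "x \<in> W_loc (?t * h)"
    then obtain g k where "x = Fract g ((?t * h) ^ k)" "g \<in> W_poly" unfolding W_loc_def by blast
    then show "x \<in> W_lloc h" unfolding W_lloc_def power_mult_distrib by blast }
qed

section \<open>The substitution of the inverse of the variable\<close>

definition iota_poly :: "'p::prime_card K poly \<Rightarrow> 'p Kt" where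
  "iota_poly g = poly (map_poly Kt_const g) (inverse Kt_t)"

lemmas Kt_const_hom = is_homD[OF is_hom_Kt_const]

lemma iota_poly_pCons: "iota_poly (pCons a g) = Kt_const a + inverse Kt_t * iota_poly g"
proof -
  have "map_poly Kt_const (pCons a g) = pCons (Kt_const a) (map_poly Kt_const g)"
    by (rule poly_eqI) (simp add: coeff_map_poly coeff_pCons Kt_const_hom(1) split: nat.split)
  then show ?thesis by (simp add: iota_poly_def)
qed

lemma iota_poly_0 [simp]: "iota_poly 0 = 0" by (simp add: iota_poly_def)

lemma is_hom_iota_poly: "is_hom (iota_poly :: 'p::prime_card K poly \<Rightarrow> 'p Kt)"
  unfolding is_hom_def
proof (intro conjI allI)
  show "iota_poly 0 = (0 :: 'p Kt)" by simp
  show "iota_poly 1 = (1 :: 'p Kt)"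
    unfolding one_pCons iota_poly_pCons by (simp add: Kt_const_hom(2))
  fix x y :: "'p K poly"
  have "map_poly Kt_const (x + y) = map_poly Kt_const x + map_poly Kt_const y"
    by (rule poly_eqI) (simp add: coeff_map_poly Kt_const_hom)
  then show "iota_poly (x + y) = iota_poly x + iota_poly y" by (simp add: iota_poly_def)
  have "map_poly Kt_const (x * y) = map_poly Kt_const x * map_poly Kt_const y"
    by (rule poly_eqI) (simp add: coeff_map_poly coeff_mult Kt_const_hom)
  then show "iota_poly (x * y) = iota_poly x * iota_poly y" by (simp add: iota_poly_def)
qed

lemmas iota_poly_hom = is_homD[OF is_hom_iota_poly]

text \<open>The polynomial \<open>t\<^sup>N g(t\<^sup>-\<^sup>1)\<close>, for degree bound \<open>N\<close>; coefficients beyond \<open>N\<close> are dropped.\<close>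

definition rev_upto :: "nat \<Rightarrow> 'p::prime_card K poly \<Rightarrow> 'p K poly" where
  "rev_upto N g = (\<Sum>i\<le>N. monom (coeff g i) (N - i))"

lemma coeff_rev_upto: "coeff (rev_upto N g) j = (if j \<le> N then coeff g (N - j) else 0)"
proof -
  have "coeff (rev_upto N g) j = (\<Sum>i\<le>N. if i = N - j \<and> j \<le> N then coeff g i else 0)"
    unfolding rev_upto_def coeff_sum by (intro sum.cong refl) auto
  then show ?thesis by (cases "j \<le> N") auto
qed

lemma emb_monom: "emb (monom c n) = Kt_const (c :: 'p::prime_card K) * Kt_t ^ n"
proof -
  have "monom c n = [:c:] * [:0, 1:] ^ n" by (simp add: monom_altdef)
  then show ?thesis unfolding Kt_const_def Kt_t_def by (simp only: emb_simps(2,7))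
qed

lemma iota_poly_rev:
  assumes "degree g \<le> N" shows "iota_poly g = emb (rev_upto N g) * inverse Kt_t ^ N"
proof -
  have "iota_poly g = (\<Sum>i\<le>degree (map_poly Kt_const g). Kt_const (coeff g i) * inverse Kt_t ^ i)"
    unfolding iota_poly_def poly_altdef by (simp add: coeff_map_poly Kt_const_hom(1))
  also have "\<dots> = (\<Sum>i\<le>N. Kt_const (coeff g i) * inverse Kt_t ^ i)"
  proof (intro sum.mono_neutral_left ballI)
    show "{..degree (map_poly Kt_const g)} \<subseteq> {..N}"
      using assms degree_map_poly_le[of Kt_const g] by auto
    fix i assume "i \<in> {..N} - {..degree (map_poly Kt_const g)}"
    then have "coeff (map_poly Kt_const g) i = 0" by (intro coeff_eq_0) auto
    then show "Kt_const (coeff g i) * inverse Kt_t ^ i = 0" by (simp add: coeff_map_poly Kt_const_hom(1))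
  qed auto
  also have "\<dots> = (\<Sum>i\<le>N. Kt_const (coeff g i) * Kt_t ^ (N - i)) * inverse Kt_t ^ N"
    unfolding sum_distrib_right
  proof (intro sum.cong refl)
    fix i assume "i \<in> {..N}"
    then have "Kt_t ^ N = (Kt_t ^ (N - i) * Kt_t ^ i :: 'a Kt)" by (simp flip: power_add)
    then have "Kt_t ^ (N - i) * inverse Kt_t ^ N = (inverse Kt_t ^ i :: 'a Kt)" 
      by (simp add: power_inverse field_simps)
    then show "Kt_const (coeff g i) * inverse Kt_t ^ i = Kt_const (coeff g i) * Kt_t ^ (N - i) * inverse Kt_t ^ N"
      by (simp only: mult.assoc)
  qed
  also have "(\<Sum>i\<le>N. Kt_const (coeff g i) * Kt_t ^ (N - i)) = emb (rev_upto N g)"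
    unfolding rev_upto_def is_homD(8)[OF is_hom_emb] emb_monom ..
  finally show ?thesis .
qed

lemma rev_upto_nz: "g \<noteq> 0 \<Longrightarrow> degree g \<le> N \<Longrightarrow> rev_upto N g \<noteq> 0"
  using coeff_rev_upto[of N g "N - degree g"] by auto

lemma iota_poly_nz: assumes "g \<noteq> 0" shows "iota_poly g \<noteq> 0"
proof -
  have "emb (rev_upto (degree g) g) \<noteq> 0" unfolding emb_0_iff using rev_upto_nz[OF assms] by simp
  then show ?thesis unfolding iota_poly_rev[OF order_refl] by (simp del: inverse_fract)
qed

text \<open>The automorphism \<open>t \<mapsto> t\<^sup>-\<^sup>1\<close> of \<open>K(t)\<close>.\<close>

definition iota :: "'p::prime_card Kt \<Rightarrow> 'p Kt" where
  "iota w = (THE v. \<exists>g q. q \<noteq> 0 \<and> w = Fract g q \<and> v = iota_poly g / iota_poly q)"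

lemma iota_Fract:
  assumes "q \<noteq> 0" shows "iota (Fract g q) = iota_poly g / iota_poly q"
  unfolding iota_def
proof (rule the_equality)
  fix v assume "\<exists>g' q'. q' \<noteq> 0 \<and> Fract g q = Fract g' q' \<and> v = iota_poly g' / iota_poly q'"
  then obtain g' q' where *: "q' \<noteq> 0" "Fract g q = Fract g' q'" "v = iota_poly g' / iota_poly q'" by blast
  have "g * q' = g' * q" using *(2) assms *(1) by (simp add: eq_fract)
  then have "iota_poly g * iota_poly q' = iota_poly g' * iota_poly q" by (simp only: iota_poly_hom(4)[symmetric])
  then show "v = iota_poly g / iota_poly q" unfolding *(3)
    by (intro frac_eq_eq[OF iota_poly_nz[OF *(1)] iota_poly_nz[OF assms], THEN iffD2]) simp
qed (use assms in blast)

lemma iota_emb: "iota (emb g) = iota_poly g"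
  using iota_Fract[of 1 g] by (simp add: iota_poly_hom(2))

lemma is_hom_iota: "is_hom (iota :: 'p::prime_card Kt \<Rightarrow> 'p Kt)"
  unfolding is_hom_def
proof (intro conjI allI)
  show "iota 0 = (0 :: 'p Kt)" using iota_emb[of 0] by (simp only: emb_simps iota_poly_0)
  show "iota 1 = (1 :: 'p Kt)" using iota_emb[of 1] by (simp only: emb_simps iota_poly_hom(2))
  fix x y :: "'p Kt"
  obtain a b where x: "x = Fract a b" "b \<noteq> 0" by (cases x) auto
  obtain c d where y: "y = Fract c d" "d \<noteq> 0" by (cases y) auto
  note nz = iota_poly_nz[OF x(2)] iota_poly_nz[OF y(2)]
  have bd: "b * d \<noteq> 0" using x(2) y(2) by simp
  have "x + y = Fract (a * d + c * b) (b * d)" using x y by simp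
  then have "iota (x + y) = iota_poly (a * d + c * b) / iota_poly (b * d)" by (simp only: iota_Fract[OF bd])
  also have "\<dots> = iota x + iota y"
    unfolding x(1) y(1) iota_Fract[OF x(2)] iota_Fract[OF y(2)] iota_poly_hom(3,4) by (rule add_frac_eq[OF nz, symmetric])
  finally show "iota (x + y) = iota x + iota y" .
  have "x * y = Fract (a * c) (b * d)" using x y by simp
  then have "iota (x * y) = iota_poly (a * c) / iota_poly (b * d)" by (simp only: iota_Fract[OF bd])
  also have "\<dots> = iota x * iota y"
    unfolding x(1) y(1) iota_Fract[OF x(2)] iota_Fract[OF y(2)] iota_poly_hom(4) times_divide_times_eq ..
  finally show "iota (x * y) = iota x * iota y" .
qed

lemmas iota_hom = is_homD[OF is_hom_iota]

lemma iota_const [simp]: "iota (Kt_const c) = Kt_const c"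
  unfolding Kt_const_def iota_emb by (simp add: iota_poly_pCons flip: Kt_const_def)

lemma iota_t: "iota Kt_t = inverse Kt_t"
  unfolding Kt_t_def iota_emb by (simp add: iota_poly_pCons Kt_const_hom flip: Kt_t_def)

lemma iota_inverse: assumes "x \<noteq> 0" shows "iota (inverse x) = inverse (iota x)"
proof -
  have "iota x * iota (inverse x) = 1" using assms unfolding iota_hom(4)[symmetric] by (simp add: iota_hom(2))
  then show ?thesis by (rule inverse_unique[symmetric])
qed

lemma iota_iota_poly: "iota (iota_poly g) = emb g"
proof (induction g)
  case 0
  show ?case by (simp add: iota_hom emb_simps)
next
  case (pCons a g)
  show ?case unfolding iota_poly_pCons iota_hom emb_pCons pCons.IH
    by (simp add: iota_inverse iota_t del: inverse_fract)
qed

lemma iota_iota: "iota (iota w) = w"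
proof -
  obtain a b where w: "w = Fract a b" "b \<noteq> 0" by (cases w) auto
  have "iota (iota w) = iota (iota_poly a * inverse (iota_poly b))"
    unfolding w(1) iota_Fract[OF w(2)] divide_inverse ..
  also have "\<dots> = emb a * inverse (emb b)"
    by (simp only: iota_hom(4) iota_inverse[OF iota_poly_nz[OF w(2)]] iota_iota_poly)
  also have "\<dots> = w" unfolding w(1) Fract_emb[OF w(2)] divide_inverse ..
  finally show ?thesis .
qed

lemma rev_upto_W: "g \<in> W_poly \<Longrightarrow> rev_upto N g \<in> W_poly"
  by (auto simp: W_poly_def coeff_rev_upto)

lemma rev_upto_prim: assumes "g \<notin> pWp 1" "degree g \<le> N" shows "rev_upto N g \<notin> pWp 1"
proof
  assume *: "rev_upto N g \<in> pWp 1"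
  have "coeff g i \<in> pW 1" for i
  proof (cases "i \<le> N")
    case True
    then have "coeff (rev_upto N g) (N - i) = coeff g i" by (simp add: coeff_rev_upto)
    then show ?thesis using * by (auto simp: pWp_def dest: spec[of _ "N - i"])
  next
    case False
    then show ?thesis using assms(2) by (simp add: coeff_eq_0)
  qed
  then show False using assms(1) by (simp add: pWp_def)
qed

lemma iota_OG: assumes "w \<in> OG" shows "iota w \<in> OG"
proof -
  obtain g q where w: "w = emb g / emb q" "g \<in> W_poly" "q \<in> W_poly" "q \<notin> pWp 1" using assms unfolding OG_def by blast
  have q: "q \<noteq> 0" using w(4) by auto
  define N where "N = max (degree g) (degree q)"
  have N: "degree g \<le> N" "degree q \<le> N" by (auto simp: N_def)
  have "iota w = iota_poly g / iota_poly q" unfolding w(1) Fract_emb[OF q, symmetric] by (rule iota_Fract[OF q])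
  also have "\<dots> = emb (rev_upto N g) / emb (rev_upto N q)"
    unfolding iota_poly_rev[OF N(1)] iota_poly_rev[OF N(2)] by (rule mult_divide_mult_cancel_right) (simp del: inverse_fract)
  finally show ?thesis
    using OG_I[OF rev_upto_W[OF w(2)] rev_upto_W[OF w(3)] rev_upto_prim[OF w(4) N(2)]] by (simp only:)
qed

lemma pcong_iota:
  assumes "pcong CARD('p) OG n x (y :: 'p::prime_card Kt)" shows "pcong CARD('p) OG n (iota x) (iota y)"
proof -
  obtain z where z: "z \<in> OG" "x - y = pKt ^ n * z" using assms unfolding pcong_def by blast
  have "iota x - iota y = iota (x - y)" by (metis add_diff_cancel_right' diff_add_cancel iota_hom(3))
  also have "\<dots> = pKt ^ n * iota z" unfolding z(2) by (simp only: iota_hom)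
  finally show ?thesis unfolding pcong_def using iota_OG[OF z(1)] by blast
qed

section \<open>The isomorphism between the completed localizations\<close>

text \<open>Two localizations \<open>A\<close>, \<open>B\<close> of \<open>W[t]\<close> whose closures in the Gauss valuation ring are interchanged
  by \<open>t \<mapsto> t\<^sup>-\<^sup>1\<close>. The substitution need not map \<open>A\<close> into \<open>B\<close>, since the denominators correspond to
  each other only modulo \<open>p\<close>. It still induces an isomorphism of the completions, which is the one
  that the theorem refers to.\<close>

locale iota_pair =
  fixes r s :: "'p::prime_card K poly"
  assumes r: "r \<in> W_poly" "r \<notin> pWp 1" and s: "s \<in> W_poly" "s \<notin> pWp 1"
    and rs: "\<And>w n. w \<in> W_loc r \<Longrightarrow> \<exists>v\<in>W_loc s. pcong CARD('p) OG n v (iota w)"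
    and sr: "\<And>v n. v \<in> W_loc s \<Longrightarrow> \<exists>w\<in>W_loc r. pcong CARD('p) OG n v (iota w)"
begin

abbreviation "A \<equiv> W_loc r"
abbreviation "B \<equiv> W_loc s"
abbreviation "CA \<equiv> p_completion CARD('p) A"
abbreviation "CB \<equiv> p_completion CARD('p) B"

lemmas A = subring_W_loc[OF r]
lemmas B = subring_W_loc[OF s]

text \<open>A coset in \<open>A\<close> goes to the elements of \<open>B\<close> that are congruent to the image of one of its elements.\<close>

definition Om :: "(nat \<Rightarrow> 'p Kt set) \<Rightarrow> nat \<Rightarrow> 'p Kt set" where
  "Om x = (if x \<in> carrier CA then (\<lambda>n. {v\<in>B. \<exists>w\<in>x n. pcong CARD('p) OG n v (iota w)}) else undefined)"

lemma Om_pmk: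
  assumes w: "pseq CARD('p) A w" and v: "\<And>n. v n \<in> B" and vw: "\<And>n. pcong CARD('p) OG n (v n) (iota (w n))"
  shows "pseq CARD('p) B v" and "Om (pmk CARD('p) A w) = pmk CARD('p) B v"
proof -
  note tr = pcong_trans[OF subring_OG] and sy = pcong_sym[OF subring_OG]
  show ps: "pseq CARD('p) B v"
  proof (rule pseqI[OF B v])
    fix n
    have "pcong CARD('p) OG n (v (Suc n)) (iota (w (Suc n)))" by (rule pcong_mono[OF subring_OG vw]) simp
    moreover have "pcong CARD('p) OG n (iota (w (Suc n))) (iota (w n))"
      using pseqD[OF A w] by (intro pcong_iota pcong_W_loc_OG[OF r, THEN iffD1]) auto
    ultimately have "pcong CARD('p) OG n (v (Suc n)) (v n)" using tr sy[OF vw] by blast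
    then show "pcong CARD('p) B n (v (Suc n)) (v n)" using pcong_W_loc_OG[OF s v v] by blast
  qed
  have "{v'\<in>B. \<exists>w'\<in>pcos CARD('p) A n (w n). pcong CARD('p) OG n v' (iota w')} = pcos CARD('p) B n (v n)" for n
  proof (intro Set.set_eqI iffI)
    fix v' assume "v' \<in> {v'\<in>B. \<exists>w'\<in>pcos CARD('p) A n (w n). pcong CARD('p) OG n v' (iota w')}"
    then obtain w' where w': "v' \<in> B" "pcong CARD('p) A n w' (w n)" "pcong CARD('p) OG n v' (iota w')"
      by (auto simp: pcos_def)
    have "w' \<in> A" by (rule pcong_in[OF A w'(2) pseqD(1)[OF A w]])
    then have "pcong CARD('p) OG n w' (w n)" using pcong_W_loc_OG[OF r _ pseqD(1)[OF A w]] w'(2) by blast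
    then have "pcong CARD('p) OG n v' (v n)" by (intro tr[OF tr[OF w'(3) pcong_iota] sy[OF vw]])
    then show "v' \<in> pcos CARD('p) B n (v n)" using pcong_W_loc_OG[OF s w'(1) v] by (simp add: pcos_def)
  next
    fix v' assume "v' \<in> pcos CARD('p) B n (v n)"
    then have c: "pcong CARD('p) B n v' (v n)" by (simp add: pcos_def)
    have v': "v' \<in> B" by (rule pcong_in[OF B c v])
    have "pcong CARD('p) OG n v' (iota (w n))"
      using c unfolding pcong_W_loc_OG[OF s v' v] by (rule tr[OF _ vw])
    moreover have "w n \<in> pcos CARD('p) A n (w n)" by (simp add: pcos_def pcong_refl[OF A])
    ultimately show "v' \<in> {v'\<in>B. \<exists>w'\<in>pcos CARD('p) A n (w n). pcong CARD('p) OG n v' (iota w')}"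
      using v' by blast
  qed
  then show "Om (pmk CARD('p) A w) = pmk CARD('p) B v"
    using pmk_carrier[OF A w] by (simp add: Om_def pmk_def)
qed

lemma Om_cases:
  assumes "x \<in> carrier CA"
  obtains w v where "pseq CARD('p) A w" "x = pmk CARD('p) A w" "\<And>n. v n \<in> B"
    "\<And>n. pcong CARD('p) OG n (v n) (iota (w n))" "pseq CARD('p) B v" "Om x = pmk CARD('p) B v"
proof -
  obtain w where w: "pseq CARD('p) A w" "x = pmk CARD('p) A w" by (rule p_completion_cases[OF A assms])
  have "\<forall>n. \<exists>v. v \<in> B \<and> pcong CARD('p) OG n v (iota (w n))" using rs[OF pseqD(1)[OF A w(1)]] by blast
  then obtain v where v: "\<And>n. v n \<in> B" "\<And>n. pcong CARD('p) OG n (v n) (iota (w n))" by metis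
  show ?thesis by (rule that[OF w v]) (use Om_pmk[OF w(1) v] w(2) in auto)
qed

lemma Om_const:
  assumes "w \<in> A" "v \<in> B" "v = iota w"
  shows "Om (p_const CARD('p) A w) = p_const CARD('p) B v"
  unfolding p_const_pmk[OF A] p_const_pmk[OF B]
  by (rule Om_pmk(2)[OF pseq_const[OF A assms(1)] assms(2)]) (simp add: assms(3) pcong_refl[OF subring_OG])

lemma Om_iso: "Om \<in> ring_iso CA CB"
proof -
  have hom: "Om \<in> Ring.ring_hom CA CB"
  proof (rule ring_hom_memI)
    fix x assume "x \<in> carrier CA"
    then show "Om x \<in> carrier CB" using pmk_carrier[OF B] by (metis Om_cases)
  next
    fix x y assume xy: "x \<in> carrier CA" "y \<in> carrier CA"
    obtain w v where w: "pseq CARD('p) A w" "x = pmk CARD('p) A w" "\<And>n. v n \<in> B"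
      "\<And>n. pcong CARD('p) OG n (v n) (iota (w n))" "pseq CARD('p) B v" "Om x = pmk CARD('p) B v"
      by (rule Om_cases[OF xy(1)]) blast
    obtain w' v' where w': "pseq CARD('p) A w'" "y = pmk CARD('p) A w'" "\<And>n. v' n \<in> B"
      "\<And>n. pcong CARD('p) OG n (v' n) (iota (w' n))" "pseq CARD('p) B v'" "Om y = pmk CARD('p) B v'"
      by (rule Om_cases[OF xy(2)]) blast
    have "Om (pmk CARD('p) A (\<lambda>n. w n * w' n)) = pmk CARD('p) B (\<lambda>n. v n * v' n)"
    proof (rule Om_pmk(2)[OF pseq_mult[OF A w(1) w'(1)]])
      fix n show "v n * v' n \<in> B" using A_ring(4)[OF B] w(3) w'(3) by blast
      have "pcong CARD('p) OG n (v n * v' n) (iota (w n) * iota (w' n))"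
        using w(3,4)[of n] w'(3,4)[of n] W_loc_OG[OF s] W_loc_OG[OF r] pseqD(1)[OF A w(1), of n] 
        by (intro pcong_mult[OF subring_OG] iota_OG) auto
      then show "pcong CARD('p) OG n (v n * v' n) (iota (w n * w' n))" by (simp only: iota_hom)
    qed
    then show "Om (x \<otimes>\<^bsub>CA\<^esub> y) = Om x \<otimes>\<^bsub>CB\<^esub> Om y"
      unfolding w(2) w'(2) pmk_mult[OF A w(1) w'(1)] unfolding w(2)[symmetric] w'(2)[symmetric] w(6) w'(6)
      by (simp only: pmk_mult[OF B w(5) w'(5)])
    have "Om (pmk CARD('p) A (\<lambda>n. w n + w' n)) = pmk CARD('p) B (\<lambda>n. v n + v' n)"
    proof (rule Om_pmk(2)[OF pseq_add[OF A w(1) w'(1)]])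
      fix n show "v n + v' n \<in> B" using A_ring(3)[OF B] w(3) w'(3) by blast
      have "pcong CARD('p) OG n (v n + v' n) (iota (w n) + iota (w' n))"
        by (intro pcong_add[OF subring_OG] w(4) w'(4))
      then show "pcong CARD('p) OG n (v n + v' n) (iota (w n + w' n))" by (simp only: iota_hom)
    qed
    then show "Om (x \<oplus>\<^bsub>CA\<^esub> y) = Om x \<oplus>\<^bsub>CB\<^esub> Om y"
      unfolding w(2) w'(2) pmk_add[OF A w(1) w'(1)] unfolding w(2)[symmetric] w'(2)[symmetric] w(6) w'(6)
      by (simp only: pmk_add[OF B w(5) w'(5)])
  next
    have "Om (p_const CARD('p) A 1) = p_const CARD('p) B 1"
      by (rule Om_const) (simp_all add: A_ring[OF A] A_ring[OF B] iota_hom(2))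
    then show "Om \<one>\<^bsub>CA\<^esub> = \<one>\<^bsub>CB\<^esub>" by (simp only: pmk_one[OF A] pmk_one[OF B] p_const_pmk[OF A] p_const_pmk[OF B])
  qed
  have "inj_on Om (carrier CA)"
  proof (rule inj_onI)
    fix x y assume xy: "x \<in> carrier CA" "y \<in> carrier CA" "Om x = Om y"
    obtain w v where w: "pseq CARD('p) A w" "x = pmk CARD('p) A w" "\<And>n. v n \<in> B"
      "\<And>n. pcong CARD('p) OG n (v n) (iota (w n))" "pseq CARD('p) B v" "Om x = pmk CARD('p) B v"
      by (rule Om_cases[OF xy(1)]) blast
    obtain w' v' where w': "pseq CARD('p) A w'" "y = pmk CARD('p) A w'" "\<And>n. v' n \<in> B"
      "\<And>n. pcong CARD('p) OG n (v' n) (iota (w' n))" "pseq CARD('p) B v'" "Om y = pmk CARD('p) B v'"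
      by (rule Om_cases[OF xy(2)]) blast
    have "pcong CARD('p) A n (w n) (w' n)" for n
    proof -
      have "pcong CARD('p) B n (v n) (v' n)" using xy(3) unfolding w(6) w'(6) pmk_eq_iff[OF B] by blast
      then have vv: "pcong CARD('p) OG n (v n) (v' n)" using pcong_W_loc_OG[OF s w(3) w'(3)] by blast
      have "pcong CARD('p) OG n (iota (w n)) (iota (w' n))"
        by (rule pcong_trans[OF subring_OG pcong_trans[OF subring_OG pcong_sym[OF subring_OG w(4)] vv] w'(4)])
      from pcong_iota[OF this] have "pcong CARD('p) OG n (w n) (w' n)" by (simp only: iota_iota)
      then show ?thesis using pcong_W_loc_OG[OF r pseqD(1)[OF A w(1)] pseqD(1)[OF A w'(1)]] by blast
    qed
    then show "x = y" unfolding w(2) w'(2) pmk_eq_iff[OF A] by blast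
  qed
  moreover have "Om ` carrier CA = carrier CB"
  proof (intro Set.set_eqI iffI)
    fix y assume "y \<in> carrier CB"
    then obtain v where v: "pseq CARD('p) B v" "y = pmk CARD('p) B v" by (rule p_completion_cases[OF B])
    have "\<forall>n. \<exists>w. w \<in> A \<and> pcong CARD('p) OG n (v n) (iota w)" using sr[OF pseqD(1)[OF B v(1)]] by blast
    then obtain w where w: "\<And>n. w n \<in> A" "\<And>n. pcong CARD('p) OG n (v n) (iota (w n))" by metis
    have "pseq CARD('p) A w"
    proof (rule pseqI[OF A w(1)])
      fix n
      have 1: "pcong CARD('p) OG n (v (Suc n)) (iota (w (Suc n)))" by (rule pcong_mono[OF subring_OG w(2)]) simp
      have 2: "pcong CARD('p) OG n (v (Suc n)) (v n)"
        using pseqD[OF B v(1)] by (intro pcong_W_loc_OG[OF s, THEN iffD1]) auto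
      have "pcong CARD('p) OG n (iota (w (Suc n))) (iota (w n))"
        by (rule pcong_trans[OF subring_OG pcong_trans[OF subring_OG pcong_sym[OF subring_OG 1] 2] w(2)])
      from pcong_iota[OF this] have "pcong CARD('p) OG n (w (Suc n)) (w n)" by (simp only: iota_iota)
      then show "pcong CARD('p) A n (w (Suc n)) (w n)" using pcong_W_loc_OG[OF r w(1) w(1)] by blast
    qed
    then show "y \<in> Om ` carrier CA"
      using Om_pmk(2)[OF _ pseqD(1)[OF B v(1)] w(2)] pmk_carrier[OF A] v(2) by (metis imageI)
  next
    fix y assume "y \<in> Om ` carrier CA"
    then show "y \<in> carrier CB" using hom by (auto simp: Ring.ring_hom_def)
  qed
  ultimately show ?thesis using hom by (simp add: ring_iso_def bij_betw_def)
qed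

lemma Om_extensional: "Om \<in> extensional (carrier CA)"
  by (simp add: extensional_def Om_def)

text \<open>A homomorphism is determined on \<open>W[t]\<close> by the images of \<open>W\<close> and \<open>t\<close>, and then on inverses. It is
  continuous because \<open>p\<^sup>n\<close> goes to \<open>p\<^sup>n\<close>: an element of the completion differs by a multiple of
  \<open>p\<^sup>n\<close> from one of \<open>A\<close>.\<close>

lemma Om_unique:
  assumes f: "f \<in> ring_iso CA CB" "f \<in> extensional (carrier CA)"
    and fW: "\<And>w. w \<in> W \<Longrightarrow> f (p_const CARD('p) A (Kt_const w)) = p_const CARD('p) B (Kt_const w)"
    and ft: "f (p_const CARD('p) A Kt_t) = p_const CARD('p) B (inverse Kt_t)"
    and tB: "inverse Kt_t \<in> B"
  shows "f = Om"
proof -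
  interpret CA: cring CA by (rule cring_p_completion[OF A])
  interpret CB: cring CB by (rule cring_p_completion[OF B])
  let ?c = "p_const CARD('p) A" and ?d = "p_const CARD('p) B"
  have fh: "f \<in> Ring.ring_hom CA CB" and gh: "Om \<in> Ring.ring_hom CA CB"
    using f(1) Om_iso by (auto simp: ring_iso_def)
  have c_carr: "a \<in> A \<Longrightarrow> ?c a \<in> carrier CA" for a
    by (simp add: p_const_pmk[OF A] pmk_carrier[OF A] pseq_const[OF A])
  have c_add: "?c (a + b) = ?c a \<oplus>\<^bsub>CA\<^esub> ?c b" and c_mult: "?c (a * b) = ?c a \<otimes>\<^bsub>CA\<^esub> ?c b"
    if "a \<in> A" "b \<in> A" for a b
    using that by (simp_all add: p_const_pmk[OF A] pmk_add[OF A] pmk_mult[OF A] pseq_const[OF A])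
  have W_A: "Kt_const w \<in> A" "Kt_const w \<in> B" if "w \<in> W" for w
    using W_loc_poly[OF r, of "[:w:]"] W_loc_poly[OF s, of "[:w:]"] that
    by (simp_all add: Kt_const_def W_poly_pCons W_poly_ring(1))
  have t_A: "Kt_t \<in> A"
    using W_loc_poly[OF r, of "[:0, 1:]"] by (simp add: Kt_t_def W_poly_pCons W_poly_ring(1))
  have agree_W: "f (?c (Kt_const w)) = Om (?c (Kt_const w))" if "w \<in> W" for w
    unfolding fW[OF that] using Om_const[OF W_A(1)[OF that] W_A(2)[OF that]] by simp
  have agree_t: "f (?c Kt_t) = Om (?c Kt_t)"
    unfolding ft using Om_const[OF t_A tB] by (simp add: iota_t)
  have ag_add: "f (?c (a + b)) = Om (?c (a + b))" and ag_mult: "f (?c (a * b)) = Om (?c (a * b))"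
    if "a \<in> A" "b \<in> A" "f (?c a) = Om (?c a)" "f (?c b) = Om (?c b)" for a b
    using that ring_hom_add[OF fh] ring_hom_add[OF gh] ring_hom_mult[OF fh] ring_hom_mult[OF gh]
    by (simp_all add: c_add c_mult c_carr)
  have agree_poly: "f (?c (emb g)) = Om (?c (emb g))" if "g \<in> W_poly" for g
    using that
  proof (induction g)
    case 0
    then show ?case using agree_W[OF W_0] by (simp only: emb_simps Kt_const_hom(1))
  next
    case (pCons a g)
    then have ag: "a \<in> W" "g \<in> W_poly" by (auto simp: W_poly_pCons)
    show ?case unfolding emb_pCons
      by (intro ag_add ag_mult agree_W agree_t pCons.IH ag W_A t_A A_ring(4)[OF A] W_loc_poly[OF r])
  qed
  have agree_inv: "f (?c b) = Om (?c b)" if ab: "a \<in> A" "b \<in> A" "a * b = 1" "f (?c a) = Om (?c a)" for a b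
  proof -
    have one: "?c 1 = \<one>\<^bsub>CA\<^esub>" by (simp add: p_const_pmk[OF A] pmk_one[OF A])
    have F: "f (?c a) \<in> carrier CB" "f (?c b) \<in> carrier CB" "Om (?c b) \<in> carrier CB"
      using ring_hom_closed[OF fh] ring_hom_closed[OF gh] c_carr ab by blast+
    have 1: "f (?c a) \<otimes>\<^bsub>CB\<^esub> f (?c b) = \<one>\<^bsub>CB\<^esub>"
      using ring_hom_mult[OF fh c_carr[OF ab(1)] c_carr[OF ab(2)]] ring_hom_one[OF fh] ab c_mult[OF ab(1,2)] one by simp
    have 2: "f (?c a) \<otimes>\<^bsub>CB\<^esub> Om (?c b) = \<one>\<^bsub>CB\<^esub>"
      using ring_hom_mult[OF gh c_carr[OF ab(1)] c_carr[OF ab(2)]] ring_hom_one[OF gh] ab c_mult[OF ab(1,2)] one by simp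
    have "f (?c b) = f (?c b) \<otimes>\<^bsub>CB\<^esub> (f (?c a) \<otimes>\<^bsub>CB\<^esub> Om (?c b))" using 2 F by simp
    also have "\<dots> = (f (?c a) \<otimes>\<^bsub>CB\<^esub> f (?c b)) \<otimes>\<^bsub>CB\<^esub> Om (?c b)" using F by (simp add: CB.m_ac)
    also have "\<dots> = Om (?c b)" using 1 F by simp
    finally show ?thesis .
  qed
  have agree_A: "f (?c a) = Om (?c a)" if aA: "a \<in> A" for a
  proof -
    obtain g k where g: "g \<in> W_poly" "a = emb g * inverse (emb r) ^ k" by (rule W_loc_E[OF r aA])
    have rk: "emb (r ^ k) \<in> A" "inverse (emb r) ^ k \<in> A"
      using W_loc_poly[OF r W_poly_ring(7)[OF r(1)]] W_loc_I[OF r W_poly_ring(2), of k] 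
      by (simp_all only: emb_simps(6) mult_1)
    have "emb (r ^ k) * inverse (emb r) ^ k = 1"
      by (simp only: emb_simps(7) power_mult_distrib[symmetric] emb_r_inv[OF r] power_one)
    then have "f (?c (inverse (emb r) ^ k)) = Om (?c (inverse (emb r) ^ k))"
      by (rule agree_inv[OF rk _ agree_poly[OF W_poly_ring(7)[OF r(1)]]])
    then show ?thesis unfolding g(2)
      by (intro ag_mult W_loc_poly[OF r] g rk agree_poly)
  qed
  have agree: "f x = Om x" if x: "x \<in> carrier CA" for x
  proof
    fix n
    obtain w where w: "pseq CARD('p) A w" "x = pmk CARD('p) A w" by (rule p_completion_cases[OF A x])
    have wn: "pseq CARD('p) A (\<lambda>_. w n)" "w n \<in> A" using pseq_const[OF A pseqD(1)[OF A w(1)]] pseqD(1)[OF A w(1)] by auto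
    define d where "d = (\<lambda>k. w k - w n)"
    have d: "pseq CARD('p) A d" using pseq_add[OF A w(1) pseq_minus[OF A wn(1)]] by (simp add: d_def)
    have "pcong CARD('p) A n (d n) 0" by (simp add: d_def pcong_refl[OF A])
    from pmk_divide[OF A pKt_tf d this] obtain z where
      z: "pseq CARD('p) A z" "pmk CARD('p) A d = pmk CARD('p) A (\<lambda>k. z k * pKt ^ n)" by blast
    have pn: "(pKt :: 'p Kt) ^ n = Kt_const (pK ^ n)" by (simp only: Kt_const_hom)
    have pA: "pKt ^ n \<in> A" unfolding pn by (rule W_A) simp
    have "x = pmk CARD('p) A (\<lambda>k. w n + d k)" using w(2) by (simp add: d_def)
    also have "\<dots> = ?c (w n) \<oplus>\<^bsub>CA\<^esub> pmk CARD('p) A d" by (simp add: p_const_pmk[OF A] pmk_add[OF A wn(1) d])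
    also have "pmk CARD('p) A d = pmk CARD('p) A z \<otimes>\<^bsub>CA\<^esub> ?c (pKt ^ n)"
      unfolding z(2) p_const_pmk[OF A] pmk_mult[OF A z(1) pseq_const[OF A pA]] ..
    finally have x_eq: "x = ?c (w n) \<oplus>\<^bsub>CA\<^esub> (pmk CARD('p) A z \<otimes>\<^bsub>CA\<^esub> ?c (pKt ^ n))" .
    have val: "\<phi> x n = \<phi> (?c (w n)) n" if \<phi>: "\<phi> \<in> Ring.ring_hom CA CB" "\<phi> (?c (pKt ^ n)) = ?d (pKt ^ n)" for \<phi>
    proof -
      have zc: "pmk CARD('p) A z \<in> carrier CA" by (rule pmk_carrier[OF A z(1)])
      have "\<phi> x = \<phi> (?c (w n)) \<oplus>\<^bsub>CB\<^esub> (\<phi> (pmk CARD('p) A z) \<otimes>\<^bsub>CB\<^esub> ?d (pKt ^ n))"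
        unfolding x_eq using ring_hom_add[OF \<phi>(1)] ring_hom_mult[OF \<phi>(1)] c_carr wn(2) pA zc \<phi>(2) by simp
      moreover obtain u where u: "pseq CARD('p) B u" "\<phi> (?c (w n)) = pmk CARD('p) B u"
        by (rule p_completion_cases[OF B ring_hom_closed[OF \<phi>(1) c_carr[OF wn(2)]]])
      moreover obtain u' where u': "pseq CARD('p) B u'" "\<phi> (pmk CARD('p) A z) = pmk CARD('p) B u'"
        by (rule p_completion_cases[OF B ring_hom_closed[OF \<phi>(1) zc]])
      moreover have pB: "pKt ^ n \<in> B" unfolding pn by (rule W_A) simp
      ultimately have "\<phi> x = pmk CARD('p) B (\<lambda>k. u k + u' k * pKt ^ n)"
        by (simp add: p_const_pmk[OF B] pmk_mult[OF B] pmk_add[OF B] pseq_const[OF B] pseq_mult[OF B])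
      moreover have "pcong CARD('p) B n (u n + u' n * pKt ^ n) (u n)"
        unfolding pcong_def using pseqD(1)[OF B u'(1)] by (intro bexI[of _ "u' n"]) (simp_all add: mult.commute)
      ultimately show ?thesis unfolding u(2) pmk_def using pcos_eq_iff[OF B] by simp
    qed
    have "f (?c (pKt ^ n)) = ?d (pKt ^ n)" unfolding pn by (rule fW) simp
    moreover from this have "Om (?c (pKt ^ n)) = ?d (pKt ^ n)" using agree_A[OF pA] by simp
    ultimately show "f x n = Om x n" using val[OF fh] val[OF gh] agree_A[OF wn(2)] by simp
  qed
  show ?thesis
  proof
    fix x show "f x = Om x"
      using agree[of x] f(2) by (cases "x \<in> carrier CA") (auto simp: extensional_def Om_def)
  qed
qed

end

section \<open>Expansions at the origin\<close>

lemma expands_unique: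
  assumes "expands w e" "expands w e'" shows "e = e'"
proof -
  obtain g q where 1: "q \<noteq> 0" "w = Fract g q" "e * fps_of_poly q = fps_of_poly g"
    using assms(1) unfolding expands_def by blast
  obtain g' q' where 2: "q' \<noteq> 0" "w = Fract g' q'" "e' * fps_of_poly q' = fps_of_poly g'"
    using assms(2) unfolding expands_def by blast
  have "g * q' = g' * q" using 1(2) 2(2) 1(1) 2(1) by (simp add: eq_fract)
  then have "fps_of_poly g * fps_of_poly q' = fps_of_poly g' * fps_of_poly q"
    by (simp only: fps_of_poly_mult[symmetric])
  then have "e * (fps_of_poly q * fps_of_poly q') = e' * (fps_of_poly q * fps_of_poly q')"
    unfolding 1(3)[symmetric] 2(3)[symmetric] by (simp only: mult_ac)
  moreover have "fps_of_poly q * fps_of_poly q' \<noteq> 0" using 1(1) 2(1) by simp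
  ultimately show ?thesis by simp
qed

lemma prim_of_one:
  assumes "coeff h 0 = 1" shows "h \<notin> pWp 1"
proof
  assume "h \<in> pWp 1"
  then have "coeff h 0 \<in> pW 1" unfolding pWp_def by blast
  then show False using assms one_notin_pW[of 0] by simp
qed

context
  fixes h :: "'p::prime_card K poly"
  assumes h: "h \<in> W_poly" "coeff h 0 = 1"
begin

lemmas hp = h(1) prim_of_one[OF h(2)]

lemma h_nz: "h \<noteq> 0" using h(2) by auto

lemma expands_W_loc:
  "expands (emb g * inverse (emb h) ^ k) (fps_of_poly g * inverse (fps_of_poly h) ^ k)"
  unfolding expands_def
proof (intro exI conjI)
  show "h ^ k \<noteq> 0" using h_nz by simp
  show "emb g * inverse (emb h) ^ k = Fract g (h ^ k)"
    by (subst inv_emb) (simp add: h_nz)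
  have "fps_of_poly g * inverse (fps_of_poly h) ^ k * fps_of_poly (h ^ k)
      = fps_of_poly g * (fps_of_poly h * inverse (fps_of_poly h)) ^ k"
    by (simp only: fps_of_poly_power power_mult_distrib mult_ac)
  then show "fps_of_poly g * inverse (fps_of_poly h) ^ k * fps_of_poly (h ^ k) = fps_of_poly g"
    by (simp only: h_inv[OF h] power_one mult_1_right)
qed

text \<open>With denominators that have constant term \<open>1\<close>, a fraction is divisible by \<open>p\<^sup>n\<close> exactly if its
  numerator is, and this in turn exactly if its expansion is.\<close>

lemma pcong_W_loc_expands:
  assumes x: "x \<in> W_loc h" "expands x e" and y: "y \<in> W_loc h" "expands y e'"
  shows "pcong CARD('p) (W_loc h) n x y \<longleftrightarrow> fcong n e e'"
proof -
  obtain g k where g: "g \<in> W_poly" "x = emb g * inverse (emb h) ^ k" by (rule W_loc_E[OF hp x(1)])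
  obtain g' k' where g': "g' \<in> W_poly" "y = emb g' * inverse (emb h) ^ k'" by (rule W_loc_E[OF hp y(1)])
  let ?i = "inverse (fps_of_poly h)"
  let ?d = "g * h ^ k' - g' * h ^ k"
  have e: "e = fps_of_poly g * ?i ^ k" using expands_unique[OF x(2)] expands_W_loc g(2) by blast
  have e': "e' = fps_of_poly g' * ?i ^ k'" using expands_unique[OF y(2)] expands_W_loc g'(2) by blast
  have xy: "x - y = emb ?d * inverse (emb h) ^ (k + k')"
    unfolding g(2) g'(2) W_loc_split[OF hp, of g k k'] W_loc_split[OF hp, of g' k' k]
    by (simp only: emb_simps(4) left_diff_distrib add.commute[of k' k])
  have ee: "e - e' = fps_of_poly ?d * ?i ^ (k + k')"
    unfolding e e' Wrat_split[OF h, of g k k'] Wrat_split[OF h, of g' k' k]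
    by (simp only: fps_of_poly_diff left_diff_distrib add.commute[of k' k])
  have d: "?d \<in> W_poly" 
    by (intro W_poly_ring(6) W_poly_ring(4) W_poly_ring(7) g g' h)
  show ?thesis
  proof
    assume "pcong CARD('p) (W_loc h) n x y"
    then obtain z where z: "z \<in> W_loc h" "x - y = pKt ^ n * z" unfolding pcong_def by blast
    obtain g2 k2 where g2: "g2 \<in> W_poly" "z = emb g2 * inverse (emb h) ^ k2" by (rule W_loc_E[OF hp z(1)])
    have "x - y = emb (smult (pK ^ n) g2) * inverse (emb h) ^ k2"
      unfolding z(2) g2(2) pKt_emb[symmetric] by (simp only: mult.assoc)
    then have "expands (x - y) (fps_of_poly (smult (pK ^ n) g2) * ?i ^ k2)" using expands_W_loc by metis
    then have "e - e' = fps_of_poly (smult (pK ^ n) g2) * ?i ^ k2"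
      using expands_unique expands_W_loc ee xy by metis
    then have "e - e' = fps_const (pK ^ n) * (fps_of_poly g2 * ?i ^ k2)"
      by (simp add: fps_of_poly_smult mult.assoc)
    moreover have "fps_of_poly g2 * ?i ^ k2 \<in> Wf"
      by (intro Wf_ring(4) Wf_ring(7) W_polyD g2 h_inv_Wf[OF h])
    ultimately have "fps_nth (e - e') i \<in> pW n" for i by (auto simp: Wf_def intro!: pW_mult_W)
    then show "fcong n e e'" by (simp add: fcong_def wcong_def)
  next
    assume ec: "fcong n e e'"
    have "fps_of_poly ?d = (e - e') * fps_of_poly h ^ (k + k')"
    proof -
      have "(e - e') * fps_of_poly h ^ (k + k') = fps_of_poly ?d * (fps_of_poly h * ?i) ^ (k + k')"
        unfolding ee by (simp only: power_mult_distrib mult_ac)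
      then show ?thesis by (simp only: h_inv[OF h] power_one mult_1_right)
    qed
    moreover have "fcong n (e - e') (e' - e')" by (intro fcong_diff ec fcong_refl)
    then have "fcong n ((e - e') * fps_of_poly h ^ (k + k')) (0 * fps_of_poly h ^ (k + k'))"
      by (intro fcong_mult_right Wf_ring(7) W_polyD h) simp
    ultimately have "fcong n (fps_of_poly ?d) 0" by simp
    then have "?d \<in> pWp n" by (simp add: fcong_def pWp_def)
    then obtain g2 where g2: "g2 \<in> W_poly" "?d = smult (pK ^ n) g2" unfolding pWp_iff by blast
    have "x - y = pKt ^ n * (emb g2 * inverse (emb h) ^ (k + k'))"
      unfolding xy g2(2) pKt_emb[symmetric] by (simp only: mult.assoc)
    then show "pcong CARD('p) (W_loc h) n x y" unfolding pcong_def using W_loc_I[OF hp g2(1)] by blast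
  qed
qed

lemma W_loc_expansion: assumes "x \<in> W_loc h" obtains e where "expands x e" "e \<in> Wrat h"
proof -
  obtain g k where g: "g \<in> W_poly" "x = emb g * inverse (emb h) ^ k" by (rule W_loc_E[OF hp assms])
  show ?thesis by (rule that[of "fps_of_poly g * inverse (fps_of_poly h) ^ k"])
     (use g expands_W_loc Wrat_I[OF h g(1)] in auto)
qed

text \<open>Rational functions that approximate \<open>f\<close> modulo \<open>p\<^sup>n\<close> form the compatible sequence. The third
  conclusion allows to replace its first component by any rational function that agrees with \<open>f\<close>
  modulo \<open>p\<close>.\<close>

lemma conv_of_fps:
  assumes "f \<in> conv h"
  obtains w where "pseq CARD('p) (W_loc h) w" "conv_of_fps h f = pmk CARD('p) (W_loc h) w"
    "\<And>x e. x \<in> W_loc h \<Longrightarrow> expands x e \<Longrightarrow> fcong 1 e f \<Longrightarrow> pcong CARD('p) (W_loc h) 1 (w 1) x"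
proof -
  note A = subring_W_loc[OF hp]
  have "\<exists>x e. x \<in> W_loc h \<and> expands x e \<and> fcong n e f" for n
  proof -
    obtain g k where g: "g \<in> W_poly" "fcong n f (fps_of_poly g * inverse (fps_of_poly h) ^ k)"
      by (rule conv_approx[OF h assms])
    show ?thesis using W_loc_I[OF hp g(1)] expands_W_loc fcong_sym[OF g(2)] by blast
  qed
  then obtain w e where w: "\<And>n. w n \<in> W_loc h" "\<And>n. expands (w n) (e n)" "\<And>n. fcong n (e n) f" by metis
  have ps: "pseq CARD('p) (W_loc h) w"
  proof (rule pseqI[OF A w(1)])
    fix n
    have "fcong n (e (Suc n)) f" by (rule fcong_mono[OF w(3)]) simp
    then have "fcong n (e (Suc n)) (e n)" by (rule fcong_trans[OF _ fcong_sym[OF w(3)]])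
    then show "pcong CARD('p) (W_loc h) n (w (Suc n)) (w n)"
      using pcong_W_loc_expands[OF w(1,2) w(1,2)] by blast
  qed
  have expn: "has_expansion (pmk CARD('p) (W_loc h) w) f"
    unfolding has_expansion_def
  proof (intro allI ballI)
    fix n x assume "x \<in> pmk CARD('p) (W_loc h) w n"
    then have c: "pcong CARD('p) (W_loc h) n x (w n)" by (simp add: pmk_def pcos_def)
    have x: "x \<in> W_loc h" by (rule pcong_in[OF A c w(1)])
    obtain e' where e': "expands x e'" by (rule W_loc_expansion[OF x])
    have "fcong n e' (e n)" using c pcong_W_loc_expands[OF x e' w(1,2)] by blast
    then have "fcong n e' f" by (rule fcong_trans[OF _ w(3)])
    then show "\<exists>e. expands x e \<and> (\<forall>i. fps_nth (e - f) i \<in> pW n)"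
      using e' by (auto simp: fcong_def wcong_def)
  qed
  have "conv_of_fps h f = pmk CARD('p) (W_loc h) w"
    unfolding conv_of_fps_def W_conv_def
  proof (rule the_equality)
    show "pmk CARD('p) (W_loc h) w \<in> carrier (p_completion CARD('p) (W_loc h)) \<and>
          has_expansion (pmk CARD('p) (W_loc h) w) f" using pmk_carrier[OF A ps] expn by blast
    fix x assume x: "x \<in> carrier (p_completion CARD('p) (W_loc h)) \<and> has_expansion x f"
    then obtain v where v: "pseq CARD('p) (W_loc h) v" "x = pmk CARD('p) (W_loc h) v"
      using p_completion_cases[OF A] by metis
    have "pcong CARD('p) (W_loc h) n (v n) (w n)" for n
    proof -
      have "v n \<in> x n" by (simp add: v(2) pmk_def pcos_def pcong_refl[OF A])
      then obtain e' where e': "expands (v n) e'" "\<forall>i. fps_nth (e' - f) i \<in> pW n"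
        using x unfolding has_expansion_def by blast
      have "fcong n e' f" using e'(2) by (simp add: fcong_def wcong_def)
      then have "fcong n e' (e n)" by (rule fcong_trans[OF _ fcong_sym[OF w(3)]])
      then show ?thesis using pcong_W_loc_expands[OF pseqD(1)[OF A v(1)] e'(1) w(1,2)] by blast
    qed
    then show "x = pmk CARD('p) (W_loc h) w" unfolding v(2) pmk_eq_iff[OF A] by blast
  qed
  moreover have "pcong CARD('p) (W_loc h) 1 (w 1) x" if "x \<in> W_loc h" "expands x e'" "fcong 1 e' f" for x e'
    using pcong_W_loc_expands[OF w(1)[of 1] w(2)[of 1] that(1,2)] fcong_trans[OF w(3)[of 1] fcong_sym[OF that(3)]] by blast
  ultimately show ?thesis using that ps by blast
qed

lemma W_lloc_props:
  shows "[:0, 1:] * h \<in> W_poly" "[:0, 1:] * h \<notin> pWp 1" "W_lloc h = W_loc ([:0, 1:] * h)"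
    "W_loc h \<subseteq> W_lloc h" "inverse Kt_t \<in> W_lloc h" "inverse (emb h) \<in> W_lloc h"
proof -
  let ?t = "[:0, 1:] :: 'p K poly"
  have t: "?t \<in> W_poly" by (simp add: W_poly_pCons W_poly_ring(1))
  show 1: "?t * h \<in> W_poly" by (rule W_poly_ring(4)[OF t h(1)])
  have "coeff (?t * h) 1 = 1" using h(2) by simp
  moreover have "coeff (?t * h) 1 \<in> pW 1" if "?t * h \<in> pWp 1" using that unfolding pWp_def by blast
  ultimately show 2: "?t * h \<notin> pWp 1" using one_notin_pW[of 0] by auto
  show 3: "W_lloc h = W_loc (?t * h)" by (rule W_lloc_eq[OF h_nz h(1)])
  show "W_loc h \<subseteq> W_lloc h"
  proof
    fix x assume "x \<in> W_loc h"
    then obtain g k where "x = Fract g (?t ^ 0 * h ^ k)" "g \<in> W_poly" unfolding W_loc_def by auto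
    then show "x \<in> W_lloc h" unfolding W_lloc_def by blast
  qed
  have "inverse Kt_t = Fract 1 (?t ^ 1 * h ^ 0)" by (simp add: Kt_t_def)
  then show "inverse Kt_t \<in> W_lloc h" unfolding W_lloc_def using W_poly_ring(2) by blast
  have "inverse (emb h) = Fract 1 (?t ^ 0 * h ^ 1)" by simp
  then show "inverse (emb h) \<in> W_lloc h" unfolding W_lloc_def using W_poly_ring(2) by blast
qed

lemma lconv_of_fps:
  assumes "f \<in> conv h"
  obtains w where "pseq CARD('p) (W_lloc h) w" "lconv_of_fps h f = pmk CARD('p) (W_lloc h) w"
    "\<And>x e. x \<in> W_loc h \<Longrightarrow> expands x e \<Longrightarrow> fcong 1 e f \<Longrightarrow> pcong CARD('p) (W_lloc h) 1 (w 1) x"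
proof -
  note A = subring_W_loc[OF hp] and B = subring_W_loc[OF W_lloc_props(1,2), folded W_lloc_props(3)]
  obtain w where w: "pseq CARD('p) (W_loc h) w" "conv_of_fps h f = pmk CARD('p) (W_loc h) w"
    "\<And>x e. x \<in> W_loc h \<Longrightarrow> expands x e \<Longrightarrow> fcong 1 e f \<Longrightarrow> pcong CARD('p) (W_loc h) 1 (w 1) x"
    by (rule conv_of_fps[OF assms]) blast
  have imp: "pcong CARD('p) (W_lloc h) n x y" if "pcong CARD('p) (W_loc h) n x y" for n x y
    using that W_lloc_props(4) unfolding pcong_def by blast
  show ?thesis
  proof (rule that)
    show "pseq CARD('p) (W_lloc h) w"
      using pseqD[OF A w(1)] imp W_lloc_props(4) by (intro pseqI[OF B]) blast+
    show "lconv_of_fps h f = pmk CARD('p) (W_lloc h) w"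
      unfolding lconv_of_fps_def w(2) by (rule p_incl_pmk[OF A W_lloc_props(4) B])
  qed (use w(3) imp in blast)
qed

end

text \<open>Here \<open>x\<close> and \<open>y\<close> are rational functions that agree with \<open>f\<close> and \<open>g\<close> modulo \<open>p\<close>. Since congruences
  modulo \<open>p\<close> in the completion are seen on first components, a congruence between \<open>x\<close> and \<open>y(t\<^sup>-\<^sup>1)\<close>
  in the Gauss valuation ring is all that is left. The congruence between \<open>k(t\<^sup>-\<^sup>1)\<close> and \<open>h\<close>, up to
  a unit of \<open>W[t, t\<^sup>-\<^sup>1]\<close>, is what makes the substitution pass to the completions.\<close>

lemma ring_cong_lconv_omega:
  fixes h k :: "'p::prime_card K poly"
  assumes h: "h \<in> W_poly" "coeff h 0 = 1" and k: "k \<in> W_poly" "coeff k 0 = 1"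
    and u: "Wunit u" and hk: "pcong CARD('p) OG 1 (iota (emb k)) (Kt_const u * inverse Kt_t ^ d * emb h)"
    and f: "f \<in> conv h" "x \<in> W_loc h" "expands x e" "fcong 1 e f"
    and g: "g \<in> conv k" "y \<in> W_loc k" "expands y e'" "fcong 1 e' g"
    and xy: "pcong CARD('p) OG 1 x (- iota y)"
  shows "ring_cong (W_lconv h) CARD('p) (lconv_of_fps h f) (\<ominus>\<^bsub>W_lconv h\<^esub> omega k h (lconv_of_fps k g))"
proof -
  let ?th = "[:0, 1:] * h" and ?tk = "[:0, 1:] * k"
  note ph = W_lloc_props[OF h] and pk = W_lloc_props[OF k]
  note O = subring_OG
  have unit: "Kt_const u \<in> OG" "Kt_const (inverse u) \<in> OG" "Kt_const (inverse u) * Kt_const u = 1"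
    "Kt_const u \<in> W_loc ?th" "Kt_const u \<in> W_loc ?tk" "Kt_const (inverse u) \<in> W_loc ?th" "Kt_const (inverse u) \<in> W_loc ?tk"
    using OG_poly[of "[:u:]"] OG_poly[of "[:inverse u:]"] W_loc_poly[OF ph(1,2), of "[:u:]"] W_loc_poly[OF pk(1,2), of "[:u:]"]
      W_loc_poly[OF ph(1,2), of "[:inverse u:]"] W_loc_poly[OF pk(1,2), of "[:inverse u:]"] 
      Wunit_W[OF u] Wunit_inverse_W[OF u] Wunit_nz[OF u]
    by (simp_all add: Kt_const_def W_poly_pCons W_poly_ring(1) Kt_const_hom(2,4)[unfolded Kt_const_def, symmetric] del: mult_fract)
  have "[:0, 1:] \<in> (W_poly :: 'p K poly set)" by (simp add: W_poly_pCons W_poly_ring(1))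
  then have tO1: "Kt_t \<in> (OG :: 'p Kt set)" unfolding Kt_t_def by (rule OG_poly)
  have tO2: "inverse Kt_t \<in> (OG :: 'p Kt set)"
    by (rule subsetD[OF W_loc_OG[OF ph(1,2)] ph(5)[unfolded ph(3)]])
  note tO = tO1 tO2
  text \<open>A localization is carried into the closure of the other one, as the image of the
    denominator is congruent to a unit.\<close>
  have transfer: "\<exists>v\<in>W_loc s. pcong CARD('p) OG n v (iota w)"
    if r: "r = [:0, 1:] * r'" "r \<in> W_poly" "r \<notin> pWp 1" "r' \<in> W_poly" "r' \<notin> pWp 1" 
      and s: "s \<in> W_poly" "s \<notin> pWp 1" and b: "b \<in> W_loc s" "b' \<in> W_loc s" "b' * b = 1"
      and ib: "pcong CARD('p) OG 1 (iota (emb r')) b" and it: "inverse Kt_t \<in> W_loc s"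
      and w: "w \<in> W_loc r" for r s r' b b' w n
  proof -
    let ?cl = "pclosure CARD('p) OG (W_loc s)"
    note S = subring_W_loc[OF s] W_loc_OG[OF s]
    note cl = subring_setD[OF subring_set_pclosure[OF O S, where p = "CARD('p)"]]
    have sub: "x \<in> ?cl" if "x \<in> W_loc s" for x using subset_pclosure[OF O S] that by blast
    have t_s: "Kt_t \<in> W_loc s" using W_loc_poly[OF s, of "[:0, 1:]"] by (simp add: Kt_t_def W_poly_pCons W_poly_ring(1))
    have poly: "iota_poly g \<in> ?cl" if "g \<in> W_poly" for g
      using that
    proof (induction g)
      case 0
      then show ?case using cl(1) by simp
    next
      case (pCons a g)
      then have ag: "a \<in> W" "g \<in> W_poly" by (auto simp: W_poly_pCons)
      have "Kt_const a \<in> W_loc s"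
        using W_loc_poly[OF s, of "[:a:]"] ag by (simp add: Kt_const_def W_poly_pCons W_poly_ring(1))
      then show ?case unfolding iota_poly_pCons by (intro cl(3) cl(4) sub it pCons.IH ag)
    qed
    have r'0: "emb r' \<noteq> 0" unfolding emb_0_iff using that(5) by auto
    have "inverse (emb r') \<in> W_loc r'" using W_loc_I[OF r(4,5) W_poly_ring(2), of 1] by (simp only: emb_simps(6) mult_1 power_one_right)
    then have inO: "inverse (emb r') \<in> OG" using W_loc_OG[OF r(4,5)] by blast
    have inv: "iota (inverse (emb r')) \<in> ?cl"
    proof (rule pclosure_inverse[OF O S])
      show "iota (emb r') \<in> ?cl" unfolding iota_emb by (rule poly[OF r(4)])
      show "b' \<in> ?cl" by (rule sub[OF b(2)])
      have "pcong CARD('p) OG 1 (iota (emb r') * b') (b * b')"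
        using b(1,2) S(2) by (intro pcong_mult[OF O] ib pcong_refl[OF O]) auto
      then show "pcong CARD('p) OG 1 (iota (emb r') * b') 1" using b(3) by (simp add: mult.commute)
      have "emb r' * inverse (emb r') = 1" using r'0 by (simp del: inverse_fract)
      then show "iota (emb r') * iota (inverse (emb r')) = 1" by (simp only: iota_hom(4)[symmetric] iota_hom(2))
      show "iota (inverse (emb r')) \<in> OG" by (rule iota_OG[OF inO])
    qed
    obtain g k where g: "g \<in> W_poly" "w = emb g * inverse (emb r) ^ k" by (rule W_loc_E[OF r(2,3) w])
    have "inverse (emb r) = inverse Kt_t * inverse (emb r')"
      unfolding r(1) emb_simps(2) Kt_t_def by (rule inverse_mult_distrib)
    then have "iota w = iota_poly g * (Kt_t * iota (inverse (emb r'))) ^ k"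
      unfolding g(2) by (simp only: iota_hom iota_emb iota_inverse[OF Kt_t_nz] iota_t inverse_inverse_eq)
    then have "iota w \<in> ?cl" by (simp only:) (intro cl(4) cl(7) poly g sub t_s inv)
    then obtain v where "v \<in> W_loc s" "pcong CARD('p) OG n (iota w) v" unfolding pclosure_def by blast
    then show ?thesis using pcong_sym[OF O] by blast
  qed
  have kO: "emb h \<in> OG" by (rule OG_poly[OF h(1)])
  interpret I: iota_pair ?tk ?th
  proof
    show "?tk \<in> W_poly" "?tk \<notin> pWp 1" "?th \<in> W_poly" "?th \<notin> pWp 1" using ph pk by auto
    fix w n assume w_in: "w \<in> W_loc ?tk"
    show "\<exists>v\<in>W_loc ?th. pcong CARD('p) OG n v (iota w)"
    proof (rule transfer[OF refl pk(1,2) k(1) prim_of_one[OF k(2)] ph(1,2) _ _ _ hk])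
      have hh: "emb h \<in> W_loc ?th" "inverse (emb h) \<in> W_loc ?th" "inverse Kt_t \<in> W_loc ?th" "Kt_t \<in> W_loc ?th"
        using W_loc_poly[OF ph(1,2) h(1)] ph(3,5,6) W_loc_poly[OF ph(1,2), of "[:0, 1:]"]
        by (auto simp: Kt_t_def W_poly_pCons W_poly_ring(1))
      note R = subring_setD[OF subring_W_loc[OF ph(1,2)]]
      show "Kt_const u * inverse Kt_t ^ d * emb h \<in> W_loc ?th"
        by (intro R(4) R(7) unit hh)
      show "Kt_const (inverse u) * Kt_t ^ d * inverse (emb h) \<in> W_loc ?th"
        by (intro R(4) R(7) unit hh)
      have "Kt_const (inverse u) * Kt_t ^ d * inverse (emb h) * (Kt_const u * inverse Kt_t ^ d * emb h)
        = (Kt_const (inverse u) * Kt_const u) * (Kt_t * inverse Kt_t) ^ d * (emb h * inverse (emb h))"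
        by (simp only: power_mult_distrib mult_ac)
      also have "\<dots> = 1" unfolding unit(3) emb_r_inv[OF h(1) prim_of_one[OF h(2)]] by (simp del: inverse_fract)
      finally show "Kt_const (inverse u) * Kt_t ^ d * inverse (emb h) * (Kt_const u * inverse Kt_t ^ d * emb h) = 1" .
      show "w \<in> W_loc ?tk" by (rule w_in)
      show "inverse Kt_t \<in> W_loc ?th" by (rule hh)
    qed
  next
    fix v n assume v_in: "v \<in> W_loc ?th"
    have hk': "pcong CARD('p) OG 1 (iota (emb h)) (Kt_const (inverse u) * inverse Kt_t ^ d * emb k)"
    proof -
      have "pcong CARD('p) OG 1 (iota (iota (emb k))) (iota (Kt_const u * inverse Kt_t ^ d * emb h))"
        by (rule pcong_iota[OF hk])
      then have "pcong CARD('p) OG 1 (emb k) (Kt_const u * Kt_t ^ d * iota (emb h))"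
        by (simp only: iota_iota iota_hom iota_const iota_inverse[OF Kt_t_nz] iota_t inverse_inverse_eq)
      then have "pcong CARD('p) OG 1 (Kt_const (inverse u) * inverse Kt_t ^ d * emb k) (Kt_const (inverse u) * inverse Kt_t ^ d * (Kt_const u * Kt_t ^ d * iota (emb h)))"
        by (intro pcong_mult[OF O] pcong_refl[OF O] OG_ring(4) OG_ring(7) unit tO OG_poly k(1))
      also have "Kt_const (inverse u) * inverse Kt_t ^ d * (Kt_const u * Kt_t ^ d * iota (emb h))
         = (Kt_const (inverse u) * Kt_const u) * (Kt_t * inverse Kt_t) ^ d * iota (emb h)"
        by (simp only: power_mult_distrib mult_ac)
      also have "\<dots> = iota (emb h)" unfolding unit(3) by (simp del: inverse_fract)
      finally show ?thesis by (rule pcong_sym[OF O])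
    qed
    have "\<exists>w\<in>W_loc ?tk. pcong CARD('p) OG n w (iota v)"
    proof (rule transfer[OF refl ph(1,2) h(1) prim_of_one[OF h(2)] pk(1,2) _ _ _ hk'])
      have hh: "emb k \<in> W_loc ?tk" "inverse (emb k) \<in> W_loc ?tk" "inverse Kt_t \<in> W_loc ?tk" "Kt_t \<in> W_loc ?tk"
        using W_loc_poly[OF pk(1,2) k(1)] pk(3,5,6) W_loc_poly[OF pk(1,2), of "[:0, 1:]"]
        by (auto simp: Kt_t_def W_poly_pCons W_poly_ring(1))
      note R = subring_setD[OF subring_W_loc[OF pk(1,2)]]
      show "Kt_const (inverse u) * inverse Kt_t ^ d * emb k \<in> W_loc ?tk"
        by (intro R(4) R(7) unit hh)
      show "Kt_const u * Kt_t ^ d * inverse (emb k) \<in> W_loc ?tk"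
        by (intro R(4) R(7) unit hh)
      have "Kt_const u * Kt_t ^ d * inverse (emb k) * (Kt_const (inverse u) * inverse Kt_t ^ d * emb k)
        = (Kt_const (inverse u) * Kt_const u) * (Kt_t * inverse Kt_t) ^ d * (emb k * inverse (emb k))"
        by (simp only: power_mult_distrib mult_ac)
      also have "\<dots> = 1" unfolding unit(3) emb_r_inv[OF k(1) prim_of_one[OF k(2)]] by (simp del: inverse_fract)
      finally show "Kt_const u * Kt_t ^ d * inverse (emb k) * (Kt_const (inverse u) * inverse Kt_t ^ d * emb k) = 1" .
      show "v \<in> W_loc ?th" by (rule v_in)
      show "inverse Kt_t \<in> W_loc ?tk" by (rule hh)
    qed
    then obtain w where w: "w \<in> W_loc ?tk" "pcong CARD('p) OG n w (iota v)" by blast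
    have "pcong CARD('p) OG n (iota w) v" using pcong_iota[OF w(2)] by (simp only: iota_iota)
    then show "\<exists>w\<in>W_loc ?tk. pcong CARD('p) OG n v (iota w)" using w(1) pcong_sym[OF O] by blast
  qed
  have Kw: "Kt_const w \<in> W_loc ?th" "Kt_const w \<in> W_loc ?tk" if "w \<in> W" for w
    using W_loc_poly[OF ph(1,2), of "[:w:]"] W_loc_poly[OF pk(1,2), of "[:w:]"] that
    by (simp_all add: Kt_const_def W_poly_pCons W_poly_ring(1))
  have tk: "Kt_t \<in> W_loc ?tk" using W_loc_poly[OF pk(1,2), of "[:0, 1:]"] by (simp add: Kt_t_def W_poly_pCons W_poly_ring(1))
  have omega: "omega k h = I.Om"
    unfolding omega_def W_lconv_def ph(3) pk(3)
  proof (rule the_equality)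
    show "I.Om \<in> ring_iso (p_completion CARD('p) (W_loc ?tk)) (p_completion CARD('p) (W_loc ?th)) \<and>
      I.Om \<in> extensional (carrier (p_completion CARD('p) (W_loc ?tk))) \<and>
      (\<forall>w\<in>W. I.Om (p_const CARD('p) (W_loc ?tk) (Kt_const w)) = p_const CARD('p) (W_loc ?th) (Kt_const w)) \<and>
      I.Om (p_const CARD('p) (W_loc ?tk) Kt_t) = p_const CARD('p) (W_loc ?th) (inverse Kt_t)"
      by (intro conjI ballI I.Om_iso I.Om_extensional I.Om_const Kw tk ph(5)[unfolded ph(3)])
        (simp_all only: iota_const iota_t)
    fix f assume "f \<in> ring_iso (p_completion CARD('p) (W_loc ?tk)) (p_completion CARD('p) (W_loc ?th)) \<and>
      f \<in> extensional (carrier (p_completion CARD('p) (W_loc ?tk))) \<and>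
      (\<forall>w\<in>W. f (p_const CARD('p) (W_loc ?tk) (Kt_const w)) = p_const CARD('p) (W_loc ?th) (Kt_const w)) \<and>
      f (p_const CARD('p) (W_loc ?tk) Kt_t) = p_const CARD('p) (W_loc ?th) (inverse Kt_t)"
    then show "f = I.Om" using ph(5)[unfolded ph(3)] by (intro I.Om_unique) blast+
  qed
  note Ah = subring_W_loc[OF ph(1,2), folded ph(3)] and Ak = subring_W_loc[OF pk(1,2), folded pk(3)]
  obtain w where w: "pseq CARD('p) (W_lloc h) w" "lconv_of_fps h f = pmk CARD('p) (W_lloc h) w"
    "pcong CARD('p) (W_lloc h) 1 (w 1) x"
    by (rule lconv_of_fps[OF h f(1)]) (use f(2-4) in blast)
  obtain v where v: "pseq CARD('p) (W_lloc k) v" "lconv_of_fps k g = pmk CARD('p) (W_lloc k) v"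
    "pcong CARD('p) (W_lloc k) 1 (v 1) y"
    by (rule lconv_of_fps[OF k g(1)]) (use g(2-4) in blast)
  have vc: "pmk CARD('p) (W_lloc k) v \<in> carrier (p_completion CARD('p) (W_loc ?tk))"
    using pmk_carrier[OF Ak v(1)] by (simp only: pk(3))
  obtain v' z where z: "pseq CARD('p) (W_loc ?tk) v'" "pmk CARD('p) (W_lloc k) v = pmk CARD('p) (W_loc ?tk) v'" 
    "\<And>n. pcong CARD('p) OG n (z n) (iota (v' n))"
    "pseq CARD('p) (W_loc ?th) z" "I.Om (pmk CARD('p) (W_lloc k) v) = pmk CARD('p) (W_loc ?th) z"
    by (rule I.Om_cases[OF vc]) blast
  have z1: "pcong CARD('p) OG 1 (w 1) (- z 1)"
  proof -
    have "pcong CARD('p) (W_lloc k) 1 (v 1) (v' 1)" using z(2) unfolding pk(3) pmk_eq_iff[OF I.A] by blast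
    then have "pcong CARD('p) (W_lloc k) 1 (v' 1) y" by (rule pcong_trans[OF Ak pcong_sym[OF Ak] v(3)])
    then have "pcong CARD('p) OG 1 (v' 1) y" using W_loc_OG[OF pk(1,2)] unfolding pk(3) pcong_def by blast
    then have "pcong CARD('p) OG 1 (z 1) (iota y)" by (rule pcong_trans[OF O z(3) pcong_iota])
    then have "pcong CARD('p) OG 1 (- iota y) (- z 1)" by (intro pcong_minus[OF O] pcong_sym[OF O, of _ _ "z 1"])
    moreover have "pcong CARD('p) OG 1 (w 1) x" using w(3) W_loc_OG[OF ph(1,2)] unfolding ph(3) pcong_def by blast
    ultimately show ?thesis using pcong_trans[OF O] xy by blast
  qed
  have zs: "pseq CARD('p) (W_lloc h) z" using z(4) by (simp only: ph(3))
  have "pcong CARD('p) (W_lloc h) 1 (w 1) (- z 1)"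
    using pcong_W_loc_OG[OF ph(1,2), of "w 1" "- z 1" 1] pseqD(1)[OF Ah w(1), of 1] pseqD(1)[OF Ah pseq_minus[OF Ah zs], of 1] z1
    by (simp only: ph(3))
  then have "ring_cong (p_completion CARD('p) (W_lloc h)) CARD('p) (pmk CARD('p) (W_lloc h) w) (pmk CARD('p) (W_lloc h) (\<lambda>n. - z n))"
    by (intro ring_cong_pmk[OF Ah pKt_tf w(1) pseq_minus[OF Ah zs]])
  then show ?thesis
    unfolding W_lconv_def w(2) omega v(2) z(5) ph(3)[symmetric] pmk_minus[OF Ah zs] .
qed

section \<open>Dwork primes and digits\<close>

lemma wcong_add_pW: "wcong n x y \<Longrightarrow> x \<in> pW n \<longleftrightarrow> y \<in> pW n"
  using wcong_trans[of n x y 0] wcong_trans[of n y x 0] wcong_sym[of n x y] by auto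

lemma dwork_l_unique_aux:
  assumes "k < CARD('p)" "l < CARD('p)" "\<alpha> + of_nat k \<in> pW 1" "\<alpha> + of_nat l \<in> (pW 1 :: 'p::prime_card K set)"
  shows "k = l"
proof -
  have "(\<alpha> + of_nat k) - (\<alpha> + of_nat l) \<in> pW 1" by (rule pW_diff[OF assms(3,4)])
  then have "wcong 1 (of_nat k :: 'p K) (of_nat l)" by (simp add: wcong_def)
  then have "[k = l] (mod CARD('p))" unfolding wcong_of_nat by simp
  then show ?thesis using assms(1,2) by (simp add: cong_def)
qed

lemma dwork_l_props:
  assumes "(\<alpha> :: 'p::prime_card K) \<in> Zp"
  shows "dwork_l \<alpha> < CARD('p)" "\<alpha> + of_nat (dwork_l \<alpha>) \<in> pW 1"
proof -
  obtain m where m: "wcong 1 (- \<alpha>) (of_nat m)" by (rule Zp_approx[OF Zp_uminus[OF assms]])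
  let ?l = "m mod CARD('p)"
  have "wcong 1 (of_nat m :: 'p K) (of_nat ?l)" unfolding wcong_of_nat by (simp add: cong_def)
  with m have "wcong 1 (- \<alpha>) (of_nat ?l)" by (rule wcong_trans)
  then have "of_nat ?l - (- \<alpha>) \<in> pW 1" using wcong_sym unfolding wcong_def by blast
  then have "?l < CARD('p) \<and> \<alpha> + of_nat ?l \<in> pW 1" by (simp add: add.commute)
  then have "\<exists>!l. l < CARD('p) \<and> \<alpha> + of_nat l \<in> pW 1" using dwork_l_unique_aux by blast
  from theI'[OF this] show "dwork_l \<alpha> < CARD('p)" "\<alpha> + of_nat (dwork_l \<alpha>) \<in> pW 1"
    unfolding dwork_l_def by blast+
qed

lemma dwork_l_eq:
  assumes "(\<alpha> :: 'p::prime_card K) \<in> Zp" "l < CARD('p)" "\<alpha> + of_nat l \<in> pW 1"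
  shows "dwork_l \<alpha> = l"
  using dwork_l_unique_aux[OF dwork_l_props(1)[OF assms(1)] assms(2) dwork_l_props(2)[OF assms(1)] assms(3)] .

lemma pK_dwork: "pK * dwork \<alpha> = \<alpha> + of_nat (dwork_l \<alpha>)"
  by (simp add: dwork_def)

lemma dwork_Zp: assumes "(\<alpha> :: 'p::prime_card K) \<in> Zp" shows "dwork \<alpha> \<in> Zp"
proof (rule Zp_div_p)
  show "pK * dwork \<alpha> \<in> Zp" unfolding pK_dwork using assms by (intro Zp_add) auto
  have "pK * dwork \<alpha> \<in> pW (Suc 0)" unfolding pK_dwork using dwork_l_props(2)[OF assms] by simp
  then show "dwork \<alpha> \<in> W" unfolding pW_scale1 by simp
qed

lemma dwork_iter_Zp: "\<alpha> \<in> Zp \<Longrightarrow> (dwork ^^ i) \<alpha> \<in> Zp"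
  by (induction i) (auto intro: dwork_Zp)

lemma dwork_one: "dwork_l (1 :: 'p::prime_card K) = CARD('p) - 1" "dwork (1 :: 'p K) = 1"
proof -
  have "1 + of_nat (CARD('p) - 1) = (pK :: 'p K)"
    by (simp add: of_nat_diff Suc_leI)
  then show l: "dwork_l (1 :: 'p K) = CARD('p) - 1" by (intro dwork_l_eq) simp_all
  show "dwork (1 :: 'p K) = 1" unfolding dwork_def l by (simp add: of_nat_diff Suc_leI)
qed

lemma dwork_iter_one: "(dwork ^^ i) (1 :: 'p::prime_card K) = 1"
  by (induction i) (simp_all add: dwork_one)

lemma dwork_one_minus:
  assumes "(\<alpha> :: 'p::prime_card K) \<in> Zp"
  shows "dwork_l (1 - \<alpha>) = CARD('p) - 1 - dwork_l \<alpha>" "dwork (1 - \<alpha>) = 1 - dwork \<alpha>"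
proof -
  have lt: "dwork_l \<alpha> \<le> CARD('p) - 1" using dwork_l_props(1)[OF assms] by simp
  have e: "(of_nat (CARD('p) - 1 - dwork_l \<alpha>) :: 'p K) = pK - 1 - of_nat (dwork_l \<alpha>)"
  proof -
    have "CARD('p) - 1 - dwork_l \<alpha> = CARD('p) - Suc (dwork_l \<alpha>)" by simp
    moreover have "Suc (dwork_l \<alpha>) \<le> CARD('p)" using dwork_l_props(1)[OF assms] by simp
    ultimately show ?thesis by (simp only: of_nat_diff of_nat_Suc diff_diff_eq add.commute)
  qed
  have "1 - \<alpha> + of_nat (CARD('p) - 1 - dwork_l \<alpha>) = pK - (\<alpha> + of_nat (dwork_l \<alpha>))"
    unfolding e by simp
  also have "\<dots> \<in> pW 1" using dwork_l_props(2)[OF assms] by (intro pW_diff) auto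
  finally show l: "dwork_l (1 - \<alpha>) = CARD('p) - 1 - dwork_l \<alpha>"
    using assms by (intro dwork_l_eq) auto
  have "dwork (1 - \<alpha>) = (pK - (\<alpha> + of_nat (dwork_l \<alpha>))) / pK" unfolding dwork_def l e by simp
  also have "\<dots> = 1 - dwork \<alpha>" by (simp add: dwork_def diff_divide_distrib)
  finally show "dwork (1 - \<alpha>) = 1 - dwork \<alpha>" .
qed

lemma dwork_iter_one_minus: "\<alpha> \<in> Zp \<Longrightarrow> (dwork ^^ i) (1 - \<alpha>) = 1 - (dwork ^^ i) \<alpha>"
  by (induction i) (simp_all add: dwork_one_minus dwork_iter_Zp)

lemma dwork_iter_sum:
  "\<alpha> + (\<Sum>i<n. of_nat (dwork_l ((dwork ^^ i) \<alpha>)) * pK ^ i) = pK ^ n * (dwork ^^ n) \<alpha>"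
proof (induction n)
  case (Suc n)
  have "\<alpha> + (\<Sum>i<Suc n. of_nat (dwork_l ((dwork ^^ i) \<alpha>)) * pK ^ i)
      = pK ^ n * ((dwork ^^ n) \<alpha> + of_nat (dwork_l ((dwork ^^ n) \<alpha>)))"
    using Suc by (simp add: algebra_simps)
  then show ?case unfolding pK_dwork[symmetric] by simp
qed simp

text \<open>With \<open>l\<^sub>i\<close> for the right-hand side, \<open>\<alpha> + (\<Sum>i<n. l\<^sub>i p\<^sup>i)\<close> is \<open>p\<^sup>n\<close> times the \<open>n\<close>-th Dwork prime of
  \<open>\<alpha>\<close>. So the \<open>l\<^sub>i\<close> are the digits of \<open>-\<alpha>\<close>, and these are unique.\<close>

lemma dwork_digit_eq:
  assumes a: "(\<alpha> :: 'p::prime_card K) \<in> Zp"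
  shows "dwork_digit \<alpha> i = dwork_l ((dwork ^^ i) \<alpha>)"
proof -
  let ?d = "\<lambda>i. dwork_l ((dwork ^^ i) \<alpha>)"
  note Z = dwork_iter_Zp[OF a]
  have "dwork_digit \<alpha> = ?d"
    unfolding dwork_digit_def
  proof (rule the_equality)
    show "(\<forall>i. ?d i < CARD('p)) \<and> (\<forall>n. \<alpha> + (\<Sum>i<n. of_nat (?d i) * pK ^ i) \<in> pW n)"
      unfolding dwork_iter_sum using dwork_l_props(1)[OF Z] Zp_W[OF Z] by (auto intro!: pW_mult_W)
  next
    fix d assume d: "(\<forall>i. d i < CARD('p)) \<and> (\<forall>n. \<alpha> + (\<Sum>i<n. of_nat (d i) * pK ^ i) \<in> pW n)"
    show "d = ?d"
    proof
      fix i show "d i = ?d i"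
      proof (induction i rule: less_induct)
        case (less i)
        have "\<alpha> + (\<Sum>j<i. of_nat (d j) * pK ^ j) = \<alpha> + (\<Sum>j<i. of_nat (?d j) * pK ^ j)"
          using less by (intro arg_cong2[where f = "(+)"] sum.cong refl) simp
        also have "\<dots> = pK ^ i * (dwork ^^ i) \<alpha>" by (rule dwork_iter_sum)
        finally have "\<alpha> + (\<Sum>j<Suc i. of_nat (d j) * pK ^ j) = pK ^ i * ((dwork ^^ i) \<alpha> + of_nat (d i))"
          by (simp add: algebra_simps)
        moreover have "\<alpha> + (\<Sum>j<Suc i. of_nat (d j) * pK ^ j) \<in> pW (Suc i)" using d by blast
        ultimately have "pK ^ i * ((dwork ^^ i) \<alpha> + of_nat (d i)) \<in> pW (i + 1)" by simp
        then have "(dwork ^^ i) \<alpha> + of_nat (d i) \<in> pW 1" unfolding pW_scale .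
        then show ?case using dwork_l_eq[OF Z, of "d i" i] d by simp
      qed
    qed
  qed
  then show ?thesis by simp
qed

text \<open>No carry occurs when \<open>-a\<close> is doubled.\<close>

lemma dwork_double_step:
  assumes b: "(b :: 'p::prime_card K) \<in> Zp" and lt: "dwork_l b < dwork_l (2 * b)"
  shows "0 < dwork_l b" "2 * dwork_l b < CARD('p)" "dwork_l (2 * b) = 2 * dwork_l b" "dwork (2 * b) = 2 * dwork b"
proof -
  let ?l = "dwork_l b"
  have b2: "2 * b \<in> Zp" unfolding mult_2 by (rule Zp_add[OF b b])
  have "2 * (b + of_nat ?l) \<in> pW 1" using dwork_l_props(2)[OF b] by (intro W_mult_pW) auto
  then have in1: "2 * b + of_nat (2 * ?l) \<in> pW 1" by (simp add: algebra_simps)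
  show small: "2 * ?l < CARD('p)"
  proof (rule ccontr)
    assume "\<not> 2 * ?l < CARD('p)"
    then have ge: "CARD('p) \<le> 2 * ?l" by simp
    have "2 * b + of_nat (2 * ?l - CARD('p)) = (2 * b + of_nat (2 * ?l)) - pK" using ge by (simp add: of_nat_diff)
    also have "\<dots> \<in> pW 1" using in1 by (intro pW_diff) auto
    finally have "dwork_l (2 * b) = 2 * ?l - CARD('p)"
      using dwork_l_props(1)[OF b] ge by (intro dwork_l_eq[OF b2]) auto
    then show False using lt dwork_l_props(1)[OF b] ge by simp
  qed
  show eq: "dwork_l (2 * b) = 2 * ?l" by (rule dwork_l_eq[OF b2 small in1])
  then show "0 < ?l" using lt by simp
  show "dwork (2 * b) = 2 * dwork b" unfolding dwork_def eq by (simp add: algebra_simps)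
qed

lemma dwork_double:
  assumes a: "(a :: 'p::prime_card K) \<in> Zp" and dig: "\<forall>i. dwork_digit a i < dwork_digit (2 * a) i"
  shows "(dwork ^^ i) (2 * a) = 2 * (dwork ^^ i) a" "0 < dwork_l ((dwork ^^ i) a)" "2 * dwork_l ((dwork ^^ i) a) < CARD('p)"
    "dwork_l (2 * (dwork ^^ i) a) = 2 * dwork_l ((dwork ^^ i) a)"
proof -
  have a2: "2 * a \<in> Zp" unfolding mult_2 by (rule Zp_add[OF a a])
  have lt: "dwork_l ((dwork ^^ i) a) < dwork_l ((dwork ^^ i) (2 * a))" for i
    using dig dwork_digit_eq[OF a] dwork_digit_eq[OF a2] by simp
  have eq: "(dwork ^^ i) (2 * a) = 2 * (dwork ^^ i) a" for i
  proof (induction i)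
    case (Suc i)
    then show ?case using dwork_double_step(4)[OF dwork_iter_Zp[OF a, of i]] lt[of i] by simp
  qed simp
  show "(dwork ^^ i) (2 * a) = 2 * (dwork ^^ i) a" by (rule eq)
  show "0 < dwork_l ((dwork ^^ i) a)" "2 * dwork_l ((dwork ^^ i) a) < CARD('p)"
    "dwork_l (2 * (dwork ^^ i) a) = 2 * dwork_l ((dwork ^^ i) a)"
    using dwork_double_step[OF dwork_iter_Zp[OF a, of i]] lt[of i] unfolding eq by auto
qed

text \<open>If \<open>\<alpha> + j = 0\<close>, then the residue of \<open>j\<close> is \<open>l\<^sub>\<alpha> > 0\<close>, and \<open>\<alpha>' + (j - l\<^sub>\<alpha>)/p = 0\<close> with a smaller
  integer.\<close>

lemma not_nonpos_int:
  assumes "\<alpha> \<in> Zp" "\<And>i. 0 < dwork_l ((dwork ^^ i) \<alpha>)"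
  shows "\<alpha> + of_nat j \<noteq> (0 :: 'p::prime_card K)"
  using assms
proof (induction j arbitrary: \<alpha> rule: less_induct)
  case (less j)
  show ?case
  proof
    assume z: "\<alpha> + of_nat j = 0"
    let ?p = "CARD('p)"
    have j: "of_nat j = (of_nat (j mod ?p) + pK * of_nat (j div ?p) :: 'p K)"
      by (metis add.commute mult_div_mod_eq of_nat_add of_nat_mult)
    have e: "\<alpha> + of_nat (j mod ?p) = - (pK * of_nat (j div ?p))"
      using z unfolding j by (simp only: add.assoc[symmetric] eq_neg_iff_add_eq_0)
    have l: "dwork_l \<alpha> = j mod ?p"
      by (rule dwork_l_eq[OF less.prems(1)]) (auto simp: e intro!: pW_neg pW_mult_W)
    have "j mod ?p > 0" using less.prems(2)[of 0] l by simp
    then have "j > 0" by (cases j) auto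
    then have lt: "j div ?p < j" using prime_gt_1_nat[OF prime_card[where 'a='p]] by simp
    have "dwork \<alpha> + of_nat (j div ?p) = 0" unfolding dwork_def l e by simp
    moreover have "dwork \<alpha> + of_nat (j div ?p) \<noteq> 0"
    proof (rule less.IH[OF lt dwork_Zp[OF less.prems(1)]])
      fix i show "0 < dwork_l ((dwork ^^ i) (dwork \<alpha>))"
        using less.prems(2)[of "Suc i"] by (simp add: funpow_swap1)
    qed
    ultimately show False by simp
  qed
qed

section \<open>Pochhammer symbols without the factors divisible by p\<close>

text \<open>Factors divisible by \<open>p\<close> are replaced by \<open>1\<close>, as in the product that defines the \<open>p\<close>-adic Gamma
  function.\<close>

definition upart :: "'p::prime_card K \<Rightarrow> 'p K" where
  "upart x = (if x \<in> pW 1 then 1 else x)"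

definition upoch :: "'p::prime_card K \<Rightarrow> nat \<Rightarrow> 'p K" where
  "upoch \<alpha> n = (\<Prod>i<n. upart (\<alpha> + of_nat i))"

lemma Wunit_upart: "x \<in> W \<Longrightarrow> Wunit (upart x)"
  by (simp add: upart_def Wunit_def[of x]) 

lemma Wunit_upoch: "\<alpha> \<in> W \<Longrightarrow> Wunit (upoch \<alpha> n)"
  unfolding upoch_def by (intro Wunit_prod Wunit_upart) auto

lemma upart_cong: "wcong n x y \<Longrightarrow> n > 0 \<Longrightarrow> wcong n (upart x) (upart y)"
  using pW1_cong[of n x y] by (simp add: upart_def)

lemma upoch_cong:
  assumes "wcong n \<alpha> \<beta>" "n > 0" "\<alpha> \<in> W" shows "wcong n (upoch \<alpha> k) (upoch \<beta> k)"
  unfolding upoch_def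
  using assms by (intro wcong_prod upart_cong wcong_add Wunit_W[OF Wunit_upart]) auto

lemma upart_of_nat: "upart (of_nat k :: 'p::prime_card K) = (if CARD('p) dvd k then 1 else of_nat k)"
  unfolding upart_def of_nat_pW1 ..

lemma in_pW1_iff_dwork_l:
  assumes "(\<alpha> :: 'p::prime_card K) \<in> Zp"
  shows "\<alpha> + of_nat i \<in> pW 1 \<longleftrightarrow> i mod CARD('p) = dwork_l \<alpha>"
proof -
  have "wcong 1 (of_nat i :: 'p K) (of_nat (i mod CARD('p)))" unfolding wcong_of_nat by (simp add: cong_def)
  then have "wcong 1 (\<alpha> + of_nat i) (\<alpha> + of_nat (i mod CARD('p)))" by (intro wcong_add wcong_refl)
  then have "\<alpha> + of_nat i \<in> pW 1 \<longleftrightarrow> \<alpha> + of_nat (i mod CARD('p)) \<in> pW 1" by (rule wcong_add_pW)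
  also have "\<dots> \<longleftrightarrow> i mod CARD('p) = dwork_l \<alpha>"
    using dwork_l_eq[OF assms, of "i mod CARD('p)"] dwork_l_props[OF assms] by auto
  finally show ?thesis .
qed

text \<open>The factors of \<open>(\<alpha>)\<^sub>n\<close> that are divisible by \<open>p\<close> are \<open>\<alpha> + l\<^sub>\<alpha> + p j = p (\<alpha>' + j)\<close>, and \<open>m\<close> counts
  them.\<close>

lemma pochhammer_upoch:
  assumes a: "(\<alpha> :: 'p::prime_card K) \<in> Zp" and m: "\<And>j. dwork_l \<alpha> + CARD('p) * j < n \<longleftrightarrow> j < m"
  shows "pochhammer \<alpha> n = pK ^ m * pochhammer (dwork \<alpha>) m * upoch \<alpha> n"
proof -
  let ?p = "CARD('p)"
  let ?g = "\<lambda>i. if \<alpha> + of_nat i \<in> pW 1 then \<alpha> + of_nat i else 1"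
  have "pochhammer \<alpha> n = (\<Prod>i<n. ?g i * upart (\<alpha> + of_nat i))"
    unfolding pochhammer_prod atLeast0LessThan by (intro prod.cong refl) (simp add: upart_def)
  also have "\<dots> = (\<Prod>i<n. ?g i) * upoch \<alpha> n" by (simp add: prod.distrib upoch_def)
  also have "(\<Prod>i<n. ?g i) = (\<Prod>i\<in>(\<lambda>j. dwork_l \<alpha> + ?p * j) ` {..<m}. \<alpha> + of_nat i)"
  proof (rule prod.mono_neutral_cong_right)
    show "(\<lambda>j. dwork_l \<alpha> + ?p * j) ` {..<m} \<subseteq> {..<n}" using m by auto
    show "\<forall>i\<in>{..<n} - (\<lambda>j. dwork_l \<alpha> + ?p * j) ` {..<m}. ?g i = 1"
    proof
      fix i assume i: "i \<in> {..<n} - (\<lambda>j. dwork_l \<alpha> + ?p * j) ` {..<m}"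
      have "\<alpha> + of_nat i \<notin> pW 1"
      proof
        assume "\<alpha> + of_nat i \<in> pW 1"
        then have im: "i = dwork_l \<alpha> + ?p * (i div ?p)"
          unfolding in_pW1_iff_dwork_l[OF a] by (metis mod_mult_div_eq)
        then have "i div ?p < m" using m[of "i div ?p"] i by simp
        then show False using i im by blast
      qed
      then show "?g i = 1" by simp
    qed
    fix i assume "i \<in> (\<lambda>j. dwork_l \<alpha> + ?p * j) ` {..<m}"
    then have "i mod ?p = dwork_l \<alpha>" using dwork_l_props(1)[OF a] by auto
    then show "?g i = \<alpha> + of_nat i" using in_pW1_iff_dwork_l[OF a, of i] by simp
  qed simp
  also have "\<dots> = (\<Prod>j<m. \<alpha> + of_nat (dwork_l \<alpha> + ?p * j))"
    by (subst prod.reindex) (auto simp: inj_on_def)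
  also have "\<dots> = (\<Prod>j<m. pK * (dwork \<alpha> + of_nat j))"
    by (intro prod.cong refl) (simp add: distrib_left pK_dwork)
  also have "\<dots> = pK ^ m * pochhammer (dwork \<alpha>) m"
    by (simp add: prod.distrib pochhammer_prod atLeast0LessThan)
  finally show ?thesis .
qed

lemma count_block:
  assumes "l < (p::nat)" "k < p"
  shows "l + p * j < k + p * m \<longleftrightarrow> j < (if l < k then Suc m else m)"
proof -
  have 1: "l + p * j < k + p * m" if "j < m" 
  proof -
    have "p * Suc j \<le> p * m" using that by (intro mult_le_mono2) simp
    then show ?thesis using assms by simp
  qed
  have 2: "\<not> l + p * j < k + p * m" if "j > m" 
  proof -
    have "p * Suc m \<le> p * j" using that by (intro mult_le_mono2) simp
    then show ?thesis using assms by simp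
  qed
  show ?thesis using 1 2 by (cases j m rule: linorder_cases) auto
qed

lemma pochhammer_block:
  assumes "(\<alpha> :: 'p::prime_card K) \<in> Zp" "k < CARD('p)"
  defines "m' \<equiv> \<lambda>m. if dwork_l \<alpha> < k then Suc m else m"
  shows "pochhammer \<alpha> (k + CARD('p) * m) = pK ^ m' m * pochhammer (dwork \<alpha>) (m' m) * upoch \<alpha> (k + CARD('p) * m)"
  unfolding m'_def using count_block[OF dwork_l_props(1)[OF assms(1)] assms(2)] by (intro pochhammer_upoch assms(1))

text \<open>The factor by which \<open>(\<alpha>)\<^sub>n / n!\<close> differs from the corresponding ratio for the Dwork prime, apart
  from carries. Unlike \<open>(\<alpha>)\<^sub>n\<close> without its multiples of \<open>p\<close> it is Lipschitz in \<open>n\<close>.\<close>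

definition rho :: "'p::prime_card K \<Rightarrow> nat \<Rightarrow> 'p K" where
  "rho \<alpha> n = upoch \<alpha> n / upoch 1 n"

lemma Wunit_rho: "\<alpha> \<in> W \<Longrightarrow> Wunit (rho \<alpha> n)"
  unfolding rho_def by (intro Wunit_divide Wunit_upoch) auto

lemma rho_cong: "wcong n \<alpha> \<beta> \<Longrightarrow> n > 0 \<Longrightarrow> \<alpha> \<in> W \<Longrightarrow> wcong n (rho \<alpha> k) (rho \<beta> k)"
  unfolding rho_def using wcong_W'[of n \<alpha> \<beta>]
  by (intro wcong_divide upoch_cong Wunit_upoch Wunit_W[OF Wunit_upoch] wcong_refl) auto

text \<open>The product over \<open>k < x\<close> and not over \<open>k \<le> x\<close>: up to sign this is \<open>\<Gamma>\<^sub>p(x)\<close>.\<close>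

definition ufact :: "nat \<Rightarrow> 'p::prime_card K" where
  "ufact x = (\<Prod>k<x. upart (of_nat k))"

lemma ufact_0 [simp]: "ufact 0 = 1" by (simp add: ufact_def)
lemma ufact_Suc: "ufact (Suc x) = ufact x * upart (of_nat x)" by (simp add: ufact_def)
lemma ufact_1 [simp]: "ufact (Suc 0) = 1" by (simp add: ufact_Suc upart_def)
lemma Wunit_ufact: "Wunit (ufact x)" unfolding ufact_def by (intro Wunit_prod Wunit_upart) auto

lemma ufact_add: "ufact (x + n) = ufact x * upoch (of_nat x) n"
  by (induction n) (simp_all add: ufact_Suc upoch_def)

lemma rho_of_nat: "rho (of_nat x :: 'p::prime_card K) n = ufact (x + n) / (ufact x * ufact (Suc n))"
proof -
  have e: "ufact (Suc n) = upoch 1 n" using ufact_add[of 1 n] by simp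
  show ?thesis unfolding ufact_add rho_def e using Wunit_nz[OF Wunit_ufact[of x, where 'a = 'p]] by simp
qed

text \<open>The same ratio with the roles of \<open>n\<close> and \<open>x\<close> exchanged. The number of factors is now fixed, so
  this form shows that the ratio is Lipschitz in \<open>n\<close>.\<close>

lemma rho_of_nat': "rho (of_nat (Suc x) :: 'p::prime_card K) n = upoch (of_nat (Suc n)) x / ufact (Suc x)"
proof -
  have "Suc x + n = Suc n + x" by simp
  then have e: "ufact (Suc x + n) = ufact (Suc n) * upoch (of_nat (Suc n)) x" by (simp only: ufact_add[of "Suc n" x])
  show ?thesis unfolding rho_of_nat e using Wunit_nz[OF Wunit_ufact[of "Suc n", where 'a = 'p]] by simp
qed

lemma wlip_rho:
  assumes a: "(\<alpha> :: 'p::prime_card K) \<in> Zp" shows "wlip (rho \<alpha>)"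
proof (rule wlipI)
  fix n show "rho \<alpha> n \<in> W" by (rule Wunit_W[OF Wunit_rho[OF Zp_W[OF a]]])
next
  fix s m n assume c: "[m = n] (mod CARD('p) ^ s)"
  show "wcong s (rho \<alpha> m) (rho \<alpha> n)"
  proof (cases "s = 0")
    case True
    then show ?thesis using Wunit_W[OF Wunit_rho[OF Zp_W[OF a]]] by (simp add: wcong_def)
  next
    case False
    obtain x where "x > 0" "wcong s \<alpha> (of_nat x)" by (rule Zp_approx[OF a])
    then obtain x' where x: "wcong s \<alpha> (of_nat (Suc x'))" by (cases x) auto
    have r: "wcong s (rho \<alpha> k) (rho (of_nat (Suc x')) k)" for k
      by (rule rho_cong[OF x _ Zp_W[OF a]]) (use False in simp)
    have "[Suc m = Suc n] (mod CARD('p) ^ s)" using cong_add[OF c cong_refl[of 1]] by simp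
    then have "wcong s (of_nat (Suc m) :: 'p K) (of_nat (Suc n))" by (simp only: wcong_of_nat)
    then have "wcong s (rho (of_nat (Suc x')) m) (rho (of_nat (Suc x')) n :: 'p K)"
      unfolding rho_of_nat' using False
      by (intro wcong_divide upoch_cong wcong_refl Wunit_ufact Wunit_W[OF Wunit_upoch]) auto
    then show ?thesis using wcong_trans[OF wcong_trans[OF r]] wcong_sym[OF r] by blast
  qed
qed

subsection \<open>Products that interpolate the ratios\<close>

text \<open>The function of \<open>y\<close> that approximates the ratios of coefficients on both sides, for an integer \<open>M\<close>
  close to \<open>a\<close>. Its logarithmic derivative at \<open>0\<close> is twice the sum of the \<open>1/k\<close>, which tends to the
  digamma value.\<close>

definition Rprod :: "nat \<Rightarrow> 'p::prime_card K \<Rightarrow> 'p K" where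
  "Rprod M y = (\<Prod>k | 1 \<le> k \<and> k < M \<and> \<not> CARD('p) dvd k. (1 + y / of_nat k) / (1 - y / of_nat k))"

definition hsum :: "nat \<Rightarrow> 'p::prime_card K" where
  "hsum M = (\<Sum>k | 1 \<le> k \<and> k < M \<and> \<not> CARD('p) dvd k. 1 / of_nat k)"

lemma unit_index_Suc:
  assumes "M \<ge> 1"
  shows "{k. 1 \<le> k \<and> k < Suc M \<and> \<not> p dvd k} = (if p dvd M then {k. 1 \<le> k \<and> k < M \<and> \<not> p dvd k} else insert M {k. 1 \<le> k \<and> k < M \<and> \<not> p dvd k})"
  using assms by (auto simp: less_Suc_eq)

lemma Rprod_1 [simp]: "Rprod (Suc 0) y = 1"
proof -
  have "{k. 1 \<le> k \<and> k < Suc 0 \<and> \<not> p dvd k} = {}" for p :: nat by auto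
  then show ?thesis by (simp add: Rprod_def)
qed

lemma hsum_1 [simp]: "hsum (Suc 0) = 0"
proof -
  have "{k. 1 \<le> k \<and> k < Suc 0 \<and> \<not> p dvd k} = {}" for p :: nat by auto
  then show ?thesis by (simp add: hsum_def)
qed

lemma Rprod_Suc: "M \<ge> 1 \<Longrightarrow> Rprod (Suc M) (y :: 'p::prime_card K) =
    (if CARD('p) dvd M then Rprod M y else (1 + y / of_nat M) / (1 - y / of_nat M) * Rprod M y)"
  unfolding Rprod_def unit_index_Suc by simp

lemma hsum_Suc: "M \<ge> 1 \<Longrightarrow> (hsum (Suc M) :: 'p::prime_card K) = (if CARD('p) dvd M then hsum M else 1 / of_nat M + hsum M)"
  unfolding hsum_def unit_index_Suc by simp

lemma upoch_shift: "upoch (\<alpha> + 1) n * upart \<alpha> = upoch \<alpha> n * upart (\<alpha> + of_nat n)"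
proof (induction n)
  case (Suc n)
  have "upoch (\<alpha> + 1) (Suc n) * upart \<alpha> = (upoch (\<alpha> + 1) n * upart \<alpha>) * upart (\<alpha> + 1 + of_nat n)"
    by (simp add: upoch_def)
  also have "\<dots> = upoch \<alpha> n * upart (\<alpha> + of_nat n) * upart (\<alpha> + 1 + of_nat n)" by (simp only: Suc)
  also have "\<dots> = upoch \<alpha> (Suc n) * upart (\<alpha> + of_nat (Suc n))" by (simp add: upoch_def algebra_simps)
  finally show ?case .
qed (simp add: upoch_def)

lemma one_pm_unit:
  assumes "y \<in> pW 1" "\<not> CARD('p) dvd k"
  shows "Wunit (1 + y / of_nat k :: 'p::prime_card K)" "Wunit (1 - y / of_nat k)"
proof -
  have "y / of_nat k \<in> pW 1" using assms by (intro pW_divide_unit) (auto simp: Wunit_of_nat)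
  then show "Wunit (1 + y / of_nat k)" "Wunit (1 - y / of_nat k)"
    using Wunit_pW1_add[of 1 "y / of_nat k"] Wunit_pW1_add[of 1 "- (y / of_nat k)"] by auto
qed

text \<open>From \<open>M\<close> to \<open>M + 1\<close> the left-hand side gains the factor \<open>(M + n)/M\<close> from the first ratio and loses
  \<open>(n - M)/(-M)\<close> from the second; as \<open>p | n\<close>, these factors are absent together exactly if \<open>p | M\<close>.\<close>

lemma rho_Rprod:
  assumes n: "CARD('p) dvd n" and M: "M \<ge> 1"
  shows "rho (of_nat M) n * rho (1 - of_nat M) n = Rprod M (of_nat n :: 'p::prime_card K)"
  using M
proof (induction M rule: nat_induct_at_least)
  case base
  have "upoch (0 + 1) n * upart 0 = upoch 0 n * upart (0 + of_nat n :: 'p K)" by (rule upoch_shift)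
  then have "upoch 1 n = (upoch 0 n :: 'p K)" using n by (simp add: upart_of_nat) (simp add: upart_def)
  then show ?case using Wunit_nz[OF Wunit_upoch[OF W_1], of n] by (simp add: rho_def) auto
next
  case (Suc M)
  let ?y = "of_nat n :: 'p K" and ?M = "of_nat M :: 'p K"
  have y: "?y \<in> pW 1" using n unfolding of_nat_pW1 .
  have 1: "upoch (?M + 1) n * upart ?M = upoch ?M n * upart (?M + ?y)" by (rule upoch_shift)
  have 2: "upoch (1 - ?M) n * upart (- ?M) = upoch (- ?M) n * upart (- ?M + ?y)"
    using upoch_shift[of "- ?M" n] by (simp add: add.commute)
  have e: "rho (of_nat (Suc M)) n = upoch (?M + 1) n / upoch 1 n" "rho (1 - of_nat (Suc M)) n = upoch (- ?M) n / upoch 1 n"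
    by (simp_all add: rho_def add.commute)
  show ?case
  proof (cases "CARD('p) dvd M")
    case True
    then have "?M \<in> pW 1" unfolding of_nat_pW1 .
    then have "upart ?M = 1" "upart (?M + ?y) = 1" "upart (- ?M) = 1" "upart (- ?M + ?y) = 1"
      using y by (auto simp: upart_def)
    then show ?thesis using Suc.IH 1 2 True Suc.hyps unfolding e by (simp add: Rprod_Suc rho_def)
  next
    case False
    then have u: "Wunit ?M" by (simp add: Wunit_of_nat)
    then have nu: "?M \<notin> pW 1" "- ?M \<notin> pW 1" using pW_neg[of "- ?M" 1] by (auto simp: Wunit_def)
    have nu2: "Wunit (?M + ?y)" "Wunit (- ?M + ?y)" using u y Wunit_pW1_add[of "- ?M" ?y] Wunit_pW1_add[of ?M ?y] by auto
    have up: "upart ?M = ?M" "upart (?M + ?y) = ?M + ?y" "upart (- ?M) = - ?M" "upart (- ?M + ?y) = - ?M + ?y"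
      using nu nu2 by (auto simp: upart_def Wunit_def)
    have nz: "?M \<noteq> 0" "- ?M + ?y \<noteq> 0" "?y \<noteq> ?M" using u nu2(2) Wunit_nz by force+
    have "upoch (?M + 1) n = upoch ?M n * (1 + ?y / ?M)" using 1 nz(1) unfolding up by (simp add: field_simps)
    moreover have "upoch (- ?M) n = upoch (1 - ?M) n / (1 - ?y / ?M)" using 2 nz unfolding up by (simp add: field_simps)
    ultimately have "rho (of_nat (Suc M)) n * rho (1 - of_nat (Suc M)) n
       = (1 + ?y / ?M) / (1 - ?y / ?M) * (rho ?M n * rho (1 - ?M) n)"
      unfolding e unfolding rho_def by (simp only: times_divide_times_eq mult_ac times_divide_eq_right times_divide_eq_left divide_divide_eq_left)
    then show ?thesis using Suc.IH False Suc.hyps by (simp add: Rprod_Suc)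
  qed
qed

text \<open>From \<open>M\<close> to \<open>M + 1\<close> the left-hand side gains \<open>x + M\<close> and loses \<open>x - M\<close>, and the quotient of these
  is \<open>- (1 + x/M)/(1 - x/M)\<close>; this explains the sign.\<close>

lemma ufact_Rprod:
  assumes x: "CARD('p) dvd x" and M: "M \<ge> 1" "M \<le> x"
  shows "ufact (x + M) * ufact (x + 1 - M) =
    (ufact x) ^ 2 * (- 1) ^ card {k. 1 \<le> k \<and> k < M \<and> \<not> CARD('p) dvd k} * Rprod M (of_nat x :: 'p::prime_card K)"
  using M
proof (induction M rule: nat_induct_at_least)
  case base
  have e: "{k. 1 \<le> k \<and> k < (1::nat) \<and> \<not> CARD('p) dvd k} = {}" by auto
  show ?case unfolding e using x by (simp add: ufact_Suc upart_of_nat power2_eq_square)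
next
  case (Suc M)
  let ?y = "of_nat x :: 'p K" and ?M = "of_nat M :: 'p K"
  let ?I = "\<lambda>M. {k. 1 \<le> k \<and> k < M \<and> \<not> CARD('p) dvd k}"
  have IH: "ufact (x + M) * ufact (x + 1 - M) = (ufact x) ^ 2 * (- 1) ^ card (?I M) * Rprod M ?y"
    using Suc by simp
  have xm: "x + 1 - M = Suc (x - M)" "x + 1 - Suc M = x - M" using Suc.prems by auto
  have 1: "ufact (x + Suc M) = ufact (x + M) * upart (of_nat (x + M) :: 'p K)" by (simp add: ufact_Suc)
  have 2: "ufact (x + 1 - M) = ufact (x - M) * upart (of_nat (x - M) :: 'p K)" unfolding xm by (rule ufact_Suc)
  have d: "CARD('p) dvd x + M \<longleftrightarrow> CARD('p) dvd M" "CARD('p) dvd x - M \<longleftrightarrow> CARD('p) dvd M"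
    using x Suc.prems by (simp_all add: dvd_add_right_iff dvd_diff_nat) (metis Suc_leD dvd_diff_nat dvd_diffD1 x)
  have nz: "ufact (x - M) \<noteq> (0 :: 'p K)" by (rule Wunit_nz[OF Wunit_ufact])
  have fin: "finite (?I M)" by simp
  show ?case
  proof (cases "CARD('p) dvd M")
    case True
    then have "upart (of_nat (x + M) :: 'p K) = 1" "upart (of_nat (x - M) :: 'p K) = 1"
      unfolding upart_of_nat d by auto
    moreover have "?I (Suc M) = ?I M" using unit_index_Suc[OF Suc.hyps, of "CARD('p)"] True by simp
    ultimately show ?thesis using IH 1 2 True Suc.hyps xm by (simp add: Rprod_Suc)
  next
    case False
    have up: "upart (of_nat (x + M) :: 'p K) = ?y + ?M" "upart (of_nat (x - M) :: 'p K) = ?y - ?M"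
      unfolding upart_of_nat d using False Suc.prems by (auto simp: of_nat_diff)
    have u: "Wunit (of_nat (x - M) :: 'p K)" using d(2) False by (simp add: Wunit_of_nat)
    then have nz2: "?y - ?M \<noteq> 0" using Wunit_nz Suc.prems by (simp add: of_nat_diff) fastforce
    have Mz: "?M \<noteq> 0" using False by (metis Wunit_nz Wunit_of_nat)
    have "?I (Suc M) = insert M (?I M)" using unit_index_Suc[OF Suc.hyps, of "CARD('p)"] False by simp
    then have card: "card (?I (Suc M)) = Suc (card (?I M))" using fin by simp
    have q: "(?y + ?M) / (?y - ?M) = - ((1 + ?y / ?M) / (1 - ?y / ?M))"
      using nz2 Mz by (simp add: field_simps)
    have "ufact (x + Suc M) * ufact (x + 1 - Suc M) = (ufact (x + M) * ufact (x + 1 - M)) * ((?y + ?M) / (?y - ?M))"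
      unfolding 1 2 up xm(2) using nz2 by (simp add: field_simps)
    also have "\<dots> = (ufact x) ^ 2 * (- 1) ^ card (?I (Suc M)) * Rprod (Suc M) ?y"
      unfolding IH q card using False Suc.hyps by (simp add: Rprod_Suc)
    finally show ?thesis .
  qed
qed

section \<open>The p-adic Gamma function\<close>

lemma upart_of_nat_cong:
  assumes "[m = n] (mod CARD('p) ^ N)" "N > 0"
  shows "wcong N (upart (of_nat m)) (upart (of_nat n) :: 'p::prime_card K)"
  by (rule upart_cong) (use assms in \<open>simp_all add: wcong_of_nat\<close>)

lemma upoch_period:
  assumes "N > 0"
  shows "wcong N (upoch (of_nat n) (CARD('p) ^ N)) (ufact (CARD('p) ^ N) :: 'p::prime_card K)"
proof (induction n)
  case 0
  then show ?case by (simp add: upoch_def ufact_def)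
next
  case (Suc n)
  let ?q = "CARD('p) ^ N"
  have eq: "upoch (of_nat (Suc n)) ?q * upart (of_nat n) = upoch (of_nat n) ?q * upart (of_nat (n + ?q) :: 'p K)"
    using upoch_shift[of "of_nat n" ?q] by (simp add: add.commute)
  have u: "Wunit (upart (of_nat n) :: 'p K)" "Wunit (upart (of_nat (n + ?q)) :: 'p K)" by (intro Wunit_upart W_of_nat)+
  have up: "Wunit (upoch (of_nat n :: 'p K) ?q)" by (intro Wunit_upoch W_of_nat)
  have c: "wcong N (upart (of_nat (n + ?q))) (upart (of_nat n) :: 'p K)"
    by (rule upart_of_nat_cong[OF _ assms]) (simp add: cong_def)
  have "upoch (of_nat (Suc n)) ?q = upoch (of_nat n) ?q * upart (of_nat (n + ?q)) / upart (of_nat n :: 'p K)"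
    using eq Wunit_nz[OF u(1)] by (simp add: nonzero_eq_divide_eq)
  also have "wcong N \<dots> (upoch (of_nat n) ?q * upart (of_nat n) / upart (of_nat n))"
    by (intro wcong_divide wcong_mult wcong_refl c u Wunit_W[OF up] Wunit_W[OF u(2)] W_mult)
  also have "\<dots> = upoch (of_nat n) ?q" using Wunit_nz[OF u(1)] by simp
  also have "wcong N \<dots> (ufact ?q)" by (rule Suc)
  finally show ?case .
qed

lemma prod_one_plus:
  fixes y :: "'p::prime_card K" and b :: "nat \<Rightarrow> nat" and m :: nat
  assumes "y \<in> pW N"
  shows "wcong (2 * N) (\<Prod>j<m. 1 + y * of_nat (b j)) (1 + y * of_nat (\<Sum>j<m. b j))"
proof (induction m)
  case (Suc m)
  let ?S = "of_nat (\<Sum>j<m. b j) :: 'p K" and ?b = "of_nat (b m) :: 'p K"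
  have yW: "y \<in> W" using assms pW_imp_W by blast
  have "(\<Prod>j<Suc m. 1 + y * of_nat (b j)) = (\<Prod>j<m. 1 + y * of_nat (b j)) * (1 + y * ?b)" by simp
  also have "wcong (2 * N) \<dots> ((1 + y * ?S) * (1 + y * ?b))"
    by (intro wcong_mult Suc wcong_refl W_prod W_add W_mult yW W_1 W_of_nat)
  also have "(1 + y * ?S) * (1 + y * ?b) = 1 + y * of_nat (\<Sum>j<Suc m. b j) + y * y * (?S * ?b)"
    by (simp add: algebra_simps)
  also have "wcong (2 * N) \<dots> (1 + y * of_nat (\<Sum>j<Suc m. b j) + 0)"
    using pW_mult[OF assms assms] by (intro wcong_add wcong_refl) (auto simp: mult_2 intro!: pW_mult_W W_mult W_sum)
  finally show ?case by simp
qed simp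

lemma power_one_plus:
  assumes "(y :: 'p::prime_card K) \<in> pW N" shows "wcong (2 * N) ((1 + y) ^ m) (1 + of_nat m * y)"
  using prod_one_plus[OF assms, where m = m and b = "\<lambda>_. 1"] by (simp add: mult.commute)

lemma wcong_power_p:
  assumes "wcong N x y" "N > 0" "Wunit (y :: 'p::prime_card K)"
  shows "wcong (Suc N) (x ^ CARD('p)) (y ^ CARD('p))"
proof -
  define w where "w = (x - y) / y"
  have w: "w \<in> pW N" unfolding w_def using assms by (intro pW_divide_unit) (auto simp: wcong_def)
  have x: "x = y * (1 + w)" unfolding w_def using Wunit_nz[OF assms(3)] by (simp add: field_simps)
  have "wcong (Suc N) ((1 + w) ^ CARD('p)) (1 + pK * w)"
    by (rule wcong_mono[OF power_one_plus[OF w]]) (use assms in simp)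
  also have "wcong (Suc N) \<dots> (1 + 0)"
    using w by (intro wcong_add wcong_refl) (simp add: pW_scale1)
  finally have "wcong (Suc N) ((1 + w) ^ CARD('p)) 1" by simp
  then have "wcong (Suc N) ((1 + w) ^ CARD('p) * y ^ CARD('p)) (1 * y ^ CARD('p))"
    using pW_imp_W[OF w] Wunit_W[OF assms(3)] by (intro wcong_mult wcong_refl W_power W_add) auto
  then show ?thesis unfolding x power_mult_distrib by (simp add: mult.commute)
qed

lemma odd_CARD: "CARD('p::prime_card) \<ge> 3 \<Longrightarrow> odd CARD('p)"
  using prime_odd_nat[OF prime_card[where 'a='p]] by simp

text \<open>Wilson's theorem for prime powers: the residues modulo \<open>p\<^sup>N\<^sup>+\<^sup>1\<close> that lie over a given unit
  modulo \<open>p\<^sup>N\<close> have the \<open>p\<close>-th power of that unit as their product.\<close>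

lemma Wilson_prime_power:
  assumes p3: "CARD('p::prime_card) \<ge> 3" and "N > 0"
  shows "wcong N (ufact (CARD('p) ^ N)) (- 1 :: 'p K)"
  using assms(2)
proof (induction N rule: nat_induct_non_zero)
  case 1
  let ?p = "CARD('p)"
  have p: "prime ?p" by (rule prime_card)
  have "(ufact ?p :: 'p K) = (\<Prod>k\<in>{1..?p - 1}. of_nat k)"
  proof -
    have s: "{..<?p} = insert 0 {1..?p - 1}" using prime_gt_0_nat[OF p] by auto
    have "(\<Prod>k\<in>{1..?p - 1}. upart (of_nat k)) = (\<Prod>k\<in>{1..?p - 1}. of_nat k :: 'p K)"
      by (intro prod.cong refl) (auto simp: upart_of_nat dest: dvd_imp_le)
    then show ?thesis unfolding ufact_def s by (simp add: upart_def)
  qed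
  also have "\<dots> = of_nat (fact (?p - 1))" unfolding fact_prod by simp
  finally have f: "(ufact ?p :: 'p K) = of_int (int (fact (?p - 1)))" by (simp only: of_int_of_nat_eq)
  have "[int (fact (?p - 1)) = - 1] (mod int ?p)" using wilson_theorem[OF p] by simp
  then have "int ?p ^ 1 dvd int (fact (?p - 1)) - (- 1)" by (simp only: cong_iff_dvd_diff power_one_right)
  then have "(of_int (int (fact (?p - 1)) - (- 1)) :: 'p K) \<in> pW 1" by (simp only: of_int_pW)
  then show ?case unfolding power_one_right f wcong_def by simp
next
  case (Suc N)
  let ?p = "CARD('p)" and ?q = "CARD('p) ^ N"
  let ?f = "\<lambda>k. upart (of_nat k) :: 'p K"
  have col: "wcong (Suc N) (\<Prod>j<?p. ?f (i + j * ?q)) (?f i ^ ?p)" for i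
  proof (cases "?p dvd i")
    case True
    have "?p dvd i + j * ?q" for j using True Suc.hyps by (intro dvd_add dvd_mult dvd_power) auto
    then show ?thesis unfolding upart_of_nat using True by simp
  next
    case False
    have nd: "\<not> ?p dvd i + j * ?q" for j
    proof -
      have "?p dvd j * ?q" using Suc.hyps by (intro dvd_mult dvd_power) auto
      then show ?thesis using False by (metis add.commute dvd_add_right_iff)
    qed
    have u: "Wunit (of_nat i :: 'p K)" using False by (simp add: Wunit_of_nat)
    define y where "y = (of_nat ?q / of_nat i :: 'p K)"
    have y: "y \<in> pW N" unfolding y_def by (rule pW_divide_unit[OF _ u]) simp
    have "(\<Prod>j<?p. ?f (i + j * ?q)) = (\<Prod>j<?p. of_nat i * (1 + y * of_nat j))"
      unfolding upart_of_nat y_def using nd Wunit_nz[OF u] by (intro prod.cong refl) (simp add: field_simps)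
    also have "\<dots> = of_nat i ^ ?p * (\<Prod>j<?p. 1 + y * of_nat j)" by (simp add: prod.distrib)
    also have "wcong (Suc N) \<dots> (of_nat i ^ ?p * (1 + y * of_nat (\<Sum>j<?p. j)))"
      using pW_imp_W[OF y] Suc.hyps
      by (intro wcong_mult wcong_refl wcong_mono[OF prod_one_plus[OF y, where m = ?p and b = "\<lambda>j. j"]] W_power W_prod W_add W_mult) auto
    also have "wcong (Suc N) \<dots> (of_nat i ^ ?p * (1 + 0))"
    proof -
      have "?p dvd (\<Sum>j<?p. j)"
      proof -
        have "(\<Sum>j<?p. j) = ?p * (?p - 1) div 2" using Sum_Ico_nat[of 0 ?p] by (simp add: atLeast0LessThan)
        also have "\<dots> = ?p * ((?p - 1) div 2)" using odd_CARD[OF p3] by (simp add: div_mult_swap)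
        finally show ?thesis by simp
      qed
      then have "(of_nat (\<Sum>j<?p. j) :: 'p K) \<in> pW 1" by (simp only: of_nat_pW1)
      then have "y * of_nat (\<Sum>j<?p. j) \<in> pW (N + 1)" by (rule pW_mult[OF y])
      then show ?thesis using pW_imp_W[OF y] by (intro wcong_mult wcong_add wcong_refl W_power W_add W_mult) auto
    qed
    also have "of_nat i ^ ?p * (1 + 0) = ?f i ^ ?p" using False by (simp add: upart_of_nat)
    finally show ?thesis .
  qed
  have "ufact (?p ^ Suc N) = (\<Prod>k<?p * ?q. ?f k)" by (simp add: ufact_def)
  also have "\<dots> = (\<Prod>j<?p. prod ?f {j * ?q..<j * ?q + ?q})" by (rule prod.nat_group[symmetric])
  also have "\<dots> = (\<Prod>j<?p. \<Prod>i<?q. ?f (i + j * ?q))"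
  proof (rule prod.cong[OF refl])
    fix j show "prod ?f {j * ?q..<j * ?q + ?q} = (\<Prod>i<?q. ?f (i + j * ?q))"
      using prod.shift_bounds_nat_ivl[of ?f 0 "j * ?q" ?q] by (simp add: atLeast0LessThan add.commute)
  qed
  also have "\<dots> = (\<Prod>i<?q. \<Prod>j<?p. ?f (i + j * ?q))" by (rule prod.swap)
  also have "wcong (Suc N) \<dots> (\<Prod>i<?q. ?f i ^ ?p)"
    by (intro wcong_prod col W_prod Wunit_W[OF Wunit_upart] W_of_nat)
  also have "(\<Prod>i<?q. ?f i ^ ?p) = ufact ?q ^ ?p" by (simp add: ufact_def prod_power_distrib)
  also have "wcong (Suc N) \<dots> ((- 1) ^ ?p)" by (rule wcong_power_p[OF Suc.IH Suc.hyps]) simp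
  also have "(- 1 :: 'p K) ^ ?p = - 1" using odd_CARD[OF p3] by simp
  finally show ?case .
qed

lemma periodic_cong:
  assumes per: "\<And>n. 0 < n \<Longrightarrow> wcong N (g (n + CARD('p) ^ N)) (g n :: 'p::prime_card K)"
    and mn: "0 < m" "0 < n" "[m = n] (mod CARD('p) ^ N)"
  shows "wcong N (g m) (g n)"
proof -
  let ?q = "CARD('p) ^ N"
  have it: "wcong N (g (n + j * ?q)) (g n)" if "0 < n" for n j
  proof (induction j)
    case (Suc j)
    have "wcong N (g ((n + j * ?q) + ?q)) (g (n + j * ?q))" using that by (intro per) simp
    then have "wcong N (g (n + Suc j * ?q)) (g (n + j * ?q))" by (simp add: algebra_simps)
    then show ?case using Suc by (rule wcong_trans)
  qed simp
  have main: "wcong N (g m) (g n)" if "n \<le> m" "0 < n" "[m = n] (mod ?q)" for m n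
  proof -
    have "?q dvd m - n" using that(1,3) by (meson cong_altdef_nat)
    then obtain j where "m - n = ?q * j" by (auto simp: dvd_def)
    then have "m = n + j * ?q" using that(1) by (simp add: mult.commute)
    then show ?thesis using it[OF that(2)] by simp
  qed
  show ?thesis
  proof (cases "n \<le> m")
    case True
    then show ?thesis using main mn by blast
  next
    case False
    then have "wcong N (g n) (g m)" using mn by (intro main) (auto simp: cong_sym_eq)
    then show ?thesis by (rule wcong_sym)
  qed
qed

lemma Gamma_prod_eq:
  "(\<Prod>k | 1 \<le> k \<and> k < n \<and> \<not> CARD('p) dvd k. of_nat k) = (ufact n :: 'p::prime_card K)"
  unfolding ufact_def by (rule prod.mono_neutral_cong_left) (auto simp: upart_of_nat intro: Suc_leI gr0I)

text \<open>By Wilson's theorem, \<open>p\<^sup>N\<close> further factors multiply the product by \<open>-1\<close> modulo \<open>p\<^sup>N\<close>, and the sign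
  \<open>(-1)\<^sup>n\<close> compensates for this. So the products depend on \<open>n\<close> modulo \<open>p\<^sup>N\<close> only.\<close>

lemma Gamma_p_props:
  assumes p3: "CARD('p::prime_card) \<ge> 3" and z: "(z :: 'p K) \<in> Zp"
  shows "Gamma_p z \<in> W"
    and "\<And>N m. 0 < m \<Longrightarrow> wcong N z (of_nat m) \<Longrightarrow> wcong N (Gamma_p z) ((- 1) ^ m * ufact m)"
proof -
  let ?g = "\<lambda>n. (- 1) ^ n * ufact n :: 'p K"
  have c: "wcong N (?g m) (?g n)" if "0 < N" "0 < m" "0 < n" "[m = n] (mod CARD('p) ^ N)" for N m n
  proof (rule periodic_cong[OF _ that(2-4)])
    fix k :: nat assume "0 < k"
    let ?q = "CARD('p) ^ N"
    have o: "(- 1 :: 'p K) ^ ?q = - 1" using odd_CARD[OF p3] by simp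
    have W: "(- 1) ^ k * ufact k \<in> (W :: 'p K set)" by (intro W_mult W_power W_neg W_1 Wunit_W[OF Wunit_ufact])
    have "?g (k + ?q) = - ((- 1) ^ k * ufact k * upoch (of_nat k) ?q)"
      unfolding power_add o ufact_add by simp
    also have "wcong N \<dots> (- ((- 1) ^ k * ufact k * (- 1)))"
      by (intro wcong_uminus wcong_mult wcong_refl W wcong_trans[OF upoch_period Wilson_prime_power] p3 that(1)
          Wunit_W[OF Wunit_upoch] W_of_nat)
    finally show "wcong N (?g (k + ?q)) (?g k)" by simp
  qed
  have W: "?g n \<in> W" for n by (intro W_mult W_power W_neg W_1 Wunit_W[OF Wunit_ufact])
  have e: "Gamma_p z = padic_lim ?g (nat_near z)" unfolding Gamma_p_def Gamma_prod_eq ..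
  show "Gamma_p z \<in> W" unfolding e by (rule padic_limD(1)[OF z W c])
  show "\<And>N m. 0 < m \<Longrightarrow> wcong N z (of_nat m) \<Longrightarrow> wcong N (Gamma_p z) ((- 1) ^ m * ufact m)"
    unfolding e by (rule padic_limD(2)[OF z W c])
qed

lemma Wunit_Gamma_p:
  assumes p3: "CARD('p::prime_card) \<ge> 3" and z: "(z :: 'p K) \<in> Zp"
  shows "Wunit (Gamma_p z)"
proof -
  obtain m where m: "m > 0" "wcong 1 z (of_nat m)" by (rule Zp_approx[OF z])
  have "wcong 1 ((- 1) ^ m * ufact m) (Gamma_p z)" by (rule wcong_sym[OF Gamma_p_props(2)[OF p3 z m]])
  then show ?thesis by (rule Wunit_cong) (auto intro!: Wunit_mult Wunit_power Wunit_ufact)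
qed

section \<open>The p-adic digamma function\<close>

lemma hsum_eq: "hsum M = (\<Sum>k<M. if CARD('p) dvd k then 0 else 1 / of_nat k :: 'p::prime_card K)"
  unfolding hsum_def by (rule sum.mono_neutral_cong_left) (auto intro: Suc_leI gr0I)

lemma W_inv_of_nat: "(if CARD('p) dvd k then 0 else 1 / of_nat k) \<in> (W :: 'p::prime_card K set)"
  by (auto intro!: W_divide simp: Wunit_of_nat)

lemma hsum_W: "hsum M \<in> (W :: 'p::prime_card K set)"
  unfolding hsum_eq by (intro W_sum W_inv_of_nat)

lemma inv_of_nat_cong:
  assumes "[m = n] (mod CARD('p) ^ N)" "N > 0"
  shows "wcong N (if CARD('p) dvd m then 0 else 1 / of_nat m :: 'p::prime_card K) (if CARD('p) dvd n then 0 else 1 / of_nat n)"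
proof -
  have "[m = n] (mod CARD('p))" using cong_dvd_modulus_nat[OF assms(1), of "CARD('p)"] assms(2) by (simp add: dvd_power)
  then have "CARD('p) dvd m \<longleftrightarrow> CARD('p) dvd n" by (rule cong_dvd_iff)
  then show ?thesis using assms by (auto intro!: wcong_divide simp: wcong_of_nat Wunit_of_nat)
qed

lemma inv_of_nat_neg:
  assumes "m + n = j * CARD('p) ^ N" "N > 0"
  shows "wcong N (if CARD('p) dvd m then 0 else 1 / of_nat m :: 'p::prime_card K) (- (if CARD('p) dvd n then 0 else 1 / of_nat n))"
proof -
  have d: "CARD('p) dvd m + n" unfolding assms(1) using assms(2) by (intro dvd_mult dvd_power) simp
  then have iff: "CARD('p) dvd m \<longleftrightarrow> CARD('p) dvd n" by (metis add.commute dvd_add_right_iff)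
  show ?thesis
  proof (cases "CARD('p) dvd m")
    case False
    then have u: "Wunit (of_nat m :: 'p K)" "Wunit (of_nat n :: 'p K)" using iff by (auto simp: Wunit_of_nat)
    have "(of_nat m + of_nat n :: 'p K) = pK ^ N * of_nat j"
      using arg_cong[OF assms(1), of "of_nat :: nat \<Rightarrow> 'p K"] by (simp add: mult.commute)
    then have "(of_nat m - (- of_nat n) :: 'p K) \<in> pW N" by (auto intro!: pW_mult_W)
    then have "wcong N (of_nat m :: 'p K) (- of_nat n)" unfolding wcong_def .
    then have "wcong N (1 / of_nat m :: 'p K) (1 / (- of_nat n))" using u by (intro wcong_divide) auto
    then show ?thesis using False iff by simp
  qed (use iff in simp)
qed

text \<open>The summands for \<open>k\<close> and \<open>p\<^sup>N - k\<close> cancel.\<close>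

lemma hsum_full:
  assumes p3: "CARD('p::prime_card) \<ge> 3" and N: "N > 0"
  shows "wcong N (hsum (CARD('p) ^ N)) (0 :: 'p K)"
proof -
  let ?q = "CARD('p) ^ N"
  let ?f = "\<lambda>k. if CARD('p) dvd k then 0 else 1 / of_nat k :: 'p K"
  have q: "?q > 0" by simp
  have s: "{..<?q} = insert 0 {1..<?q}" using q by auto
  have S: "hsum ?q = (\<Sum>k\<in>{1..<?q}. ?f k)" unfolding hsum_eq s by simp
  have "(\<Sum>k\<in>{1..<?q}. ?f k) = (\<Sum>k\<in>{1..<?q}. ?f (?q - k))"
    by (rule sum.reindex_bij_witness[of _ "\<lambda>k. ?q - k" "\<lambda>k. ?q - k"]) auto
  also have "wcong N \<dots> (\<Sum>k\<in>{1..<?q}. - ?f k)"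
    by (intro wcong_sum inv_of_nat_neg[of _ _ 1] N) auto
  finally have "wcong N (hsum ?q) (- hsum ?q :: 'p K)" unfolding S by (simp add: sum_negf)
  then have "hsum ?q - (- hsum ?q) \<in> (pW N :: 'p K set)" unfolding wcong_def .
  then have "of_nat 2 * hsum ?q \<in> (pW N :: 'p K set)" by simp
  moreover have "Wunit (of_nat 2 :: 'p K)" unfolding Wunit_of_nat using p3 by (auto dest: dvd_imp_le)
  ultimately show ?thesis using unit_mult_pW by auto
qed

lemma hsum_add: "hsum (m + n) = hsum m + (\<Sum>i<n. if CARD('p) dvd m + i then 0 else 1 / of_nat (m + i) :: 'p::prime_card K)"
  by (induction n) (simp_all add: hsum_eq add.assoc)

lemma hsum_period:
  assumes p3: "CARD('p::prime_card) \<ge> 3" and N: "N > 0"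
  shows "wcong N (hsum (m + CARD('p) ^ N)) (hsum m :: 'p K)"
proof (induction m)
  case 0
  then show ?case using hsum_full[OF assms] by (simp add: hsum_eq)
next
  case (Suc m)
  let ?q = "CARD('p) ^ N"
  let ?f = "\<lambda>k. if CARD('p) dvd k then 0 else 1 / of_nat k :: 'p K"
  have "hsum (Suc m + ?q) = hsum (m + ?q) + ?f (m + ?q)" by (simp add: hsum_eq)
  also have "wcong N \<dots> (hsum m + ?f m)"
    by (intro wcong_add Suc inv_of_nat_cong N) (simp add: cong_def)
  also have "hsum m + ?f m = hsum (Suc m)" by (simp add: hsum_eq)
  finally show ?case .
qed

lemma psi_tilde_props:
  assumes p3: "CARD('p::prime_card) \<ge> 3" and z: "(z :: 'p K) \<in> Zp"
  shows "psi_tilde z \<in> W"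
    and "\<And>N m. 0 < m \<Longrightarrow> wcong N z (of_nat m) \<Longrightarrow> wcong N (psi_tilde z) (hsum m)"
proof -
  have c: "wcong N (hsum m) (hsum n :: 'p K)" if "0 < N" "0 < m" "0 < n" "[m = n] (mod CARD('p) ^ N)" for N m n
    by (rule periodic_cong[where g = hsum, OF hsum_period[OF p3 that(1)] that(2-4)])
  have e: "psi_tilde z = padic_lim hsum (nat_near z)" unfolding psi_tilde_def hsum_def[abs_def] ..
  show "psi_tilde z \<in> W" unfolding e by (rule padic_limD(1)[OF z hsum_W c])
  show "\<And>N m. 0 < m \<Longrightarrow> wcong N z (of_nat m) \<Longrightarrow> wcong N (psi_tilde z) (hsum m)"
    unfolding e by (rule padic_limD(2)[OF z hsum_W c])
qed

text \<open>The reflection formula, from \<open>1/k + 1/(n - k) \<equiv> 0\<close> for \<open>n\<close> divisible by \<open>p\<^sup>N\<close>.\<close>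

lemma psi_tilde_reflection:
  assumes p3: "CARD('p::prime_card) \<ge> 3" and z: "(z :: 'p K) \<in> Zp"
  shows "psi_tilde (1 - z) = psi_tilde z"
proof -
  have "psi_tilde (1 - z) - psi_tilde z \<in> pW N" for N
  proof (cases "N = 0")
    case True
    then show ?thesis
      using W_diff[OF psi_tilde_props(1)[OF p3 Zp_diff[OF Zp_1 z]] psi_tilde_props(1)[OF p3 z]] by simp
  next
    case False
    let ?q = "CARD('p) ^ N"
    let ?f = "\<lambda>k. if CARD('p) dvd k then 0 else 1 / of_nat k :: 'p K"
    obtain M where M: "M > 0" "wcong N z (of_nat M)" by (rule Zp_approx[OF z])
    define n where "n = M * ?q + 1 - M"
    have Mq: "M \<le> M * ?q" by simp
    have n: "n > 0" "n + M = M * ?q + 1" unfolding n_def using Mq by linarith+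
    have "wcong N (1 - z) (1 - of_nat M)" by (intro wcong_diff wcong_refl M)
    also have "wcong N (1 - of_nat M :: 'p K) (of_nat n)"
    proof -
      have "(of_nat n + of_nat M :: 'p K) = of_nat M * pK ^ N + 1"
        using arg_cong[OF n(2), of "of_nat :: nat \<Rightarrow> 'p K"] by simp
      then have "1 - of_nat M - of_nat n = (- of_nat M * pK ^ N :: 'p K)" by (simp add: algebra_simps)
      then show ?thesis unfolding wcong_def by (auto intro!: W_mult_pW)
    qed
    finally have "wcong N (psi_tilde (1 - z)) (hsum n)" using z n by (intro psi_tilde_props(2) p3) auto
    also have "wcong N (hsum n) (hsum M :: 'p K)"
    proof -
      have "hsum (n + M) = hsum n + (\<Sum>i<M. ?f (n + i))" by (rule hsum_add)
      also have "(\<Sum>i<M. ?f (n + i)) = (\<Sum>i<M. ?f (n + (M - Suc i)))" by (rule sum.nat_diff_reindex[symmetric])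
      also have "wcong N (hsum n + \<dots>) (hsum n + (\<Sum>i<M. - ?f i))"
      proof (intro wcong_add wcong_refl wcong_sum inv_of_nat_neg)
        fix i assume "i \<in> {..<M}"
        then show "n + (M - Suc i) + i = M * ?q" using n(2) by simp
      qed (use False in simp)
      also have "\<dots> = hsum n - hsum M" by (simp add: hsum_eq sum_negf)
      finally have 1: "wcong N (hsum (n + M)) (hsum n - hsum M :: 'p K)" .
      have "wcong N (hsum (n + M)) (hsum 1 :: 'p K)"
      proof (rule periodic_cong[where g = hsum, OF hsum_period[OF p3]])
        have "[M * ?q + 1 = 0 + 1] (mod ?q)" by (intro cong_add cong_refl) (simp add: cong_def)
        then show "[n + M = 1] (mod ?q)" unfolding n(2) by simp
      qed (use n False in auto)
      then have "wcong N (hsum n - hsum M) (hsum 1 :: 'p K)" by (rule wcong_trans[OF wcong_sym[OF 1]])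
      then show ?thesis by (simp add: wcong_def)
    qed
    also have "wcong N (hsum M) (psi_tilde z)" by (rule wcong_sym[OF psi_tilde_props(2)[OF p3 z M]])
    finally show ?thesis by (simp add: wcong_def)
  qed
  then show ?thesis using pW_Inter[of "psi_tilde (1 - z) - psi_tilde z"] by simp
qed

section \<open>Powers and the p-adic logarithm\<close>

lemma pW_divide_of_nat:
  assumes "(x :: 'p::prime_card K) \<in> pW (n + v)" "k = CARD('p) ^ v * u" "\<not> CARD('p) dvd u"
  shows "x / of_nat k \<in> pW n"
proof -
  obtain y where y: "y \<in> W" "x = pK ^ (n + v) * y" using assms(1) by (rule pW_E)
  have u: "Wunit (of_nat u :: 'p K)" using assms(3) by (simp add: Wunit_of_nat)
  have "x / of_nat k = pK ^ n * (y / of_nat u)"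
    unfolding y(2) assms(2) using Wunit_nz[OF u] by (simp add: power_add field_simps)
  then show ?thesis using W_divide[OF y(1) u] by (auto intro: pW_I)
qed

lemma three_power_bounds: "n + 1 \<le> 3 ^ n" "2 * n \<le> 3 ^ n" "0 < n \<Longrightarrow> n + 2 \<le> (3 :: nat) ^ n"
proof -
  show "n + 1 \<le> 3 ^ n" "2 * n \<le> 3 ^ n" by (induction n) auto
  show "0 < n \<Longrightarrow> n + 2 \<le> 3 ^ n" by (induction n rule: nat_induct_non_zero) auto
qed

lemma falling_fact: "i \<le> n \<Longrightarrow> (n choose i) * fact i = (\<Prod>j<i. n - j :: nat)"
proof (induction i)
  case (Suc i)
  have "Suc i * (n choose Suc i) = (n - i) * (n choose i)"
    using binomial_absorption[of i n] binomial_absorb_comp[of n i] by simp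
  then have "(n choose Suc i) * fact (Suc i) = (n choose i) * fact i * (n - i)"
    unfolding fact_Suc by (metis (no_types, lifting) mult.assoc mult.commute of_nat_id)
  then show ?case using Suc by simp
qed simp

context
  assumes p3: "CARD('p::prime_card) \<ge> 3"
begin

lemma three_le_power: "3 ^ v \<le> CARD('p) ^ v" using p3 by (rule power_mono) simp

text \<open>The index \<open>k\<close> is divisible by at most \<open>v\<close> powers of \<open>p\<close> with \<open>3\<^sup>v \<le> k\<close>, and the power of \<open>w\<close>
  outweighs these. For \<open>p = 2\<close> this would fail at \<open>k = 2\<close>.\<close>

lemma power_over_index:
  assumes "(w :: 'p K) \<in> pW m" "m \<ge> 1" "k \<ge> 2" shows "w ^ (k - 1) / of_nat k \<in> pW m"
proof -
  obtain v u where vu: "k = CARD('p) ^ v * u" "\<not> CARD('p) dvd u" 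
    using of_nat_unit_part[of k, where 'p='p] assms(3) by (metis gr0I not_numeral_le_zero)
  have "u > 0" using vu(2) by (cases u) auto
  then have "CARD('p) ^ v \<le> k" unfolding vu(1) by simp
  then have vk: "3 ^ v \<le> k" using three_le_power[of v] by linarith
  have "v + 2 \<le> k"
  proof (cases "v = 0")
    case True
    then show ?thesis using assms(3) by simp
  next
    case False
    then show ?thesis using vk three_power_bounds(3)[of v] by linarith
  qed
  then have le: "m + v \<le> m * (k - 1)"
  proof -
    have "m + v \<le> m + m * v" using assms(2) by simp
    also have "\<dots> = m * (v + 1)" by simp
    also have "\<dots> \<le> m * (k - 1)" using \<open>v + 2 \<le> k\<close> by (intro mult_le_mono2) simp
    finally show ?thesis .
  qed
  have "w ^ n \<in> pW (m * n)" for n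
  proof (induction n)
    case (Suc n)
    then show ?case using pW_mult[OF assms(1) Suc] by simp
  qed simp
  then have "w ^ (k - 1) \<in> pW (m + v)" using pW_mono le by blast
  then show ?thesis by (rule pW_divide_of_nat[OF _ vu])
qed

definition tau :: "'p K \<Rightarrow> nat \<Rightarrow> 'p K" where
  "tau c d = (c ^ d - 1) / (pK * of_nat d)"

lemma tau_eq: "d > 0 \<Longrightarrow> c ^ d = 1 + pK * of_nat d * tau c d"
  by (simp add: tau_def of_nat_K_eq_0)

text \<open>The binomial expansion of \<open>(1 + w)\<^sup>j\<close> for \<open>w = c\<^sup>d - 1\<close>, in the form \<open>(j choose k) / j = (j - 1
  choose k - 1) / k\<close>.\<close>

lemma tau_mult_expansion:
  assumes "d > 0" "j > 0"
  shows "tau c (d * j) = (\<Sum>k=1..j. of_nat (j - 1 choose (k - 1)) * ((c ^ d - 1) ^ (k - 1) / of_nat k) * tau c d)"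
proof -
  define w where "w = c ^ d - 1"
  have w: "w = pK * of_nat d * tau c d" using tau_eq[OF assms(1), of c] by (simp add: w_def)
  have nz: "of_nat d \<noteq> (0 :: 'p K)" "of_nat j \<noteq> (0 :: 'p K)" using assms by (simp_all add: of_nat_K_eq_0)
  have "c ^ (d * j) = (w + 1) ^ j" by (simp add: w_def power_mult)
  also have "\<dots> = (\<Sum>k\<le>j. of_nat (j choose k) * w ^ k)" by (simp add: binomial_ring)
  also have "{..j} = insert 0 {1..j}" by auto
  also have "(\<Sum>k\<in>\<dots>. of_nat (j choose k) * w ^ k) = 1 + (\<Sum>k=1..j. of_nat (j choose k) * w ^ k)" by simp
  finally have "tau c (d * j) = (\<Sum>k=1..j. of_nat (j choose k) * w ^ k / (pK * of_nat (d * j)))"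
    by (simp add: tau_def sum_divide_distrib)
  also have "\<dots> = (\<Sum>k=1..j. of_nat (j - 1 choose (k - 1)) * (w ^ (k - 1) / of_nat k) * tau c d)"
  proof (intro sum.cong refl)
    fix k assume k: "k \<in> {1..j}"
    then have kz: "of_nat k \<noteq> (0 :: 'p K)" by (simp add: of_nat_K_eq_0)
    have "k * (j choose k) = j * (j - 1 choose (k - 1))" using k times_binomial_minus1_eq[of k j] by simp
    then have b: "of_nat k * of_nat (j choose k) = (of_nat j * of_nat (j - 1 choose (k - 1)) :: 'p K)"
      by (metis of_nat_mult)
    have wk: "w ^ k = w ^ (k - 1) * (pK * of_nat d * tau c d)" using k w by (metis Suc_diff_1 Suc_le_eq atLeastAtMost_iff power_Suc2 One_nat_def)
    have "of_nat (j choose k) = (of_nat j * of_nat (j - 1 choose (k - 1)) / of_nat k :: 'p K)"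
      using b kz by (simp add: nonzero_eq_divide_eq mult.commute)
    then show "of_nat (j choose k) * w ^ k / (pK * of_nat (d * j)) = of_nat (j - 1 choose (k - 1)) * (w ^ (k - 1) / of_nat k) * tau c d"
      unfolding wk using nz kz by simp
  qed
  finally show ?thesis unfolding w_def .
qed

lemma tau_mult_cong:
  assumes "d > 0" "j > 0" "CARD('p) ^ v dvd d" "tau c d \<in> W"
  shows "wcong (Suc v) (tau c (d * j)) (tau c d)"
proof -
  let ?g = "\<lambda>k. of_nat (j - 1 choose (k - 1)) * ((c ^ d - 1) ^ (k - 1) / of_nat k) * tau c d"
  have "(of_nat d :: 'p K) \<in> pW v" using assms(3) by (auto simp: dvd_def intro!: pW_mult_W)
  then have "pK * (of_nat d * tau c d) \<in> pW (Suc v)" unfolding pW_scale1 using assms(4) by (rule pW_mult_W)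
  then have w: "c ^ d - 1 \<in> pW (Suc v)" using tau_eq[OF assms(1), of c] by (simp add: mult.assoc)
  have "{1..j} = insert 1 {2..j}" using assms(2) by auto
  then have "tau c (d * j) = ?g 1 + (\<Sum>k=2..j. ?g k)"
    unfolding tau_mult_expansion[OF assms(1,2)] by simp
  also have "wcong (Suc v) \<dots> (?g 1 + 0)"
  proof (intro wcong_add wcong_refl, unfold wcong_0, intro pW_sum)
    fix k assume "k \<in> {2..j}"
    then have "(c ^ d - 1) ^ (k - 1) / of_nat k \<in> pW (Suc v)" by (intro power_over_index w) auto
    then show "?g k \<in> pW (Suc v)" by (intro pW_mult_W W_mult_pW assms(4) W_of_nat)
  qed
  finally show ?thesis by simp
qed

lemma tau_W: assumes "c - 1 \<in> pW 1" "d > 0" shows "tau c d \<in> W"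
proof -
  obtain y where "y \<in> W" "c - 1 = pK ^ 1 * y" using assms(1) by (rule pW_E)
  then have 1: "tau c 1 \<in> W" by (simp add: tau_def)
  have "wcong (Suc 0) (tau c (1 * d)) (tau c 1)" by (rule tau_mult_cong) (use assms 1 in auto)
  then show ?thesis using wcong_W 1 by simp
qed

lemma power_near_one:
  fixes c :: "'p K"
  assumes "c - 1 \<in> pW 1" "CARD('p) ^ v dvd d" shows "wcong (Suc v) (c ^ d) 1"
proof (cases "d = 0")
  case False
  have "(of_nat d :: 'p K) \<in> pW v" using assms(2) by (auto simp: dvd_def intro!: pW_mult_W)
  then have "pK * (of_nat d * tau c d) \<in> pW (Suc v)"
    unfolding pW_scale1 by (rule pW_mult_W) (use tau_W[OF assms(1)] False in auto)
  then show ?thesis using tau_eq[of d c] False by (simp add: wcong_def mult.assoc)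
qed simp

text \<open>If \<open>p\<^sup>s\<close> divides \<open>m\<close> and \<open>n\<close>, both values are close to the one at \<open>p\<^sup>s\<close>. Otherwise write \<open>m = n +
  d\<close>; then \<open>m (\<tau>(m) - \<tau>(n))\<close> equals \<open>d (c\<^sup>n \<tau>(d) - \<tau>(n))\<close>, where the valuation \<open>v\<close> of \<open>n\<close> and of \<open>m\<close>
  is less than \<open>s\<close>. The difference in brackets is divisible by \<open>p\<^bsup>v+1\<^esup>\<close>, which pays for the division
  by \<open>m\<close>.\<close>

lemma tau_cong:
  assumes c: "c - 1 \<in> pW 1" and mn: "m > 0" "n > 0" "[m = n] (mod CARD('p) ^ s)"
  shows "wcong (Suc s) (tau c m) (tau c n)"
proof -
  let ?p = "CARD('p)"
  have base: "wcong (Suc s) (tau c m) (tau c (?p ^ s))" if m0: "m > 0" "?p ^ s dvd m" for m s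
  proof -
    obtain j where j: "m = ?p ^ s * j" using m0(2) by (auto simp: dvd_def)
    show ?thesis unfolding j using m0(1) j by (intro tau_mult_cong tau_W c) auto
  qed
  have main: "wcong (Suc s) (tau c m) (tau c n)" if nm: "0 < n" "n \<le> m" "[m = n] (mod ?p ^ s)" for m n
  proof (cases "m = n \<or> ?p ^ s dvd n")
    case True
    have "?p ^ s dvd m \<longleftrightarrow> ?p ^ s dvd n" using cong_dvd_iff[OF nm(3)] .
    then show ?thesis using True wcong_trans[OF base wcong_sym[OF base]] nm(1,2) by auto
  next
    case False
    have "?p ^ s dvd m - n" using nm(2,3) by (meson cong_altdef_nat)
    define d where "d = m - n"
    have d: "d > 0" "m = n + d" "?p ^ s dvd d" using False nm(2) \<open>?p ^ s dvd m - n\<close> by (auto simp: d_def)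
    obtain v u where vu: "n = ?p ^ v * u" "\<not> ?p dvd u"
      using of_nat_unit_part[OF nm(1), where 'p='p] by metis
    have vs: "v < s" 
    proof (rule ccontr)
      assume "\<not> v < s"
      then have "?p ^ s dvd n" unfolding vu(1) by (simp add: le_imp_power_dvd)
      then show False using False by simp
    qed
    have vd: "?p ^ v dvd d" using d(3) vs by (meson dvd_trans le_imp_power_dvd less_imp_le)
    have vn: "?p ^ v dvd n" unfolding vu(1) by simp
    have W: "tau c n \<in> W" "tau c d \<in> W" "tau c m \<in> W" using c nm d by (auto intro!: tau_W)
    have nd: "wcong (Suc v) (tau c d) (tau c n)"
      using wcong_trans[OF base wcong_sym[OF base]] nm(1) d(1) vd vn by blast
    have "wcong (Suc v) (c ^ n * tau c d) (1 * tau c n)"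
      by (intro wcong_mult power_near_one c vn nd W) (use wcong_W[OF power_near_one[OF c vn]] in simp)
    then have k: "c ^ n * tau c d - tau c n \<in> pW (Suc v)" by (simp add: wcong_def)
    have "pK * of_nat m * tau c m = c ^ m - 1" using tau_eq[of m c] nm by simp
    also have "c ^ m = c ^ n * c ^ d" unfolding d(2) by (simp add: power_add)
    also have "\<dots> = c ^ n * (1 + pK * of_nat d * tau c d)" using tau_eq[OF d(1), of c] by simp
    also have "\<dots> - 1 = c ^ n * (pK * of_nat d * tau c d) + (c ^ n - 1)" by (simp add: algebra_simps)
    also have "c ^ n - 1 = pK * of_nat n * tau c n" using tau_eq[OF nm(1), of c] by simp
    finally have "pK * (of_nat m * (tau c m - tau c n)) = pK * (of_nat d * (c ^ n * tau c d - tau c n))"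
      unfolding d(2) by (simp add: algebra_simps)
    then have "of_nat m * (tau c m - tau c n) = of_nat d * (c ^ n * tau c d - tau c n)" by simp
    also have "\<dots> \<in> pW (s + Suc v)"
    proof (rule pW_mult[OF _ k])
      show "(of_nat d :: 'p K) \<in> pW s" using d(3) by (auto simp: dvd_def intro!: pW_mult_W)
    qed
    finally have fin: "of_nat m * (tau c m - tau c n) \<in> pW (Suc s + v)" by simp
    obtain d' where d': "d = ?p ^ s * d'" using d(3) by (auto simp: dvd_def)
    have ps: "?p ^ s = ?p ^ v * ?p ^ (s - v)" using vs by (simp flip: power_add)
    have m: "m = ?p ^ v * (u + ?p ^ (s - v) * d')" unfolding d(2) d' vu(1) ps by (simp add: algebra_simps)
    have "?p dvd ?p ^ (s - v) * d'" using vs by (simp add: dvd_power)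
    then have nu: "\<not> ?p dvd u + ?p ^ (s - v) * d'" using vu(2) by (metis dvd_add_left_iff)
    have "of_nat m * (tau c m - tau c n) / of_nat m \<in> pW (Suc s)" by (rule pW_divide_of_nat[OF fin m nu])
    moreover have "of_nat m \<noteq> (0 :: 'p K)" using nm by (simp add: of_nat_K_eq_0)
    ultimately show ?thesis by (simp add: wcong_def)
  qed
  show ?thesis
  proof (cases "n \<le> m")
    case True
    then show ?thesis using main mn by blast
  next
    case False
    then have "wcong (Suc s) (tau c n) (tau c m)" using mn by (intro main) (auto simp: cong_sym_eq)
    then show ?thesis by (rule wcong_sym)
  qed
qed

text \<open>The limit of \<open>(c\<^sup>m - 1) / (p m)\<close> as \<open>m\<close> tends to \<open>0\<close>, which is \<open>p\<^sup>-\<^sup>1 log c\<close>; outside of \<open>1 + p W\<close>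
  the value is arbitrary.\<close>

definition plog :: "'p K \<Rightarrow> 'p K" where
  "plog c = (SOME L. L \<in> W \<and> (\<forall>s m. 0 < m \<longrightarrow> CARD('p) ^ s dvd m \<longrightarrow> wcong (Suc s) L (tau c m)))"

lemma plog_props:
  assumes c: "c - 1 \<in> pW 1"
  shows "plog c \<in> W" "\<And>s m. 0 < m \<Longrightarrow> CARD('p) ^ s dvd m \<Longrightarrow> wcong (Suc s) (plog c) (tau c m)"
proof -
  let ?p = "CARD('p)"
  have st: "wcong (Suc n) (tau c (?p ^ Suc n)) (tau c (?p ^ n))" for n
    by (rule tau_cong[OF c]) (simp_all add: cong_def)
  have "\<exists>L\<in>W. \<forall>n. L - tau c (?p ^ n) \<in> pW n"
  proof (rule W_complete)
    fix n
    show "tau c (?p ^ n) \<in> W" by (rule tau_W[OF c]) simp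
    show "tau c (?p ^ Suc n) - tau c (?p ^ n) \<in> pW n"
      using wcong_mono[OF st[of n], of n] by (simp only: wcong_def)
  qed
  then obtain L where L: "L \<in> W" "\<And>n. wcong n L (tau c (?p ^ n))" by (auto simp: wcong_def)
  have "L \<in> W \<and> (\<forall>s m. 0 < m \<longrightarrow> ?p ^ s dvd m \<longrightarrow> wcong (Suc s) L (tau c m))"
  proof (intro conjI allI impI L(1))
    fix s m :: nat assume m: "0 < m" "?p ^ s dvd m"
    have "[?p ^ Suc s = m] (mod ?p ^ s)" using m(2) by (auto simp: cong_def dvd_def)
    then have "wcong (Suc s) (tau c (?p ^ Suc s)) (tau c m)" by (intro tau_cong c m) simp
    then show "wcong (Suc s) L (tau c m)" by (rule wcong_trans[OF L(2)])
  qed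
  then have ex: "\<exists>L. L \<in> W \<and> (\<forall>s m. 0 < m \<longrightarrow> ?p ^ s dvd m \<longrightarrow> wcong (Suc s) L (tau c m))" by blast
  from someI_ex[OF ex] show "plog c \<in> W" "\<And>s m. 0 < m \<Longrightarrow> ?p ^ s dvd m \<Longrightarrow> wcong (Suc s) (plog c) (tau c m)"
    unfolding plog_def by blast+
qed

lemma one_unit_mult: "a - 1 \<in> pW 1 \<Longrightarrow> b - 1 \<in> pW 1 \<Longrightarrow> a * b - 1 \<in> (pW 1 :: 'p K set)"
proof -
  assume ab: "a - 1 \<in> pW 1" "b - 1 \<in> pW 1"
  have "b \<in> W" using W_add[OF pW_imp_W[OF ab(2)] W_1] by simp
  then have "(a - 1) * b + (b - 1) \<in> pW 1" using ab by (intro pW_add pW_mult_W)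
  then show ?thesis by (simp add: algebra_simps)
qed

text \<open>As \<open>(a b)\<^sup>m = a\<^sup>m b\<^sup>m\<close>, the quotients satisfy \<open>\<tau>(a b) = \<tau>(a) + \<tau>(b) + p m \<tau>(a) \<tau>(b)\<close>, and the last
  term tends to \<open>0\<close> with \<open>m\<close>.\<close>

lemma plog_mult:
  assumes a: "a - 1 \<in> pW 1" and b: "b - 1 \<in> pW 1" shows "plog (a * b) = plog a + plog b"
proof -
  let ?p = "CARD('p)"
  note ab = one_unit_mult[OF a b]
  have "plog (a * b) - (plog a + plog b) \<in> pW s" for s
  proof -
    let ?m = "?p ^ s"
    have m: "?m > 0" by simp
    have nz: "of_nat ?m \<noteq> (0 :: 'p K)" by (simp add: of_nat_K_eq_0)
    define x where "x = (pK * of_nat ?m :: 'p K)"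
    have x: "x \<noteq> 0" using nz by (simp add: x_def)
    have "1 + x * tau (a * b) ?m = (1 + x * tau a ?m) * (1 + x * tau b ?m)"
      unfolding x_def tau_eq[OF m, symmetric] by (rule power_mult_distrib)
    then have "x * tau (a * b) ?m = x * (tau a ?m + tau b ?m + x * (tau a ?m * tau b ?m))"
      by (simp add: algebra_simps)
    then have e': "tau (a * b) ?m = tau a ?m + tau b ?m + x * (tau a ?m * tau b ?m)"
      unfolding mult_left_cancel[OF x] .
    have e: "tau (a * b) ?m = tau a ?m + tau b ?m + pK * of_nat ?m * (tau a ?m * tau b ?m)"
      using e' unfolding x_def .
    have 1: "wcong s (plog c) (tau c ?m)" if "c - 1 \<in> pW 1" for c
      by (rule wcong_mono[OF plog_props(2)[OF that m, of s]]) auto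
    have "wcong s (plog (a * b)) (tau (a * b) ?m)" by (rule 1[OF ab])
    also have "wcong s (tau (a * b) ?m) (tau a ?m + tau b ?m + 0)"
      unfolding e
    proof (intro wcong_add wcong_refl)
      show "wcong s (pK * of_nat ?m * (tau a ?m * tau b ?m)) 0"
        unfolding wcong_0
      proof (rule pW_I)
        show "pK * (tau a ?m * tau b ?m) \<in> W" by (intro W_mult tau_W a b m W_of_nat)
        show "pK * of_nat ?m * (tau a ?m * tau b ?m) = pK ^ s * (pK * (tau a ?m * tau b ?m))"
          by (simp only: of_nat_power mult_ac)
      qed
    qed
    also have "wcong s (tau a ?m + tau b ?m + 0) (plog a + plog b)"
      using wcong_add[OF wcong_sym[OF 1[OF a]] wcong_sym[OF 1[OF b]]] by simp
    finally show ?thesis by (simp add: wcong_def)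
  qed
  then show ?thesis using pW_Inter[of "plog (a * b) - (plog a + plog b)"] by simp
qed

text \<open>Induction: \<open>n!\<close> is a unit times \<open>p\<^sup>m m!\<close> for \<open>m\<close> the integral part of \<open>n / p\<close>, and \<open>2 m \<le> n\<close>.\<close>

lemma p_power_over_fact: "pK ^ n / of_nat (fact n) \<in> (W :: 'p K set)"
proof (induction n rule: less_induct)
  case (less n)
  let ?p = "CARD('p)"
  let ?m = "n div ?p"
  show ?case
  proof (cases "n = 0")
    case False
    have fp: "of_nat (fact k) = (pochhammer 1 k :: 'p K)" for k
      by (induction k) (simp_all add: pochhammer_Suc algebra_simps)
    have n: "n = n mod ?p + ?p * ?m" by simp
    have k: "n mod ?p < ?p" by simp
    have k': "\<not> ?p - 1 < n mod ?p" using k by linarith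
    have "pochhammer 1 n = pK ^ ?m * pochhammer 1 ?m * (upoch 1 n :: 'p K)"
      using pochhammer_block[OF Zp_1 k, of ?m] k' unfolding dwork_one n[symmetric] by (simp only: if_False)
    then have e: "of_nat (fact n) = pK ^ ?m * of_nat (fact ?m) * (upoch 1 n :: 'p K)" unfolding fp .
    have "?p * ?m \<le> n" using n by linarith
    then have le: "2 * ?m \<le> n" using p3 mult_le_mono1[of 2 ?p ?m] by linarith
    then have "n = ?m + ((n - 2 * ?m) + ?m)" by simp
    then have pw: "pK ^ n = (pK ^ ?m * (pK ^ (n - 2 * ?m) * pK ^ ?m) :: 'p K)" by (metis power_add)
    have lt: "?m < n" using False p3 by simp
    have u: "Wunit (upoch 1 n :: 'p K)" by (intro Wunit_upoch) simp
    have "pK ^ n / of_nat (fact n) = pK ^ (n - 2 * ?m) * (pK ^ ?m / of_nat (fact ?m)) / (upoch 1 n :: 'p K)"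
      unfolding e pw by simp
    also have "\<dots> \<in> W" by (intro W_divide W_mult less.IH lt u W_power W_of_nat)
    finally show ?thesis .
  qed simp
qed

text \<open>In the binomial expansion, \<open>(p\<^sup>s - 1 choose i)\<close> is close to \<open>(-1)\<^sup>i\<close> after multiplication with
  \<open>i!\<close>, and the factorial is absorbed by the power of \<open>x\<close>.\<close>

lemma log_partial_sum:
  assumes x: "(x :: 'p K) \<in> pW 1"
  shows "wcong s (pK * tau (1 + x) (CARD('p) ^ s)) (\<Sum>k=1..CARD('p) ^ s. (- 1) ^ (k + 1) * x ^ k / of_nat k)"
proof -
  let ?q = "CARD('p) ^ s"
  have q: "?q > 0" by simp
  have t1: "tau (1 + x) 1 = x / pK" by (simp add: tau_def)
  have "pK * tau (1 + x) (1 * ?q) = (\<Sum>k=1..?q. pK * (of_nat (?q - 1 choose (k - 1)) * (x ^ (k - 1) / of_nat k) * (x / pK)))"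
    unfolding tau_mult_expansion[OF zero_less_one q] t1 by (simp add: sum_distrib_left)
  also have "wcong s \<dots> (\<Sum>k=1..?q. (- 1) ^ (k + 1) * x ^ k / of_nat k)"
  proof (intro wcong_sum)
    fix k assume k: "k \<in> {1..?q}"
    obtain i where i: "k = Suc i" using k by (cases k) auto
    have iq: "i < ?q" using k i by simp
    let ?b = "of_nat (?q - 1 choose i) :: 'p K"
    have fp: "(\<Prod>j<i. - 1 - of_nat j) = (- 1) ^ i * (of_nat (fact i) :: 'p K)" for i
      by (induction i) (simp_all add: algebra_simps)
    have "of_nat (\<Prod>j<i. ?q - 1 - j) = (\<Prod>j<i. of_nat (?q - 1 - j) :: 'p K)" by simp
    also have "\<dots> = (\<Prod>j<i. of_nat ?q + (- 1 - of_nat j))"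
    proof (rule prod.cong[OF refl])
      fix j assume "j \<in> {..<i}"
      then have "?q = (?q - 1 - j) + 1 + j" using iq by simp
      then have "(of_nat ?q :: 'p K) = of_nat (?q - 1 - j) + 1 + of_nat j" by (metis of_nat_1 of_nat_add)
      then show "of_nat (?q - 1 - j) = (of_nat ?q + (- 1 - of_nat j) :: 'p K)" by simp
    qed
    also have "wcong s \<dots> (\<Prod>j<i. 0 + (- 1 - of_nat j))"
      by (intro wcong_prod wcong_add wcong_refl W_add W_diff W_neg W_1 W_of_nat) simp
    finally have "wcong s (of_nat ((?q - 1 choose i) * fact i)) ((- 1) ^ i * (of_nat (fact i) :: 'p K))"
      using falling_fact[of i "?q - 1"] iq by (simp add: fp)
    then have b: "(?b - (- 1) ^ i) * of_nat (fact i) \<in> pW s" by (simp add: wcong_def algebra_simps)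
    obtain y where y: "y \<in> W" "x = pK ^ 1 * y" using x by (rule pW_E)
    have xk: "x ^ k / of_nat (fact k) \<in> W"
    proof -
      have "x ^ k / of_nat (fact k) = y ^ k * (pK ^ k / of_nat (fact k))" unfolding y(2) by (simp add: power_mult_distrib)
      then show ?thesis using p_power_over_fact[of k] y(1) by (metis W_mult W_power)
    qed
    have nz: "of_nat (fact i) \<noteq> (0 :: 'p K)" "of_nat k \<noteq> (0 :: 'p K)" using i by (simp_all add: of_nat_K_eq_0 del: of_nat_fact of_nat_Suc)
    have fk: "of_nat (fact k) = (of_nat k * of_nat (fact i) :: 'p K)" unfolding i fact_Suc of_nat_mult by simp
    have "pK * (?b * (x ^ i / of_nat k) * (x / pK)) - (- 1) ^ (k + 1) * x ^ k / of_nat k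
      = ((?b - (- 1) ^ i) * of_nat (fact i)) * (x ^ k / of_nat (fact k))"
    proof -
      have "((?b - (- 1) ^ i) * of_nat (fact i)) * (x ^ k / of_nat (fact k)) = (?b - (- 1) ^ i) * x ^ k / of_nat k"
        unfolding fk using nz by simp
      moreover have "pK * (?b * (x ^ i / of_nat k) * (x / pK)) = ?b * x ^ k / of_nat k" unfolding i by simp
      moreover have "(- 1 :: 'p K) ^ (k + 1) = (- 1) ^ i" unfolding i by simp
      ultimately show ?thesis by (simp only: left_diff_distrib diff_divide_distrib)
    qed
    also have "\<dots> \<in> pW s" by (rule pW_mult_W[OF b xk])
    finally show "wcong s (pK * (of_nat (?q - 1 choose (k - 1)) * (x ^ (k - 1) / of_nat k) * (x / pK))) ((- 1) ^ (k + 1) * x ^ k / of_nat k)"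
      unfolding wcong_def i by simp
  qed
  finally show ?thesis by simp
qed

end

text \<open>An element of the algebraic closure of a finite field generates a finite field, so two of its
  powers agree.\<close>

lemma alg_closure_root_of_unity:
  fixes y :: "'a::{field,finite} alg_closure"
  assumes "y \<noteq> 0" shows "\<exists>n>0. y ^ n = 1"
proof -
  define K where "K = (ring_of_type_algebra :: 'a ring)"
  define L where "L = field.alg_closure K"
  interpret K: field K unfolding K_def by rule
  have carK: "carrier K = UNIV" by (auto simp: K_def ring_of_type_algebra_def)
  interpret algebraic_closure L "range K.indexed_const"
    unfolding carK[symmetric] L_def by (rule K.alg_closureE)
  let ?x = "Rep_alg_closure y" and ?E = "range K.indexed_const"
  have x: "?x \<in> carrier L" using Rep_alg_closure[of y] by (simp add: L_def K_def)
  have sf: "subfield ?E L" by (rule subfield_axioms)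
  have "finite_dimension ?E (simple_extension ?E ?x)"
    using finite_dimension_simple_extension[OF sf x] algebraic_extension[OF x] by simp
  then obtain n where "dimension n ?E (simple_extension ?E ?x)" unfolding finite_dimension_def by blast
  then obtain Vs where Vs: "set Vs \<subseteq> carrier L" "Span ?E Vs = simple_extension ?E ?x"
    using exists_base[OF sf] by blast
  have "finite {Ks. set Ks \<subseteq> ?E \<and> length Ks = length Vs}" by (rule finite_lists_length_eq) simp
  then have "finite ((\<lambda>Ks. combine Ks Vs) ` {Ks. set Ks \<subseteq> ?E \<and> length Ks = length Vs})" by (rule finite_imageI)
  moreover have "Span ?E Vs \<subseteq> (\<lambda>Ks. combine Ks Vs) ` {Ks. set Ks \<subseteq> ?E \<and> length Ks = length Vs}"
    using Span_eq_combine_set_length_version[OF sf Vs(1)] by auto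
  ultimately have fin: "finite (simple_extension ?E ?x)" unfolding Vs(2)[symmetric] by (rule finite_subset[rotated])
  have sub: "subring (simple_extension ?E ?x) L"
    by (rule simple_extension_is_subring[OF subfieldE(1)[OF sf] x])
  have mem: "?x \<in> simple_extension ?E ?x" by (rule simple_extension_mem[OF subfieldE(1)[OF sf] x])
  have pow: "Rep_alg_closure (y ^ n) \<in> simple_extension ?E ?x" for n
  proof (induction n)
    case 0
    have "Rep_alg_closure (1 :: 'a alg_closure) = \<one>\<^bsub>L\<^esub>" by (simp add: one_alg_closure.rep_eq L_def K_def)
    then show ?case using subringE(3)[OF sub] by simp
  next
    case (Suc n)
    have "Rep_alg_closure (y * y ^ n) = ?x \<otimes>\<^bsub>L\<^esub> Rep_alg_closure (y ^ n)" by (simp add: times_alg_closure.rep_eq L_def K_def)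
    then show ?case using subringE(6)[OF sub mem Suc] by simp
  qed
  have "\<not> inj (\<lambda>n. Rep_alg_closure (y ^ n))"
  proof
    assume "inj (\<lambda>n. Rep_alg_closure (y ^ n))"
    moreover have "finite (range (\<lambda>n. Rep_alg_closure (y ^ n)))" by (rule finite_subset[OF _ fin]) (use pow in auto)
    ultimately have "finite (UNIV :: nat set)" by (rule finite_imageD[rotated])
    then show False by simp
  qed
  then obtain i j where ij: "i < j" "y ^ i = y ^ j"
    by (auto simp: inj_def Rep_alg_closure_inject) (metis linorder_neqE_nat)
  have "y ^ j = y ^ i * y ^ (j - i)" using ij(1) by (simp flip: power_add)
  then have "y ^ i * y ^ (j - i) = y ^ i * 1" using ij(2) by simp
  then have "y ^ (j - i) = 1" using assms by simp
  then show ?thesis using ij(1) by (intro exI[of _ "j - i"]) simp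
qed

text \<open>The residue of a unit is a nonzero element of the algebraic closure of a finite field, hence a
  root of unity.\<close>

lemma Wunit_power_one:
  assumes "Wunit (x :: 'p::prime_card K)" shows "\<exists>n>0. x ^ n - 1 \<in> pW 1"
proof -
  obtain w where w: "x = emb w" using Wunit_W[OF assms] by (auto simp: W_def)
  have nz: "witt_nth w 0 \<noteq> 0"
  proof
    assume "witt_nth w 0 = 0"
    then have "of_nat CHAR('p mod_ring alg_closure) ^ 1 dvd w - 0" unfolding witt_cong_iff by simp
    then have "x \<in> pW 1" unfolding w pW_emb by simp
    then show False using assms by (simp add: Wunit_def)
  qed
  obtain n where n: "n > 0" "witt_nth w 0 ^ n = 1" using alg_closure_root_of_unity[OF nz] by blast
  have "witt_nth (w ^ n) 0 = 1" unfolding n(2)[symmetric] by (induction n) (simp_all add: witt_nth_mult_0)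
  then have "of_nat CHAR('p mod_ring alg_closure) ^ 1 dvd w ^ n - 1" unfolding witt_cong_iff by simp
  then have "emb (w ^ n - 1) \<in> (pW 1 :: 'p K set)" unfolding pW_emb .
  then show ?thesis using n(1) unfolding w emb_simps by blast
qed

context
  assumes p3: "CARD('p::prime_card) \<ge> 3"
begin

text \<open>The partial sum up to the index \<open>p\<^sup>N\<close> is close to \<open>((1 + x)\<^bsup>p^N\<^esup> - 1) / p\<^sup>N\<close>, and the terms after
  it are small.\<close>

lemma log_series_plog:
  assumes x: "(x :: 'p K) \<in> pW 1" shows "log_series x = pK * plog (1 + x)"
  unfolding log_series_def
proof (rule padic_limI)
  fix N
  let ?q = "CARD('p) ^ N"
  let ?t = "\<lambda>k. (- 1) ^ (k + 1) * x ^ k / of_nat k :: 'p K"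
  have q: "2 * N \<le> ?q" using three_le_power[OF p3, of N] three_power_bounds(2)[of N] by linarith
  have xn: "x ^ n \<in> pW n" for n
  proof (induction n)
    case (Suc n)
    show ?case using pW_mult[OF x Suc] by simp
  qed simp
  have small: "?t k \<in> pW N" if k: "k \<ge> 2 * N" "k > 0" for k
  proof -
    obtain v u where vu: "k = CARD('p) ^ v * u" "\<not> CARD('p) dvd u" 
      using of_nat_unit_part[OF k(2), where 'p='p] by metis
    have "u > 0" using vu(2) by (cases u) auto
    then have "CARD('p) ^ v \<le> k" unfolding vu(1) by simp
    then have "N + v \<le> k" using three_le_power[OF p3, of v] three_power_bounds(2)[of v] k(1) by linarith
    then have "(- 1) ^ (k + 1) * x ^ k \<in> pW (N + v)" by (intro W_mult_pW pW_mono[OF xn]) auto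
    then show ?thesis by (rule pW_divide_of_nat[OF _ vu])
  qed
  have "wcong N (\<Sum>k=1..n. ?t k) (pK * plog (1 + x))" if n: "n \<ge> ?q" for n
  proof -
    have "{1..n} = {1..?q} \<union> {?q<..n}" using n by auto
    moreover have "{1..?q} \<inter> {?q<..n} = {}" by auto
    ultimately have "(\<Sum>k=1..n. ?t k) = (\<Sum>k=1..?q. ?t k) + (\<Sum>k\<in>{?q<..n}. ?t k)"
      by (simp only: sum.union_disjoint finite_atLeastAtMost finite_greaterThanAtMost)
    also have "wcong N \<dots> (pK * tau (1 + x) ?q + 0)"
    proof (rule wcong_add[OF wcong_sym[OF log_partial_sum[OF p3 x]]])
      show "wcong N (\<Sum>k\<in>{?q<..n}. ?t k) 0" unfolding wcong_0
        by (intro pW_sum small) (use q in auto)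
    qed
    also have "pK * tau (1 + x) ?q + 0 = pK * tau (1 + x) ?q" by simp
    also have "wcong N \<dots> (pK * plog (1 + x))"
    proof (rule wcong_mono[OF wcong_pK_mult[OF wcong_sym]])
      show "wcong (Suc N) (plog (1 + x)) (tau (1 + x) ?q)" by (rule plog_props(2)[OF p3]) (use x in auto)
    qed simp
    finally show ?thesis .
  qed
  then show "\<forall>\<^sub>F n in sequentially. wcong N (\<Sum>k=1..n. ?t k) (pK * plog (1 + x))"
    unfolding eventually_sequentially by blast
qed simp

lemma plog_one: "plog (1 :: 'p K) = 0"
proof -
  have "plog (1 :: 'p K) + plog 1 = plog 1 + 0" using plog_mult[OF p3, of 1 1] by simp
  then show ?thesis by (simp only: add_left_cancel)
qed

lemma one_unit_power: "v - 1 \<in> pW 1 \<Longrightarrow> v ^ n - 1 \<in> (pW 1 :: 'p K set)"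
proof (induction n)
  case (Suc n)
  then show ?case unfolding power_Suc by (intro one_unit_mult[OF p3])
qed simp

lemma plog_power:
  assumes v: "v - 1 \<in> pW 1" shows "plog (v ^ n) = of_nat n * plog (v :: 'p K)"
proof (induction n)
  case (Suc n)
  have "plog (v ^ Suc n) = plog v + plog (v ^ n)"
    unfolding power_Suc by (rule plog_mult[OF p3 v one_unit_power[OF v]])
  then show ?case by (simp add: Suc algebra_simps)
qed (simp add: plog_one)

lemma unit_part_unique:
  assumes "pK ^ i * u = pK ^ j * (w :: 'p K)" "Wunit u" "Wunit w" shows "u = w"
proof -
  have le: "i = j" if le: "i \<le> j" and eq: "pK ^ i * u = pK ^ j * w" and uu: "Wunit u" and ww: "Wunit w" for i j and u w :: "'p K"
  proof (rule ccontr)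
    assume "i \<noteq> j"
    then have "i < j" using le by simp
    then obtain k where k: "j = i + Suc k" using less_imp_Suc_add[of i j] by auto
    have "pK ^ i * u = pK ^ i * (pK ^ Suc k * w)" using eq unfolding k by (simp only: power_add mult.assoc)
    then have "u = pK ^ Suc k * w" by simp
    then have "u \<in> pW (Suc k)" using Wunit_W[OF ww] by (intro pW_I)
    then have "u \<in> pW 1" by (rule pW_mono) simp
    then show False using uu by (simp add: Wunit_def)
  qed
  have "i = j" using le[of i j u w] le[of j i w u] assms by (cases "i \<le> j") auto
  then show ?thesis using assms(1) by simp
qed

text \<open>\<open>y\<close> is the logarithm of \<open>x\<close>, computed from a power of \<open>x\<close> that lies in \<open>p\<^sup>\<int> (1 + p W)\<close>.\<close>

definition log_of :: "'p K \<Rightarrow> 'p K \<Rightarrow> bool" where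
  "log_of x y \<longleftrightarrow> (\<exists>n>0. \<exists>i j v. v - 1 \<in> pW 1 \<and> pK ^ i * x ^ n = pK ^ j * v \<and> of_nat n * y = pK * plog v)"

lemma log_ofI: "n > 0 \<Longrightarrow> v - 1 \<in> pW 1 \<Longrightarrow> pK ^ i * x ^ n = pK ^ j * v \<Longrightarrow> of_nat n * y = pK * plog v \<Longrightarrow> log_of x y"
  unfolding log_of_def by blast

lemma one_unit_Wunit: "v - 1 \<in> pW 1 \<Longrightarrow> Wunit (v :: 'p K)"
  using Wunit_pW1_add[of 1 "v - 1"] by simp

text \<open>Raise the two representations to a common power: the powers of \<open>p\<close> must agree, and the logarithm
  of a power in \<open>1 + p W\<close> is a multiple of the logarithm.\<close>

lemma log_of_unique:
  assumes "log_of x y" "log_of x y'" "x \<noteq> 0" shows "y = y'"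
proof -
  obtain n i j v where 1: "n > 0" "v - 1 \<in> pW 1" "pK ^ i * x ^ n = pK ^ j * v" "of_nat n * y = pK * plog v"
    using assms(1) unfolding log_of_def by blast
  obtain n' i' j' v' where 2: "n' > 0" "v' - 1 \<in> pW 1" "pK ^ i' * x ^ n' = pK ^ j' * v'" "of_nat n' * y' = pK * plog v'"
    using assms(2) unfolding log_of_def by blast
  have "(pK ^ i * x ^ n) ^ n' * (pK ^ j' * v') ^ n = (pK ^ j * v) ^ n' * (pK ^ i' * x ^ n') ^ n"
    unfolding 1(3) 2(3) ..
  then have "(pK ^ (i * n' + j' * n) * v' ^ n) * x ^ (n * n') = (pK ^ (j * n' + i' * n) * v ^ n') * x ^ (n * n')"
    by (simp add: power_mult_distrib power_add mult_ac flip: power_mult)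
  then have "pK ^ (i * n' + j' * n) * v' ^ n = pK ^ (j * n' + i' * n) * v ^ n'" using assms(3) by simp
  then have vv: "v' ^ n = v ^ n'" by (rule unit_part_unique) (intro Wunit_power one_unit_Wunit 1 2)+
  have "of_nat n * (of_nat n' * y') = pK * (of_nat n * plog v')" unfolding 2(4) by (simp add: mult_ac)
  also have "\<dots> = pK * plog (v ^ n')" unfolding plog_power[OF 2(2), symmetric] vv ..
  also have "\<dots> = of_nat n' * (of_nat n * y)" unfolding plog_power[OF 1(2)] 1(4) by (simp add: mult_ac)
  finally have "of_nat (n * n') * y' = of_nat (n * n') * y" by (simp add: mult_ac)
  moreover have "of_nat (n * n') \<noteq> (0 :: 'p K)" using 1 2 by (simp only: of_nat_K_eq_0) simp
  ultimately show ?thesis by simp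
qed

lemma log_of_exists: assumes "x \<noteq> 0" shows "\<exists>y. log_of x y"
proof -
  obtain i where i: "pK ^ i * x \<in> W" using K_denom by blast
  have "pK ^ i * x \<noteq> 0" using assms by simp
  then obtain j u where u: "pK ^ i * x = pK ^ j * u" "Wunit u" by (rule W_unit_part[OF i])
  obtain n where n: "n > 0" "u ^ n - 1 \<in> pW 1" using Wunit_power_one[OF u(2)] by blast
  have "(pK ^ i * x) ^ n = (pK ^ j * u) ^ n" using u(1) by simp
  then have "pK ^ (i * n) * x ^ n = pK ^ (j * n) * u ^ n" by (simp add: power_mult_distrib power_mult)
  moreover have "of_nat n * (pK * plog (u ^ n) / of_nat n) = pK * plog (u ^ n)"
    using n(1) by (simp add: of_nat_K_eq_0)
  ultimately show ?thesis using log_ofI[OF n] by blast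
qed

lemma log_of_mult:
  assumes "log_of x y" "log_of x' y'" shows "log_of (x * x') (y + y')"
proof -
  obtain n i j v where 1: "n > 0" "v - 1 \<in> pW 1" "pK ^ i * x ^ n = pK ^ j * v" "of_nat n * y = pK * plog v"
    using assms(1) unfolding log_of_def by blast
  obtain n' i' j' v' where 2: "n' > 0" "v' - 1 \<in> pW 1" "pK ^ i' * x' ^ n' = pK ^ j' * v'" "of_nat n' * y' = pK * plog v'"
    using assms(2) unfolding log_of_def by blast
  show ?thesis
  proof (rule log_ofI)
    show "n * n' > 0" using 1 2 by simp
    show "v ^ n' * v' ^ n - 1 \<in> pW 1" by (intro one_unit_mult[OF p3] one_unit_power 1 2)
    have "(pK ^ i * x ^ n) ^ n' * (pK ^ i' * x' ^ n') ^ n = (pK ^ j * v) ^ n' * (pK ^ j' * v') ^ n"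
      unfolding 1(3) 2(3) ..
    then show "pK ^ (i * n' + i' * n) * (x * x') ^ (n * n') = pK ^ (j * n' + j' * n) * (v ^ n' * v' ^ n)"
      by (simp add: power_mult_distrib power_add mult_ac flip: power_mult)
    have pl: "plog (v ^ n' * v' ^ n) = of_nat n' * plog v + of_nat n * plog v'"
      using plog_mult[OF p3 one_unit_power[OF 1(2)] one_unit_power[OF 2(2)]]
      by (simp only: plog_power[OF 1(2)] plog_power[OF 2(2)])
    have "of_nat (n * n') * (y + y') = of_nat n' * (of_nat n * y) + of_nat n * (of_nat n' * y')"
      by (simp add: algebra_simps)
    also have "\<dots> = pK * plog (v ^ n' * v' ^ n)"
      unfolding 1(4) 2(4) pl by (simp add: algebra_simps)
    finally show "of_nat (n * n') * (y + y') = pK * plog (v ^ n' * v' ^ n)" .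
  qed
qed

text \<open>The function that \<open>log_of\<close> describes has the properties that characterize the Iwasawa logarithm,
  and any function with these properties is equal to it, since some power of each nonzero element
  lies in \<open>p\<^sup>\<int> (1 + p W)\<close> and \<open>K\<close> has characteristic \<open>0\<close>. On \<open>1 + p W\<close> this is \<open>p\<close> times \<open>plog\<close>.\<close>

lemma iwasawa_log_one_unit:
  assumes c: "c - 1 \<in> pW 1" shows "iwasawa_log (c :: 'p K) = pK * plog c"
proof -
  let ?P = "\<lambda>L :: 'p K \<Rightarrow> 'p K. L 0 = 0 \<and> L pK = 0 \<and>
     (\<forall>x y. x \<noteq> 0 \<longrightarrow> y \<noteq> 0 \<longrightarrow> L (x * y) = L x + L y) \<and> (\<forall>x\<in>pW 1. L (1 + x) = log_series x)"
  define L where "L x = (if x = 0 then 0 else SOME y. log_of x y)" for x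
  have L: "log_of x (L x)" if "x \<noteq> 0" for x
    using someI_ex[OF log_of_exists[OF that]] that by (simp add: L_def)
  have Leq: "L x = y" if "x \<noteq> 0" "log_of x y" for x y
    using log_of_unique[OF L[OF that(1)] that(2,1)] .
  have PL: "?P L"
  proof (intro conjI allI impI ballI)
    show "L 0 = 0" by (simp add: L_def)
    show "L pK = 0" by (rule Leq[OF pK_nz log_ofI[of 1 1 0 _ 1]]) (simp_all add: plog_one)
    show "L (x * y) = L x + L y" if "x \<noteq> 0" "y \<noteq> 0" for x y
      using that by (intro Leq log_of_mult L) auto
    show "L (1 + x) = log_series x" if "x \<in> pW 1" for x
    proof (rule Leq)
      show "1 + x \<noteq> 0" using Wunit_nz[OF Wunit_pW1_add[OF Wunit_1 that]] .
      show "log_of (1 + x) (log_series x)"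
        unfolding log_series_plog[OF that] by (rule log_ofI[of 1 "1 + x" 0 _ 0]) (use that in simp_all)
    qed
  qed
  have uniq: "L' = L" if L': "?P L'" for L'
  proof
    fix x show "L' x = L x"
    proof (cases "x = 0")
      case False
      obtain n i j v where 1: "n > 0" "v - 1 \<in> pW 1" "pK ^ i * x ^ n = pK ^ j * v" "of_nat n * L x = pK * plog v"
        using L[OF False] unfolding log_of_def by blast
      have mul: "L' (x * y) = L' x + L' y" if "x \<noteq> 0" "y \<noteq> 0" for x y using L' that by blast
      have "L' 1 = L' 1 + L' 1" using mul[OF one_neq_zero one_neq_zero] by (simp only: mult_1_left)
      then have "L' 1 + L' 1 = L' 1 + 0" unfolding add_0_right by (rule sym)
      then have one: "L' 1 = 0" by (simp only: add_left_cancel)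
      have pow: "L' (z ^ k) = of_nat k * L' z" if "z \<noteq> 0" for z k
        using that L' by (induction k) (simp_all add: one algebra_simps)
      have v: "v \<noteq> 0" by (rule Wunit_nz[OF one_unit_Wunit[OF 1(2)]])
      have lhs: "L' (pK ^ i * x ^ n) = of_nat i * L' pK + of_nat n * L' x" using L' False by (simp add: pow)
      have rhs: "L' (pK ^ j * v) = of_nat j * L' pK + L' v" using L' v by (simp add: pow)
      have "L' (1 + (v - 1)) = log_series (v - 1)" using L' 1(2) by blast
      then have "L' v = pK * plog v" using log_series_plog[OF 1(2)] by simp
      moreover have "L' pK = 0" using L' by simp
      moreover have "L' (pK ^ i * x ^ n) = L' (pK ^ j * v)" by (simp only: 1(3))
      ultimately have "of_nat n * L' x = of_nat n * L x" unfolding lhs rhs 1(4) by simp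
      then show ?thesis using 1(1) by (simp add: of_nat_K_eq_0)
    qed (use L' PL in simp)
  qed
  have "iwasawa_log = L" unfolding iwasawa_log_def
  proof (rule the_equality)
    show "?P L" by (rule PL)
    show "L' = L" if "?P L'" for L' by (rule uniq[OF that])
  qed
  moreover have "L (1 + (c - 1)) = log_series (c - 1)" using PL c by blast
  ultimately show ?thesis using log_series_plog[OF c] by simp
qed

section \<open>Functions with a Lipschitz logarithmic difference quotient\<close>

text \<open>On the index set \<open>I\<close>, \<open>e\<close> is the quotient \<open>(E - 1) / pos\<close>. It is a Lipschitz function of \<open>pos n\<close>
  and tends to \<open>lam\<close> as \<open>pos n\<close> tends to \<open>0\<close>. Here \<open>pos n\<close> will be \<open>n\<close> or \<open>a + n\<close>, on the residue
  class where it is divisible by \<open>p\<close>.\<close>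

definition dquot :: "(nat \<Rightarrow> 'p K) \<Rightarrow> nat set \<Rightarrow> (nat \<Rightarrow> 'p K) \<Rightarrow> 'p K \<Rightarrow> (nat \<Rightarrow> 'p K) \<Rightarrow> bool" where
  "dquot pos I E lam e \<longleftrightarrow> (\<forall>n\<in>I. e n \<in> W \<and> E n = 1 + pos n * e n \<and> (\<forall>s. pos n \<in> pW s \<longrightarrow> wcong s (e n) lam)
     \<and> (\<forall>m\<in>I. \<forall>s. wcong s (pos n) (pos m) \<longrightarrow> wcong s (e n) (e m)))"

text \<open>It is enough to find, for each \<open>N\<close>, functions \<open>r\<close> that have these properties up to precision
  \<open>p\<^sup>N\<close>. The approximation of \<open>E\<close> to precision \<open>p\<^bsup>M+v\<^esup>\<close> determines the quotient by \<open>pos n\<close>, of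
  valuation \<open>v\<close>, to precision \<open>p\<^sup>M\<close>.\<close>

lemma dquot_limit:
  assumes pos: "\<And>n. n \<in> I \<Longrightarrow> pos n \<in> W" and lam: "lam \<in> W"
    and appr: "\<And>N. \<exists>r. (\<forall>n\<in>I. r (pos n) \<in> W \<and> wcong N (E n) (1 + pos n * r (pos n))) \<and> wcong N (r 0) lam \<and>
       (\<forall>y\<in>insert 0 (pos ` I). \<forall>y'\<in>insert 0 (pos ` I). \<forall>s\<le>N. wcong s y y' \<longrightarrow> wcong s (r y) (r y'))"
  shows "\<exists>e. dquot pos I E lam e"
proof -
  \<comment> \<open>\<open>pos n = 0\<close> does occur, for \<open>n = 0\<close> on the logarithmic side\<close>
  define e where "e n = (if pos n = 0 then lam else (E n - 1) / pos n)" for n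
  have "\<forall>N. \<exists>r. (\<forall>n\<in>I. r (pos n) \<in> W \<and> wcong N (E n) (1 + pos n * r (pos n))) \<and> wcong N (r 0) lam \<and>
       (\<forall>y\<in>insert 0 (pos ` I). \<forall>y'\<in>insert 0 (pos ` I). \<forall>s\<le>N. wcong s y y' \<longrightarrow> wcong s (r y) (r y'))"
    using appr by blast
  then obtain r where r: "\<And>N n. n \<in> I \<Longrightarrow> r N (pos n) \<in> W" "\<And>N n. n \<in> I \<Longrightarrow> wcong N (E n) (1 + pos n * r N (pos n))"
    "\<And>N. wcong N (r N 0) lam"
    "\<And>N y y' s. y \<in> insert 0 (pos ` I) \<Longrightarrow> y' \<in> insert 0 (pos ` I) \<Longrightarrow> s \<le> N \<Longrightarrow> wcong s y y' \<Longrightarrow> wcong s (r N y) (r N y')"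
    by metis
  have near: "\<exists>v. \<forall>N M. M + v \<le> N \<longrightarrow> wcong M (e n) (r N (pos n))" if n: "n \<in> I" for n
  proof (cases "pos n = 0")
    case True
    have "wcong M (e n) (r N (pos n))" if "M + 0 \<le> N" for N M
    proof -
      have "wcong M (r N 0) lam" by (rule wcong_mono[OF r(3)]) (use that in simp)
      then show ?thesis using True wcong_sym by (simp add: e_def)
    qed
    then show ?thesis by blast
  next
    case False
    obtain v u where vu: "pos n = pK ^ v * u" "Wunit u" by (rule W_unit_part[OF pos[OF n] False])
    have "wcong M (e n) (r N (pos n))" if "M + v \<le> N" for N M
    proof -
      have "wcong (v + M) (E n) (1 + pos n * r N (pos n))" by (rule wcong_mono[OF r(2)[OF n]]) (use that in simp)
      then have "E n - 1 - pos n * r N (pos n) \<in> pW (v + M)" by (simp add: wcong_def algebra_simps)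
      moreover have "E n - 1 = pos n * e n" using False by (simp add: e_def)
      ultimately have "pos n * (e n - r N (pos n)) \<in> pW (v + M)" by (simp add: right_diff_distrib)
      then have "pK ^ v * (u * (e n - r N (pos n))) \<in> pW (v + M)" unfolding vu(1) by (simp add: mult.assoc)
      then have "u * (e n - r N (pos n)) \<in> pW M" unfolding pW_scale .
      then show ?thesis unfolding wcong_def unit_mult_pW[OF vu(2)] .
    qed
    then show ?thesis by blast
  qed
  have "dquot pos I E lam e"
    unfolding dquot_def
  proof (intro ballI conjI allI impI)
    fix n assume n: "n \<in> I"
    obtain v where v: "\<And>N M. M + v \<le> N \<Longrightarrow> wcong M (e n) (r N (pos n))" using near[OF n] by blast
    show "e n \<in> W" using wcong_W[OF v[of 0 v] r(1)[OF n]] by simp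
    show "E n = 1 + pos n * e n"
    proof (cases "pos n = 0")
      case True
      have "E n - 1 \<in> pW N" for N using r(2)[OF n, of N] True by (simp add: wcong_def)
      then show ?thesis using pW_Inter[of "E n - 1"] True by simp
    qed (simp add: e_def)
    show "wcong s (e n) lam" if "pos n \<in> pW s" for s
    proof -
      have "wcong s (e n) (r (s + v) (pos n))" by (rule v) simp
      also have "wcong s (r (s + v) (pos n)) (r (s + v) 0)" by (rule r(4)) (use n that in auto)
      also have "wcong s (r (s + v) 0) lam" by (rule wcong_mono[OF r(3)]) simp
      finally show ?thesis .
    qed
    fix m s assume m: "m \<in> I" "wcong s (pos n) (pos m)"
    obtain v' where v': "\<And>N M. M + v' \<le> N \<Longrightarrow> wcong M (e m) (r N (pos m))" using near[OF m(1)] by blast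
    have "wcong s (e n) (r (s + v + v') (pos n))" by (rule v) simp
    also have "wcong s (r (s + v + v') (pos n)) (r (s + v + v') (pos m))" by (rule r(4)) (use n m in auto)
    also have "wcong s (r (s + v + v') (pos m)) (e m)" by (rule wcong_sym[OF v']) simp
    finally show "wcong s (e n) (e m)" .
  qed
  then show ?thesis by blast
qed

text \<open>The product of two functions \<open>1 + y g(y)\<close> and \<open>1 + y r(y)\<close> has difference quotient \<open>g + r + y g
  r\<close>.\<close>

lemma Rprod_dquot:
  "M \<ge> 1 \<Longrightarrow> \<exists>r. r 0 = 2 * hsum M \<and> (\<forall>y\<in>pW 1. r y \<in> W \<and> Rprod M y = 1 + (y :: 'p K) * r y \<and>
     (\<forall>y'\<in>pW 1. \<forall>s. wcong s y y' \<longrightarrow> wcong s (r y) (r y')))"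
proof (induction M rule: nat_induct_at_least)
  case base
  show ?case by (rule exI[of _ "\<lambda>_. 0"]) simp
next
  case (Suc M)
  then obtain r where r: "r 0 = 2 * hsum M" "\<And>y. y \<in> pW 1 \<Longrightarrow> r y \<in> W" "\<And>y. y \<in> pW 1 \<Longrightarrow> Rprod M y = 1 + (y :: 'p K) * r y"
     "\<And>y y' s. y \<in> pW 1 \<Longrightarrow> y' \<in> pW 1 \<Longrightarrow> wcong s y y' \<Longrightarrow> wcong s (r y) (r y')" by blast
  show ?case
  proof (cases "CARD('p) dvd M")
    case True
    then show ?thesis using r Suc.hyps by (intro exI[of _ r]) (simp add: Rprod_Suc hsum_Suc)
  next
    case False
    let ?M = "of_nat M :: 'p K"
    have uM: "Wunit ?M" using False by (simp add: Wunit_of_nat)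
    define g where "g y = (2 / ?M) / (1 - y / ?M)" for y
    have gW: "g y \<in> W" if "y \<in> pW 1" for y
      unfolding g_def by (intro W_divide one_pm_unit(2)[OF that False] uM) simp
    have gc: "wcong s (g y) (g y')" if "y \<in> pW 1" "y' \<in> pW 1" "wcong s y y'" for y y' s
      unfolding g_def using that uM
      by (intro wcong_divide wcong_diff wcong_refl one_pm_unit(2) False W_divide pW_imp_W[of y 1]) auto
    have geq: "(1 + y / ?M) / (1 - y / ?M) = 1 + y * g y" if "y \<in> pW 1" for y
      using Wunit_nz[OF one_pm_unit(2)[OF that False]] Wunit_nz[OF uM] by (simp add: g_def field_simps)
    show ?thesis
    proof (intro exI[of _ "\<lambda>y. g y + r y + y * (g y * r y)"] conjI ballI allI impI)
      show "g 0 + r 0 + 0 * (g 0 * r 0) = 2 * hsum (Suc M)"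
        using Suc.hyps False by (simp add: g_def r(1) hsum_Suc algebra_simps)
      fix y :: "'p K" assume y: "y \<in> pW 1"
      show "g y + r y + y * (g y * r y) \<in> W" using gW[OF y] r(2)[OF y] pW_imp_W[OF y] by auto
      show "Rprod (Suc M) y = 1 + y * (g y + r y + y * (g y * r y))"
        using Suc.hyps False by (simp add: Rprod_Suc geq[OF y] r(3)[OF y] algebra_simps)
      fix y' s assume y': "y' \<in> pW 1" "wcong s y y'"
      show "wcong s (g y + r y + y * (g y * r y)) (g y' + r y' + y' * (g y' * r y'))"
        by (intro wcong_add wcong_mult gc r(4) y y' gW r(2) pW_imp_W[OF y] W_mult)
    qed
  qed
qed

text \<open>The difference quotient of the product for \<open>M\<close> has twice the sum of the \<open>1/k\<close> as its value at \<open>0\<close>,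
  and this approximates the digamma value if \<open>M\<close> approximates \<open>a\<close>.\<close>

lemma dquot_Rprod:
  assumes a: "(a :: 'p K) \<in> Zp" and pos: "\<And>n. n \<in> I \<Longrightarrow> pos n \<in> pW 1"
    and E: "\<And>n N M. n \<in> I \<Longrightarrow> N \<ge> 1 \<Longrightarrow> M \<ge> 1 \<Longrightarrow> wcong N a (of_nat M) \<Longrightarrow> wcong N (E n) (Rprod M (pos n))"
  shows "\<exists>e. dquot pos I E (2 * psi_tilde a) e"
proof (rule dquot_limit)
  show "pos n \<in> W" if "n \<in> I" for n using pos[OF that] pW_imp_W by blast
  show "2 * psi_tilde a \<in> W" using psi_tilde_props(1)[OF p3 a] by auto
  fix N
  obtain M where M: "M > 0" "wcong (Suc N) a (of_nat M)" by (rule Zp_approx[OF a])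
  have M1: "M \<ge> 1" using M(1) by simp
  obtain r where r: "r 0 = 2 * hsum M" "\<And>y. y \<in> pW 1 \<Longrightarrow> r y \<in> W" "\<And>y. y \<in> pW 1 \<Longrightarrow> Rprod M y = 1 + (y :: 'p K) * r y"
     "\<And>y y' s. y \<in> pW 1 \<Longrightarrow> y' \<in> pW 1 \<Longrightarrow> wcong s y y' \<Longrightarrow> wcong s (r y) (r y')"
    using Rprod_dquot[OF M1] by blast
  have "wcong (Suc N) (psi_tilde a) (hsum M)" by (rule psi_tilde_props(2)[OF p3 a M])
  then have "wcong N (psi_tilde a) (hsum M)" by (rule wcong_mono) simp
  then have r0: "wcong N (r 0) (2 * psi_tilde a)" unfolding r(1) using hsum_W
    by (intro wcong_mult wcong_refl wcong_sym[of N "psi_tilde a"]) auto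
  have E': "wcong N (E n) (1 + pos n * r (pos n))" if "n \<in> I" for n
    unfolding r(3)[OF pos[OF that], symmetric] by (rule wcong_mono[OF E[OF that _ _ M(2)]]) (use M(1) in auto)
  have ins: "y \<in> pW 1" if "y \<in> insert 0 (pos ` I)" for y using that pos by auto
  show "\<exists>r. (\<forall>n\<in>I. r (pos n) \<in> W \<and> wcong N (E n) (1 + pos n * r (pos n))) \<and> wcong N (r 0) (2 * psi_tilde a) \<and>
       (\<forall>y\<in>insert 0 (pos ` I). \<forall>y'\<in>insert 0 (pos ` I). \<forall>s\<le>N. wcong s y y' \<longrightarrow> wcong s (r y) (r y'))"
  proof (intro exI[of _ r] conjI ballI allI impI)
    show "r (pos n) \<in> W" if "n \<in> I" for n by (rule r(2)[OF pos[OF that]])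
  qed (use E' r0 r(4)[OF ins ins] in blast)+
qed

text \<open>Here \<open>c\<^sup>M = 1 + p M \<tau>(M)\<close> with \<open>\<tau>\<close> Lipschitz, and \<open>p M\<close> approximates \<open>pos n\<close>.\<close>

lemma dquot_power:
  assumes c: "(c :: 'p K) - 1 \<in> pW 1" and pos: "\<And>n. n \<in> I \<Longrightarrow> pos n = pK * z n" "\<And>n. n \<in> I \<Longrightarrow> z n \<in> Zp"
    and E: "\<And>n N M. n \<in> I \<Longrightarrow> M > 0 \<Longrightarrow> wcong N (z n) (of_nat M) \<Longrightarrow> wcong N (E n) (c ^ M)"
  shows "\<exists>e. dquot pos I E (plog c) e"
proof (rule dquot_limit)
  show "pos n \<in> W" if "n \<in> I" for n using pos(1)[OF that] Zp_W[OF pos(2)[OF that]] by auto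
  show "plog c \<in> W" by (rule plog_props(1)[OF p3 c])
  fix N
  have "\<exists>M. M > 0 \<and> wcong N (y / pK) (of_nat M)" if "y / pK \<in> (Zp :: 'p K set)" for y
    by (rule Zp_approx[OF that, of 0 N]) auto
  then obtain M where M: "\<And>y. y / pK \<in> (Zp :: 'p K set) \<Longrightarrow> M y > 0" "\<And>y. y / pK \<in> (Zp :: 'p K set) \<Longrightarrow> wcong N (y / pK) (of_nat (M y))"
    by metis
  have Z: "y / pK \<in> (Zp :: 'p K set)" if "y \<in> insert 0 (pos ` I)" for y using that pos by auto
  let ?r = "\<lambda>y. tau c (M y)"
  have W: "?r y \<in> W" if "y \<in> insert 0 (pos ` I)" for y by (rule tau_W[OF p3 c M(1)[OF Z[OF that]]])
  have "wcong N (E n) (1 + pos n * ?r (pos n))" if n: "n \<in> I" for n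
  proof -
    have y: "pos n \<in> insert 0 (pos ` I)" using n by blast
    have "z n = pos n / pK" using pos(1)[OF n] by simp
    then have zM: "wcong N (z n) (of_nat (M (pos n)))" using M(2)[OF Z[OF y]] by simp
    have "wcong N (E n) (c ^ M (pos n))" by (rule E[OF n M(1)[OF Z[OF y]] zM])
    also have "c ^ M (pos n) = 1 + pK * of_nat (M (pos n)) * ?r (pos n)" by (rule tau_eq[OF p3 M(1)[OF Z[OF y]]])
    also have "wcong N \<dots> (1 + pos n * ?r (pos n))"
      unfolding pos(1)[OF n] using zM Zp_W[OF pos(2)[OF n]] W[OF y] unfolding pos(1)[OF n]
      by (intro wcong_add wcong_refl wcong_mult wcong_sym[of N "z n"] W_mult W_of_nat) auto
    finally show ?thesis .
  qed
  moreover have "wcong N (?r 0) (plog c)"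
  proof -
    have "wcong N (of_nat 0 :: 'p K) (of_nat (M 0))" using M(2)[of 0] by simp
    then have "[0 = M 0] (mod CARD('p) ^ N)" unfolding wcong_of_nat .
    then have "CARD('p) ^ N dvd M 0" by (simp add: cong_0_iff cong_sym_eq[of 0])
    then have "wcong (Suc N) (plog c) (?r 0)" by (intro plog_props(2)[OF p3 c] M(1)) auto
    then have "wcong N (plog c) (?r 0)" by (rule wcong_mono) simp
    then show ?thesis by (rule wcong_sym)
  qed
  moreover have "wcong s (?r y) (?r y')" if yy: "y \<in> insert 0 (pos ` I)" "y' \<in> insert 0 (pos ` I)" "s \<le> N" "wcong s y y'" for y y' s
  proof (cases s)
    case 0
    then show ?thesis using W[OF yy(1)] W[OF yy(2)] by (simp add: wcong_def)
  next
    case (Suc t)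
    have "wcong (Suc t) (pK * (y / pK)) (pK * (y' / pK))" using yy(4) Suc by simp
    then have 1: "wcong t (y / pK) (y' / pK)" unfolding wcong_pK_cancel .
    have t: "t \<le> N" using yy(3) Suc by simp
    have "wcong t (of_nat (M y)) (y / pK)" by (rule wcong_sym[OF wcong_mono[OF M(2)[OF Z[OF yy(1)]] t]])
    also note 1
    also have "wcong t (y' / pK) (of_nat (M y'))" by (rule wcong_mono[OF M(2)[OF Z[OF yy(2)]] t])
    finally have "[M y = M y'] (mod CARD('p) ^ t)" unfolding wcong_of_nat .
    then show ?thesis unfolding Suc by (intro tau_cong[OF p3 c] M(1) Z yy)
  qed
  ultimately show "\<exists>r. (\<forall>n\<in>I. r (pos n) \<in> W \<and> wcong N (E n) (1 + pos n * r (pos n))) \<and> wcong N (r 0) (plog c) \<and>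
       (\<forall>y\<in>insert 0 (pos ` I). \<forall>y'\<in>insert 0 (pos ` I). \<forall>s\<le>N. wcong s y y' \<longrightarrow> wcong s (r y) (r y'))"
    using W by (intro exI[of _ ?r]) blast
qed

text \<open>The positive exponents are compared first; adding \<open>p\<^sup>N\<close> to both exponents covers the exponent \<open>0\<close>.\<close>

lemma power_cong:
  assumes c: "(c :: 'p K) - 1 \<in> pW 1" and mn: "[m = n] (mod CARD('p) ^ N)" shows "wcong N (c ^ m) (c ^ n)"
proof -
  have cW: "c \<in> W" by (rule Wunit_W[OF one_unit_Wunit[OF c]])
  have per: "wcong N (c ^ (n + CARD('p) ^ N)) (c ^ n)" for n
  proof -
    have "wcong (Suc N) (c ^ (CARD('p) ^ N)) 1" by (rule power_near_one[OF p3 c]) simp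
    then have "wcong N (c ^ (CARD('p) ^ N)) 1" by (rule wcong_mono) simp
    then have "wcong N (c ^ n * c ^ (CARD('p) ^ N)) (c ^ n * 1)" using cW by (intro wcong_mult wcong_refl) auto
    then show ?thesis by (simp add: power_add)
  qed
  have pos: "wcong N (c ^ m) (c ^ n)" if "0 < m" "0 < n" "[m = n] (mod CARD('p) ^ N)" for m n
    by (rule periodic_cong[where g = "\<lambda>n. c ^ n", OF per that])
  have "[m + CARD('p) ^ N = n + CARD('p) ^ N] (mod CARD('p) ^ N)" using mn by (intro cong_add cong_refl)
  then have "wcong N (c ^ (m + CARD('p) ^ N)) (c ^ (n + CARD('p) ^ N))" by (intro pos) auto
  then show ?thesis using wcong_trans[OF wcong_trans[OF wcong_sym[OF per]]] per by blast
qed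

lemma padic_powr_props:
  assumes c: "(c :: 'p K) - 1 \<in> pW 1" and z: "z \<in> Zp"
  shows "padic_powr c z \<in> W" "\<And>N m. 0 < m \<Longrightarrow> wcong N z (of_nat m) \<Longrightarrow> wcong N (padic_powr c z) (c ^ m)"
proof -
  have cW: "c \<in> W" by (rule Wunit_W[OF one_unit_Wunit[OF c]])
  have cc: "wcong N (c ^ m) (c ^ n)" if "[m = n] (mod CARD('p) ^ N)" for N m n by (rule power_cong[OF c that])
  show "padic_powr c z \<in> W" unfolding padic_powr_def by (rule padic_limD(1)[OF z]) (use cW cc in auto)
  show "\<And>N m. 0 < m \<Longrightarrow> wcong N z (of_nat m) \<Longrightarrow> wcong N (padic_powr c z) (c ^ m)"
    unfolding padic_powr_def by (rule padic_limD(2)[OF z]) (use cW cc in auto)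
qed

end

section \<open>The hypergeometric coefficients in blocks of length p\<close>

definition hyp_coeff :: "'p::prime_card K \<Rightarrow> 'p K \<Rightarrow> 'p K \<Rightarrow> nat \<Rightarrow> 'p K" where
  "hyp_coeff \<alpha> \<beta> \<gamma> n = pochhammer \<alpha> n * pochhammer \<beta> n / (pochhammer 1 n * pochhammer \<gamma> n)"

lemma hyp_eq: "hyp \<alpha> \<beta> \<gamma> = Abs_fps (hyp_coeff \<alpha> \<beta> \<gamma>)"
  unfolding hyp_def hyp_coeff_def ..

lemma hyp_coeff_0 [simp]: "hyp_coeff \<alpha> \<beta> \<gamma> 0 = 1"
  by (simp add: hyp_coeff_def)

text \<open>The factor \<open>p (\<alpha>' + m)\<close> that is divisible by \<open>p\<close> occurs within the last, incomplete block exactly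
  if \<open>l\<^sub>\<alpha> < k\<close>.\<close>

definition carry :: "'p::prime_card K \<Rightarrow> nat \<Rightarrow> nat \<Rightarrow> 'p K" where
  "carry \<alpha> k m = (if dwork_l \<alpha> < k then pK * (dwork \<alpha> + of_nat m) else 1)"

lemma pochhammer_carry:
  assumes "(\<alpha> :: 'p::prime_card K) \<in> Zp" "k < CARD('p)"
  shows "pochhammer \<alpha> (k + CARD('p) * m) = pK ^ m * pochhammer (dwork \<alpha>) m * upoch \<alpha> (k + CARD('p) * m) * carry \<alpha> k m"
  unfolding pochhammer_block[OF assms] carry_def by (simp add: pochhammer_Suc mult_ac)

lemma carry_one: "k < CARD('p) \<Longrightarrow> carry (1 :: 'p::prime_card K) k m = 1"
  by (simp add: carry_def dwork_one)

lemma hyp_coeff_block: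
  assumes Z: "\<alpha> \<in> Zp" "\<beta> \<in> Zp" "\<gamma> \<in> Zp" and k: "k < CARD('p::prime_card)"
  shows "hyp_coeff \<alpha> \<beta> \<gamma> (k + CARD('p) * m) = carry \<alpha> k m * carry \<beta> k m / carry \<gamma> k m
     * (rho \<alpha> (k + CARD('p) * m) * rho \<beta> (k + CARD('p) * m) / rho \<gamma> (k + CARD('p) * m))
     * hyp_coeff (dwork \<alpha>) (dwork \<beta>) (dwork \<gamma> :: 'p K) m"
proof -
  let ?n = "k + CARD('p) * m"
  have o: "upoch 1 ?n \<noteq> (0 :: 'p K)" by (rule Wunit_nz[OF Wunit_upoch]) simp
  have *: "(q * A * uA * cA) * (q * B * uB * cB) / ((q * C * uC * 1) * (q * D * uD * cD)) =
    cA * cB / cD * ((uA / uC) * (uB / uC) / (uD / uC)) * (A * B / (C * D))"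
    if "q \<noteq> 0" "uC \<noteq> 0" for q A uA cA B uB cB C uC D uD cD :: "'p K"
    using that by (cases "C = 0 \<or> D = 0 \<or> uD = 0 \<or> cD = 0") (auto simp: field_simps)
  show ?thesis
    unfolding hyp_coeff_def pochhammer_carry[OF Z(1) k] pochhammer_carry[OF Z(2) k] pochhammer_carry[OF Z(3) k]
      pochhammer_carry[OF Zp_1 k] carry_one[OF k] rho_def dwork_one
    by (rule *) (simp, rule o)
qed

lemma wlip_mult: assumes f: "wlip f" and g: "wlip g" shows "wlip (\<lambda>n. f n * g n)"
  by (rule wlipI) (auto intro!: wcong_mult wlipD[OF f] wlipD[OF g])

lemma wlip_divide:
  assumes f: "wlip f" and g: "wlip g" "\<And>n. Wunit (g n)" shows "wlip (\<lambda>n. f n / g n)"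
  by (rule wlipI) (auto intro!: wcong_divide wlipD[OF f] wlipD[OF g(1)] g(2))

lemma wlip_rho_quotient:
  assumes Z: "\<alpha> \<in> Zp" "\<beta> \<in> Zp" "\<gamma> \<in> Zp" shows "wlip (\<lambda>n. rho \<alpha> n * rho \<beta> n / rho \<gamma> n)"
  by (intro wlip_divide wlip_mult wlip_rho Z Wunit_rho Zp_W)

lemma wlip_gain_carry:
  assumes Z: "(\<alpha> :: 'p::prime_card K) \<in> Zp" shows "wlip_gain (carry \<alpha> k)"
  unfolding wlip_gain_def
proof (intro conjI allI impI)
  have W: "dwork \<alpha> \<in> W" by (rule Zp_W[OF dwork_Zp[OF Z]])
  then show "carry \<alpha> k m \<in> W" for m by (auto simp: carry_def)
  fix s m n assume "[m = n] (mod CARD('p) ^ s)"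
  then have "wcong s (of_nat m :: 'p K) (of_nat n)" unfolding wcong_of_nat .
  then have "wcong (Suc s) (pK * (dwork \<alpha> + of_nat m)) (pK * (dwork \<alpha> + of_nat n))"
    by (intro wcong_pK_mult wcong_add wcong_refl)
  then show "wcong (Suc s) (carry \<alpha> k m) (carry \<alpha> k n)" by (auto simp: carry_def)
qed

lemma carry_pW1:
  assumes Z: "(\<alpha> :: 'p::prime_card K) \<in> Zp" and "dwork_l \<alpha> < k" shows "carry \<alpha> k m \<in> pW 1"
  using assms Zp_W[OF dwork_Zp[OF Z]] by (auto simp: carry_def intro!: pW_mult_W)

text \<open>Induction on \<open>n\<close>, with \<open>i\<close> arbitrary: both recursions refer to smaller indices. In the second one
  this needs \<open>k \<ge> 2\<close>, as the new index is \<open>m + 1\<close>.\<close>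

lemma tower_integral:
  fixes A :: "nat \<Rightarrow> nat \<Rightarrow> 'p::prime_card K"
  assumes A0: "\<And>i. A i 0 = 1"
    and step: "\<And>i k. k < CARD('p) \<Longrightarrow>
       (\<exists>u. wlip_gain u \<and> (\<forall>m. A i (k + CARD('p) * m) = u m * A (Suc i) m)) \<or>
       (k \<ge> 2 \<and> (\<exists>w. wlip w \<and> (\<forall>m. A i (k + CARD('p) * m) = pK * of_nat (Suc m) * w m * A (Suc i) (Suc m))))"
  shows "A i n \<in> W"
proof (induction n arbitrary: i rule: less_induct)
  case (less n)
  let ?p = "CARD('p)" and ?k = "n mod CARD('p)" and ?m = "n div CARD('p)"
  have p2: "?p \<ge> 2" using prime_ge_2_nat[OF prime_card[where 'a='p]] .
  have n: "n = ?k + ?p * ?m" by simp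
  show ?case
  proof (cases "n = 0")
    case False
    have lt: "?k < ?p" by simp
    from step[OF this, of i] show ?thesis
    proof (elim disjE conjE exE)
      fix u assume u: "wlip_gain u" "\<forall>m. A i (?k + ?p * m) = u m * A (Suc i) m"
      have "A i n = u ?m * A (Suc i) ?m" using u(2)[rule_format, of ?m] by simp
      moreover have "?m < n" using False p2 by simp
      ultimately show ?thesis using less wlip_gainD(1)[OF u(1)] by auto
    next
      fix w assume k: "?k \<ge> 2" and w: "wlip w" "\<forall>m. A i (?k + ?p * m) = pK * of_nat (Suc m) * w m * A (Suc i) (Suc m)"
      have "A i n = pK * of_nat (Suc ?m) * w ?m * A (Suc i) (Suc ?m)" using w(2)[rule_format, of ?m] by (simp del: of_nat_Suc)
      moreover have "Suc ?m < n"
      proof -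
        have "?m \<le> ?p * ?m" using p2 by simp
        then show ?thesis using n k by linarith
      qed
      moreover have "pK * of_nat (Suc ?m) * w ?m \<in> W" using wlipD(1)[OF w(1)] by (intro W_mult W_of_nat)
      ultimately show ?thesis using less by (metis W_mult)
    qed
  qed (simp add: A0)
qed

lemma hyp_coeff_step_one:
  assumes b: "(b :: 'p::prime_card K) \<in> Zp" and k: "k < CARD('p)"
  shows "\<exists>u. wlip_gain u \<and> (\<forall>m. hyp_coeff b (1 - b) 1 (k + CARD('p) * m) = u m * hyp_coeff (dwork b) (1 - dwork b) 1 m)"
proof -
  have b1: "1 - b \<in> Zp" using b by (intro Zp_diff) auto
  let ?r = "\<lambda>n. rho b n * rho (1 - b) n / rho 1 n"
  have "wlip_gain (\<lambda>m. carry b k m * carry (1 - b) k m * ?r (k + CARD('p) * m))"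
    by (intro wlip_gain_mult wlip_gain_carry b b1 wlip_block_gain wlip_rho_quotient Zp_1)
  moreover have "hyp_coeff b (1 - b) 1 (k + CARD('p) * m)
     = (carry b k m * carry (1 - b) k m * ?r (k + CARD('p) * m)) * hyp_coeff (dwork b) (1 - dwork b) 1 m" for m
    unfolding hyp_coeff_block[OF b b1 Zp_1 k] by (simp add: carry_one[OF k] dwork_one dwork_one_minus(2)[OF b])
  ultimately show ?thesis by blast
qed

lemma hyp_coeff_Suc:
  "hyp_coeff \<alpha> \<beta> \<gamma> (Suc n) = hyp_coeff \<alpha> \<beta> \<gamma> n * ((\<alpha> + of_nat n) * (\<beta> + of_nat n) / (of_nat (Suc n) * (\<gamma> + of_nat n)))"
  unfolding hyp_coeff_def by (simp add: pochhammer_Suc divide_inverse mult_ac)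

text \<open>With \<open>l = l\<^sub>b\<close> and no carry in doubling, \<open>l\<^bsub>2b\<^esub> = 2 l\<close>. For \<open>k > 2 l\<close> the denominator carries as
  well, so that a single \<open>p\<close> is left; the remaining factor \<open>(b' + m)\<^sup>2 / (2 b' + m)\<close> leads to the
  coefficient at \<open>m + 1\<close>, up to \<open>m + 1\<close>.\<close>

lemma hyp_coeff_step_double:
  assumes b: "(b :: 'p::prime_card K) \<in> Zp" and k: "k < CARD('p)"
    and l: "0 < dwork_l b" "dwork_l (2 * b) = 2 * dwork_l b" and d: "dwork (2 * b) = 2 * dwork b"
    and nz: "\<And>j. 2 * dwork b + of_nat j \<noteq> 0"
  shows "(\<exists>u. wlip_gain u \<and> (\<forall>m. hyp_coeff b b (2 * b) (k + CARD('p) * m) = u m * hyp_coeff (dwork b) (dwork b) (2 * dwork b) m)) \<or>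
     (k \<ge> 2 \<and> (\<exists>w. wlip w \<and> (\<forall>m. hyp_coeff b b (2 * b) (k + CARD('p) * m)
        = pK * of_nat (Suc m) * w m * hyp_coeff (dwork b) (dwork b) (2 * dwork b) (Suc m))))"
proof -
  have b2: "2 * b \<in> Zp" unfolding mult_2 by (rule Zp_add[OF b b])
  let ?r = "\<lambda>n. rho b n * rho b n / rho (2 * b) n" and ?p = "CARD('p)"
  have rl: "wlip ?r" by (intro wlip_rho_quotient b b2)
  note block = hyp_coeff_block[OF b b b2 k, unfolded d]
  show ?thesis
  proof (cases "k \<le> 2 * dwork_l b")
    case True
    then have c2: "carry (2 * b) k m = 1" for m by (simp add: carry_def l(2))
    have "wlip_gain (\<lambda>m. carry b k m * carry b k m * ?r (k + ?p * m))"
      by (intro wlip_gain_mult wlip_gain_carry b wlip_block_gain rl)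
    moreover have "hyp_coeff b b (2 * b) (k + ?p * m)
       = (carry b k m * carry b k m * ?r (k + ?p * m)) * hyp_coeff (dwork b) (dwork b) (2 * dwork b) m" for m
      unfolding block c2 by simp
    ultimately show ?thesis by blast
  next
    case False
    have c: "carry b k m = pK * (dwork b + of_nat m)" "carry (2 * b) k m = pK * (2 * dwork b + of_nat m)" for m
      using False by (simp_all add: carry_def l(2) d)
    have *: "(q * x) * (q * x) / (q * y) * R * h = q * s * R * (h * (x * x / (s * y)))"
      if "q \<noteq> 0" "s \<noteq> 0" for q x y s R h :: "'p K"
      using that by (simp add: divide_inverse mult_ac)
    have s: "of_nat (Suc m) \<noteq> (0 :: 'p K)" for m unfolding of_nat_K_eq_0 by simp
    have "hyp_coeff b b (2 * b) (k + ?p * m)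
        = pK * of_nat (Suc m) * ?r (k + ?p * m) * hyp_coeff (dwork b) (dwork b) (2 * dwork b) (Suc m)" for m
      unfolding block c hyp_coeff_Suc by (rule *[OF pK_nz s])
    moreover have "wlip (\<lambda>m. ?r (k + ?p * m))"
    proof (rule wlipI)
      show "?r (k + ?p * n) \<in> W" for n by (rule wlipD(1)[OF rl])
      show "wcong s (?r (k + ?p * m)) (?r (k + ?p * n))" if "[m = n] (mod ?p ^ s)" for s m n
        by (rule wcong_mono[OF wlipD(2)[OF rl cong_block[OF that]]]) simp
    qed
    moreover have "k \<ge> 2" using False l(1) by simp
    ultimately show ?thesis by blast
  qed
qed

lemma hyp_coeff_one_small:
  assumes b: "(b :: 'p::prime_card K) \<in> Zp" and k: "dwork_l b < k" "k < CARD('p)"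
  shows "hyp_coeff b (1 - b) 1 k \<in> pW 1"
proof -
  have b1: "1 - b \<in> Zp" using b by (intro Zp_diff) auto
  have e: "hyp_coeff b (1 - b) 1 k = carry b k 0 * (carry (1 - b) k 0 * (rho b k * rho (1 - b) k / rho 1 k))"
    using hyp_coeff_block[OF b b1 Zp_1 k(2), of 0] by (simp add: carry_one[OF k(2)])
  show ?thesis unfolding e
    by (intro pW_mult_W carry_pW1[OF b k(1)] W_mult wlip_gainD(1)[OF wlip_gain_carry[OF b1]]
       wlipD(1)[OF wlip_rho_quotient[OF b b1 Zp_1]])
qed

text \<open>For \<open>l < k \<le> 2 l\<close> the numerator carries twice. For \<open>k > 2 l\<close> the denominator carries too, and what
  is left is \<open>p\<close> times the coefficient of index \<open>1\<close> of the next series, which is integral by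
  assumption.\<close>

lemma hyp_coeff_double_small:
  assumes b: "(b :: 'p::prime_card K) \<in> Zp" and k: "dwork_l b < k" "k < CARD('p)"
    and l: "0 < dwork_l b" "dwork_l (2 * b) = 2 * dwork_l b" and d: "dwork (2 * b) = 2 * dwork b"
    and nz: "2 * dwork b \<noteq> 0"
    and W: "hyp_coeff (dwork b) (dwork b) (2 * dwork b) (Suc 0) \<in> W"
  shows "hyp_coeff b b (2 * b) k \<in> pW 1"
proof -
  have b2: "2 * b \<in> Zp" unfolding mult_2 by (rule Zp_add[OF b b])
  note rW = wlipD(1)[OF wlip_rho_quotient[OF b b b2]]
  have bl: "hyp_coeff b b (2 * b) k = carry b k 0 * carry b k 0 / carry (2 * b) k 0 * (rho b k * rho b k / rho (2 * b) k)"
    using hyp_coeff_block[OF b b b2 k(2), of 0] by simp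
  show ?thesis
  proof (cases "k \<le> 2 * dwork_l b")
    case True
    then have c2: "carry (2 * b) k 0 = 1" by (simp add: carry_def l(2))
    have "hyp_coeff b b (2 * b) k = carry b k 0 * (carry b k 0 * (rho b k * rho b k / rho (2 * b) k))"
      unfolding bl c2 by (simp add: mult.assoc)
    then show ?thesis
      using pW_mult_W[OF carry_pW1[OF b k(1), of 0] W_mult[OF wlip_gainD(1)[OF wlip_gain_carry[OF b]] rW]] by simp
  next
    case False
    have c: "carry b k 0 = pK * dwork b" "carry (2 * b) k 0 = pK * (2 * dwork b)"
      using False by (simp_all add: carry_def l(2) d)
    have 1: "hyp_coeff (dwork b) (dwork b) (2 * dwork b) (Suc 0) = dwork b * dwork b / (2 * dwork b)"
      unfolding hyp_coeff_Suc by simp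
    have *: "(q * x) * (q * x) / (q * y) * R = q ^ 1 * ((x * x / y) * R)" if "q \<noteq> 0" for q x y R :: "'p K"
      using that by (simp add: divide_inverse mult_ac)
    have "hyp_coeff b b (2 * b) k = pK ^ 1 * (hyp_coeff (dwork b) (dwork b) (2 * dwork b) (Suc 0) * (rho b k * rho b k / rho (2 * b) k))"
      unfolding bl c 1 by (rule *[OF pK_nz])
    then show ?thesis by (rule pW_I[rotated]) (intro W_mult W rW)
  qed
qed

lemma hyp_coeff_double_unit:
  assumes b: "(b :: 'p::prime_card K) \<in> Zp" and k: "k \<le> dwork_l b" and l: "dwork_l (2 * b) = 2 * dwork_l b"
  shows "Wunit (hyp_coeff b b (2 * b) k)"
proof -
  have b2: "2 * b \<in> Zp" unfolding mult_2 by (rule Zp_add[OF b b])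
  have kp: "k < CARD('p)" using k dwork_l_props(1)[OF b] by simp
  have "hyp_coeff b b (2 * b) k = rho b k * rho b k / rho (2 * b) k"
    using hyp_coeff_block[OF b b b2 kp, of 0] k by (simp add: carry_def l)
  then show ?thesis using b b2 by (auto intro!: Wunit_divide Wunit_mult Wunit_rho Zp_W)
qed

text \<open>Induction on \<open>k\<close>, comparing the ratios of successive coefficients. As \<open>b \<equiv> -l\<close>, going from \<open>l - k\<close>
  down to \<open>j = l - k - 1\<close> multiplies the second family by \<open>(j + 1)(2 b + j)/(b + j)\<^sup>2 \<equiv> - (j + 1)(l
  + k + 1)/(k + 1)\<^sup>2\<close>. This is also the residue of the ratio \<open>(b + k)(1 - b + k)/(k + 1)\<^sup>2\<close> of the
  first family.\<close>

lemma hyp_coeff_reversal: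
  assumes b: "(b :: 'p::prime_card K) \<in> Zp" and l: "dwork_l (2 * b) = 2 * dwork_l b"
    and nz: "\<And>j. 2 * b + of_nat j \<noteq> 0" and W: "\<And>k. hyp_coeff b (1 - b) 1 k \<in> W"
    and k: "k \<le> dwork_l b"
  shows "wcong 1 (hyp_coeff b b (2 * b) (dwork_l b - k)) (hyp_coeff b b (2 * b) (dwork_l b) * hyp_coeff b (1 - b) 1 k)"
  using k
proof (induction k)
  case (Suc k)
  let ?l = "dwork_l b"
  let ?A = "hyp_coeff b (1 - b) 1" and ?B = "hyp_coeff b b (2 * b)"
  define j where "j = ?l - Suc k"
  have lj: "?l = Suc k + j" "?l - k = Suc j" "?l - Suc k = j" using Suc.prems by (auto simp: j_def)
  have lp: "?l < CARD('p)" by (rule dwork_l_props(1)[OF b])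
  have bl: "wcong 1 b (- of_nat ?l)" using dwork_l_props(2)[OF b] by (simp add: wcong_def)
  have bW: "b \<in> W" by (rule Zp_W[OF b])
  have IH: "wcong 1 (?B (Suc j)) (?B ?l * ?A k)" using Suc lj by simp
  have k1: "Wunit (of_nat (Suc k) :: 'p K)" unfolding Wunit_of_nat
    using lj(1) lp by (metis Suc_neq_Zero add_leE dvd_imp_le le_imp_less_Suc less_le_trans nat_less_le not_less zero_less_Suc)
  have bj: "wcong 1 (b + of_nat j) (- of_nat (Suc k))"
  proof -
    have "wcong 1 (b + of_nat j) (- of_nat ?l + of_nat j)" by (intro wcong_add bl wcong_refl)
    then show ?thesis unfolding lj(1) by (simp add: algebra_simps)
  qed
  have ubj: "Wunit (b + of_nat j)" by (rule Wunit_cong[OF wcong_sym[OF bj]]) (use k1 in \<open>simp_all del: of_nat_Suc\<close>)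
  have B: "?B j = ?B (Suc j) * (of_nat (Suc j) * (2 * b + of_nat j) / (b + of_nat j) ^ 2)"
    unfolding hyp_coeff_Suc using Wunit_nz[OF ubj] nz[of j] of_nat_K_eq_0[of "Suc j", where 'p='p]
    by (simp add: power2_eq_square del: of_nat_Suc)
  have A: "?A (Suc k) = ?A k * ((b + of_nat k) * (1 - b + of_nat k) / of_nat (Suc k) ^ 2)"
    unfolding hyp_coeff_Suc by (simp add: power2_eq_square)
  let ?x = "- of_nat (Suc j) * (of_nat ?l + of_nat (Suc k)) :: 'p K"
  have n1: "wcong 1 (of_nat (Suc j) * (2 * b + of_nat j)) ?x"
  proof -
    have "wcong 1 (of_nat (Suc j) * (b + (b + of_nat j))) (of_nat (Suc j) * (- of_nat ?l + - of_nat (Suc k)))"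
      by (intro wcong_mult wcong_refl wcong_add bl bj W_add bW W_of_nat)
    then show ?thesis by (simp add: algebra_simps)
  qed
  have n2: "wcong 1 ((b + of_nat k) * (1 - b + of_nat k)) ?x"
  proof -
    have "wcong 1 ((b + of_nat k) * (1 - b + of_nat k)) ((- of_nat ?l + of_nat k) * (1 - - of_nat ?l + of_nat k))"
      by (intro wcong_mult wcong_refl wcong_add wcong_diff bl W_add W_diff bW W_of_nat W_1)
    also have "(- of_nat ?l + of_nat k) * (1 - - of_nat ?l + of_nat k) = ?x" unfolding lj(1) by (simp add: algebra_simps)
    finally show ?thesis .
  qed
  have d: "wcong 1 ((b + of_nat j) ^ 2) (of_nat (Suc k) ^ 2)"
    using wcong_power[OF bj W_add[OF bW W_of_nat], of 2] by (simp del: of_nat_Suc)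
  have "wcong 1 (?B (Suc j) * (of_nat (Suc j) * (2 * b + of_nat j) / (b + of_nat j) ^ 2))
     ((?B ?l * ?A k) * (?x / of_nat (Suc k) ^ 2))"
  proof (rule wcong_mult[OF IH wcong_divide[OF n1 d]])
    show "?B (Suc j) \<in> W" by (rule Wunit_W[OF hyp_coeff_double_unit[OF b _ l]]) (use lj(1) in simp)
    show w: "of_nat (Suc j) * (2 * b + of_nat j) \<in> W" unfolding mult_2 by (intro W_mult W_add bW W_of_nat)
    show "of_nat (Suc j) * (2 * b + of_nat j) / (b + of_nat j)\<^sup>2 \<in> W" by (intro W_divide w Wunit_power ubj)
  qed (intro Wunit_power ubj k1)+
  also have "wcong 1 ((?B ?l * ?A k) * (?x / of_nat (Suc k) ^ 2)) ((?B ?l * ?A k) * ((b + of_nat k) * (1 - b + of_nat k) / of_nat (Suc k) ^ 2))"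
  proof (rule wcong_mult[OF wcong_refl wcong_divide[OF wcong_sym[OF n2] wcong_refl]])
    have xW: "?x \<in> W" by (intro W_mult W_add W_neg W_of_nat)
    then show "?x \<in> W" .
    show "?x / (of_nat (Suc k))\<^sup>2 \<in> W" by (intro W_divide xW Wunit_power k1)
    show "?B ?l * ?A k \<in> W" by (intro W_mult W Wunit_W[OF hyp_coeff_double_unit[OF b _ l]]) simp
  qed (intro Wunit_power k1)+
  finally show ?case unfolding lj(3) B A by (simp add: mult.assoc)
qed simp

section \<open>Elements fixed by the p-th power map modulo p\<close>

text \<open>The elements of \<open>W\<close> whose residue lies in the field with \<open>p\<close> elements.\<close>

definition pfixed :: "'p::prime_card K set" where
  "pfixed = {x \<in> W. wcong 1 (x ^ CARD('p)) x}"

lemma subring_W: "subring_set (W :: 'p::prime_card K set)"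
  by (auto simp: subring_set_def)

lemma pfixed_add: assumes "x \<in> pfixed" "y \<in> (pfixed :: 'p::prime_card K set)" shows "x + y \<in> pfixed"
proof -
  have xy: "x \<in> W" "y \<in> W" "wcong 1 (x ^ CARD('p)) x" "wcong 1 (y ^ CARD('p)) y" using assms by (auto simp: pfixed_def)
  have "pcong CARD('p) W 1 ((x + y) ^ CARD('p)) (x ^ CARD('p) + y ^ CARD('p))"
    by (rule freshman_subring[OF prime_card subring_W xy(1,2)])
  then have "wcong 1 ((x + y) ^ CARD('p)) (x ^ CARD('p) + y ^ CARD('p))"
    unfolding pcong_def wcong_def pW_iff by blast
  also have "wcong 1 (x ^ CARD('p) + y ^ CARD('p)) (x + y)" by (intro wcong_add xy)
  finally show ?thesis using xy by (auto simp: pfixed_def)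
qed

lemma pfixed_mult: assumes "x \<in> pfixed" "y \<in> (pfixed :: 'p::prime_card K set)" shows "x * y \<in> pfixed"
proof -
  have xy: "x \<in> W" "y \<in> W" "wcong 1 (x ^ CARD('p)) x" "wcong 1 (y ^ CARD('p)) y" using assms by (auto simp: pfixed_def)
  have "wcong 1 (x ^ CARD('p) * y ^ CARD('p)) (x * y)" by (intro wcong_mult xy W_power)
  then show ?thesis using xy by (auto simp: pfixed_def power_mult_distrib)
qed

lemma pfixed_pW1: assumes "x \<in> pW 1" shows "x \<in> (pfixed :: 'p::prime_card K set)"
proof -
  obtain q where q: "CARD('p) = Suc q" using not0_implies_Suc[of "CARD('p)"] by auto
  have xW: "x \<in> W" by (rule pW_imp_W[OF assms])
  have "x ^ CARD('p) \<in> pW 1" unfolding q power_Suc by (intro pW_mult_W assms W_power xW)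
  then show ?thesis using assms xW by (auto simp: pfixed_def wcong_def intro: pW_diff)
qed

lemma pfixed_Zp: assumes "x \<in> Zp" shows "x \<in> (pfixed :: 'p::prime_card K set)"
proof -
  obtain m where m: "wcong 1 x (of_int m)" using Zp_approx_int[OF assms] by blast
  have xW: "x \<in> W" by (rule Zp_W[OF assms])
  have "wcong 1 (of_int m :: 'p K) (of_int m ^ CARD('p))"
  proof -
    have "(of_int (m - m ^ CARD('p)) :: 'p K) \<in> pW 1"
      unfolding of_int_pW power_one_right by (rule int_fermat[OF prime_card])
    then show ?thesis by (simp add: wcong_def)
  qed
  then have "wcong 1 (of_int m ^ CARD('p) :: 'p K) (of_int m)" by (rule wcong_sym)
  also have "wcong 1 (of_int m) x" by (rule wcong_sym[OF m])
  finally have "wcong 1 (x ^ CARD('p)) x" using wcong_trans[OF wcong_power[OF m xW]] by blast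
  then show ?thesis using xW by (simp add: pfixed_def)
qed

lemma pfixed_divide:
  assumes "x \<in> pfixed" "y \<in> (pfixed :: 'p::prime_card K set)" "Wunit y" shows "x / y \<in> pfixed"
proof -
  have xy: "x \<in> W" "y \<in> W" "wcong 1 (x ^ CARD('p)) x" "wcong 1 (y ^ CARD('p)) y" using assms by (auto simp: pfixed_def)
  have "wcong 1 (x ^ CARD('p) / y ^ CARD('p)) (x / y)" by (intro wcong_divide xy W_power Wunit_power assms(3))
  then show ?thesis using xy assms(3) by (auto simp: pfixed_def power_divide)
qed

lemma pfixed_sum: "(\<And>i. i \<in> A \<Longrightarrow> f i \<in> pfixed) \<Longrightarrow> sum f A \<in> pfixed"
  by (induction A rule: infinite_finite_induct) (auto intro: pfixed_add pfixed_Zp)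

text \<open>Products of polynomials over the prime field: this yields the condition on \<open>h\<close> in a Dwork tower.\<close>

lemma pfixed_poly_prod:
  assumes "\<And>i j. i \<in> A \<Longrightarrow> coeff (T i) j \<in> pfixed" shows "coeff (\<Prod>i\<in>A. T i) j \<in> pfixed"
  using assms
proof (induction A arbitrary: j rule: infinite_finite_induct)
  case (insert x F)
  then have 1: "\<And>j. coeff (T x) j \<in> pfixed" "\<And>j. coeff (\<Prod>i\<in>F. T i) j \<in> pfixed" by auto
  show ?case using insert.hyps by (simp add: coeff_mult pfixed_sum pfixed_mult 1)
qed (auto simp: coeff_1 intro: pfixed_Zp)

lemma Zp_mult: assumes "x \<in> Zp" "y \<in> (Zp :: 'p::prime_card K set)" shows "x * y \<in> Zp"
proof (rule ZpI)
  show "x * y \<in> W" by (intro W_mult Zp_W assms)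
  fix n
  obtain k l where "wcong n x (of_int k)" "wcong n y (of_int l)"
    using Zp_approx_int[OF assms(1)] Zp_approx_int[OF assms(2)] by blast
  then have "wcong n (x * y) (of_int k * of_int l)" by (rule wcong_mult[OF _ _ Zp_W[OF assms(1)] Zp_W[OF assms(2)]])
  then have "wcong n (x * y) (of_int (k * l))" by simp
  then show "\<exists>m. wcong n (x * y) (of_int m)" by blast
qed

lemma Zp_pochhammer: assumes "\<alpha> \<in> (Zp :: 'p::prime_card K set)" shows "pochhammer \<alpha> n \<in> Zp"
proof (induction n)
  case (Suc n)
  show ?case unfolding pochhammer_Suc using assms by (intro Zp_mult Suc Zp_add) auto
qed simp

lemma Wunit_pochhammer:
  assumes Z: "\<alpha> \<in> (Zp :: 'p::prime_card K set)" and k: "k \<le> dwork_l \<alpha>" shows "Wunit (pochhammer \<alpha> k)"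
  unfolding pochhammer_prod
proof (intro Wunit_prod)
  fix i assume "i \<in> {0..<k}"
  then have "i < dwork_l \<alpha>" "i < CARD('p)" using k dwork_l_props(1)[OF Z] by auto
  then have "\<alpha> + of_nat i \<notin> pW 1" unfolding in_pW1_iff_dwork_l[OF Z] by simp
  then show "Wunit (\<alpha> + of_nat i)" using Zp_W[OF Z] by (auto simp: Wunit_def)
qed

text \<open>Numerator and denominator are in \<open>\<int>\<^sub>p\<close>, and for \<open>k \<le> l\<^sub>\<gamma>\<close> no factor of the denominator is
  divisible by \<open>p\<close>.\<close>

lemma hyp_coeff_pfixed:
  assumes Z: "\<alpha> \<in> Zp" "\<beta> \<in> Zp" "\<gamma> \<in> (Zp :: 'p::prime_card K set)" and k: "k < CARD('p)" "k \<le> dwork_l \<gamma>"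
  shows "hyp_coeff \<alpha> \<beta> \<gamma> k \<in> pfixed"
  unfolding hyp_coeff_def using k
  by (intro pfixed_divide pfixed_mult pfixed_Zp Zp_pochhammer Z Zp_1 Wunit_mult Wunit_pochhammer) (auto simp: dwork_one)

section \<open>Products of truncations\<close>

lemma prod_truncations:
  fixes T :: "nat \<Rightarrow> 'p::prime_card K poly"
  assumes W: "\<And>i. T i \<in> W_poly" and T0: "\<And>i. coeff (T i) 0 = 1" 
  shows "(\<Prod>i<r. T i) \<in> W_poly" "coeff (\<Prod>i<r. T i) 0 = 1"
proof -
  have "(\<Prod>i<r. T i) \<in> W_poly \<and> coeff (\<Prod>i<r. T i) 0 = 1"
    by (induction r) (auto simp: coeff_mult T0 W_poly_ring W)
  then show "(\<Prod>i<r. T i) \<in> W_poly" "coeff (\<Prod>i<r. T i) 0 = 1" by auto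
qed

lemma prod_cofactor:
  fixes T :: "nat \<Rightarrow> 'p::prime_card K poly"
  assumes W: "\<And>i. T i \<in> W_poly" and i: "i < r"
  obtains C where "C \<in> W_poly" "(\<Prod>i<r. T i) = T i * C"
proof (rule that)
  have all: "(\<Prod>j\<in>S. T j) \<in> W_poly" for S
    by (induction S rule: infinite_finite_induct) (auto simp: W W_poly_ring)
  show "(\<Prod>i<r. T i) = T i * (\<Prod>j\<in>{..<r} - {i}. T j)" using i by (intro prod.remove) auto
  show "(\<Prod>j\<in>{..<r} - {i}. T j) \<in> W_poly"
    by (rule all)
qed

lemma inverse_factor:
  fixes T C h :: "'p::prime_card K poly"
  assumes h: "h = T * C" and T0: "coeff T 0 = 1" and h0: "coeff h 0 = 1"
  shows "inverse (fps_of_poly T) = fps_of_poly C * inverse (fps_of_poly h)"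
proof -
  have T: "fps_of_poly T * inverse (fps_of_poly T) = 1"
    using inverse_mult_eq_1[of "fps_of_poly T"] T0 by (simp add: mult.commute)
  have hh: "fps_of_poly h * inverse (fps_of_poly h) = 1"
    using inverse_mult_eq_1[of "fps_of_poly h"] h0 by (simp add: mult.commute)
  have "inverse (fps_of_poly T) = inverse (fps_of_poly T) * (fps_of_poly h * inverse (fps_of_poly h))"
    unfolding hh by simp
  also have "\<dots> = (fps_of_poly T * inverse (fps_of_poly T)) * (fps_of_poly C * inverse (fps_of_poly h))"
    by (simp add: h fps_of_poly_mult mult_ac)
  finally show ?thesis unfolding T by simp
qed

section \<open>The two Dwork towers\<close>

text \<open>Both sides are governed by the Dwork primes of \<open>a\<close>. The condition on the digits says that doubling
  produces no carry, and the periodicity ensures that finitely many truncations suffice as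
  denominators.\<close>

locale dwork_setting =
  fixes a :: "'p::prime_card K" and r :: nat
  assumes p3: "CARD('p) \<ge> 3" and aZ: "a \<in> Zp" and dig: "\<forall>i. dwork_digit a i < dwork_digit (2 * a) i"
    and r0: "r > 0" and per: "(dwork ^^ r) a = a"
begin

abbreviation b :: "nat \<Rightarrow> 'p K" where "b i \<equiv> (dwork ^^ i) a"
abbreviation l :: "nat \<Rightarrow> nat" where "l i \<equiv> dwork_l (b i)"
abbreviation A :: "nat \<Rightarrow> nat \<Rightarrow> 'p K" where "A i \<equiv> hyp_coeff (b i) (1 - b i) 1"
abbreviation B :: "nat \<Rightarrow> nat \<Rightarrow> 'p K" where "B i \<equiv> hyp_coeff (b i) (b i) (2 * b i)"
abbreviation TA :: "nat \<Rightarrow> 'p K poly" where "TA i \<equiv> truncate_fps CARD('p) (Abs_fps (A i))"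
abbreviation TB :: "nat \<Rightarrow> 'p K poly" where "TB i \<equiv> truncate_fps CARD('p) (Abs_fps (B i))"

lemma bZ: "b i \<in> Zp" by (rule dwork_iter_Zp[OF aZ])
lemma b2Z: "2 * b i \<in> Zp" unfolding mult_2 by (rule Zp_add[OF bZ bZ])
lemma b1Z: "1 - b i \<in> Zp" by (intro Zp_diff bZ Zp_1)
lemma l_pos: "0 < l i" by (rule dwork_double(2)[OF aZ dig])
lemma l_small: "2 * l i < CARD('p)" by (rule dwork_double(3)[OF aZ dig])
lemma l_double: "dwork_l (2 * b i) = 2 * l i" by (rule dwork_double(4)[OF aZ dig])
lemma dwork_double_b: "dwork (2 * b i) = 2 * dwork (b i)"
  using dwork_double(1)[OF aZ dig, of i] dwork_double(1)[OF aZ dig, of "Suc i"] by simp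

lemma iter_double: "(dwork ^^ j) (2 * b i) = 2 * b (j + i)"
  by (induction j) (simp_all add: dwork_double_b[unfolded funpow.simps o_def])

text \<open>All digits of \<open>2 b\<^sub>i\<close> are positive.\<close>

lemma double_nz: "2 * b i + of_nat j \<noteq> 0"
  by (rule not_nonpos_int[OF b2Z]) (use l_pos in \<open>simp add: iter_double l_double\<close>)

lemma b_nz: "b i + of_nat j \<noteq> 0"
  by (rule not_nonpos_int[OF bZ]) (use l_pos in \<open>simp flip: funpow_add[unfolded o_def fun_eq_iff, rule_format]\<close>)

lemma A_step: "k < CARD('p) \<Longrightarrow> \<exists>u. wlip_gain u \<and> (\<forall>m. A i (k + CARD('p) * m) = u m * A (Suc i) m)"
  using hyp_coeff_step_one[OF bZ, of k i] by simp

lemma B_step: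
  assumes "k < CARD('p)"
  shows "(\<exists>u. wlip_gain u \<and> (\<forall>m. B i (k + CARD('p) * m) = u m * B (Suc i) m)) \<or>
     (k \<ge> 2 \<and> (\<exists>w. wlip w \<and> (\<forall>m. B i (k + CARD('p) * m) = pK * of_nat (Suc m) * w m * B (Suc i) (Suc m))))"
proof -
  have "2 * dwork (b i) + of_nat j \<noteq> 0" for j using double_nz[of "Suc i" j] by simp
  from hyp_coeff_step_double[OF bZ assms l_pos l_double dwork_double_b this] show ?thesis by simp
qed

lemma A_W: "A i n \<in> W" 
  by (rule tower_integral[where A = A]) (simp, use A_step in blast)

lemma B_W: "B i n \<in> W"
  by (rule tower_integral[where A = B]) (simp, rule B_step)

lemma A_small: "l i < k \<Longrightarrow> k < CARD('p) \<Longrightarrow> A i k \<in> pW 1"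
  by (rule hyp_coeff_one_small[OF bZ])

lemma B_small:
  assumes "l i < k" "k < CARD('p)" shows "B i k \<in> pW 1"
proof (rule hyp_coeff_double_small[OF bZ assms l_pos l_double dwork_double_b])
  show "2 * dwork (b i) \<noteq> 0" using double_nz[of "Suc i" 0] by simp
  show "hyp_coeff (dwork (b i)) (dwork (b i)) (2 * dwork (b i)) (Suc 0) \<in> W" using B_W[of "Suc i" "Suc 0"] by simp
qed

lemma B_unit: "k \<le> l i \<Longrightarrow> Wunit (B i k)"
  by (rule hyp_coeff_double_unit[OF bZ _ l_double])

lemma reversal: "k \<le> l i \<Longrightarrow> wcong 1 (B i (l i - k)) (B i (l i) * A i k)"
  by (rule hyp_coeff_reversal[OF bZ l_double double_nz A_W])

lemma TA_W: "TA i \<in> W_poly" and TB_W: "TB i \<in> W_poly"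
  by (auto simp: W_poly_def coeff_truncate_fps A_W B_W)
lemma TA0: "coeff (TA i) 0 = 1" and TB0: "coeff (TB i) 0 = 1" by simp_all

lemma h_poly_eq: "h_poly a r = (\<Prod>i<r. TA i)"
  unfolding h_poly_def hyp_dwork_def hyp_eq dwork_iter_one dwork_iter_one_minus[OF aZ] ..

lemma hhat_poly_eq: "hhat_poly a r = (\<Prod>i<r. TB i)"
  unfolding hhat_poly_def hyp_dwork_def hyp_eq dwork_double(1)[OF aZ dig] ..

lemma b_mod: "b i = b (i mod r)"
  by (rule funpow_mod_eq[OF per, symmetric])

lemma h_W: "h_poly a r \<in> W_poly" "coeff (h_poly a r) 0 = 1"
  unfolding h_poly_eq by (rule prod_truncations[OF TA_W TA0])+
lemma hhat_W: "hhat_poly a r \<in> W_poly" "coeff (hhat_poly a r) 0 = 1"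
  unfolding hhat_poly_eq by (rule prod_truncations[OF TB_W TB0])+

lemma h_fixed: "coeff (h_poly a r) i \<in> pfixed"
  unfolding h_poly_eq
proof (rule pfixed_poly_prod)
  fix i k show "coeff (TA i) k \<in> pfixed"
  proof (cases "k < CARD('p)")
    case True
    then show ?thesis by (auto intro!: hyp_coeff_pfixed bZ b1Z simp: dwork_one coeff_truncate_fps)
  qed (simp add: coeff_truncate_fps pfixed_Zp)
qed

lemma hhat_fixed: "coeff (hhat_poly a r) i \<in> pfixed"
  unfolding hhat_poly_eq
proof (rule pfixed_poly_prod)
  fix i k 
  have "B i k \<in> pfixed" if k: "k < CARD('p)"
  proof (cases "k \<le> 2 * l i")
    case True
    then show ?thesis using k by (intro hyp_coeff_pfixed bZ b2Z) (auto simp: l_double)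
  next
    case False
    then show ?thesis using k by (intro pfixed_pW1 B_small) auto
  qed
  then show "coeff (TB i) k \<in> pfixed" unfolding coeff_truncate_fps by (auto intro: pfixed_Zp)
qed

text \<open>By periodicity every truncation is, up to its index modulo \<open>r\<close>, a factor of \<open>h\<close>.\<close>

lemma unit_A: "inverse (fps_cutoff CARD('p) (Abs_fps (A i))) \<in> conv (h_poly a r)"
proof -
  have "i mod r < r" using r0 by simp
  then obtain C where C: "C \<in> W_poly" "(\<Prod>i<r. TA i) = TA (i mod r) * C" by (rule prod_cofactor[of TA, OF TA_W])
  have "inverse (fps_of_poly (TA (i mod r))) = fps_of_poly C * inverse (fps_of_poly (h_poly a r)) ^ 1"
    using inverse_factor[OF C(2)[folded h_poly_eq] TA0 h_W(2)] by simp
  then have "inverse (fps_of_poly (TA (i mod r))) \<in> conv (h_poly a r)"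
    using Wrat_conv[OF h_W Wrat_I[OF h_W C(1)], of 1] by simp
  then show ?thesis unfolding b_mod[of i, symmetric] fps_of_poly_truncate .
qed

lemma unit_B: "inverse (fps_cutoff CARD('p) (Abs_fps (B i))) \<in> conv (hhat_poly a r)"
proof -
  have "i mod r < r" using r0 by simp
  then obtain C where C: "C \<in> W_poly" "(\<Prod>i<r. TB i) = TB (i mod r) * C" by (rule prod_cofactor[of TB, OF TB_W])
  have "inverse (fps_of_poly (TB (i mod r))) = fps_of_poly C * inverse (fps_of_poly (hhat_poly a r)) ^ 1"
    using inverse_factor[OF C(2)[folded hhat_poly_eq] TB0 hhat_W(2)] by simp
  then have "inverse (fps_of_poly (TB (i mod r))) \<in> conv (hhat_poly a r)"
    using Wrat_conv[OF hhat_W Wrat_I[OF hhat_W C(1)], of 1] by simp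
  then show ?thesis unfolding b_mod[of i, symmetric] fps_of_poly_truncate .
qed

lemma tower_A: "dwork_tower A (h_poly a r)"
proof
  show "wcong 1 (coeff (h_poly a r) i ^ CARD('p)) (coeff (h_poly a r) i)" for i
    using h_fixed[of i] by (simp add: pfixed_def)
  fix i k :: nat assume "k < CARD('p)"
  then show "(\<exists>u. wlip_gain u \<and> (\<forall>m. A i (k + CARD('p) * m) = u m * A (Suc i) m)) \<or>
       (\<exists>w. wlip w \<and> (\<forall>m. A i (k + CARD('p) * m) = pK * of_nat (Suc m) * w m * A (Suc i) (Suc m)))"
    using A_step by blast
qed (fact h_W A_W unit_A | simp)+

lemma tower_B: "dwork_tower B (hhat_poly a r)"
proof
  show "wcong 1 (coeff (hhat_poly a r) i ^ CARD('p)) (coeff (hhat_poly a r) i)" for i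
    using hhat_fixed[of i] by (simp add: pfixed_def)
  fix i k :: nat assume "k < CARD('p)"
  then show "(\<exists>u. wlip_gain u \<and> (\<forall>m. B i (k + CARD('p) * m) = u m * B (Suc i) m)) \<or>
       (\<exists>w. wlip w \<and> (\<forall>m. B i (k + CARD('p) * m) = pK * of_nat (Suc m) * w m * B (Suc i) (Suc m)))"
    using B_step by blast
qed (fact hhat_W B_W unit_B | simp)+

end

section \<open>The numerators as Lipschitz multiples of the hypergeometric coefficients\<close>

lemma subst_sigma_nth:
  "fps_nth (subst_sigma c f) n = (if CARD('p) dvd n then c ^ (n div CARD('p)) * fps_nth f (n div CARD('p)) else (0 :: 'p::prime_card K))"
proof -
  let ?p = "CARD('p)"
  have pow: "fps_nth ((fps_const c * fps_X ^ ?p) ^ i) n = (if n = ?p * i then c ^ i else 0)" for i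
    by (simp add: power_mult_distrib fps_const_power fps_X_power_nth flip: power_mult)
  have "fps_nth (subst_sigma c f) n = (\<Sum>i=0..n. fps_nth f i * (if n = ?p * i then c ^ i else 0))"
    unfolding subst_sigma_def fps_compose_nth pow ..
  also have "\<dots> = (\<Sum>i=0..n. if i = n div ?p \<and> ?p dvd n then c ^ i * fps_nth f i else 0)"
    by (intro sum.cong refl) auto
  also have "\<dots> = (if ?p dvd n then c ^ (n div ?p) * fps_nth f (n div ?p) else 0)"
    by (cases "?p dvd n") simp_all
  finally show ?thesis .
qed

text \<open>On the residue class where \<open>\<gamma> + n\<close> is divisible by \<open>p\<close>, the function is prescribed; elsewhere it
  is \<open>1/(\<gamma> + n)\<close>, the inverse of a unit. A congruence modulo \<open>p\<close> preserves the residue class, so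
  both pieces can be treated separately.\<close>

lemma wlip_piecewise:
  fixes g :: "nat \<Rightarrow> 'p::prime_card K"
  assumes \<gamma>: "\<gamma> \<in> Zp" and I: "I = {n. n mod CARD('p) = dwork_l \<gamma>}"
    and gW: "\<And>n. n \<in> I \<Longrightarrow> g n \<in> W"
    and g: "\<And>m n s. m \<in> I \<Longrightarrow> n \<in> I \<Longrightarrow> wcong s (\<gamma> + of_nat m) (\<gamma> + of_nat n) \<Longrightarrow> wcong s (g m) (g n)"
  shows "wlip (\<lambda>n. if n \<in> I then g n else 1 / (\<gamma> + of_nat n))"
proof (rule wlipI)
  have gamW: "\<gamma> + of_nat n \<in> W" for n using Zp_W[OF \<gamma>] by auto
  have unit: "Wunit (\<gamma> + of_nat n)" if "n \<notin> I" for n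
    using that gamW in_pW1_iff_dwork_l[OF \<gamma>, of n] unfolding I Wunit_def by blast
  have W: "(if n \<in> I then g n else 1 / (\<gamma> + of_nat n)) \<in> W" for n
    using gW unit by (auto intro!: W_divide)
  then show "(if n \<in> I then g n else 1 / (\<gamma> + of_nat n)) \<in> W" for n .
  fix s m n assume c: "[m = n] (mod CARD('p) ^ s)"
  show "wcong s (if m \<in> I then g m else 1 / (\<gamma> + of_nat m)) (if n \<in> I then g n else 1 / (\<gamma> + of_nat n))"
  proof (cases s)
    case 0
    show ?thesis unfolding 0 wcong_def using W_diff[OF W W, of m n] by simp
  next
    case (Suc t)
    have "[m = n] (mod CARD('p))" using c unfolding Suc power_Suc by (rule cong_modulus_mult_nat)
    then have mn: "m \<in> I \<longleftrightarrow> n \<in> I" unfolding I by (simp add: cong_def)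
    have cc: "wcong s (\<gamma> + of_nat m) (\<gamma> + of_nat n)" using c by (intro wcong_add wcong_refl) (simp add: wcong_of_nat)
    show ?thesis
    proof (cases "n \<in> I")
      case True
      then show ?thesis using mn g[OF _ _ cc] by simp
    next
      case False
      then show ?thesis using mn cc unit by (auto intro!: wcong_divide)
    qed
  qed
qed

lemma card_coprime_below:
  assumes "M \<ge> 1" and p: "p > 0"
  shows "card {k. 1 \<le> k \<and> k < M \<and> \<not> p dvd k} + (M - 1) div p = M - (1::nat)"
  using assms(1)
proof (induction M rule: nat_induct_at_least)
  case base
  have "{k. 1 \<le> k \<and> k < (1::nat) \<and> \<not> p dvd k} = {}" by auto
  then show ?case by simp
next
  case (Suc M)
  obtain M' where M: "M = Suc M'" using Suc.hyps by (cases M) auto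
  have fin: "finite {k. 1 \<le> k \<and> k < M \<and> \<not> p dvd k}" by simp
  show ?case
  proof (cases "p dvd M")
    case True
    then have "M div p = Suc (M' div p)" using p unfolding M by (simp add: div_Suc mod_eq_0_iff_dvd)
    moreover have "{k. 1 \<le> k \<and> k < Suc M \<and> \<not> p dvd k} = {k. 1 \<le> k \<and> k < M \<and> \<not> p dvd k}"
      unfolding unit_index_Suc[OF Suc.hyps] using True by simp
    ultimately show ?thesis using Suc.IH by (simp add: M)
  next
    case False
    then have "M div p = M' div p" using p unfolding M by (simp add: div_Suc mod_eq_0_iff_dvd)
    then show ?thesis using Suc.IH Suc.hyps fin False M unfolding unit_index_Suc[OF Suc.hyps] by simp
  qed
qed

context dwork_setting
begin

lemma dquotD:
  assumes dq: "dquot pos I E (lam :: 'p K) e" and n: "n \<in> I"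
  shows "e n \<in> W" "E n = 1 + pos n * e n" "pos n \<in> pW s \<Longrightarrow> wcong s (e n) lam"
    "m \<in> I \<Longrightarrow> wcong s (pos n) (pos m) \<Longrightarrow> wcong s (e n) (e m)"
  using bspec[OF dq[unfolded dquot_def[OF p3]] n] by auto

text \<open>With \<open>M \<equiv> -l\<close> modulo \<open>p\<close>, the number of units below \<open>M\<close> is \<open>q (p - 1) + p - 1 - l\<close> for some \<open>q\<close>,
  which has the parity of \<open>l\<close> as \<open>p\<close> is odd.\<close>

lemma Gamma_sign_cancels:
  assumes M: "M \<ge> 1" "wcong 1 a (of_nat M)"
  shows "(- 1) ^ l 0 * (- 1) ^ card {k. 1 \<le> k \<and> k < M \<and> \<not> CARD('p) dvd k} = (1 :: 'p K)"
proof -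
  let ?p = "CARD('p)" and ?c = "card {k. 1 \<le> k \<and> k < M \<and> \<not> CARD('p) dvd k}"
  have "a + of_nat (l 0) \<in> pW 1" using dwork_l_props(2)[OF aZ] by simp
  moreover have "wcong 1 (a + of_nat (l 0)) (of_nat M + of_nat (l 0))" by (intro wcong_add M(2) wcong_refl)
  ultimately have "of_nat (M + l 0) \<in> (pW 1 :: 'p K set)" using wcong_add_pW by (metis of_nat_add)
  then have "?p dvd M + l 0" unfolding of_nat_pW1 .
  then obtain q where q: "M + l 0 = ?p * q" by blast
  have "q > 0" using q M(1) by (cases q) auto
  then obtain q' where q': "q = Suc q'" by (cases q) auto
  have l: "0 < l 0" "l 0 < ?p" using l_pos[of 0] l_small[of 0] by auto
  have M1: "M - 1 = (?p - 1 - l 0) + ?p * q'" using q l by (simp add: q')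
  have "(?p - 1 - l 0) div ?p = 0" using l by (intro div_less) linarith
  then have "(M - 1) div ?p = q'" unfolding M1 by (simp only: div_mult_self2[OF zero_less_card_finite[THEN gr_implies_not0]] add_0_right)
  then have "?c + q' = ?p * q' + (?p - 1 - l 0)" using card_coprime_below[OF M(1), of ?p] M1 by simp
  moreover obtain d where d: "?p = 2 * d + 1" using odd_CARD[OF p3] by (rule oddE)
  ultimately have "l 0 + ?c = 2 * (d * q' + d)" using l by (simp add: algebra_simps)
  then have "(- 1) ^ (l 0 + ?c) = (1 :: 'p K)" by simp
  then show ?thesis by (simp add: power_add)
qed

lemma Rprod_cong:
  assumes "M \<ge> 1" "y \<in> pW 1" "y' \<in> pW 1" "wcong s y (y' :: 'p K)" shows "wcong s (Rprod M y) (Rprod M y')"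
proof -
  obtain r where r: "\<And>y. y \<in> pW 1 \<Longrightarrow> r y \<in> W" "\<And>y. y \<in> pW 1 \<Longrightarrow> Rprod M y = 1 + (y :: 'p K) * r y"
     "\<And>y y' s. y \<in> pW 1 \<Longrightarrow> y' \<in> pW 1 \<Longrightarrow> wcong s y y' \<Longrightarrow> wcong s (r y) (r y')"
    using Rprod_dquot[OF p3 assms(1)] by blast
  show ?thesis unfolding r(2)[OF assms(2)] r(2)[OF assms(3)]
    by (intro wcong_add wcong_refl wcong_mult r(1,3) assms pW_imp_W[OF assms(2)])
qed

lemma plog_inverse: assumes c: "c - 1 \<in> pW 1" shows "inverse c - 1 \<in> pW 1" "plog (inverse c) = - plog (c :: 'p K)"
proof -
  have u: "Wunit c" by (rule one_unit_Wunit[OF p3 c])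
  have "inverse c - 1 = - (inverse c * (c - 1))" using Wunit_nz[OF u] by (simp add: algebra_simps)
  then show i: "inverse c - 1 \<in> pW 1" using Wunit_inverse_W[OF u] c by (simp only: pW_neg W_mult_pW)
  have "plog (c * inverse c) = plog c + plog (inverse c)" by (rule plog_mult[OF p3 c i])
  then show "plog (inverse c) = - plog c" using Wunit_nz[OF u] plog_one[OF p3] by (simp add: eq_neg_iff_add_eq_0 add.commute)
qed

lemma l_le: "l 0 < CARD('p)" by (rule dwork_l_props(1)[OF bZ])

text \<open>For \<open>p | n\<close> the ratio \<open>E\<^sub>H(n)\<close> of \<open>A(n)\<close> to the coefficient \<open>n/p\<close> of the next series is
  approximated by the products \<open>Rprod\<close> at \<open>y = n\<close>. Hence \<open>G\<close> has coefficient \<open>A(n) (1 -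
  c\<^bsup>n/p\<^esup>/E\<^sub>H(n))/n\<close>, and with \<open>E = 1 + n e\<close> for both functions the factor of \<open>A(n)\<close> is \<open>(e\<^sub>H -
  e\<^sub>c)/E\<^sub>H\<close>, in which the division by \<open>n\<close> has disappeared. At \<open>n = 0\<close> this is the constant term of
  \<open>G\<close>.\<close>

lemma G_log_coeffs:
  assumes c: "c - 1 \<in> pW 1"
  obtains f where "wlip f" "G_log c a = Abs_fps (\<lambda>n. f n * A 0 n)" "f 0 = 2 * psi_tilde a - plog c"
    "\<And>k. 0 < k \<Longrightarrow> k < CARD('p) \<Longrightarrow> f k = 1 / of_nat k"
proof -
  let ?p = "CARD('p)" and ?I = "{n. n mod CARD('p) = dwork_l (0 :: 'p K)}"
  have l0: "dwork_l (0 :: 'p K) = 0" by (intro dwork_l_eq) auto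
  have I: "n \<in> ?I \<longleftrightarrow> ?p dvd n" for n by (simp add: l0 mod_eq_0_iff_dvd)
  have a1: "1 - a \<in> Zp" using b1Z[of 0] by simp
  define EH where "EH n = rho a n * rho (1 - a) n" for n
  define Ec where "Ec n = c ^ (n div ?p)" for n
  have pos: "of_nat n \<in> (pW 1 :: 'p K set)" if "n \<in> ?I" for n unfolding of_nat_pW1 using that I by blast
  have "\<exists>e. dquot of_nat ?I EH (2 * psi_tilde a) e"
  proof (rule dquot_Rprod[OF p3 aZ pos])
    fix n N M assume h: "n \<in> ?I" "N \<ge> 1" "M \<ge> 1" "wcong N a (of_nat M)"
    have "wcong N (EH n) (rho (of_nat M) n * rho (1 - of_nat M) n)" unfolding EH_def
      using h Zp_W[OF aZ] Zp_W[OF a1] 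
      by (intro wcong_mult rho_cong wcong_diff wcong_refl Wunit_W[OF Wunit_rho]) auto
    moreover have "?p dvd n" using h(1) I by blast
    ultimately show "wcong N (EH n) (Rprod M (of_nat n))" by (simp only: rho_Rprod[OF _ h(3)])
  qed
  then obtain eH where eH: "dquot of_nat ?I EH (2 * psi_tilde a) eH" by blast
  have "\<exists>e. dquot of_nat ?I Ec (plog c) e"
  proof (rule dquot_power[OF p3 c])
    show "of_nat n = pK * (of_nat (n div ?p) :: 'p K)" if "n \<in> ?I" for n
      using that unfolding I of_nat_mult[symmetric] by simp
    show "wcong N (Ec n) (c ^ M)" if "wcong N (of_nat (n div ?p) :: 'p K) (of_nat M)" for n N M
      unfolding Ec_def by (rule power_cong[OF p3 c]) (use that wcong_of_nat in blast)
  qed simp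
  then obtain ec where ec: "dquot of_nat ?I Ec (plog c) ec" by blast
  define g where "g n = (eH n - ec n) / EH n" for n
  define f where "f n = (if n \<in> ?I then g n else 1 / (0 + of_nat n))" for n
  have uEH: "Wunit (EH n)" for n unfolding EH_def by (intro Wunit_mult Wunit_rho Zp_W aZ a1)
  have lip: "wlip f" unfolding f_def
  proof (rule wlip_piecewise[OF Zp_0 refl])
    show "g n \<in> W" if "n \<in> ?I" for n
      unfolding g_def by (intro W_divide W_diff dquotD(1)[OF eH that] dquotD(1)[OF ec that] uEH)
    fix m n s assume mn: "m \<in> ?I" "n \<in> ?I" "wcong s (0 + of_nat m :: 'p K) (0 + of_nat n)"
    then have mn': "wcong s (of_nat m :: 'p K) (of_nat n)" by simp
    have "wcong s (EH m) (EH n)" unfolding dquotD(2)[OF eH mn(1)] dquotD(2)[OF eH mn(2)]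
      by (intro wcong_add wcong_refl wcong_mult mn' dquotD(4)[OF eH] mn dquotD(1)[OF eH mn(1)]) auto
    then show "wcong s (g m) (g n)" unfolding g_def
      by (intro wcong_divide wcong_diff dquotD(4)[OF eH mn(1,2)] dquotD(4)[OF ec mn(1,2)] mn' uEH W_diff
          dquotD(1)[OF eH mn(1)] dquotD(1)[OF ec mn(1)])
  qed
  have zero: "x = y" if "\<And>s. wcong s x y" for x y :: "'p K"
    using pW_Inter[of "x - y"] that unfolding wcong_def by simp
  have I0: "0 \<in> ?I" by (simp add: l0)
  have eH0: "eH 0 = 2 * psi_tilde a" by (rule zero, rule dquotD(3)[OF eH I0]) simp
  have ec0: "ec 0 = plog c" by (rule zero, rule dquotD(3)[OF ec I0]) simp
  have f0: "f 0 = 2 * psi_tilde a - plog c"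
    unfolding f_def g_def eH0 ec0 using I0 dquotD(2)[OF eH I0] by simp
  show ?thesis
  proof (rule that[OF lip _ f0])
    show "f k = 1 / of_nat k" if "0 < k" "k < ?p" for k
      using that by (simp add: f_def l0)
    show "G_log c a = Abs_fps (\<lambda>n. f n * A 0 n)"
    proof (rule fps_ext)
      fix n
      have hd: "hyp_dwork 1 a (1 - a) 1 = Abs_fps (A 1)"
        unfolding hyp_dwork_def hyp_eq dwork_iter_one dwork_iter_one_minus[OF aZ] ..
      show "fps_nth (G_log c a) n = fps_nth (Abs_fps (\<lambda>n. f n * A 0 n)) n"
      proof (cases "n = 0")
        case True
        have "psi_p a + psi_p (1 - a) + 2 * gamma_p - (1 / pK) * iwasawa_log c = 2 * psi_tilde a - plog c"
          unfolding psi_p_def psi_tilde_reflection[OF p3 aZ] iwasawa_log_one_unit[OF p3 c] mult_2 by simp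
        then show ?thesis unfolding True by (simp add: G_log_def int_dtt_def f0)
      next
        case False
        have nz: "of_nat n \<noteq> (0 :: 'p K)" using False unfolding of_nat_K_eq_0 .
        have coeff: "fps_nth (G_log c a) n = (A 0 n - (if ?p dvd n then c ^ (n div ?p) * A 1 (n div ?p) else 0)) / of_nat n"
          using False unfolding G_log_def int_dtt_def hd by (simp add: subst_sigma_nth hyp_eq)
        show ?thesis
        proof (cases "?p dvd n")
          case True
          then have n: "n = 0 + ?p * (n div ?p)" by simp
          have p0: "0 < ?p" by simp
          have "A 0 n = EH n * A 1 (n div ?p)"
            using hyp_coeff_block[OF aZ a1 Zp_1 p0, of "n div ?p"] n[symmetric]
            by (simp add: carry_def EH_def dwork_one dwork_one_minus[OF aZ] rho_def[of 1] Wunit_nz[OF Wunit_upoch])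
          moreover have "EH n - Ec n = of_nat n * (eH n - ec n)"
            using True I by (simp add: dquotD(2)[OF eH] dquotD(2)[OF ec] algebra_simps)
          ultimately have "(A 0 n - Ec n * A 1 (n div ?p)) / of_nat n = (eH n - ec n) * A 1 (n div ?p)"
            using nz by (simp add: left_diff_distrib[symmetric])
          also have "\<dots> = f n * A 0 n"
            using True I Wunit_nz[OF uEH[of n]] \<open>A 0 n = _\<close> by (simp add: f_def g_def)
          finally show ?thesis using True by (simp add: coeff Ec_def)
        next
          case False
          then show ?thesis using coeff I by (simp add: f_def)
        qed
      qed
    qed
  qed
qed

text \<open>For \<open>n \<equiv> l\<close> modulo \<open>p\<close> both terms of the integrand contribute at the exponent \<open>y = a + n = p (a' +
  (n - l)/p)\<close>. The second one is \<open>E\<^sub>H(n) E\<^sub>u(n)\<close> times the first, where \<open>E\<^sub>u(n) = u\<^bsup>y/p\<^esup>\<close>, and \<open>E\<^sub>H\<close>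
  consists of the Beta value and the ratio of coefficients. If \<open>M\<close> is a positive integer close to
  \<open>a\<close>, these Gamma values and ratios are factorials without the multiples of \<open>p\<close>, and they combine
  to \<open>Rprod M\<close> at \<open>y = M + n\<close>. Integration divides by \<open>y\<close>, and with \<open>E = 1 + y e\<close> for both functions
  the result is \<open>1 - E\<^sub>H E\<^sub>u = - y (e\<^sub>H + e\<^sub>u + y e\<^sub>H e\<^sub>u)\<close> over \<open>y\<close>.\<close>

lemma G_hat_coeffs:
  assumes u: "u - 1 \<in> pW 1"
  obtains f where "wlip f" "G_hat u a = Abs_fps (\<lambda>n. f n * B 0 n)" "wcong 1 (f (l 0)) (- (2 * psi_tilde a + plog u))"
    "\<And>k. k < l 0 \<Longrightarrow> f k = 1 / (a + of_nat k)"
proof -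
  let ?p = "CARD('p)" and ?I = "{n. n mod CARD('p) = dwork_l a}" and ?pos = "\<lambda>n. a + of_nat n :: 'p K"
  have a2: "2 * a \<in> Zp" using b2Z[of 0] by simp
  have aW: "a \<in> W" "2 * a \<in> W" by (rule Zp_W[OF aZ] Zp_W[OF a2])+
  have l_lt: "dwork_l a < ?p" using l_le by simp
  define \<beta> where "\<beta> = (- 1) ^ dwork_l a * inverse (Beta_p a a)"
  define EH where "EH n = \<beta> * (rho (2 * a) n / (rho a n * rho a n))" for n
  define Eu where "Eu n = padic_powr u (dwork a) * u ^ (n div ?p)" for n
  have pos: "?pos n \<in> pW 1" if "n \<in> ?I" for n using that in_pW1_iff_dwork_l[OF aZ, of n] by blast
  have Idec: "n = dwork_l a + ?p * (n div ?p)" if "n \<in> ?I" for n using that mod_mult_div_eq[of n ?p] by auto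
  have pnz: "?pos n \<noteq> 0" for n using b_nz[of 0 n] by simp
  have uG: "Wunit (Gamma_p a)" "Wunit (Gamma_p (2 * a))" by (rule Wunit_Gamma_p[OF p3 aZ] Wunit_Gamma_p[OF p3 a2])+
  have beta: "\<beta> = (- 1) ^ dwork_l a * (Gamma_p (2 * a) / (Gamma_p a * Gamma_p a))"
    unfolding \<beta>_def Beta_p_def mult_2 by simp
  have ur: "Wunit (rho a n)" "Wunit (rho (2 * a) n)" for n by (rule Wunit_rho[OF aW(1)] Wunit_rho[OF aW(2)])+
  have "\<exists>e. dquot ?pos ?I EH (2 * psi_tilde a) e"
  proof (rule dquot_Rprod[OF p3 aZ pos])
    fix n N M assume h: "n \<in> ?I" "N \<ge> 1" "M \<ge> 1" "wcong N a (of_nat M)"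
    \<comment> \<open>\<open>ufact_Rprod\<close> is applied at \<open>x = M + n\<close>, a multiple of \<open>p\<close> that approximates \<open>a + n\<close>\<close>
    let ?x = "M + n"
    have a1M: "wcong 1 a (of_nat M)" by (rule wcong_mono[OF h(4,2)])
    have a2M: "wcong N (2 * a) (of_nat (M + M))" unfolding mult_2 of_nat_add by (intro wcong_add h(4))
    have posx: "wcong N (of_nat ?x) (?pos n)" unfolding of_nat_add by (intro wcong_add wcong_refl wcong_sym[OF h(4)])
    have "wcong 1 (of_nat ?x) (?pos n)" by (rule wcong_mono[OF posx h(2)])
    then have x1: "of_nat ?x \<in> (pW 1 :: 'p K set)" using wcong_add_pW[of 1 "of_nat ?x" "?pos n"] pos[OF h(1)] by blast
    then have px: "?p dvd ?x" unfolding of_nat_pW1 .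
    have M0: "0 < M" "0 < M + M" using h(3) by auto
    have uf: "ufact k \<noteq> (0 :: 'p K)" for k by (rule Wunit_nz[OF Wunit_ufact])
    let ?G2 = "(- 1) ^ (M + M) * ufact (M + M) :: 'p K" and ?G1 = "(- 1) ^ M * ufact M :: 'p K"
    have g1: "wcong N (Gamma_p a) ?G1" by (rule Gamma_p_props(2)[OF p3 aZ M0(1) h(4)])
    have g2: "wcong N (Gamma_p (2 * a)) ?G2" by (rule Gamma_p_props(2)[OF p3 a2 M0(2) a2M])
    have uG1: "Wunit ?G1" by (intro Wunit_mult Wunit_power Wunit_ufact) simp
    have r1: "wcong N (rho a n) (rho (of_nat M) n)" using h(2) by (intro rho_cong h(4) aW) auto
    have r2: "wcong N (rho (2 * a) n) (rho (of_nat (M + M)) n)" using h(2) by (intro rho_cong a2M aW) auto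
    have urM: "Wunit (rho (of_nat M :: 'p K) n)" by (intro Wunit_rho) auto
    have "wcong N (EH n) ((- 1) ^ dwork_l a * (?G2 / (?G1 * ?G1)) * (rho (of_nat (M + M)) n / (rho (of_nat M) n * rho (of_nat M) n)))"
      unfolding EH_def beta
      by (intro wcong_mult wcong_refl wcong_divide g1 g2 r1 r2 Wunit_mult uG uG1 urM ur W_mult W_divide W_power W_neg W_1
           Wunit_W[OF uG(1)] Wunit_W[OF uG(2)] Wunit_W[OF ur(1)] Wunit_W[OF ur(2)])
    also have "(- 1) ^ dwork_l a * (?G2 / (?G1 * ?G1)) * (rho (of_nat (M + M)) n / (rho (of_nat M) n * rho (of_nat M) n))
        = (- 1) ^ dwork_l a * (ufact (M + M + n) * ufact (Suc n) / (ufact (M + n) * ufact (M + n)))"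
    proof -
      have s: "(- 1 :: 'p K) ^ M \<noteq> 0" by simp
      have *: "e * ((s * s * F2) / ((s * F) * (s * F))) * ((X2 / (F2 * S)) / ((X1 / (F * S)) * (X1 / (F * S)))) = e * (X2 * S / (X1 * X1))"
        if "s \<noteq> 0" "F \<noteq> 0" "F2 \<noteq> 0" "S \<noteq> 0" "X1 \<noteq> 0" for e s F F2 S X1 X2 :: "'p K"
        using that by (simp add: field_simps)
      show ?thesis unfolding rho_of_nat power_add by (rule *[OF s uf uf uf uf])
    qed
    also have "\<dots> = Rprod M (of_nat ?x)"
    proof -
      have e1: "?x + M = M + M + n" and e2: "?x + 1 - M = Suc n" by simp_all
      have R: "ufact (M + M + n) * ufact (Suc n) = (ufact ?x) ^ 2 * (- 1) ^ card {k. 1 \<le> k \<and> k < M \<and> \<not> ?p dvd k} * Rprod M (of_nat ?x :: 'p K)"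
        using ufact_Rprod[OF px h(3)] unfolding e1 e2 by simp
      have sg: "(- 1) ^ dwork_l a * (- 1) ^ card {k. 1 \<le> k \<and> k < M \<and> \<not> ?p dvd k} = (1 :: 'p K)"
        using Gamma_sign_cancels[OF h(3) a1M] by simp
      have *: "e * (x ^ 2 * s * R / (x * x)) = (e * s) * R" if "x \<noteq> 0" for e x s R :: "'p K"
        using that by (simp add: power2_eq_square)
      show ?thesis unfolding R *[OF uf] sg by simp
    qed
    also have "wcong N \<dots> (Rprod M (?pos n))" by (rule Rprod_cong[OF h(3) x1 pos[OF h(1)] posx])
    finally show "wcong N (EH n) (Rprod M (?pos n))" .
  qed
  then obtain eH where eH: "dquot ?pos ?I EH (2 * psi_tilde a) eH" by blast
  have dZ: "dwork a \<in> Zp" by (rule dwork_Zp[OF aZ])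
  note pp = padic_powr_props[OF p3 u dZ]
  have uW: "u \<in> W" by (rule Wunit_W[OF one_unit_Wunit[OF p3 u]])
  have "\<exists>e. dquot ?pos ?I Eu (plog u) e"
  proof (rule dquot_power[OF p3 u])
    show "?pos n = pK * (dwork a + of_nat (n div ?p))" if "n \<in> ?I" for n
    proof -
      have "?pos n = a + of_nat (dwork_l a + ?p * (n div ?p))" using Idec[OF that] by simp
      then show ?thesis by (simp add: distrib_left pK_dwork)
    qed
    show "dwork a + of_nat (n div ?p) \<in> Zp" for n by (intro Zp_add dZ Zp_of_nat)
    fix n N M assume M: "wcong N (dwork a + of_nat (n div ?p)) (of_nat M)"
    obtain M' where M': "M' > 0" "wcong N (dwork a) (of_nat M')" by (rule Zp_approx[OF dZ])
    have "wcong N (of_nat (M' + n div ?p) :: 'p K) (of_nat M)"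
      unfolding of_nat_add by (rule wcong_trans[OF wcong_add[OF wcong_sym[OF M'(2)] wcong_refl] M])
    then have MM: "[M' + n div ?p = M] (mod ?p ^ N)" unfolding wcong_of_nat .
    have "wcong N (Eu n) (u ^ M' * u ^ (n div ?p))"
      unfolding Eu_def by (intro wcong_mult wcong_refl pp M' W_power uW)
    also have "u ^ M' * u ^ (n div ?p) = u ^ (M' + n div ?p)" by (simp add: power_add)
    also have "wcong N \<dots> (u ^ M)" by (rule power_cong[OF p3 u MM])
    finally show "wcong N (Eu n) (u ^ M)" .
  qed
  then obtain eu where eu: "dquot ?pos ?I Eu (plog u) eu" by blast
  define g where "g n = - (eH n + eu n + ?pos n * (eH n * eu n))" for n
  define f where "f n = (if n \<in> ?I then g n else 1 / (a + of_nat n))" for n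
  have posW: "?pos n \<in> W" for n using aW by auto
  have lip: "wlip f" unfolding f_def
  proof (rule wlip_piecewise[OF aZ refl])
    show "g n \<in> W" if "n \<in> ?I" for n
      unfolding g_def by (intro W_neg W_add W_mult posW dquotD(1)[OF eH that] dquotD(1)[OF eu that])
    fix m n s assume mn: "m \<in> ?I" "n \<in> ?I" "wcong s (?pos m) (?pos n)"
    show "wcong s (g m) (g n)" unfolding g_def
      by (intro wcong_uminus wcong_add wcong_mult mn(3) dquotD(4)[OF eH mn(1,2)] dquotD(4)[OF eu mn(1,2)] posW W_mult
          dquotD(1)[OF eH mn(1)] dquotD(1)[OF eu mn(1)])
  qed
  have l_I: "l 0 \<in> ?I" using l_lt by simp
  show ?thesis
  proof (rule that[OF lip])
    show "f k = 1 / (a + of_nat k)" if "k < l 0" for k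
      using that l_lt by (simp add: f_def)
    have p1: "?pos (l 0) \<in> pW 1" by (rule pos[OF l_I])
    have "wcong 1 (g (l 0)) (- (2 * psi_tilde a + plog u + 0))"
      unfolding g_def
      by (intro wcong_uminus wcong_add dquotD(3)[OF eH l_I p1] dquotD(3)[OF eu l_I p1] iffD2[OF wcong_0] pW_mult_W p1 W_mult
           dquotD(1)[OF eH l_I] dquotD(1)[OF eu l_I])
    then show "wcong 1 (f (l 0)) (- (2 * psi_tilde a + plog u))" using l_I by (simp add: f_def)
    show "G_hat u a = Abs_fps (\<lambda>n. f n * B 0 n)"
    proof (rule fps_ext)
      fix n
      have hd: "hyp_dwork 1 a a (2 * a) = Abs_fps (B 1)"
        unfolding hyp_dwork_def hyp_eq dwork_double(1)[OF aZ dig] ..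
      \<comment> \<open>the sum over all \<open>n\<close> with a given exponent has at most one term\<close>
      have inj: "(\<beta>' + of_nat n = \<beta>' + of_nat m) = (n = m)" for n m and \<beta>' :: "'p K"
      proof
        assume "\<beta>' + of_nat n = \<beta>' + of_nat m"
        then have "(of_nat n :: 'p K) = of_nat m" by (simp only: add_left_cancel)
        then have "wcong N (of_nat n :: 'p K) (of_nat m)" for N by simp
        then have "[n = m] (mod ?p ^ Suc (n + m))" unfolding wcong_of_nat by blast
        moreover have "2 * Suc (n + m) \<le> ?p ^ Suc (n + m)"
          by (rule order_trans[OF three_power_bounds(2) three_le_power[OF p3]])
        then have "n < ?p ^ Suc (n + m)" "m < ?p ^ Suc (n + m)" by (auto elim: less_le_trans[rotated] simp del: power_Suc)
        ultimately show "n = m" by (simp add: cong_def)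
      qed simp
      have S1: "{m. ?pos n = a + of_nat m} = {n}" using inj[of a n] by auto
      then have S1': "{m. of_nat n = (of_nat m :: 'p K)} = {n}" by simp
      have S2: "{m. ?pos n = pK * dwork a + of_nat m} = (if dwork_l a \<le> n then {n - dwork_l a} else {})"
      proof -
        have e: "?pos n = pK * dwork a + of_nat m \<longleftrightarrow> n = dwork_l a + m" for m
        proof -
          have "pK * dwork a + of_nat m = a + of_nat (dwork_l a + m)" unfolding pK_dwork by (simp add: add.assoc)
          then show ?thesis using inj[of a n "dwork_l a + m"] by simp
        qed
        show ?thesis unfolding e by auto
      qed
      have idx: "dwork_l a \<le> n \<and> ?p dvd n - dwork_l a \<longleftrightarrow> n \<in> ?I"
      proof
        assume n: "n \<in> ?I"
        have "n mod ?p = dwork_l a" using n by simp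
        then show "dwork_l a \<le> n \<and> ?p dvd n - dwork_l a" by (metis dvd_minus_mod mod_less_eq_dividend)
      next
        assume n: "dwork_l a \<le> n \<and> ?p dvd n - dwork_l a"
        then obtain q where "n - dwork_l a = ?p * q" by blast
        then have "n = dwork_l a + ?p * q" using n by linarith
        then show "n \<in> ?I" using l_lt by simp
      qed
      have coeff: "fps_nth (G_hat u a) n = (B 0 n - \<beta> * (if n \<in> ?I then Eu n * B 1 (n div ?p) else 0)) / ?pos n"
      proof -
        have "gser_tau u (dwork a) (hyp_dwork 1 a a (2 * a)) (?pos n) = (if n \<in> ?I then Eu n * B 1 (n div ?p) else 0)"
        proof (cases "dwork_l a \<le> n \<and> ?p dvd n - dwork_l a")
          case True
          then have nI: "n \<in> ?I" using idx by blast
          have "n - dwork_l a = ?p * (n div ?p)" using Idec[OF nI] by (metis add_diff_cancel_left')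
          then have "(n - dwork_l a) div ?p = n div ?p" by simp
          then show ?thesis unfolding gser_tau_def tpow_mult_def S2 hd using True nI
            by (simp add: subst_sigma_nth Eu_def)
        next
          case False
          then have nI: "n \<notin> ?I" using idx by blast
          show ?thesis unfolding gser_tau_def tpow_mult_def S2 hd using False nI
            by (auto simp: subst_sigma_nth)
        qed
        then show ?thesis unfolding G_hat_def tpow_unmult_def gser_int_dtt_def
          by (simp add: tpow_mult_def[of a] S1' hyp_eq \<beta>_def mult.assoc)
      qed
      show "fps_nth (G_hat u a) n = fps_nth (Abs_fps (\<lambda>n. f n * B 0 n)) n"
      proof (cases "n \<in> ?I")
        case True
        have blk: "B 0 n = rho a n * rho a n / rho (2 * a) n * B 1 (n div ?p)"
          using hyp_coeff_block[OF aZ aZ a2 l_lt, of "n div ?p"] Idec[OF True, symmetric] l_double[of 0] dwork_double_b[of 0]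
          by (simp add: carry_def)
        have B1: "\<beta> * (Eu n * B 1 (n div ?p)) = EH n * Eu n * B 0 n"
          unfolding blk EH_def using Wunit_nz[OF ur(1)[of n]] Wunit_nz[OF ur(2)[of n]] by simp
        have "1 - EH n * Eu n = ?pos n * g n"
          unfolding g_def dquotD(2)[OF eH True] dquotD(2)[OF eu True] by (simp add: algebra_simps)
        then have "B 0 n - EH n * Eu n * B 0 n = ?pos n * (g n * B 0 n)"
          using left_diff_distrib[of 1 "EH n * Eu n" "B 0 n"] by (simp only: mult.assoc mult_1_left)
        then have "fps_nth (G_hat u a) n = ?pos n * (g n * B 0 n) / ?pos n"
          unfolding coeff using True B1 by (simp only: if_True)
        then show ?thesis using True pnz[of n] by (simp add: f_def)
      next
        case False
        then show ?thesis unfolding coeff by (simp add: f_def)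
      qed
    qed
  qed
qed

end

section \<open>Reversal of the truncations and the congruence\<close>

lemma pcong_OG_poly:
  assumes "\<And>i. wcong 1 (coeff g i) (coeff g' i)"
  shows "pcong CARD('p::prime_card) OG 1 (emb g) (emb (g' :: 'p K poly))"
proof -
  have "g - g' \<in> pWp 1" using assms by (simp add: pWp_def wcong_def)
  then obtain q where q: "q \<in> W_poly" "g - g' = smult (pK ^ 1) q" unfolding pWp_iff by blast
  have "emb g - emb g' = pKt ^ 1 * emb q" unfolding pKt_emb q(2)[symmetric] by (simp only: emb_simps(4))
  then show ?thesis unfolding pcong_def using OG_poly[OF q(1)] by auto
qed

lemma emb_smult: "emb (smult v g) = Kt_const v * emb (g :: 'p::prime_card K poly)"
proof -
  have "smult v g = [:v:] * g" by simp
  then show ?thesis unfolding Kt_const_def by (simp only: emb_simps(2))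
qed

lemma inverse_t_OG: "inverse Kt_t \<in> (OG :: 'p::prime_card Kt set)"
proof -
  have "(Kt_t :: 'p Kt) \<in> OG" unfolding Kt_t_def by (rule OG_poly) (simp add: W_poly_pCons W_poly_ring(1))
  then show ?thesis using iota_OG iota_t by metis
qed

lemma const_OG: "v \<in> W \<Longrightarrow> Kt_const v \<in> (OG :: 'p::prime_card Kt set)"
  unfolding Kt_const_def by (rule OG_poly) (simp add: W_poly_pCons W_poly_ring(1))

lemma inverse_emb_OG:
  assumes "g \<in> W_poly" "coeff g 0 = (1 :: 'p::prime_card K)" shows "inverse (emb g) \<in> OG"
proof -
  have "emb 1 / emb g \<in> OG" by (rule OG_I[OF W_poly_ring(2) assms(1) prim_of_one[OF assms(2)]])
  then show ?thesis unfolding divide_inverse by (simp only: emb_simps(6) mult_1_left)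
qed

text \<open>If the coefficients of \<open>Q\<close> are modulo \<open>p\<close> those of \<open>v P\<close> in reversed order, then \<open>Q(t\<^sup>-\<^sup>1) \<equiv> v
  t\<^bsup>-d\<^esup> P(t)\<close>. The degrees of \<open>P\<close> and \<open>Q\<close> may exceed \<open>d\<close>, and reversing twice cuts \<open>Q\<close> off at degree
  \<open>d\<close>.\<close>

lemma iota_reversal:
  fixes P Q :: "'p::prime_card K poly"
  assumes PQ: "P \<in> W_poly" "Q \<in> W_poly" and v: "v \<in> W"
    and Qs: "\<And>j. j > d \<Longrightarrow> coeff Q j \<in> pW 1" and Ps: "\<And>j. j > d \<Longrightarrow> coeff P j \<in> pW 1"
    and rev: "\<And>k. k \<le> d \<Longrightarrow> wcong 1 (coeff Q (d - k)) (v * coeff P k)"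
  shows "pcong CARD('p) OG 1 (iota (emb Q)) (Kt_const v * inverse Kt_t ^ d * emb P)"
proof -
  define Q' where "Q' = rev_upto d (rev_upto d Q)"
  have Q': "coeff Q' j = (if j \<le> d then coeff Q j else 0)" for j
    unfolding Q'_def coeff_rev_upto by simp
  have deg: "degree Q' \<le> d" by (rule degree_le) (simp add: Q')
  have "pcong CARD('p) OG 1 (emb Q) (emb Q')"
  proof (rule pcong_OG_poly)
    show "wcong 1 (coeff Q i) (coeff Q' i)" for i using Qs[of i] by (cases "i \<le> d") (simp_all add: Q')
  qed
  then have 1: "pcong CARD('p) OG 1 (iota (emb Q)) (iota (emb Q'))" by (rule pcong_iota)
  have 2: "iota (emb Q') = emb (rev_upto d Q') * inverse Kt_t ^ d"
    unfolding iota_emb by (rule iota_poly_rev[OF deg])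
  have vP: "smult v P \<in> W_poly" using PQ(1) v by (auto simp: W_poly_def)
  have small: "wcong 1 0 (v * coeff P i)" if "i > d" for i
    by (rule wcong_sym) (use W_mult_pW[OF v Ps[OF that]] in simp)
  have "pcong CARD('p) OG 1 (emb (rev_upto d Q')) (emb (smult v P))"
  proof (rule pcong_OG_poly)
    fix i show "wcong 1 (coeff (rev_upto d Q') i) (coeff (smult v P) i)"
    proof (cases "i \<le> d")
      case True
      then show ?thesis using rev[OF True] by (simp add: coeff_rev_upto Q')
    next
      case False
      then show ?thesis using small[of i] by (simp add: coeff_rev_upto)
    qed
  qed
  then have "pcong CARD('p) OG 1 (emb (rev_upto d Q') * inverse Kt_t ^ d) (emb (smult v P) * inverse Kt_t ^ d)"
    by (rule pcong_mult[OF subring_OG _ pcong_refl[OF subring_OG]]) (intro OG_ring(7) inverse_t_OG OG_poly vP)+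
  then have 3: "pcong CARD('p) OG 1 (iota (emb Q')) (Kt_const v * inverse Kt_t ^ d * emb P)"
    unfolding 2 emb_smult by (simp only: mult_ac)
  show ?thesis by (rule pcong_trans[OF subring_OG 1 3])
qed

lemma iota_prod_reversal:
  fixes P Q :: "nat \<Rightarrow> 'p::prime_card K poly"
  assumes P: "\<And>i. P i \<in> W_poly" and v: "\<And>i. v i \<in> W" 
    and rev: "\<And>i. pcong CARD('p) OG 1 (iota (emb (Q i))) (Kt_const (v i) * inverse Kt_t ^ d i * emb (P i))"
  shows "pcong CARD('p) OG 1 (iota (emb (\<Prod>i<n. Q i))) (Kt_const (\<Prod>i<n. v i) * inverse Kt_t ^ (\<Sum>i<n. d i) * emb (\<Prod>i<n. P i))"
proof (induction n)
  case 0
  have "iota (emb (1 :: 'p K poly)) = 1" "Kt_const (1 :: 'p K) = 1" "emb (1 :: 'p K poly) = 1"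
    by (simp_all only: emb_simps(6) iota_hom(2) Kt_const_hom(2))
  then show ?case using pcong_refl[OF subring_OG] by (simp only: lessThan_0 prod.empty sum.empty power_0 mult_1_left)
next
  case (Suc n)
  have PW: "(\<Prod>i<n. P i) \<in> W_poly" by (induction n) (simp_all add: W_poly_ring P)
  have vW: "(\<Prod>i<n. v i) \<in> W" by (rule W_prod) (rule v)
  have rhs: "Kt_const (v i) * inverse Kt_t ^ d i * emb (P i) \<in> OG" for i
    by (intro OG_ring(4,7) const_OG v inverse_t_OG OG_poly P)
  have "Kt_const (\<Prod>i<n. v i) * inverse Kt_t ^ (\<Sum>i<n. d i) * emb (\<Prod>i<n. P i) \<in> OG"
    by (intro OG_ring(4,7) const_OG vW inverse_t_OG OG_poly PW)
  then have "pcong CARD('p) OG 1 (iota (emb (\<Prod>i<n. Q i)) * iota (emb (Q n)))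
     ((Kt_const (\<Prod>i<n. v i) * inverse Kt_t ^ (\<Sum>i<n. d i) * emb (\<Prod>i<n. P i)) * (Kt_const (v n) * inverse Kt_t ^ d n * emb (P n)))"
    by (rule pcong_mult[OF subring_OG Suc rev pcong_in[OF subring_OG rev rhs]])
  then show ?case
    by (simp only: prod.lessThan_Suc sum.lessThan_Suc emb_simps(2) iota_hom(4) Kt_const_hom(4) power_add mult_ac)
qed

context dwork_tower
begin

text \<open>The rational function by which the quotient of the truncations represents \<open>G / F\<close> modulo \<open>p\<close>. The
  truncation of \<open>F\<close> divides \<open>h\<close>, so it lies in the localization.\<close>

lemma quotient_witness:
  fixes i :: nat
  assumes f: "wlip f" and C: "C \<in> W_poly" "h = truncate_fps CARD('p) (Abs_fps (A i)) * C"
  defines "G \<equiv> Abs_fps (\<lambda>n. f n * A i n)"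
  defines "x \<equiv> emb (truncate_fps CARD('p) G) * inverse (emb (truncate_fps CARD('p) (Abs_fps (A i))))"
  shows "\<exists>e. x \<in> W_loc h \<and> expands x e \<and> fcong 1 e (G / Abs_fps (A i))"
proof -
  let ?T = "truncate_fps CARD('p) (Abs_fps (A i))" and ?TG = "truncate_fps CARD('p) G"
  have T0: "coeff ?T 0 = 1" by (simp add: A0)
  have TW: "?T \<in> W_poly" by (simp add: W_poly_def coeff_truncate_fps A_W)
  have TGW: "?TG \<in> W_poly" by (simp add: W_poly_def coeff_truncate_fps G_def A_W wlipD(1)[OF f])
  have Tnz: "emb ?T \<noteq> 0" "emb C \<noteq> 0"
    using T0 C(2) h(2) unfolding emb_0_iff by auto
  have x: "x = emb (?TG * C) * inverse (emb h) ^ 1"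
  proof -
    have *: "g * inverse t = (g * s) * inverse (t * s) ^ 1" if "t \<noteq> 0" "s \<noteq> 0" for g t s :: "'p Kt"
      using that by simp
    have "emb ?TG * inverse (emb ?T) = (emb ?TG * emb C) * inverse (emb ?T * emb C) ^ 1" by (rule *[OF Tnz])
    then show ?thesis unfolding x_def by (simp only: emb_simps(2) arg_cong[OF C(2), of emb])
  qed
  let ?e = "fps_of_poly (?TG * C) * inverse (fps_of_poly h) ^ 1"
  have "x \<in> W_loc h" unfolding x by (rule W_loc_I[OF h(1) prim_of_one[OF h(2)]]) (rule W_poly_ring(4)[OF TGW C(1)])
  moreover have "expands x ?e" unfolding x by (rule expands_W_loc[OF h])
  moreover have "fcong 1 ?e (G / Abs_fps (A i))"
  proof -
    let ?i = "inverse (fps_of_poly ?T)" and ?q = "G / Abs_fps (A i)"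
    have e: "?e = fps_of_poly ?TG * ?i"
      unfolding inverse_factor[OF C(2) T0 h(2)] by (simp add: fps_of_poly_mult mult_ac)
    have iW: "?i \<in> Wf" by (rule Wf_inverse[OF W_polyD[OF TW]]) (simp add: A0)
    have Ti: "fps_of_poly ?T * ?i = 1"
      using inverse_mult_eq_1[of "fps_of_poly ?T"] T0 by (simp add: mult.commute)
    have "fcong 1 (?q * fps_of_poly ?T) (fps_of_poly ?TG)"
      unfolding fps_of_poly_truncate G_def by (rule quotient_conv(2)[OF f])
    then have "fcong 1 (?q * fps_of_poly ?T * ?i) (fps_of_poly ?TG * ?i)" by (rule fcong_mult_right[OF _ iW])
    then have "fcong 1 ?q ?e" unfolding e mult.assoc Ti by simp
    then show ?thesis by (rule fcong_sym)
  qed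
  ultimately show ?thesis by blast
qed

end

context dwork_setting
begin

text \<open>For the truncations, \<open>t \<mapsto> t\<^sup>-\<^sup>1\<close> becomes \<open>n \<mapsto> l\<^sub>i - n\<close> on coefficients.\<close>

lemma iota_TB: "pcong CARD('p) OG 1 (iota (emb (TB i))) (Kt_const (B i (l i)) * inverse Kt_t ^ l i * emb (TA i))"
proof (rule iota_reversal[OF TA_W TB_W B_W])
  show "coeff (TB i) j \<in> pW 1" "coeff (TA i) j \<in> pW 1" if "l i < j" for j
    using that A_small B_small by (auto simp: coeff_truncate_fps pW_0)
  have lp: "l i < CARD('p)" by (rule dwork_l_props(1)[OF bZ])
  show "wcong 1 (coeff (TB i) (l i - k)) (B i (l i) * coeff (TA i) k)" if "k \<le> l i" for k
  proof -
    have "l i - k < CARD('p)" "k < CARD('p)" using that lp by linarith+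
    then show ?thesis using reversal[OF that] by (simp add: coeff_truncate_fps)
  qed
qed

text \<open>Modulo \<open>p\<close> both functions are quotients of truncations; \<open>t \<mapsto> t\<^sup>-\<^sup>1\<close> multiplies denominator and
  numerator of the second by \<open>B(l) t\<^bsup>-l\<^esup>\<close> and \<open>- B(l) t\<^bsup>-l\<^esup>\<close> relative to those of the first.
  Clearing the denominators, which are units of the Gauss valuation ring, gives the congruence.\<close>

theorem congruence:
  assumes c: "c - 1 \<in> pW 1"
  shows "ring_cong (W_lconv (h_poly a r)) CARD('p)
           (lconv_of_fps (h_poly a r) (F_log c a))
           (\<ominus>\<^bsub>W_lconv (h_poly a r)\<^esub> omega (hhat_poly a r) (h_poly a r)
             (lconv_of_fps (hhat_poly a r) (F_hat (inverse c) a)))"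
proof -
  let ?p = "CARD('p)"
  interpret TA: dwork_tower A "h_poly a r" by (rule tower_A)
  interpret TB: dwork_tower B "hhat_poly a r" by (rule tower_B)
  obtain f where f: "wlip f" "G_log c a = Abs_fps (\<lambda>n. f n * A 0 n)" "f 0 = 2 * psi_tilde a - plog c"
    "\<And>k. 0 < k \<Longrightarrow> k < ?p \<Longrightarrow> f k = 1 / of_nat k" by (rule G_log_coeffs[OF c]) blast
  obtain g where g: "wlip g" "G_hat (inverse c) a = Abs_fps (\<lambda>n. g n * B 0 n)"
    "wcong 1 (g (l 0)) (- (2 * psi_tilde a + plog (inverse c)))"
    "\<And>k. k < l 0 \<Longrightarrow> g k = 1 / (a + of_nat k)" by (rule G_hat_coeffs[OF plog_inverse(1)[OF c]]) blast
  have F: "F_log c a = G_log c a / Abs_fps (A 0)" "F_hat (inverse c) a = G_hat (inverse c) a / Abs_fps (B 0)"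
    by (simp_all add: F_log_def F_hat_def hyp_eq)
  obtain CA where CA: "CA \<in> W_poly" "h_poly a r = TA 0 * CA"
    using prod_cofactor[of TA, OF TA_W r0] unfolding h_poly_eq by blast
  obtain CB where CB: "CB \<in> W_poly" "hhat_poly a r = TB 0 * CB"
    using prod_cofactor[of TB, OF TB_W r0] unfolding hhat_poly_eq by blast
  let ?GA = "truncate_fps ?p (G_log c a)" and ?GB = "truncate_fps ?p (G_hat (inverse c) a)"
  define x where "x = emb ?GA * inverse (emb (TA 0))"
  define y where "y = emb ?GB * inverse (emb (TB 0))"
  obtain e where e: "x \<in> W_loc (h_poly a r)" "expands x e" "fcong 1 e (F_log c a)"
    using TA.quotient_witness[OF f(1) CA] unfolding F(1) f(2) x_def by blast
  obtain e' where e': "y \<in> W_loc (hhat_poly a r)" "expands y e'" "fcong 1 e' (F_hat (inverse c) a)"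
    using TB.quotient_witness[OF g(1) CB] unfolding F(2) g(2) y_def by blast
  have conv: "F_log c a \<in> conv (h_poly a r)" "F_hat (inverse c) a \<in> conv (hhat_poly a r)"
    unfolding F f(2) g(2) by (rule TA.quotient_conv(1)[OF f(1)] TB.quotient_conv(1)[OF g(1)])+
  have lp: "l 0 < ?p" by (rule l_le)
  have GW: "?GA \<in> W_poly" "?GB \<in> W_poly"
    by (auto simp: f(2) g(2) W_poly_def coeff_truncate_fps A_W B_W wlipD(1)[OF f(1)] wlipD(1)[OF g(1)] A_W[of 0, simplified] B_W[of 0, simplified])
  \<comment> \<open>the values at \<open>k = 0\<close> are limits, and \<open>plog (inverse c) = - plog c\<close> accounts for \<open>c\<^sup>-\<^sup>1\<close> on
    the other side\<close>
  have gf: "wcong 1 (g (l 0 - k)) (- f k)" if k: "k \<le> l 0" for k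
  proof (cases "k = 0")
    case True
    then show ?thesis using g(3) unfolding plog_inverse(2)[OF c] by (simp add: f(3))
  next
    case False
    have kp: "0 < k" "k < ?p" using False k lp by auto
    have lk: "l 0 - k < l 0" using False k by simp
    have u: "Wunit (of_nat k :: 'p K)" unfolding Wunit_of_nat using kp by (auto dest: dvd_imp_le)
    have "wcong 1 (a + of_nat (l 0) - of_nat k) (0 - of_nat k)"
      using dwork_l_props(2)[OF aZ] by (intro wcong_diff wcong_refl) simp
    then have w: "wcong 1 (a + of_nat (l 0 - k)) (- of_nat k)"
      using k by (simp add: of_nat_diff algebra_simps)
    have "wcong 1 (1 / (a + of_nat (l 0 - k))) (1 / (- of_nat k))"
      by (rule wcong_divide[OF wcong_refl w]) (use u Wunit_cong[OF wcong_sym[OF w]] in auto)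
    then show ?thesis unfolding g(4)[OF lk] f(4)[OF kp] by simp
  qed
  have v: "B 0 (l 0) \<in> W" by (rule B_W)
  have revG: "pcong ?p OG 1 (iota (emb ?GB)) (Kt_const (B 0 (l 0)) * inverse Kt_t ^ l 0 * emb (- ?GA))"
  proof (rule iota_reversal[OF _ GW(2) v])
    show "- ?GA \<in> W_poly" by (rule W_poly_ring(5)[OF GW(1)])
    show "coeff ?GB j \<in> pW 1" "coeff (- ?GA) j \<in> pW 1" if "l 0 < j" for j
      using A_small[of 0 j] B_small[of 0 j] that wlipD(1)[OF f(1), of j] wlipD(1)[OF g(1), of j]
      by (auto simp: coeff_truncate_fps f(2) g(2) intro!: W_mult_pW pW_neg)
    show "wcong 1 (coeff ?GB (l 0 - k)) (B 0 (l 0) * coeff (- ?GA) k)" if k: "k \<le> l 0" for k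
    proof -
      have "wcong 1 (g (l 0 - k) * B 0 (l 0 - k)) (- f k * (B 0 (l 0) * A 0 k))"
        by (rule wcong_mult[OF gf[OF k] reversal[OF k] wlipD(1)[OF g(1)] B_W])
      also have "- f k * (B 0 (l 0) * A 0 k) = B 0 (l 0) * (- (f k * A 0 k))" by simp
      finally have "wcong 1 (g (l 0 - k) * B 0 (l 0 - k)) (B 0 (l 0) * (- (f k * A 0 k)))" .
      moreover have "coeff ?GB (l 0 - k) = g (l 0 - k) * B 0 (l 0 - k)" "coeff (- ?GA) k = - (f k * A 0 k)"
        using k lp by (simp_all add: coeff_truncate_fps f(2) g(2))
      ultimately show ?thesis by (simp only:)
    qed
  qed
  have xy: "pcong ?p OG 1 x (- iota y)"
  proof -
    let ?T = "emb (TA 0)" and ?S = "iota (emb (TB 0))" and ?m = "Kt_const (B 0 (l 0)) * inverse Kt_t ^ l 0"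
    have nz: "?T \<noteq> 0" "emb (TB 0) \<noteq> 0" unfolding emb_0_iff using TA0[of 0] TB0[of 0] by (metis coeff_0 zero_neq_one)+
    have Snz: "?S \<noteq> 0" unfolding iota_emb by (rule iota_poly_nz) (metis TB0[of 0] coeff_0 zero_neq_one)
    have iy: "iota y = iota (emb ?GB) * inverse ?S"
      unfolding y_def iota_hom(4) iota_inverse[OF nz(2)] ..
    have mW: "?m \<in> OG" by (intro OG_ring(4,7) const_OG v inverse_t_OG)
    have "pcong ?p OG 1 (emb ?GA * ?S + iota (emb ?GB) * ?T) (emb ?GA * (?m * ?T) + (?m * emb (- ?GA)) * ?T)"
    proof (rule pcong_add[OF subring_OG])
      have "pcong ?p OG 1 (?S * emb ?GA) ((?m * ?T) * emb ?GA)"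
        by (rule pcong_mult[OF subring_OG iota_TB pcong_refl[OF subring_OG]])
           (intro OG_poly GW OG_ring(4) mW TA_W)+
      then show "pcong ?p OG 1 (emb ?GA * ?S) (emb ?GA * (?m * ?T))" by (simp only: mult.commute)
      show "pcong ?p OG 1 (iota (emb ?GB) * ?T) ((?m * emb (- ?GA)) * ?T)"
        by (rule pcong_mult[OF subring_OG revG pcong_refl[OF subring_OG]])
           (intro OG_poly GW OG_ring(4) mW TA_W W_poly_ring(5))+
    qed
    also have "emb ?GA * (?m * ?T) + (?m * emb (- ?GA)) * ?T = 0"
      unfolding emb_simps(3) by (simp only: mult_minus_right mult_minus_left mult_ac add.right_inverse)
    finally have "pcong ?p OG 1 (emb ?GA * ?S + iota (emb ?GB) * ?T) 0" .
    then have "pcong ?p OG 1 ((emb ?GA * ?S + iota (emb ?GB) * ?T) * (inverse ?T * inverse ?S)) (0 * (inverse ?T * inverse ?S))"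
    proof (rule pcong_mult[OF subring_OG _ pcong_refl[OF subring_OG]])
      have "inverse ?S \<in> OG" unfolding iota_inverse[OF nz(2), symmetric]
        by (rule iota_OG[OF inverse_emb_OG[OF TB_W TB0]])
      then show "inverse ?T * inverse ?S \<in> OG" by (intro OG_ring(4) inverse_emb_OG TA_W TA0)
      show "0 \<in> OG" by (rule OG_ring(1))
    qed
    moreover have "(G * S + H * T) * (inverse T * inverse S) = G * inverse T - - (H * inverse S)" if "T \<noteq> 0" "S \<noteq> 0" for G H S T :: "'p Kt"
      using that by (simp add: field_simps)
    from this[OF nz(1) Snz] have "(emb ?GA * ?S + iota (emb ?GB) * ?T) * (inverse ?T * inverse ?S) = x - - iota y"
      unfolding x_def iy .
    ultimately have "pcong ?p OG 1 (x - - iota y) 0" by (simp only: mult_zero_left)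
    then show ?thesis unfolding pcong_def by (simp only: diff_0_right)
  qed
  have hk: "pcong ?p OG 1 (iota (emb (hhat_poly a r)))
     (Kt_const (\<Prod>i<r. B i (l i)) * inverse Kt_t ^ (\<Sum>i<r. l i) * emb (h_poly a r))"
    unfolding h_poly_eq hhat_poly_eq by (rule iota_prod_reversal[OF TA_W B_W iota_TB])
  have u: "Wunit (\<Prod>i<r. B i (l i))" by (intro Wunit_prod B_unit order_refl)
  show ?thesis by (rule ring_cong_lconv_omega[OF h_W hhat_W u hk conv(1) e conv(2) e' xy])
qed

end

theorem theorem7p4:
  fixes a c :: "'p::prime_card K" and r :: nat
  assumes "CARD('p) \<ge> 3"
    and "a \<in> Zp"
    and "\<exists>N::nat. N \<ge> 2 \<and> \<not> CARD('p) dvd N \<and> (\<exists>m::int. a = of_int m / of_nat N)"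
    and "\<forall>i. dwork_digit a i < dwork_digit (2 * a) i"
    and "r > 0" and "(dwork ^^ r) a = a"
    and "c - 1 \<in> pW 1"
  shows "ring_cong (W_lconv (h_poly a r)) CARD('p)
           (lconv_of_fps (h_poly a r) (F_log c a))
           (\<ominus>\<^bsub>W_lconv (h_poly a r)\<^esub> omega (hhat_poly a r) (h_poly a r)
             (lconv_of_fps (hhat_poly a r) (F_hat (inverse c) a)))"
proof -
  interpret dwork_setting a r by (unfold_locales; fact assms)
  show ?thesis by (rule congruence[OF assms(7)])
qed

end
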